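(* There exists a constant $\alpha>0$, independent of $h$ and $\nu$, such that for all $(\boldsymbol\sigma,\boldsymbol u)\in\underline{\boldsymbol\Sigma}_{h,0}\times\boldsymbol{\mathcal V}_h$ $$\alpha\,\|(\boldsymbol\sigma,\boldsymbol u)\|_{nc}\le\sup_{\boldsymbol0\ne(\boldsymbol\tau,\boldsymbol v)\in\underline{\boldsymbol\Sigma}_{h,0}\times\boldsymbol{\mathcal V}_h}\frac{\mathcal B_{nc}[(\boldsymbol\sigma,\boldsymbol u),(\boldsymbol\tau,\boldsymbol v)]}{\|(\boldsymbol\tau,\boldsymbol v)\|_{nc}},$$ where $\mathcal B_{nc}[(\boldsymbol\sigma,\boldsymbol u),(\boldsymbol\tau,\boldsymbol v)]=a_h(\boldsymbol\sigma,\boldsymbol\tau)+b_h(\boldsymbol\tau,\boldsymbol u)+b_h(\boldsymbol\sigma,\boldsymbol v)$.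
   Context: $\Omega\subset\mathbb R^2$ is a bounded, simply connected domain with polygonal boundary; $\nu>0$ is a constant. For a tensor $\boldsymbol\tau$, $\boldsymbol\tau^d=\boldsymbol\tau-\frac12(\operatorname{tr}\boldsymbol\tau)\mathbf I$ with $\mathbf I$ the identity matrix, and $\boldsymbol\sigma:\boldsymbol\tau=\sum_{i,j}\sigma_{ij}\tau_{ij}$; $\mathbf{div}_h\boldsymbol\tau$ is the vector of elementwise divergences of the rows. $\{\mathcal T_h\}_{h>0}$ is a family of conforming triangulations of $\bar\Omega$ into straight-sided triangles $T$ with diameter $h_T$ and unit outward normal $\boldsymbol\nu_T$; $h=\max_{T\in\mathcal T_h} h_T$. $\mathcal E_I$ is the set of interior edges and $|e|$ the length of $e$. For $e=\partial T\cap\partial T'\in\mathcal E_I$, the jump of a piecewise smooth tensor is $[\![\boldsymbol\tau]\!]=\boldsymbol\tau|_T\boldsymbol\nu_T+\boldsymbol\tau|_{T'}\boldsymbol\nu_{T'}$, and of a scalar $[\![q]\!]=q|_T\boldsymbol\nu_T+q|_{T'}\boldsymbol\nu_{T'}$. Spaces: $\mathrm{CR}_h$ is the space of $v\in L^2(\Omega)$ with $v|_T$ affine for each $T\in\mathcal T_h$ and $\int_e[\![v]\!]=0$ for all $e\in\mathcal E_I$; $\underline{\boldsymbol\Sigma}_h=[\mathrm{CR}_h]^{2\times2}$; $\underline{\boldsymbol\Sigma}_{h,0}=\{\boldsymbol\tau\in\underline{\boldsymbol\Sigma}_h:\int_\Omega\operatorname{tr}(\boldsymbol\tau)=0\}$;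 $\boldsymbol{\mathcal V}_h$ is the space of $\mathbb R^2$-valued functions constant on each $T\in\mathcal T_h$. Forms, with $\gamma|_e=1/|e|$: $a_h(\boldsymbol\sigma,\boldsymbol\tau)=\frac1\nu\int_\Omega\boldsymbol\sigma^d:\boldsymbol\tau^d+\frac1\nu\sum_{e\in\mathcal E_I}\int_e\gamma[\![\boldsymbol\sigma]\!]\cdot[\![\boldsymbol\tau]\!]$, $\ b_h(\boldsymbol\tau,\boldsymbol v)=\int_\Omega\boldsymbol v\cdot\mathbf{div}_h\boldsymbol\tau$. Norm: $\|(\boldsymbol\tau,\boldsymbol v)\|_{nc}^2=\frac1\nu\|\boldsymbol\tau^d\|_{0,\Omega}^2+\frac1\nu\sum_{e\in\mathcal E_I}\|\gamma^{1/2}[\![\boldsymbol\tau]\!]\|_{0,e}^2+\frac1\nu\|\mathbf{div}_h\boldsymbol\tau\|_{0,\Omega}^2+\nu\|\boldsymbol v\|_{0,\Omega}^2$, with $\|\cdot\|_{0,D}$ the $L^2(D)$ norm. *)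

theory Defs
  imports "HOL-Analysis.Analysis"
begin

type_synonym point = "real^2"
type_synonym mesh = "point set set"

(* The condition interior (closure \<Omega>) = \<Omega> says that \<Omega> lies on one side of its boundary (no slits),
   so that an edge shared by two triangles of a triangulation of closure \<Omega> is inside \<Omega>. *)
definition polygonal_domain :: "point set \<Rightarrow> bool" where
  "polygonal_domain \<Omega> \<longleftrightarrow>
     open \<Omega> \<and> connected \<Omega> \<and> \<Omega> \<noteq> {} \<and> bounded \<Omega> \<and> simply_connected \<Omega> \<and>
     interior (closure \<Omega>) = \<Omega> \<and>
     (\<exists>S :: (point \<times> point) set. finite S \<and> frontier \<Omega> = (\<Union>(a, b)\<in>S. closed_segment a b))"

(* Conformity is part of the library's triangulation: finitely many simplices, any two of
   which intersect in a common face. *)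
definition conforming_triangulation :: "point set \<Rightarrow> mesh \<Rightarrow> bool" where
  "conforming_triangulation \<Omega> \<T> \<longleftrightarrow>
     triangulation \<T> \<and> (\<forall>T\<in>\<T>. 2 simplex T) \<and> \<Union>\<T> = closure \<Omega>"

definition mesh_size :: "mesh \<Rightarrow> real" where
  "mesh_size \<T> = Max (diameter ` \<T>)"

definition interior_edges :: "mesh \<Rightarrow> point set set" where
  "interior_edges \<T> = {e. \<exists>T\<in>\<T>. \<exists>T'\<in>\<T>. T \<noteq> T' \<and> e facet_of T \<and> e facet_of T'}"

(* Piecewise smooth functions are functions on the plane whose values on the skeleton of the
   mesh (a null set) are irrelevant.  The restriction of q to the closed triangle T is
   understood as the continuous extension of q from the interior of T. *)
definition elt :: "(point \<Rightarrow> 'b::t2_space) \<Rightarrow> point set \<Rightarrow> point \<Rightarrow> 'b" where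
  "elt q T x = Lim (at x within interior T) q"

definition outer_normal :: "point set \<Rightarrow> point set \<Rightarrow> point" where
  "outer_normal T e =
     (THE n. norm n = 1 \<and> (\<exists>c. (\<forall>x\<in>e. n \<bullet> x = c) \<and> (\<forall>x\<in>T. n \<bullet> x \<le> c)))"

(* For an interior edge the sums below have exactly two terms. *)
definition jump :: "mesh \<Rightarrow> point set \<Rightarrow> (point \<Rightarrow> real) \<Rightarrow> point \<Rightarrow> real^2" where
  "jump \<T> e q x = (\<Sum>T | T \<in> \<T> \<and> e facet_of T. elt q T x *\<^sub>R outer_normal T e)"

definition tensor_jump :: "mesh \<Rightarrow> point set \<Rightarrow> (point \<Rightarrow> real^2^2) \<Rightarrow> point \<Rightarrow> real^2" where
  "tensor_jump \<T> e \<tau> x = (\<Sum>T | T \<in> \<T> \<and> e facet_of T. elt \<tau> T x *v outer_normal T e)"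

(* Integral with respect to arc length over a segment e, whose length is diameter e; the value
   does not depend on the order in which the end points are chosen. *)
definition edge_integral :: "point set \<Rightarrow> (point \<Rightarrow> 'b::real_normed_vector) \<Rightarrow> 'b" where
  "edge_integral e f =
     (let (a, b) = (SOME (a, b). e = closed_segment a b)
      in diameter e *\<^sub>R integral {0..1} (\<lambda>t. f (linepath a b t)))"

definition edge_weight :: "point set \<Rightarrow> real" where
  "edge_weight e = 1 / diameter e"

definition L2_on :: "point set \<Rightarrow> (point \<Rightarrow> real) set" where
  "L2_on \<Omega> = {v. v \<in> borel_measurable (lebesgue_on \<Omega>) \<and> integrable (lebesgue_on \<Omega>) (\<lambda>x. (v x)\<^sup>2)}"

definition CR :: "point set \<Rightarrow> mesh \<Rightarrow> (point \<Rightarrow> real) set" where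
  "CR \<Omega> \<T> = {v \<in> L2_on \<Omega>.
     (\<forall>T\<in>\<T>. \<exists>(a::real) (b::real^2). \<forall>x\<in>interior T. v x = a + b \<bullet> x) \<and>
     (\<forall>e\<in>interior_edges \<T>. edge_integral e (jump \<T> e v) = 0)}"

definition Sigma_h :: "point set \<Rightarrow> mesh \<Rightarrow> (point \<Rightarrow> real^2^2) set" where
  "Sigma_h \<Omega> \<T> = {\<tau>. \<forall>i j. (\<lambda>x. \<tau> x $ i $ j) \<in> CR \<Omega> \<T>}"

definition Sigma_h0 :: "point set \<Rightarrow> mesh \<Rightarrow> (point \<Rightarrow> real^2^2) set" where
  "Sigma_h0 \<Omega> \<T> = {\<tau> \<in> Sigma_h \<Omega> \<T>. (LINT x:\<Omega>|lebesgue. trace (\<tau> x)) = 0}"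

definition V_h :: "mesh \<Rightarrow> (point \<Rightarrow> real^2) set" where
  "V_h \<T> = {v. \<forall>T\<in>\<T>. \<exists>c. \<forall>x\<in>interior T. v x = c}"

(* Elements of the discrete spaces are identified when they agree almost everywhere in \<Omega>, so
   being nonzero means not vanishing almost everywhere. *)
definition nonzero_pair ::
  "point set \<Rightarrow> (point \<Rightarrow> real^2^2) \<times> (point \<Rightarrow> real^2) \<Rightarrow> bool" where
  "nonzero_pair \<Omega> = (\<lambda>(\<tau>, v). \<not> (AE x in lebesgue_on \<Omega>. \<tau> x = 0 \<and> v x = 0))"

definition deviator :: "real^2^2 \<Rightarrow> real^2^2" where
  "deviator A = A - (trace A / 2) *\<^sub>R mat 1"

(* For piecewise affine \<tau> this is the elementwise row divergence in the interior of every
   triangle, that is, almost everywhere in \<Omega>. *)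
definition div_h :: "(point \<Rightarrow> real^2^2) \<Rightarrow> point \<Rightarrow> real^2" where
  "div_h \<tau> x = (\<chi> i. \<Sum>j\<in>UNIV. frechet_derivative \<tau> (at x) (axis j 1) $ i $ j)"

(* On real^2^2 the inner product is the sum of the products of all entries and norm is the
   corresponding (Frobenius) norm. *)
definition a_h ::
  "point set \<Rightarrow> mesh \<Rightarrow> real \<Rightarrow> (point \<Rightarrow> real^2^2) \<Rightarrow> (point \<Rightarrow> real^2^2) \<Rightarrow> real" where
  "a_h \<Omega> \<T> \<nu> \<sigma> \<tau> =
     1 / \<nu> * (LINT x:\<Omega>|lebesgue. deviator (\<sigma> x) \<bullet> deviator (\<tau> x)) +
     1 / \<nu> * (\<Sum>e\<in>interior_edges \<T>.
       edge_integral e (\<lambda>x. edge_weight e * (tensor_jump \<T> e \<sigma> x \<bullet> tensor_jump \<T> e \<tau> x)))"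

definition b_h :: "point set \<Rightarrow> (point \<Rightarrow> real^2^2) \<Rightarrow> (point \<Rightarrow> real^2) \<Rightarrow> real" where
  "b_h \<Omega> \<tau> v = (LINT x:\<Omega>|lebesgue. v x \<bullet> div_h \<tau> x)"

definition B_nc ::
  "point set \<Rightarrow> mesh \<Rightarrow> real \<Rightarrow> (point \<Rightarrow> real^2^2) \<times> (point \<Rightarrow> real^2) \<Rightarrow>
     (point \<Rightarrow> real^2^2) \<times> (point \<Rightarrow> real^2) \<Rightarrow> real" where
  "B_nc \<Omega> \<T> \<nu> = (\<lambda>(\<sigma>, u) (\<tau>, v). a_h \<Omega> \<T> \<nu> \<sigma> \<tau> + b_h \<Omega> \<tau> u + b_h \<Omega> \<sigma> v)"

definition L2_norm :: "point set \<Rightarrow> (point \<Rightarrow> 'b::euclidean_space) \<Rightarrow> real" where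
  "L2_norm S f = sqrt (LINT x:S|lebesgue. (norm (f x))\<^sup>2)"

definition edge_L2_norm :: "point set \<Rightarrow> (point \<Rightarrow> 'b::euclidean_space) \<Rightarrow> real" where
  "edge_L2_norm e f = sqrt (edge_integral e (\<lambda>x. (norm (f x))\<^sup>2))"

definition nc_norm ::
  "point set \<Rightarrow> mesh \<Rightarrow> real \<Rightarrow> (point \<Rightarrow> real^2^2) \<times> (point \<Rightarrow> real^2) \<Rightarrow> real" where
  "nc_norm \<Omega> \<T> \<nu> = (\<lambda>(\<tau>, v). sqrt (
     1 / \<nu> * (L2_norm \<Omega> (\<lambda>x. deviator (\<tau> x)))\<^sup>2 +
     1 / \<nu> * (\<Sum>e\<in>interior_edges \<T>.
       (edge_L2_norm e (\<lambda>x. sqrt (edge_weight e) *\<^sub>R tensor_jump \<T> e \<tau> x))\<^sup>2) +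
     1 / \<nu> * (L2_norm \<Omega> (div_h \<tau>))\<^sup>2 +
     \<nu> * (L2_norm \<Omega> v)\<^sup>2))"

end

theory Submission
  imports Defs
begin

text \<open>
  Testing with \<open>(\<sigma>, - u + div \<sigma> / \<nu>)\<close> gives \<open>a_h(\<sigma>, \<sigma>)\<close> plus the squared norm of the divergence, so
  only the norm of \<open>u\<close> is missing. It is recovered by adding to \<open>\<sigma>\<close> a small multiple of a discrete
  stress \<open>\<tau>\<close> for which \<open>b_h(\<tau>, u)\<close> bounds both \<open>\<parallel>u\<parallel>\<^sup>2\<close> and the deviator, jumps and divergence of \<open>\<tau>\<close>
  (\<open>stress_lifting\<close>, \<open>inf_sup_on_mesh\<close>). The difficulty is to find such a \<open>\<tau>\<close> with one constant for all
  triangulations, whatever the shape of their triangles.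

  The two rows of \<open>\<tau>\<close> decouple, so let \<open>u\<close> be scalar and let the row be the Crouzeix-Raviart vector
  field with values \<open>m\<close> at the midpoints of the sides. Along a side the normal component of the field
  changes by an amount called the slope; since jumps vanish at midpoints, the slopes bound the jumps. The
  energy of \<open>m\<close> is the sum of the squared slopes and of the squared \<open>L\<^sup>2\<close> norm of the field, and
  \<open>m\<close> is taken to minimise \<open>\<Sum>T. |T| (u_T - div_T m)\<^sup>2\<close> plus the energy. Writing \<open>\<lambda>_T = u_T - div_T m\<close>, the
  normal equations are \<open>\<Sum>T. |T| \<lambda>_T div_T y = e(m, y)\<close> for all \<open>y\<close>, where \<open>e\<close> is the bilinear form of
  the energy. For \<open>y = m\<close> they show that \<open>\<Sum>T. |T| u_T div_T m\<close> is the sum of \<open>\<parallel>div m\<parallel>\<^sup>2\<close> and the energy.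
  Hence the lifting works as soon as \<open>\<parallel>\<lambda>\<parallel>\<^sup>2\<close> is at most a constant times the energy.

  This bound is \<open>projection_residual_bound\<close>. The normal equations, tested with the edge means of a
  smooth vector field, say that a piecewise affine tensor \<open>P = \<lambda> I - M - D\<close> on the plane, zero outside
  the mesh, has a weak divergence \<open>- q\<close> that is bounded by the energy. Here \<open>M\<close> is a trace-free matrix made of
  the slopes and \<open>D\<close> an affine field made of the midpoint values. If \<open>q\<close> were zero, the rows of \<open>P\<close> would be
  rotated gradients of compactly supported potentials and \<open>det P\<close>, a Jacobian determinant, would have
  integral zero. Since \<open>det P\<close> is \<open>\<lambda>\<^sup>2\<close> up to energy terms, this would bound \<open>\<lambda>\<close>. For general \<open>q\<close> the
  potentials themselves enter. They are absorbed by integrating \<open>w det P\<close> with the convex weight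
  \<open>w = K + |x|\<^sup>2 / 2\<close>, at the price of a term \<open>(tr P)\<^sup>2\<close> with a factor that depends on the size of the
  domain only (\<open>plane_estimate\<close>). A large \<open>K\<close> makes \<open>2 w \<lambda>\<^sup>2\<close> dominate that term.
  The shape of the triangles drops out because \<open>|T| |det M|\<close> is bounded by the squared slopes for
  every triangle (\<open>slope_matrix_det\<close>).
\<close>

section \<open>Least squares by normal equations\<close>

text \<open>
  Induction on the index set, as in the Gram-Schmidt process: when an index \<open>k\<close> is added, the part \<open>w\<close>
  of \<open>v k\<close> that is orthogonal to the old vectors is found by the induction hypothesis, and the old
  residual is projected on \<open>w\<close>. If \<open>w = 0\<close>, then \<open>v k\<close> depends on the old
  vectors and its coefficient \<open>t\<close> is \<open>0\<close> by the convention for division.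
\<close>
lemma least_squares_normal_equations:
  fixes v :: "'i \<Rightarrow> 'r \<Rightarrow> real"
  assumes "finite I"
  shows "\<exists>x. \<forall>i\<in>I. (\<Sum>r\<in>R. (f r - (\<Sum>j\<in>I. x j * v j r)) * v i r) = 0"
  using assms
proof (induction I arbitrary: f rule: finite_induct)
  case empty
  show ?case by simp
next
  case (insert k I)
  obtain x where x: "\<And>i. i \<in> I \<Longrightarrow> (\<Sum>r\<in>R. (f r - (\<Sum>j\<in>I. x j * v j r)) * v i r) = 0"
    using insert.IH[of f] by blast
  obtain y where y: "\<And>i. i \<in> I \<Longrightarrow> (\<Sum>r\<in>R. (v k r - (\<Sum>j\<in>I. y j * v j r)) * v i r) = 0"
    using insert.IH[of "v k"] by blast
  define g where "g r = f r - (\<Sum>j\<in>I. x j * v j r)" for r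
  define w where "w r = v k r - (\<Sum>j\<in>I. y j * v j r)" for r
  define t where "t = (\<Sum>r\<in>R. g r * w r) / (\<Sum>r\<in>R. w r * w r)"
  define z where "z j = (if j = k then t else x j - t * y j)" for j
  have g0: "(\<Sum>r\<in>R. g r * v i r) = 0" if "i \<in> I" for i
    using x[OF that] by (simp add: g_def)
  have w0: "(\<Sum>r\<in>R. w r * v i r) = 0" if "i \<in> I" for i
    using y[OF that] by (simp add: w_def)
  have res: "f r - (\<Sum>j\<in>insert k I. z j * v j r) = g r - t * w r" for r
  proof -
    have "(\<Sum>j\<in>I. z j * v j r) = (\<Sum>j\<in>I. x j * v j r - t * (y j * v j r))"
      using insert.hyps by (intro sum.cong) (auto simp: z_def algebra_simps)
    then have "(\<Sum>j\<in>insert k I. z j * v j r)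
        = t * v k r + ((\<Sum>j\<in>I. x j * v j r) - t * (\<Sum>j\<in>I. y j * v j r))"
      using insert.hyps by (simp add: z_def sum_subtractf sum_distrib_left)
    then show ?thesis by (simp add: g_def w_def algebra_simps)
  qed
  have ortho: "(\<Sum>r\<in>R. h r * v k r) = (\<Sum>r\<in>R. h r * w r)"
    if "\<And>i. i \<in> I \<Longrightarrow> (\<Sum>r\<in>R. h r * v i r) = 0" for h :: "'r \<Rightarrow> real"
  proof -
    have "(\<Sum>r\<in>R. h r * v k r) = (\<Sum>r\<in>R. h r * w r) + (\<Sum>r\<in>R. \<Sum>j\<in>I. y j * (h r * v j r))"
      by (simp add: w_def sum.distrib[symmetric] algebra_simps sum_distrib_left)
    also have "(\<Sum>r\<in>R. \<Sum>j\<in>I. y j * (h r * v j r)) = (\<Sum>j\<in>I. y j * (\<Sum>r\<in>R. h r * v j r))"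
      by (subst sum.swap) (simp add: sum_distrib_left)
    also have "\<dots> = 0" using that by simp
    finally show ?thesis by simp
  qed
  have tw: "(\<Sum>r\<in>R. g r * w r) = t * (\<Sum>r\<in>R. w r * w r)"
  proof (cases "(\<Sum>r\<in>R. w r * w r) = 0")
    case True
    have "(\<Sum>r\<in>R. g r * w r) = 0"
    proof (cases "finite R")
      case True
      then show ?thesis
        using \<open>(\<Sum>r\<in>R. w r * w r) = 0\<close> by (subst (asm) sum_nonneg_eq_0_iff) auto
    qed simp
    then show ?thesis using True by simp
  qed (simp add: t_def)
  have "\<forall>i\<in>insert k I. (\<Sum>r\<in>R. (f r - (\<Sum>j\<in>insert k I. z j * v j r)) * v i r) = 0"
  proof
    fix i assume "i \<in> insert k I"
    have split: "(\<Sum>r\<in>R. (f r - (\<Sum>j\<in>insert k I. z j * v j r)) * u r)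
        = (\<Sum>r\<in>R. g r * u r) - t * (\<Sum>r\<in>R. w r * u r)" for u
      unfolding res by (simp add: algebra_simps sum_subtractf sum_distrib_left)
    show "(\<Sum>r\<in>R. (f r - (\<Sum>j\<in>insert k I. z j * v j r)) * v i r) = 0"
    proof (cases "i = k")
      case True
      show ?thesis unfolding split True using ortho[OF g0] ortho[OF w0] tw by simp
    next
      case False
      then have "i \<in> I" using \<open>i \<in> insert k I\<close> by simp
      then show ?thesis unfolding split using g0 w0 by simp
    qed
  qed
  then show ?case by blast
qed

section \<open>The weighted determinant inequality for smooth tensors\<close>

abbreviation cont2 :: "(real \<Rightarrow> real \<Rightarrow> real) \<Rightarrow> bool" where
  "cont2 f \<equiv> continuous_on UNIV (\<lambda>p. f (fst p) (snd p))"

definition square_integral :: "real \<Rightarrow> (real \<Rightarrow> real \<Rightarrow> real) \<Rightarrow> real" where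
  "square_integral L f = integral (cbox (-L, -L) (L, L)) (\<lambda>p. f (fst p) (snd p))"

lemma cont2_compose:
  assumes "cont2 f" "continuous_on S g" "continuous_on S h"
  shows "continuous_on S (\<lambda>t. f (g t) (h t))"
proof -
  have "continuous_on S (\<lambda>t. (\<lambda>p. f (fst p) (snd p)) (g t, h t))"
    by (rule continuous_on_compose2[OF assms(1)]) (auto intro!: continuous_intros assms)
  then show ?thesis by simp
qed

lemma square_integral_iterated:
  assumes "cont2 f"
  shows "square_integral L f = integral {-L..L} (\<lambda>x. integral {-L..L} (\<lambda>y. f x y))"
    and "square_integral L f = integral {-L..L} (\<lambda>y. integral {-L..L} (\<lambda>x. f x y))"
proof -
  have c: "continuous_on S (\<lambda>p. f (fst p) (snd p))" for S
    using assms continuous_on_subset by blast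
  show 1: "square_integral L f = integral {-L..L} (\<lambda>x. integral {-L..L} (\<lambda>y. f x y))"
    unfolding square_integral_def
    using integral_prod_continuous[OF c, of "-L" "-L" L L] by (simp add: cbox_interval)
  have "integral (cbox (-L) L) (\<lambda>x. integral (cbox (-L) L) (f x)) =
           integral (cbox (-L) L) (\<lambda>y. integral (cbox (-L) L) (\<lambda>x. f x y))"
    by (rule integral_swap_continuous) (use c in \<open>simp add: case_prod_beta\<close>)
  then show "square_integral L f = integral {-L..L} (\<lambda>y. integral {-L..L} (\<lambda>x. f x y))"
    unfolding 1 by (simp add: cbox_interval)
qed

lemma cont2_integrable:
  assumes "cont2 f"
  shows "(\<lambda>p. f (fst p) (snd p)) integrable_on cbox (-L, -L) (L, L)"
  by (rule integrable_continuous) (use assms continuous_on_subset in blast)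

lemma square_integral_mono:
  assumes "cont2 f" "cont2 g" "\<And>x y. \<bar>x\<bar> \<le> L \<Longrightarrow> \<bar>y\<bar> \<le> L \<Longrightarrow> f x y \<le> g x y"
  shows "square_integral L f \<le> square_integral L g"
  unfolding square_integral_def
  by (rule integral_le[OF cont2_integrable cont2_integrable])
    (use assms in \<open>auto simp: cbox_Pair_eq abs_le_iff\<close>)

lemma square_integral_add:
  assumes "cont2 f" "cont2 g"
  shows "square_integral L (\<lambda>x y. f x y + g x y) = square_integral L f + square_integral L g"
  unfolding square_integral_def
  by (rule integral_add[OF cont2_integrable cont2_integrable]) (use assms in auto)

lemma square_integral_cmult: "square_integral L (\<lambda>x y. c * f x y) = c * square_integral L f"
  unfolding square_integral_def by simp

text \<open>
  The fundamental theorem of calculus on horizontal lines; together with \<open>square_integral_dy\<close> it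
  replaces the divergence theorem on the square.
\<close>
lemma square_integral_dx:
  assumes "cont2 A'" "0 \<le> L"
    and "\<And>x y. ((\<lambda>x. A x y) has_real_derivative A' x y) (at x)"
    and "\<And>y. A L y = 0" "\<And>y. A (-L) y = 0"
  shows "square_integral L A' = 0"
proof -
  have "integral {-L..L} (\<lambda>x. A' x y) = 0" for y
  proof -
    have "((\<lambda>x. A' x y) has_integral (A L y - A (-L) y)) {-L..L}"
      by (rule fundamental_theorem_of_calculus)
        (use assms in \<open>auto simp: has_real_derivative_iff_has_vector_derivative[symmetric]
            intro: has_field_derivative_at_within\<close>)
    then show ?thesis using assms by (auto dest: integral_unique)
  qed
  then show ?thesis by (simp add: square_integral_iterated(2)[OF assms(1)])
qed

text \<open>
  The value on the upper side remains: potentials obtained by integrating upwards from the lower side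
  need not vanish there.
\<close>
lemma square_integral_dy:
  assumes "cont2 B'" "0 \<le> L"
    and "\<And>x y. ((\<lambda>y. B x y) has_real_derivative B' x y) (at y)"
    and "\<And>x. B x (-L) = 0"
  shows "square_integral L B' = integral {-L..L} (\<lambda>x. B x L)"
proof -
  have "integral {-L..L} (\<lambda>y. B' x y) = B x L" for x
  proof -
    have "((\<lambda>y. B' x y) has_integral (B x L - B x (-L))) {-L..L}"
      by (rule fundamental_theorem_of_calculus)
        (use assms in \<open>auto simp: has_real_derivative_iff_has_vector_derivative[symmetric]
            intro: has_field_derivative_at_within\<close>)
    then show ?thesis using assms by (auto dest: integral_unique)
  qed
  then show ?thesis by (simp add: square_integral_iterated(1)[OF assms(1)])
qed

text \<open>
  The Cauchy-Schwarz inequality against the constant function \<open>1\<close>.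
\<close>
lemma integral_square_le:
  fixes f :: "real \<Rightarrow> real"
  assumes "continuous_on {a..b} f" "a \<le> b"
  shows "(integral {a..b} f)\<^sup>2 \<le> (b - a) * integral {a..b} (\<lambda>t. (f t)\<^sup>2)"
proof (cases "a = b")
  case False
  then have ab: "b - a > 0" using assms by simp
  define m where "m = integral {a..b} f / (b - a)"
  have i1: "f integrable_on {a..b}" and i2: "(\<lambda>t. (f t)\<^sup>2) integrable_on {a..b}"
    by (auto intro!: integrable_continuous_real continuous_intros assms)
  have "((\<lambda>t. (f t)\<^sup>2 + ((- 2 * m) * f t + m\<^sup>2)) has_integral
      (integral {a..b} (\<lambda>t. (f t)\<^sup>2) + ((- 2 * m) * (m * (b - a)) + (b - a) *\<^sub>R m\<^sup>2))) {a..b}"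
    using ab by (intro has_integral_add has_integral_mult_right integrable_integral[OF i2])
       (use integrable_integral[OF i1] has_integral_const_real[of "m\<^sup>2" a b] in \<open>auto simp: m_def\<close>)
  then have "((\<lambda>t. (f t - m)\<^sup>2) has_integral
      (integral {a..b} (\<lambda>t. (f t)\<^sup>2) - (b - a) * m\<^sup>2)) {a..b}"
  proof (rule has_integral_eq_rhs[OF has_integral_eq, rotated])
    show "(f t)\<^sup>2 + ((- 2 * m) * f t + m\<^sup>2) = (f t - m)\<^sup>2" for t
      by (simp add: power2_eq_square algebra_simps)
  qed (simp_all add: power2_eq_square algebra_simps)
  then have "0 \<le> integral {a..b} (\<lambda>t. (f t)\<^sup>2) - (b - a) * m\<^sup>2"
    by (rule has_integral_nonneg) simp
  then have "(b - a) * ((b - a) * m\<^sup>2) \<le> (b - a) * integral {a..b} (\<lambda>t. (f t)\<^sup>2)"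
    using ab by (intro mult_left_mono) auto
  moreover have "(b - a) * ((b - a) * m\<^sup>2) = (integral {a..b} f)\<^sup>2"
    using ab by (simp add: m_def power2_eq_square)
  ultimately show ?thesis by simp
qed simp

lemma primitive_square_le:
  fixes f :: "real \<Rightarrow> real"
  assumes "continuous_on UNIV g" "\<And>t. (f has_real_derivative g t) (at t)" "f (-L) = 0"
    and "\<bar>t\<bar> \<le> L"
  shows "(f t)\<^sup>2 \<le> 2 * L * integral {-L..L} (\<lambda>s. (g s)\<^sup>2)"
proof -
  have t: "-L \<le> t" "t \<le> L" using assms(4) by auto
  have c: "continuous_on S g" for S using assms(1) continuous_on_subset by blast
  have "(g has_integral (f t - f (-L))) {-L..t}"
    by (rule fundamental_theorem_of_calculus)
      (use t assms in \<open>auto simp: has_real_derivative_iff_has_vector_derivative[symmetric]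
          intro: has_field_derivative_at_within\<close>)
  then have "f t = integral {-L..t} g" using assms(3) by (auto dest: integral_unique)
  then have "(f t)\<^sup>2 \<le> (t + L) * integral {-L..t} (\<lambda>s. (g s)\<^sup>2)"
    using integral_square_le[OF c t(1)] by simp
  also have "\<dots> \<le> (2 * L) * integral {-L..L} (\<lambda>s. (g s)\<^sup>2)"
    using t by (intro mult_mono integral_subset_le integral_nonneg)
      (auto intro!: integrable_continuous_real continuous_intros c)
  finally show ?thesis .
qed

lemma integral_primitive_square_le:
  fixes f :: "real \<Rightarrow> real"
  assumes "continuous_on UNIV g" "\<And>t. (f has_real_derivative g t) (at t)" "f (-L) = 0" "0 \<le> L"
  shows "integral {-L..L} (\<lambda>t. (f t)\<^sup>2) \<le> 4 * L\<^sup>2 * integral {-L..L} (\<lambda>s. (g s)\<^sup>2)"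
proof -
  have "continuous_on UNIV f"
    by (rule DERIV_continuous_on) (use assms(2) in auto)
  then have c: "continuous_on {-L..L} f" using continuous_on_subset by blast
  have "integral {-L..L} (\<lambda>t. (f t)\<^sup>2) \<le> integral {-L..L} (\<lambda>t. 2 * L * integral {-L..L} (\<lambda>s. (g s)\<^sup>2))"
    by (rule integral_le)
      (use primitive_square_le[OF assms(1,2,3)] in
        \<open>auto intro!: integrable_continuous_real continuous_intros c\<close>)
  also have "\<dots> = 4 * L\<^sup>2 * integral {-L..L} (\<lambda>s. (g s)\<^sup>2)"
    using assms(4) by (simp add: power2_eq_square)
  finally show ?thesis .
qed

text \<open>
  The three summands collect the direct contribution of \<open>q\<close>, that of its primitives \<open>Q\<close> over the square
  (\<open>8 L\<^sup>2 \<cdot> 4 L\<^sup>2\<close>), and the boundary term on the upper side.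
\<close>
definition plane_const :: "real \<Rightarrow> real \<Rightarrow> real" where
  "plane_const L W = 4 * W\<^sup>2 + 32 * L^4 + 2 * L * ((2 * L + W) * (4 * L\<^sup>2) + W)"

text \<open>
  Here \<open>f1\<close> and \<open>f2\<close> are potentials of the rows of \<open>P\<close>, obtained by integrating \<open>P11\<close> and \<open>P21\<close>
  in the second variable; \<open>Q1\<close> and \<open>Q2\<close>, the primitives of \<open>q1\<close> and \<open>q2\<close>, are the defects by which
  the rows fail to be rotated gradients. Integrating the weighted determinant by parts twice, the second
  derivatives of the weight produce \<open>- f1\<^sup>2 - f2\<^sup>2\<close>. Young's inequality spends these two squares on all
  terms that contain the potentials.
\<close>
lemma smooth_plane_estimate:
  fixes P11 P12 P21 P22 D1 D2 q1 q2 f1 f2 Q1 Q2 :: "real \<Rightarrow> real \<Rightarrow> real"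
  assumes cont: "cont2 P11" "cont2 P12" "cont2 P21" "cont2 P22" "cont2 D1" "cont2 D2"
      "cont2 q1" "cont2 q2" "cont2 f1" "cont2 f2" "cont2 Q1" "cont2 Q2"
    and P11: "\<And>x y. ((\<lambda>x. P11 x y) has_real_derivative D1 x y) (at x)"
    and P12: "\<And>x y. ((\<lambda>y. P12 x y) has_real_derivative - q1 x y - D1 x y) (at y)"
    and P21: "\<And>x y. ((\<lambda>x. P21 x y) has_real_derivative D2 x y) (at x)"
    and P22: "\<And>x y. ((\<lambda>y. P22 x y) has_real_derivative - q2 x y - D2 x y) (at y)"
    and f1x: "\<And>x y. ((\<lambda>x. f1 x y) has_real_derivative - P12 x y - Q1 x y) (at x)"
    and f1y: "\<And>x y. ((\<lambda>y. f1 x y) has_real_derivative P11 x y) (at y)"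
    and f2x: "\<And>x y. ((\<lambda>x. f2 x y) has_real_derivative - P22 x y - Q2 x y) (at x)"
    and f2y: "\<And>x y. ((\<lambda>y. f2 x y) has_real_derivative P21 x y) (at y)"
    and Q1y: "\<And>x y. ((\<lambda>y. Q1 x y) has_real_derivative q1 x y) (at y)"
    and Q2y: "\<And>x y. ((\<lambda>y. Q2 x y) has_real_derivative q2 x y) (at y)"
    and vanish: "\<And>y. f1 L y = 0" "\<And>y. f1 (-L) y = 0" "\<And>x. f1 x (-L) = 0"
      "\<And>y. f2 L y = 0" "\<And>y. f2 (-L) y = 0" "\<And>x. f2 x (-L) = 0"
      "\<And>x. P12 x L = 0" "\<And>x. P22 x L = 0" "\<And>x. Q1 x (-L) = 0" "\<And>x. Q2 x (-L) = 0"
    and "0 \<le> L" "0 \<le> K"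
  shows "2 * square_integral L (\<lambda>x y. (K + (x\<^sup>2 + y\<^sup>2) / 2) * (P11 x y * P22 x y - P12 x y * P21 x y))
     \<le> 8 * L\<^sup>2 * square_integral L (\<lambda>x y. (P11 x y + P22 x y)\<^sup>2)
       + plane_const L (K + L\<^sup>2) * square_integral L (\<lambda>x y. (q1 x y)\<^sup>2 + (q2 x y)\<^sup>2)"
proof -
  define w where "w x y = K + (x\<^sup>2 + y\<^sup>2) / 2" for x y :: real
  define W where "W = K + L\<^sup>2"
  have W0: "0 \<le> W" using assms by (simp add: W_def)
  define dt where "dt x y = P11 x y * P22 x y - P12 x y * P21 x y" for x y
  define d where "d x y = P11 x y + P22 x y" for x y
  \<comment> \<open>The divergence of (A, B) is R: two times the weighted determinant, the squares of the potentials
     and remainders.\<close>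
  define A where "A x y = P21 x y * w x y * f1 x y - P11 x y * w x y * f2 x y
      + x * (f2 x y)\<^sup>2 - y * f1 x y * f2 x y" for x y
  define B where "B x y = P22 x y * w x y * f1 x y - P12 x y * w x y * f2 x y
      + y * (f1 x y)\<^sup>2 - x * f1 x y * f2 x y - w x y * f1 x y * Q2 x y + w x y * f2 x y * Q1 x y" for x y
  define A' where "A' x y = D2 x y * w x y * f1 x y + P21 x y * x * f1 x y
      + P21 x y * w x y * (- P12 x y - Q1 x y)
      - (D1 x y * w x y * f2 x y + P11 x y * x * f2 x y + P11 x y * w x y * (- P22 x y - Q2 x y))
      + ((f2 x y)\<^sup>2 + x * (2 * f2 x y * (- P22 x y - Q2 x y)))
      - (y * (- P12 x y - Q1 x y) * f2 x y + y * f1 x y * (- P22 x y - Q2 x y))" for x y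
  define B' where "B' x y = (- q2 x y - D2 x y) * w x y * f1 x y + P22 x y * y * f1 x y
      + P22 x y * w x y * P11 x y
      - ((- q1 x y - D1 x y) * w x y * f2 x y + P12 x y * y * f2 x y + P12 x y * w x y * P21 x y)
      + ((f1 x y)\<^sup>2 + y * (2 * f1 x y * P11 x y))
      - (x * P11 x y * f2 x y + x * f1 x y * P21 x y)
      - (y * f1 x y * Q2 x y + w x y * P11 x y * Q2 x y + w x y * f1 x y * q2 x y)
      + (y * f2 x y * Q1 x y + w x y * P21 x y * Q1 x y + w x y * f2 x y * q1 x y)" for x y
  have cw: "cont2 w" unfolding w_def by (auto intro!: continuous_intros)
  have cA': "cont2 A'" unfolding A'_def by (intro continuous_intros cont cw)
  have cB': "cont2 B'" unfolding B'_def by (intro continuous_intros cont cw)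
  have wx: "((\<lambda>x. w x y) has_real_derivative x) (at x)" for x y
    unfolding w_def by (auto intro!: derivative_eq_intros)
  have wy: "((\<lambda>y. w x y) has_real_derivative y) (at y)" for x y
    unfolding w_def by (auto intro!: derivative_eq_intros)
  have dA: "((\<lambda>x. A x y) has_real_derivative A' x y) (at x)" for x y
    unfolding A_def A'_def
    by (rule derivative_eq_intros P11 P21 f1x f2x wx refl)+ (simp add: algebra_simps power2_eq_square)
  have dB: "((\<lambda>y. B x y) has_real_derivative B' x y) (at y)" for x y
    unfolding B_def B'_def
    by (rule derivative_eq_intros P12 P22 f1y f2y wy Q1y Q2y refl)+ (simp add: algebra_simps power2_eq_square)
  define R where "R x y = 2 * w x y * dt x y + (f1 x y)\<^sup>2 + (f2 x y)\<^sup>2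
      + 2 * d x y * (y * f1 x y - x * f2 x y) + 2 * w x y * (q1 x y * f2 x y - q2 x y * f1 x y)
      + 2 * y * Q1 x y * f2 x y - 2 * x * Q2 x y * f2 x y" for x y
  have RAB: "R x y = A' x y + B' x y" for x y
    unfolding R_def A'_def B'_def dt_def d_def by algebra
  have IA: "square_integral L A' = 0"
    by (rule square_integral_dx[OF cA' _ dA]) (use assms in \<open>auto simp: A_def\<close>)
  have IB: "square_integral L B' = integral {-L..L} (\<lambda>x. B x L)"
    by (rule square_integral_dy[OF cB' _ dB]) (use assms in \<open>auto simp: B_def\<close>)
  have cR: "cont2 R" unfolding RAB[abs_def] by (intro continuous_intros cA' cB')
  have IR: "square_integral L R = integral {-L..L} (\<lambda>x. B x L)"
    unfolding RAB[abs_def] by (simp add: square_integral_add[OF cA' cB'] IA IB)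
  define q where "q x y = (q1 x y)\<^sup>2 + (q2 x y)\<^sup>2" for x y
  define QQ where "QQ x y = (Q1 x y)\<^sup>2 + (Q2 x y)\<^sup>2" for x y
  have cq: "cont2 q" unfolding q_def by (intro continuous_intros cont)
  have cQQ: "cont2 QQ" unfolding QQ_def by (intro continuous_intros cont)
  have cd: "cont2 (\<lambda>x y. (d x y)\<^sup>2)" unfolding d_def by (intro continuous_intros cont)
  have cwdt: "cont2 (\<lambda>x y. w x y * dt x y)" unfolding dt_def by (intro continuous_intros cont cw)
  \<comment> \<open>In R the potentials appear squared with factor 1; each of the six products below takes a part of them.\<close>
  have young: "2 * (w x y * dt x y) \<le> R x y + (8 * L\<^sup>2 * (d x y)\<^sup>2 + (4 * W\<^sup>2 * q x y + 8 * L\<^sup>2 * QQ x y))"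
    if xy: "\<bar>x\<bar> \<le> L" "\<bar>y\<bar> \<le> L" for x y
  proof -
    have x2: "x\<^sup>2 \<le> L\<^sup>2" and y2: "y\<^sup>2 \<le> L\<^sup>2" using xy abs_le_square_iff[of x L] abs_le_square_iff[of y L] by auto
    have w0: "0 \<le> w x y" and wW: "w x y \<le> W"
      using x2 y2 assms by (auto simp: w_def W_def)
    have w2: "(w x y)\<^sup>2 \<le> W\<^sup>2" using w0 wW by (rule power_mono[rotated])
    have yng: "2 * a * b \<le> t * a\<^sup>2 + b\<^sup>2 / t" if "t > 0" for a b t :: real
    proof -
      have "0 \<le> (t * a - b)\<^sup>2 / t" using that by simp
      also have "\<dots> = t * a\<^sup>2 + b\<^sup>2 / t - 2 * a * b"
        using that by (simp add: field_simps power2_eq_square)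
      finally show ?thesis by simp
    qed
    have t1: "- (2 * d x y * (y * f1 x y)) \<le> 4 * L\<^sup>2 * (d x y)\<^sup>2 + (f1 x y)\<^sup>2 / 4"
      using yng[of 4 "- (d x y * y)" "f1 x y"] mult_right_mono[OF y2, of "4 * (d x y)\<^sup>2"]
      by (simp add: power_mult_distrib algebra_simps)
    have t2: "2 * d x y * (x * f2 x y) \<le> 4 * L\<^sup>2 * (d x y)\<^sup>2 + (f2 x y)\<^sup>2 / 4"
      using yng[of 4 "d x y * x" "f2 x y"] mult_right_mono[OF x2, of "4 * (d x y)\<^sup>2"]
      by (simp add: power_mult_distrib algebra_simps)
    have t3: "- (2 * w x y * (q1 x y * f2 x y)) \<le> 4 * W\<^sup>2 * (q1 x y)\<^sup>2 + (f2 x y)\<^sup>2 / 4"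
      using yng[of 4 "- (w x y * q1 x y)" "f2 x y"] mult_right_mono[OF w2, of "4 * (q1 x y)\<^sup>2"]
      by (simp add: power_mult_distrib algebra_simps)
    have t4: "2 * w x y * (q2 x y * f1 x y) \<le> 4 * W\<^sup>2 * (q2 x y)\<^sup>2 + (f1 x y)\<^sup>2 / 4"
      using yng[of 4 "w x y * q2 x y" "f1 x y"] mult_right_mono[OF w2, of "4 * (q2 x y)\<^sup>2"]
      by (simp add: power_mult_distrib algebra_simps)
    have t5: "- (2 * y * Q1 x y * f2 x y) \<le> 8 * L\<^sup>2 * (Q1 x y)\<^sup>2 + (f2 x y)\<^sup>2 / 8"
      using yng[of 8 "- (y * Q1 x y)" "f2 x y"] mult_right_mono[OF y2, of "8 * (Q1 x y)\<^sup>2"]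
      by (simp add: power_mult_distrib algebra_simps)
    have t6: "2 * x * Q2 x y * f2 x y \<le> 8 * L\<^sup>2 * (Q2 x y)\<^sup>2 + (f2 x y)\<^sup>2 / 8"
      using yng[of 8 "x * Q2 x y" "f2 x y"] mult_right_mono[OF x2, of "8 * (Q2 x y)\<^sup>2"]
      by (simp add: power_mult_distrib algebra_simps)
    have "R x y = 2 * (w x y * dt x y) + (f1 x y)\<^sup>2 + (f2 x y)\<^sup>2
        + 2 * d x y * (y * f1 x y) - 2 * d x y * (x * f2 x y)
        + 2 * w x y * (q1 x y * f2 x y) - 2 * w x y * (q2 x y * f1 x y)
        + 2 * y * Q1 x y * f2 x y - 2 * x * Q2 x y * f2 x y"
      by (simp add: R_def algebra_simps)
    moreover have "4 * W\<^sup>2 * q x y = 4 * W\<^sup>2 * (q1 x y)\<^sup>2 + 4 * W\<^sup>2 * (q2 x y)\<^sup>2"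
      "8 * L\<^sup>2 * QQ x y = 8 * L\<^sup>2 * (Q1 x y)\<^sup>2 + 8 * L\<^sup>2 * (Q2 x y)\<^sup>2"
      by (simp_all add: q_def QQ_def algebra_simps)
    ultimately show ?thesis
      using t1 t2 t3 t4 t5 t6 zero_le_power2[of "f1 x y"] zero_le_power2[of "f2 x y"] by linarith
  qed
  have main: "2 * square_integral L (\<lambda>x y. w x y * dt x y) \<le> integral {-L..L} (\<lambda>x. B x L)
     + (8 * L\<^sup>2 * square_integral L (\<lambda>x y. (d x y)\<^sup>2) + (4 * W\<^sup>2 * square_integral L q + 8 * L\<^sup>2 * square_integral L QQ))"
  proof -
    have "square_integral L (\<lambda>x y. 2 * (w x y * dt x y))
      \<le> square_integral L (\<lambda>x y. R x y + (8 * L\<^sup>2 * (d x y)\<^sup>2 + (4 * W\<^sup>2 * q x y + 8 * L\<^sup>2 * QQ x y)))"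
      by (rule square_integral_mono) (intro continuous_intros cR cd cq cQQ cwdt young | assumption)+
    also have "\<dots> = square_integral L R + (8 * L\<^sup>2 * square_integral L (\<lambda>x y. (d x y)\<^sup>2)
        + (4 * W\<^sup>2 * square_integral L q + 8 * L\<^sup>2 * square_integral L QQ))"
      by (subst square_integral_add | intro continuous_intros cR cd cq cQQ)+ 
        (simp only: square_integral_cmult)
    finally show ?thesis by (simp add: square_integral_cmult IR)
  qed
  have cx: "continuous_on S (\<lambda>x. f x y)" and cy: "continuous_on S (\<lambda>y. f x y)"
    if "cont2 f" for f :: "real \<Rightarrow> real \<Rightarrow> real" and S x y
    by (auto intro!: cont2_compose[OF that] continuous_intros)
  have Qint: "integral {-L..L} (\<lambda>y. (Q x y)\<^sup>2) \<le> 4 * L\<^sup>2 * integral {-L..L} (\<lambda>y. (qq x y)\<^sup>2)"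
    and Qtop: "(Q x L)\<^sup>2 \<le> 2 * L * integral {-L..L} (\<lambda>y. (qq x y)\<^sup>2)"
    if "cont2 qq" "\<And>x y. ((\<lambda>y. Q x y) has_real_derivative qq x y) (at y)" "\<And>x. Q x (-L) = 0"
    for Q qq x
    using integral_primitive_square_le[OF cy[OF that(1)] that(2,3)]
      primitive_square_le[OF cy[OF that(1)] that(2,3), of L] assms by auto
  have Qsq: "square_integral L (\<lambda>x y. (Q x y)\<^sup>2) \<le> 4 * L\<^sup>2 * square_integral L (\<lambda>x y. (qq x y)\<^sup>2)"
    and Msq: "integral {-L..L} (\<lambda>x. (Q x L)\<^sup>2) \<le> 2 * L * square_integral L (\<lambda>x y. (qq x y)\<^sup>2)"
    if Q: "cont2 qq" "\<And>x y. ((\<lambda>y. Q x y) has_real_derivative qq x y) (at y)" "\<And>x. Q x (-L) = 0"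
      and cQ: "cont2 Q" for Q qq
  proof -
    have c1: "cont2 (\<lambda>x y. (Q x y)\<^sup>2)" "cont2 (\<lambda>x y. (qq x y)\<^sup>2)"
      by (intro continuous_intros cQ Q)+
    have int: "(\<lambda>x. integral {-L..L} (\<lambda>y. f x y)) integrable_on {-L..L}" if "cont2 f" for f :: "real \<Rightarrow> real \<Rightarrow> real"
    proof -
      have "continuous_on (cbox (-L) L) (\<lambda>x. integral (cbox (-L) L) (\<lambda>y. f x y))"
        by (rule integral_continuous_on_param)
          (use that continuous_on_subset in \<open>auto simp: case_prod_beta\<close>)
      then show ?thesis by (auto intro!: integrable_continuous_real)
    qed
    show "square_integral L (\<lambda>x y. (Q x y)\<^sup>2) \<le> 4 * L\<^sup>2 * square_integral L (\<lambda>x y. (qq x y)\<^sup>2)"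
      unfolding square_integral_iterated(1)[OF c1(1)] square_integral_iterated(1)[OF c1(2)]
        integral_mult_right[symmetric]
      by (rule integral_le) (use int[OF c1(1)] integrable_on_cmult_left[OF int[OF c1(2)], of "4 * L\<^sup>2"] Qint[OF Q] in auto)
    show "integral {-L..L} (\<lambda>x. (Q x L)\<^sup>2) \<le> 2 * L * square_integral L (\<lambda>x y. (qq x y)\<^sup>2)"
      unfolding square_integral_iterated(1)[OF c1(2)] integral_mult_right[symmetric]
      by (rule integral_le)
        (use integrable_on_cmult_left[OF int[OF c1(2)], of "2 * L"] Qtop[OF Q] in \<open>auto intro!: integrable_continuous_real continuous_intros cx cQ\<close>)
  qed
  have q_split: "square_integral L q = square_integral L (\<lambda>x y. (q1 x y)\<^sup>2) + square_integral L (\<lambda>x y. (q2 x y)\<^sup>2)"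
    unfolding q_def by (rule square_integral_add) (intro continuous_intros cont)+
  have QQ_le: "square_integral L QQ \<le> 4 * L\<^sup>2 * square_integral L q"
  proof -
    have "square_integral L QQ = square_integral L (\<lambda>x y. (Q1 x y)\<^sup>2) + square_integral L (\<lambda>x y. (Q2 x y)\<^sup>2)"
      unfolding QQ_def by (rule square_integral_add) (intro continuous_intros cont)+
    then show ?thesis
      using Qsq[OF cont(7) Q1y vanish(9) cont(11)] Qsq[OF cont(8) Q2y vanish(10) cont(12)]
      unfolding q_split by (simp add: algebra_simps)
  qed
  define M where "M = integral {-L..L} (\<lambda>x. (Q1 x L)\<^sup>2) + integral {-L..L} (\<lambda>x. (Q2 x L)\<^sup>2)"
  have M_le: "M \<le> 2 * L * square_integral L q"
    using Msq[OF cont(7) Q1y vanish(9) cont(11)] Msq[OF cont(8) Q2y vanish(10) cont(12)]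
    unfolding q_split M_def by (simp add: algebra_simps)
  have c_le: "integral {-L..L} (\<lambda>x. (f x L)\<^sup>2) \<le> 4 * L\<^sup>2 * integral {-L..L} (\<lambda>x. (Q x L)\<^sup>2)"
    if "cont2 Q" "\<And>x. ((\<lambda>x. f x L) has_real_derivative - Q x L) (at x)" "f (-L) L = 0" for f Q :: "real \<Rightarrow> real \<Rightarrow> real"
    using integral_primitive_square_le[OF continuous_on_minus[OF cx[OF that(1)]] that(2,3) \<open>0 \<le> L\<close>]
    by simp
  have c1: "integral {-L..L} (\<lambda>x. (f1 x L)\<^sup>2) \<le> 4 * L\<^sup>2 * integral {-L..L} (\<lambda>x. (Q1 x L)\<^sup>2)"
    by (rule c_le[OF cont(11)]) (use f1x[where y = L] vanish in auto)
  have c2: "integral {-L..L} (\<lambda>x. (f2 x L)\<^sup>2) \<le> 4 * L\<^sup>2 * integral {-L..L} (\<lambda>x. (Q2 x L)\<^sup>2)"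
    by (rule c_le[OF cont(12)]) (use f2x[where y = L] vanish in auto)
  \<comment> \<open>On the upper side the potentials are primitives of - Q, because the second components of the rows of P vanish there.\<close>
  have Btop: "B x L \<le> (2 * L + W) * ((f1 x L)\<^sup>2 + (f2 x L)\<^sup>2) + W * ((Q1 x L)\<^sup>2 + (Q2 x L)\<^sup>2)"
    if "\<bar>x\<bar> \<le> L" for x
  proof -
    have w0: "0 \<le> w x L" and wW: "w x L \<le> W"
      using that abs_le_square_iff[of x L] assms by (auto simp: w_def W_def)
    have yng: "\<bar>a * b\<bar> \<le> (a\<^sup>2 + b\<^sup>2) / 2" for a b :: real
    proof -
      have "0 \<le> (a - b)\<^sup>2" "0 \<le> (a + b)\<^sup>2" by simp_all
      then have "a * b \<le> (a\<^sup>2 + b\<^sup>2) / 2" "- (a * b) \<le> (a\<^sup>2 + b\<^sup>2) / 2"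
        by (simp_all add: power2_eq_square algebra_simps)
      then show ?thesis by (simp add: abs_le_iff)
    qed
    have "- (x * f1 x L * f2 x L) \<le> L * (f1 x L)\<^sup>2 / 2 + L * (f2 x L)\<^sup>2 / 2"
    proof -
      have "- (x * f1 x L * f2 x L) \<le> \<bar>x\<bar> * \<bar>f1 x L * f2 x L\<bar>" by (simp add: abs_mult[symmetric] mult.assoc)
      also have "\<dots> \<le> L * (((f1 x L)\<^sup>2 + (f2 x L)\<^sup>2) / 2)"
        by (intro mult_mono yng that) (use assms in auto)
      finally show ?thesis by (simp add: field_simps)
    qed
    moreover have wle: "\<bar>w x L * a * b\<bar> \<le> W * ((a\<^sup>2 + b\<^sup>2) / 2)" for a b :: real
    proof -
      have "\<bar>w x L * a * b\<bar> = w x L * \<bar>a * b\<bar>" using w0 by (simp add: abs_mult mult.assoc)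
      also have "\<dots> \<le> W * ((a\<^sup>2 + b\<^sup>2) / 2)" by (intro mult_mono yng wW W0) auto
      finally show ?thesis .
    qed
    moreover have "0 \<le> L * (f1 x L)\<^sup>2" "0 \<le> L * (f2 x L)\<^sup>2" "0 \<le> W * (f1 x L)\<^sup>2" "0 \<le> W * (f2 x L)\<^sup>2"
      "0 \<le> W * (Q1 x L)\<^sup>2" "0 \<le> W * (Q2 x L)\<^sup>2" using assms W0 by auto
    moreover have "- (w x L * f1 x L * Q2 x L) \<le> W * (f1 x L)\<^sup>2 / 2 + W * (Q2 x L)\<^sup>2 / 2"
      using abs_le_D2[OF wle[of "f1 x L" "Q2 x L"]] by (simp add: field_simps)
    moreover have "w x L * f2 x L * Q1 x L \<le> W * (f2 x L)\<^sup>2 / 2 + W * (Q1 x L)\<^sup>2 / 2"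
      using abs_le_D1[OF wle[of "f2 x L" "Q1 x L"]] by (simp add: field_simps)
    ultimately have "L * (f1 x L)\<^sup>2 + - (x * f1 x L * f2 x L) + - (w x L * f1 x L * Q2 x L)
        + w x L * f2 x L * Q1 x L \<le> 2 * (L * (f1 x L)\<^sup>2) + 2 * (L * (f2 x L)\<^sup>2) + W * (f1 x L)\<^sup>2 + W * (f2 x L)\<^sup>2
         + W * (Q1 x L)\<^sup>2 + W * (Q2 x L)\<^sup>2"
      by linarith
    moreover have "B x L = L * (f1 x L)\<^sup>2 + - (x * f1 x L * f2 x L) + - (w x L * f1 x L * Q2 x L)
        + w x L * f2 x L * Q1 x L"
      by (simp add: B_def vanish)
    moreover have "(2 * L + W) * ((f1 x L)\<^sup>2 + (f2 x L)\<^sup>2) + W * ((Q1 x L)\<^sup>2 + (Q2 x L)\<^sup>2)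
       = 2 * (L * (f1 x L)\<^sup>2) + 2 * (L * (f2 x L)\<^sup>2) + W * (f1 x L)\<^sup>2 + W * (f2 x L)\<^sup>2
         + W * (Q1 x L)\<^sup>2 + W * (Q2 x L)\<^sup>2"
      by (simp add: algebra_simps)
    ultimately show ?thesis by simp
  qed
  have Bint: "integral {-L..L} (\<lambda>x. B x L) \<le> ((2 * L + W) * (4 * L\<^sup>2) + W) * M"
  proof -
    have cB: "continuous_on {-L..L} (\<lambda>x. B x L)"
      unfolding B_def by (intro continuous_intros cx cont cw)
    note i = integrable_continuous_real
    have "integral {-L..L} (\<lambda>x. B x L) \<le> integral {-L..L} (\<lambda>x. (2 * L + W) * ((f1 x L)\<^sup>2 + (f2 x L)\<^sup>2) + W * ((Q1 x L)\<^sup>2 + (Q2 x L)\<^sup>2))"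
      by (rule integral_le) (use Btop cB in \<open>auto intro!: i continuous_intros cx cont\<close>)
    also have "\<dots> = (2 * L + W) * (integral {-L..L} (\<lambda>x. (f1 x L)\<^sup>2) + integral {-L..L} (\<lambda>x. (f2 x L)\<^sup>2)) + W * M"
      unfolding M_def
      by (subst integral_add, (intro i continuous_intros cx cont)+)
         (simp only: integral_mult_right, subst (1 2) integral_add, (intro i continuous_intros cx cont)+, rule refl)
    also have "\<dots> \<le> (2 * L + W) * (4 * L\<^sup>2 * M) + W * M"
      using c1 c2 assms W0 unfolding M_def by (intro add_mono mult_left_mono) (auto simp: algebra_simps)
    finally show ?thesis by (simp add: algebra_simps)
  qed
  have "2 * square_integral L (\<lambda>x y. w x y * dt x y) \<le> ((2 * L + W) * (4 * L\<^sup>2) + W) * (2 * L * square_integral L q)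
     + (8 * L\<^sup>2 * square_integral L (\<lambda>x y. (d x y)\<^sup>2)
     + (4 * W\<^sup>2 * square_integral L q + 8 * L\<^sup>2 * (4 * L\<^sup>2 * square_integral L q)))"
    by (rule order_trans[OF main])
      (intro add_mono order_trans[OF Bint] mult_left_mono M_le QQ_le order_refl, use assms W0 in auto)
  also have "\<dots> = 8 * L\<^sup>2 * square_integral L (\<lambda>x y. (d x y)\<^sup>2) + plane_const L W * square_integral L q"
    by (simp add: plane_const_def algebra_simps power2_eq_square power4_eq_xxxx)
  finally show ?thesis unfolding w_def dt_def d_def q_def W_def .
qed

section \<open>Mollification with tensor product kernels\<close>

lemma prod_Basis_vec2: "(\<Prod>b\<in>Basis. (v::real^2) \<bullet> b) = v $ 1 * v $ 2"
proof -
  have B: "Basis = {axis 1 1, axis 2 (1::real) :: real^2}"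
    by (auto simp: Basis_vec_def UNIV_2)
  have "axis 1 (1::real) \<noteq> (axis 2 1 :: real^2)"
    by (auto simp: axis_def vec_eq_iff)
  then show ?thesis by (simp add: B inner_axis)
qed

definition vec2 :: "real \<times> real \<Rightarrow> real^2" where
  "vec2 p = vector [fst p, snd p]"

lemma vec2_nth [simp]: "vec2 p $ 1 = fst p" "vec2 p $ 2 = snd p"
  by (simp_all add: vec2_def)

lemma vec2_measurable [measurable]: "vec2 \<in> borel_measurable borel"
proof -
  have "continuous_on UNIV vec2"
    by (rule continuous_on_vec_lambda[where f="\<lambda>i p. vec2 p $ i", simplified])
      (metis (mono_tags, lifting) continuous_on_cong continuous_on_fst continuous_on_snd continuous_on_id exhaust_2 vec2_nth)
  then show ?thesis by (rule borel_measurable_continuous_onI)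
qed

text \<open>
  Identifies the plane with pairs of reals, where Fubini's theorem applies.
\<close>
lemma lborel_vec2: "distr lborel borel vec2 = (lborel :: (real^2) measure)"
proof (rule lborel_eqI[symmetric])
  fix l u :: "real^2"
  assume lu: "\<And>b. b \<in> Basis \<Longrightarrow> l \<bullet> b \<le> u \<bullet> b"
  have l: "l $ i \<le> u $ i" for i
    using lu[of "axis i 1"] by (simp add: inner_axis)
  have v: "vec2 -` box l u = box (l $ 1, l $ 2) (u $ 1, u $ 2)"
    by (auto simp: mem_box_cart forall_2 box_prod mem_box)
  have "emeasure (distr lborel borel vec2) (box l u) = emeasure lborel (vec2 -` box l u)"
    by (subst emeasure_distr) auto
  also have "\<dots> = ennreal ((u $ 1 - l $ 1) * (u $ 2 - l $ 2))"
    unfolding v lborel_prod[symmetric] box_prod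
    using l by (subst lborel.emeasure_pair_measure_Times) (auto simp: ennreal_mult box_real)
  also have "\<dots> = (\<Prod>b\<in>Basis. (u - l) \<bullet> b)"
    by (simp add: prod_Basis_vec2)
  finally show "emeasure (distr lborel borel vec2) (box l u) = (\<Prod>b\<in>Basis. (u - l) \<bullet> b)" .
qed simp

lemma square_integral_LINT:
  assumes "cont2 f"
  shows "square_integral L f
    = (LINT z|lborel. indicator (cbox (vec2 (-L, -L)) (vec2 (L, L))) z * f (z $ 1) (z $ 2))"
proof -
  have m: "(\<lambda>z::real^2. indicator (cbox (vec2 (-L, -L)) (vec2 (L, L))) z * f (z $ 1) (z $ 2)) \<in> borel_measurable borel"
  proof -
    have "continuous_on UNIV (\<lambda>z::real^2. f (z $ 1) (z $ 2))"
      by (rule cont2_compose[OF assms]) (intro continuous_intros)+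
    then have "(\<lambda>z::real^2. f (z $ 1) (z $ 2)) \<in> borel_measurable borel"
      by (rule borel_measurable_continuous_onI)
    then show ?thesis by measurable
  qed
  have "(LINT z|lborel. indicator (cbox (vec2 (-L, -L)) (vec2 (L, L))) z * f (z $ 1) (z $ 2))
     = (LINT p|lborel. indicator (cbox (vec2 (-L, -L)) (vec2 (L, L))) (vec2 p) * f (vec2 p $ 1) (vec2 p $ 2))"
    unfolding lborel_vec2[symmetric] by (rule integral_distr) (use m in auto)
  also have "\<dots> = (LINT p:cbox (-L, -L) (L, L)|lborel. f (fst p) (snd p))"
    unfolding set_lebesgue_integral_def
    by (rule Bochner_Integration.integral_cong)
      (auto simp: indicator_def mem_box_cart forall_2 cbox_Pair_eq mem_box)
  also have "\<dots> = square_integral L f"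
    unfolding square_integral_def
    by (rule set_borel_integral_eq_integral(2))
      (unfold set_integrable_def, rule borel_integrable_compact,
        auto intro: continuous_on_subset[OF assms])
  finally show ?thesis by simp
qed

text \<open>
  The second function is the derivative of the first, uniformly up to a quadratic remainder. In this
  form differentiation under the integral sign needs no convergence theorem.
\<close>
definition kernel_pair :: "(real \<Rightarrow> real) \<Rightarrow> (real \<Rightarrow> real) \<Rightarrow> bool" where
  "kernel_pair \<alpha> \<alpha>' \<longleftrightarrow> continuous_on UNIV \<alpha> \<and> continuous_on UNIV \<alpha>' \<and>
     (\<exists>B. \<forall>t. \<bar>\<alpha> t\<bar> \<le> B) \<and> (\<exists>B. \<forall>t. \<bar>\<alpha>' t\<bar> \<le> B) \<and>
     (\<exists>C. \<forall>t s. \<bar>s\<bar> \<le> 1 \<longrightarrow> \<bar>\<alpha> (t + s) - \<alpha> t - s * \<alpha>' t\<bar> \<le> C * s\<^sup>2)"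

text \<open>
  The convolution of \<open>f\<close> with \<open>\<alpha> \<otimes> \<beta>\<close>. Different kernels in the two variables allow one of them
  to be a primitive of the mollifier, so that potentials of mollified fields have the same form.
\<close>
definition smear :: "(real^2 \<Rightarrow> real) \<Rightarrow> (real \<Rightarrow> real) \<Rightarrow> (real \<Rightarrow> real) \<Rightarrow> real \<Rightarrow> real \<Rightarrow> real" where
  "smear f \<alpha> \<beta> x y = (LINT z|lborel. f z * (\<alpha> (x - z $ 1) * \<beta> (y - z $ 2)))"

definition bounded_continuous :: "(real \<Rightarrow> real) \<Rightarrow> bool" where
  "bounded_continuous \<alpha> \<longleftrightarrow> continuous_on UNIV \<alpha> \<and> (\<exists>B. \<forall>t. \<bar>\<alpha> t\<bar> \<le> B)"

lemma bounded_continuousE: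
  assumes "bounded_continuous \<alpha>"
  obtains B where "B \<ge> 0" "\<And>t. \<bar>\<alpha> t\<bar> \<le> B" "continuous_on UNIV \<alpha>"
proof -
  obtain B where B: "\<And>t. \<bar>\<alpha> t\<bar> \<le> B" and c: "continuous_on UNIV \<alpha>"
    using assms by (auto simp: bounded_continuous_def)
  have "0 \<le> B" using order_trans[OF abs_ge_zero B] .
  then show ?thesis using that B c by blast
qed

lemma kernel_pair_bounded_continuous:
  assumes "kernel_pair \<alpha> \<alpha>'"
  shows "bounded_continuous \<alpha>" "bounded_continuous \<alpha>'"
  using assms by (auto simp: kernel_pair_def bounded_continuous_def)

lemma tensor_kernel_measurable:
  fixes \<alpha> \<beta> :: "real \<Rightarrow> real"
  assumes "continuous_on UNIV \<alpha>" "continuous_on UNIV \<beta>"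
  shows "(\<lambda>z::real^2. \<alpha> (x - z $ 1) * \<beta> (y - z $ 2)) \<in> borel_measurable borel"
proof -
  have "continuous_on UNIV (\<lambda>z::real^2. \<alpha> (x - z $ 1))" "continuous_on UNIV (\<lambda>z::real^2. \<beta> (y - z $ 2))"
    by (rule continuous_on_compose2[OF assms(1)] continuous_on_compose2[OF assms(2)];
        auto intro!: continuous_intros)+
  then show ?thesis
    by (intro borel_measurable_continuous_onI continuous_on_mult)
qed

lemma abs_mult_le_scaled:
  fixes f a b A B :: real
  assumes "\<bar>a\<bar> \<le> A" "\<bar>b\<bar> \<le> B"
  shows "\<bar>f * (a * b)\<bar> \<le> \<bar>f\<bar> * (A * B)"
  unfolding abs_mult using assms by (intro mult_left_mono mult_mono) auto

lemma smear_integrable: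
  assumes "integrable lborel f" "bounded_continuous \<alpha>" "bounded_continuous \<beta>"
  shows "integrable lborel (\<lambda>z::real^2. f z * (\<alpha> (x - z $ 1) * \<beta> (y - z $ 2)))"
proof -
  obtain A where A: "A \<ge> 0" "\<And>t. \<bar>\<alpha> t\<bar> \<le> A" "continuous_on UNIV \<alpha>"
    by (rule bounded_continuousE[OF assms(2)], rule that; assumption)
  obtain B where B: "B \<ge> 0" "\<And>t. \<bar>\<beta> t\<bar> \<le> B" "continuous_on UNIV \<beta>"
    by (rule bounded_continuousE[OF assms(3)], rule that; assumption)
  show ?thesis
  proof (rule Bochner_Integration.integrable_bound[OF integrable_mult_left[OF assms(1), of "A * B"]])
    show "(\<lambda>z::real^2. f z * (\<alpha> (x - z $ 1) * \<beta> (y - z $ 2))) \<in> borel_measurable lborel"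
      using borel_measurable_times[OF borel_measurable_integrable[OF assms(1)]
          tensor_kernel_measurable[OF A(3) B(3), folded measurable_lborel2]] .
    show "AE z in lborel. norm (f z * (\<alpha> (x - z $ 1) * \<beta> (y - z $ 2))) \<le> norm (f z * (A * B))"
      using abs_mult_le_scaled[OF A(2) B(2)] A(1) B(1) by (simp add: abs_mult[of _ "A * B"])
  qed
qed

lemma cont2_smear:
  assumes f: "integrable lborel f" and ab: "bounded_continuous \<alpha>" "bounded_continuous \<beta>"
  shows "cont2 (smear f \<alpha> \<beta>)"
proof -
  obtain A where A: "A \<ge> 0" "\<And>t. \<bar>\<alpha> t\<bar> \<le> A" "continuous_on UNIV \<alpha>"
    by (rule bounded_continuousE[OF ab(1)], rule that; assumption)
  obtain B where B: "B \<ge> 0" "\<And>t. \<bar>\<beta> t\<bar> \<le> B" "continuous_on UNIV \<beta>"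
    by (rule bounded_continuousE[OF ab(2)], rule that; assumption)
  show ?thesis
  proof (rule continuous_on_sequentiallyI)
    fix p :: "nat \<Rightarrow> real \<times> real" and a
    assume p: "p \<longlonglongrightarrow> a"
    have px: "(\<lambda>n. fst (p n) - t) \<longlonglongrightarrow> fst a - t" and py: "(\<lambda>n. snd (p n) - t) \<longlonglongrightarrow> snd a - t" for t
      by (intro tendsto_intros p)+
    have c: "isCont \<alpha> t" "isCont \<beta> t" for t
      using A(3) B(3) by (auto simp: continuous_on_eq_continuous_at)
    show "(\<lambda>n. smear f \<alpha> \<beta> (fst (p n)) (snd (p n))) \<longlonglongrightarrow> smear f \<alpha> \<beta> (fst a) (snd a)"
      unfolding smear_def
    proof (rule integral_dominated_convergence[where w="\<lambda>z. \<bar>f z * (A * B)\<bar>"])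
      show "(\<lambda>z. f z * (\<alpha> (fst a - z $ 1) * \<beta> (snd a - z $ 2))) \<in> borel_measurable lborel"
        "\<And>n. (\<lambda>z. f z * (\<alpha> (fst (p n) - z $ 1) * \<beta> (snd (p n) - z $ 2))) \<in> borel_measurable lborel"
        by (rule borel_measurable_integrable[OF smear_integrable[OF f ab]])+
      show "integrable lborel (\<lambda>z. \<bar>f z * (A * B)\<bar>)" using f by auto
      show "AE z in lborel. (\<lambda>n. f z * (\<alpha> (fst (p n) - z $ 1) * \<beta> (snd (p n) - z $ 2)))
          \<longlonglongrightarrow> f z * (\<alpha> (fst a - z $ 1) * \<beta> (snd a - z $ 2))"
        by (intro AE_I2 tendsto_intros isCont_tendsto_compose[OF c(1)] isCont_tendsto_compose[OF c(2)] px py)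
      show "AE z in lborel. norm (f z * (\<alpha> (fst (p n) - z $ 1) * \<beta> (snd (p n) - z $ 2))) \<le> \<bar>f z * (A * B)\<bar>" for n
        using abs_mult_le_scaled[OF A(2) B(2)] A(1) B(1) by (simp add: abs_mult[of _ "A * B"])
    qed
  qed
qed

text \<open>
  The difference quotient deviates from \<open>D\<close> by at most \<open>C |s|\<close>.
\<close>
lemma has_derivative_quadratic_remainder:
  fixes F :: "real \<Rightarrow> real"
  assumes "\<And>s. \<bar>s\<bar> \<le> 1 \<Longrightarrow> \<bar>F (x + s) - F x - s * D\<bar> \<le> C * s\<^sup>2"
  shows "(F has_real_derivative D) (at x)"
proof -
  have C0: "C \<ge> 0" using assms[of 1] by simp
  have "((\<lambda>s. (F (x + s) - F x) / s - D) \<longlongrightarrow> 0) (at 0)"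
  proof (rule Lim_null_comparison)
    show "eventually (\<lambda>s. norm ((F (x + s) - F x) / s - D) \<le> C * \<bar>s\<bar>) (at 0)"
      unfolding eventually_at
    proof (intro exI[of _ 1] conjI ballI impI)
      fix s :: real assume "s \<noteq> 0 \<and> dist s 0 < 1"
      then have s: "s \<noteq> 0" "\<bar>s\<bar> \<le> 1" by auto
      have "(F (x + s) - F x) / s - D = (F (x + s) - F x - s * D) / s"
        using s by (simp add: field_simps)
      then have "norm ((F (x + s) - F x) / s - D) \<le> C * s\<^sup>2 / \<bar>s\<bar>"
        using assms[OF s(2)] by (simp add: divide_right_mono)
      also have "\<dots> = C * \<bar>s\<bar>" using s
        by (simp add: power2_eq_square abs_if)
      finally show "norm ((F (x + s) - F x) / s - D) \<le> C * \<bar>s\<bar>" .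
    qed simp
    show "((\<lambda>s. C * \<bar>s\<bar>) \<longlongrightarrow> 0) (at 0)" by (auto intro!: tendsto_eq_intros)
  qed
  then show ?thesis unfolding DERIV_def by (rule Lim_null[THEN iffD2])
qed

text \<open>
  The quadratic remainder of the kernel passes through the integral.
\<close>
lemma smear_dx:
  assumes f: "integrable lborel f" and k: "kernel_pair \<alpha> \<alpha>'" and b: "bounded_continuous \<beta>"
  shows "((\<lambda>x. smear f \<alpha> \<beta> x y) has_real_derivative smear f \<alpha>' \<beta> x y) (at x)"
proof -
  obtain B where B: "B \<ge> 0" "\<And>t. \<bar>\<beta> t\<bar> \<le> B" by (rule bounded_continuousE[OF b], rule that; assumption)
  obtain C where C: "\<And>t s. \<bar>s\<bar> \<le> 1 \<Longrightarrow> \<bar>\<alpha> (t + s) - \<alpha> t - s * \<alpha>' t\<bar> \<le> C * s\<^sup>2"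
    using k by (auto simp: kernel_pair_def)
  note bc = kernel_pair_bounded_continuous[OF k] b
  show ?thesis
  proof (rule has_derivative_quadratic_remainder)
    fix s :: real assume s: "\<bar>s\<bar> \<le> 1"
    have i: "integrable lborel (\<lambda>z::real^2. f z * (\<alpha> (u - z $ 1) * \<beta> (y - z $ 2)))"
      "integrable lborel (\<lambda>z::real^2. f z * (\<alpha>' (u - z $ 1) * \<beta> (y - z $ 2)))" for u
      by (rule smear_integrable[OF f]; rule bc)+
    have eq: "smear f \<alpha> \<beta> (x + s) y - smear f \<alpha> \<beta> x y - s * smear f \<alpha>' \<beta> x y
      = (LINT z|lborel. f z * (\<alpha> (x + s - z $ 1) * \<beta> (y - z $ 2)) - f z * (\<alpha> (x - z $ 1) * \<beta> (y - z $ 2))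
           - s * (f z * (\<alpha>' (x - z $ 1) * \<beta> (y - z $ 2))))"
      unfolding smear_def using i by simp
    show "\<bar>smear f \<alpha> \<beta> (x + s) (y) - smear f \<alpha> \<beta> x y - s * smear f \<alpha>' \<beta> x y\<bar> \<le> (C * B * (LINT z|lborel. \<bar>f z\<bar>)) * s\<^sup>2"
      unfolding eq
    proof -
    have "\<bar>(LINT z|lborel. f z * (\<alpha> (x + s - z $ 1) * \<beta> (y - z $ 2)) - f z * (\<alpha> (x - z $ 1) * \<beta> (y - z $ 2))
           - s * (f z * (\<alpha>' (x - z $ 1) * \<beta> (y - z $ 2))))\<bar> \<le> (LINT z|lborel. (C * s\<^sup>2 * B) * \<bar>f z\<bar>)"
    proof (rule order_trans[OF integral_abs_bound integral_mono])
      show "integrable lborel (\<lambda>z. \<bar>f z * (\<alpha> (x + s - z $ 1) * \<beta> (y - z $ 2)) - f z * (\<alpha> (x - z $ 1) * \<beta> (y - z $ 2))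
           - s * (f z * (\<alpha>' (x - z $ 1) * \<beta> (y - z $ 2)))\<bar>)"
        using i by auto
      show "integrable lborel (\<lambda>z. (C * s\<^sup>2 * B) * \<bar>f z\<bar>)" using f by auto
      fix z :: "real^2"
      have "\<bar>f z * (\<alpha> (x + s - z $ 1) * \<beta> (y - z $ 2)) - f z * (\<alpha> (x - z $ 1) * \<beta> (y - z $ 2))
           - s * (f z * (\<alpha>' (x - z $ 1) * \<beta> (y - z $ 2)))\<bar>
        = \<bar>f z\<bar> * (\<bar>\<alpha> ((x - z $ 1) + s) - \<alpha> (x - z $ 1) - s * \<alpha>' (x - z $ 1)\<bar> * \<bar>\<beta> (y - z $ 2)\<bar>)"
        unfolding abs_mult[symmetric] by (rule arg_cong[where f=abs]) (simp add: algebra_simps)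
      also have "\<dots> \<le> \<bar>f z\<bar> * ((C * s\<^sup>2) * B)"
        by (intro mult_left_mono mult_mono C[OF s] B(1,2) order_trans[OF abs_ge_zero C[OF s]] abs_ge_zero)
      finally show "\<bar>f z * (\<alpha> (x + s - z $ 1) * \<beta> (y - z $ 2)) - f z * (\<alpha> (x - z $ 1) * \<beta> (y - z $ 2))
           - s * (f z * (\<alpha>' (x - z $ 1) * \<beta> (y - z $ 2)))\<bar> \<le> (C * s\<^sup>2 * B) * \<bar>f z\<bar>"
        by (simp add: mult.commute)
    qed
    also have "\<dots> = (C * B * (LINT z|lborel. \<bar>f z\<bar>)) * s\<^sup>2" by simp
    finally show "\<bar>(LINT z|lborel. f z * (\<alpha> (x + s - z $ 1) * \<beta> (y - z $ 2)) - f z * (\<alpha> (x - z $ 1) * \<beta> (y - z $ 2))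
           - s * (f z * (\<alpha>' (x - z $ 1) * \<beta> (y - z $ 2))))\<bar> \<le> (C * B * (LINT z|lborel. \<bar>f z\<bar>)) * s\<^sup>2" .
    qed
  qed
qed

lemma smear_dy:
  assumes f: "integrable lborel f" and k: "kernel_pair \<beta> \<beta>'" and b: "bounded_continuous \<alpha>"
  shows "((\<lambda>y. smear f \<alpha> \<beta> x y) has_real_derivative smear f \<alpha> \<beta>' x y) (at y)"
proof -
  obtain B where B: "B \<ge> 0" "\<And>t. \<bar>\<alpha> t\<bar> \<le> B" by (rule bounded_continuousE[OF b], rule that; assumption)
  obtain C where C: "\<And>t s. \<bar>s\<bar> \<le> 1 \<Longrightarrow> \<bar>\<beta> (t + s) - \<beta> t - s * \<beta>' t\<bar> \<le> C * s\<^sup>2"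
    using k by (auto simp: kernel_pair_def)
  note bc = kernel_pair_bounded_continuous[OF k] b
  show ?thesis
  proof (rule has_derivative_quadratic_remainder)
    fix s :: real assume s: "\<bar>s\<bar> \<le> 1"
    have i: "integrable lborel (\<lambda>z::real^2. f z * (\<alpha> (x - z $ 1) * \<beta> (u - z $ 2)))"
      "integrable lborel (\<lambda>z::real^2. f z * (\<alpha> (x - z $ 1) * \<beta>' (u - z $ 2)))" for u
      by (rule smear_integrable[OF f]; rule bc)+
    have eq: "smear f \<alpha> \<beta> x (y + s) - smear f \<alpha> \<beta> x y - s * smear f \<alpha> \<beta>' x y
      = (LINT z|lborel. f z * (\<alpha> (x - z $ 1) * \<beta> (y + s - z $ 2)) - f z * (\<alpha> (x - z $ 1) * \<beta> (y - z $ 2))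
           - s * (f z * (\<alpha> (x - z $ 1) * \<beta>' (y - z $ 2))))"
      unfolding smear_def using i by simp
    show "\<bar>smear f \<alpha> \<beta> (x) (y + s) - smear f \<alpha> \<beta> x y - s * smear f \<alpha> \<beta>' x y\<bar> \<le> (C * B * (LINT z|lborel. \<bar>f z\<bar>)) * s\<^sup>2"
      unfolding eq
    proof -
    have "\<bar>(LINT z|lborel. f z * (\<alpha> (x - z $ 1) * \<beta> (y + s - z $ 2)) - f z * (\<alpha> (x - z $ 1) * \<beta> (y - z $ 2))
           - s * (f z * (\<alpha> (x - z $ 1) * \<beta>' (y - z $ 2))))\<bar> \<le> (LINT z|lborel. (C * s\<^sup>2 * B) * \<bar>f z\<bar>)"
    proof (rule order_trans[OF integral_abs_bound integral_mono])
      show "integrable lborel (\<lambda>z. \<bar>f z * (\<alpha> (x - z $ 1) * \<beta> (y + s - z $ 2)) - f z * (\<alpha> (x - z $ 1) * \<beta> (y - z $ 2))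
           - s * (f z * (\<alpha> (x - z $ 1) * \<beta>' (y - z $ 2)))\<bar>)"
        using i by auto
      show "integrable lborel (\<lambda>z. (C * s\<^sup>2 * B) * \<bar>f z\<bar>)" using f by auto
      fix z :: "real^2"
      have "\<bar>f z * (\<alpha> (x - z $ 1) * \<beta> (y + s - z $ 2)) - f z * (\<alpha> (x - z $ 1) * \<beta> (y - z $ 2))
           - s * (f z * (\<alpha> (x - z $ 1) * \<beta>' (y - z $ 2)))\<bar>
        = \<bar>f z\<bar> * (\<bar>\<beta> ((y - z $ 2) + s) - \<beta> (y - z $ 2) - s * \<beta>' (y - z $ 2)\<bar> * \<bar>\<alpha> (x - z $ 1)\<bar>)"
        unfolding abs_mult[symmetric] by (rule arg_cong[where f=abs]) (simp add: algebra_simps)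
      also have "\<dots> \<le> \<bar>f z\<bar> * ((C * s\<^sup>2) * B)"
        by (intro mult_left_mono mult_mono C[OF s] B(1,2) order_trans[OF abs_ge_zero C[OF s]] abs_ge_zero)
      finally show "\<bar>f z * (\<alpha> (x - z $ 1) * \<beta> (y + s - z $ 2)) - f z * (\<alpha> (x - z $ 1) * \<beta> (y - z $ 2))
           - s * (f z * (\<alpha> (x - z $ 1) * \<beta>' (y - z $ 2)))\<bar> \<le> (C * s\<^sup>2 * B) * \<bar>f z\<bar>"
        by (simp add: mult.commute)
    qed
    also have "\<dots> = (C * B * (LINT z|lborel. \<bar>f z\<bar>)) * s\<^sup>2" by simp
    finally show "\<bar>(LINT z|lborel. f z * (\<alpha> (x - z $ 1) * \<beta> (y + s - z $ 2)) - f z * (\<alpha> (x - z $ 1) * \<beta> (y - z $ 2))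
           - s * (f z * (\<alpha> (x - z $ 1) * \<beta>' (y - z $ 2))))\<bar> \<le> (C * B * (LINT z|lborel. \<bar>f z\<bar>)) * s\<^sup>2" .
    qed
  qed
qed

section \<open>A compactly supported kernel\<close>

text \<open>
  The square of the positive part makes the kernel continuously differentiable, which suffices here,
  and keeps all its bounds elementary.
\<close>
definition bump :: "real \<Rightarrow> real \<Rightarrow> real" where
  "bump h t = (max 0 (h\<^sup>2 - t\<^sup>2))\<^sup>2"

definition bump_deriv :: "real \<Rightarrow> real \<Rightarrow> real" where
  "bump_deriv h t = - 4 * t * max 0 (h\<^sup>2 - t\<^sup>2)"

definition bump_primitive :: "real \<Rightarrow> real \<Rightarrow> real" where
  "bump_primitive h t = integral {-h..t} (bump h)"

lemma max0_outside: 
  fixes h t :: real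
  assumes "0 \<le> h" "h \<le> \<bar>t\<bar>" shows "max 0 (h\<^sup>2 - t\<^sup>2) = 0"
  using assms abs_le_square_iff[of h t] by (simp add: max_def)

lemma bump_outside: "0 \<le> h \<Longrightarrow> h \<le> \<bar>t\<bar> \<Longrightarrow> bump h t = 0"
  by (simp add: bump_def max0_outside)

lemma bump_deriv_outside: "0 \<le> h \<Longrightarrow> h \<le> \<bar>t\<bar> \<Longrightarrow> bump_deriv h t = 0"
  by (simp add: bump_deriv_def max0_outside)

lemma bump_nonneg: "0 \<le> bump h t"
  by (simp add: bump_def)

lemma bump_le: "bump h t \<le> h^4"
proof -
  have "(max 0 (h\<^sup>2 - t\<^sup>2))\<^sup>2 \<le> (h\<^sup>2)\<^sup>2"
    by (rule power_mono) auto
  then show ?thesis by (simp add: bump_def)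
qed

lemma continuous_bump: "continuous_on S (bump h)" and continuous_bump_deriv: "continuous_on S (bump_deriv h)"
  unfolding bump_def bump_deriv_def by (intro continuous_intros)+

lemma bump_deriv_bound:
  assumes "0 \<le> h" shows "\<bar>bump_deriv h t\<bar> \<le> 4 * h * h\<^sup>2"
proof (cases "h \<le> \<bar>t\<bar>")
  case True
  then show ?thesis using bump_deriv_outside assms by simp
next
  case False
  have "\<bar>bump_deriv h t\<bar> = 4 * \<bar>t\<bar> * max 0 (h\<^sup>2 - t\<^sup>2)"
    by (simp add: bump_deriv_def abs_mult)
  also have "\<dots> \<le> 4 * h * h\<^sup>2"
    using False assms by (intro mult_mono) auto
  finally show ?thesis .
qed

text \<open>
  The square of the positive part has a Lipschitz derivative, so its Taylor remainder is quadratic also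
  across the kink.
\<close>
lemma max0_square_remainder:
  fixes v w :: real
  shows "\<bar>(max 0 (v + w))\<^sup>2 - (max 0 v)\<^sup>2 - 2 * w * max 0 v\<bar> \<le> w\<^sup>2"
proof -
  consider "v \<ge> 0" "v + w \<ge> 0" | "v \<ge> 0" "v + w \<le> 0" | "v \<le> 0" "v + w \<ge> 0" | "v \<le> 0" "v + w \<le> 0"
    by linarith
  then show ?thesis
  proof cases
    case 1
    then show ?thesis by (simp add: max_def power2_eq_square algebra_simps)
  next
    case 2
    have a: "(max 0 (v + w))\<^sup>2 - (max 0 v)\<^sup>2 - 2 * w * max 0 v = w\<^sup>2 - (v + w)\<^sup>2"
      using 2 by (simp add: max_def power2_eq_square algebra_simps)
    have "(v + w)\<^sup>2 \<le> w\<^sup>2"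
      using 2 by (intro abs_le_square_iff[THEN iffD1]) auto
    then show ?thesis unfolding a by simp
  next
    case 3
    then have "(v + w)\<^sup>2 \<le> w\<^sup>2" by (intro power_mono) auto
    then show ?thesis using 3 by (simp add: max_def)
  next
    case 4
    then show ?thesis by (simp add: max_def)
  qed
qed

lemma bump_remainder:
  assumes "0 \<le> h" "\<bar>s\<bar> \<le> 1"
  shows "\<bar>bump h (t + s) - bump h t - s * bump_deriv h t\<bar> \<le> (2 * h\<^sup>2 + (2 * h + 3)\<^sup>2) * s\<^sup>2"
proof (cases "h + 1 \<le> \<bar>t\<bar>")
  case True
  have "h \<le> \<bar>t + s\<bar>" "h \<le> \<bar>t\<bar>" using True assms by linarith+
  then show ?thesis using assms by (simp add: bump_outside bump_deriv_outside)
next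
  case False
  define v where "v = h\<^sup>2 - t\<^sup>2"
  define w where "w = - (2 * t * s) - s\<^sup>2"
  have vw: "h\<^sup>2 - (t + s)\<^sup>2 = v + w" by (simp add: v_def w_def power2_eq_square algebra_simps)
  have "\<bar>w\<bar> = \<bar>s\<bar> * \<bar>2 * t + s\<bar>"
    unfolding w_def abs_mult[symmetric] by (subst abs_minus_cancel[symmetric]) (simp add: power2_eq_square algebra_simps)
  also have "\<dots> \<le> \<bar>s\<bar> * (2 * h + 3)"
    using False assms by (intro mult_left_mono) auto
  finally have "w\<^sup>2 \<le> (\<bar>s\<bar> * (2 * h + 3))\<^sup>2"
    using assms by (intro abs_le_square_iff[THEN iffD1]) auto
  then have w2: "w\<^sup>2 \<le> (2 * h + 3)\<^sup>2 * s\<^sup>2" by (simp add: power_mult_distrib mult.commute)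
  have "bump h (t + s) - bump h t - s * bump_deriv h t
     = ((max 0 (v + w))\<^sup>2 - (max 0 v)\<^sup>2 - 2 * w * max 0 v) - 2 * s\<^sup>2 * max 0 v"
    unfolding bump_def bump_deriv_def vw v_def[symmetric] by (simp add: w_def power2_eq_square algebra_simps)
  also have "\<bar>\<dots>\<bar> \<le> w\<^sup>2 + 2 * s\<^sup>2 * max 0 v"
  proof -
    have "0 \<le> 2 * s\<^sup>2 * max 0 v" by simp
    then show ?thesis using max0_square_remainder[of v w] by linarith
  qed
  also have "\<dots> \<le> (2 * h + 3)\<^sup>2 * s\<^sup>2 + 2 * s\<^sup>2 * h\<^sup>2"
    using w2 by (intro add_mono mult_left_mono) (auto simp: v_def)
  finally show ?thesis by (simp add: algebra_simps)
qed

lemma kernel_pair_bump: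
  assumes "0 \<le> h" shows "kernel_pair (bump h) (bump_deriv h)"
  unfolding kernel_pair_def
proof (intro conjI)
  show "\<exists>B. \<forall>t. \<bar>bump h t\<bar> \<le> B" using bump_le bump_nonneg by (intro exI[of _ "h^4"]) simp
  show "\<exists>B. \<forall>t. \<bar>bump_deriv h t\<bar> \<le> B" using bump_deriv_bound[OF assms] by blast
  show "\<exists>C. \<forall>t s. \<bar>s\<bar> \<le> 1 \<longrightarrow> \<bar>bump h (t + s) - bump h t - s * bump_deriv h t\<bar> \<le> C * s\<^sup>2"
    using bump_remainder[OF assms] by blast
qed (rule continuous_bump continuous_bump_deriv)+

lemma DERIV_bump: "0 \<le> h \<Longrightarrow> (bump h has_real_derivative bump_deriv h t) (at t)"
  by (rule has_derivative_quadratic_remainder[OF bump_remainder])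

lemma bump_lipschitz:
  assumes "0 \<le> h" shows "\<bar>bump h a - bump h b\<bar> \<le> (4 * h * h\<^sup>2) * \<bar>a - b\<bar>"
proof -
  have "norm (bump h a - bump h b) \<le> (4 * h * h\<^sup>2) * norm (a - b)"
    by (rule field_differentiable_bound[of UNIV])
      (use DERIV_bump[OF assms] bump_deriv_bound[OF assms] in auto)
  then show ?thesis by simp
qed

lemma bump_primitive_eq:
  assumes "0 \<le> h" "a \<le> -h" "a \<le> t"
  shows "bump_primitive h t = integral {a..t} (bump h)"
proof -
  have z: "integral {a..b} (bump h) = 0" if "b \<le> -h" for b
  proof -
    have "integral {a..b} (bump h) = integral {a..b} (\<lambda>x. 0)"
      by (rule integral_cong) (use that assms in \<open>auto intro!: bump_outside\<close>)
    then show ?thesis by simp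
  qed
  show ?thesis
  proof (cases "-h \<le> t")
    case True
    have "integral {a..-h} (bump h) + integral {-h..t} (bump h) = integral {a..t} (bump h)"
      by (rule Henstock_Kurzweil_Integration.integral_combine)
        (use assms True in \<open>auto intro!: integrable_continuous_real continuous_bump\<close>)
    then show ?thesis using z[of "-h"] by (simp add: bump_primitive_def)
  next
    case False
    then show ?thesis using z[of t] by (simp add: bump_primitive_def)
  qed
qed

lemma DERIV_bump_primitive:
  assumes "0 \<le> h" shows "(bump_primitive h has_real_derivative bump h t) (at t)"
proof -
  define a where "a = - h - \<bar>t\<bar> - 1"
  have a: "a \<le> - h" "a < t" using assms by (auto simp: a_def)
  have "((\<lambda>u. integral {a..u} (bump h)) has_real_derivative bump h t) (at t within {a..t+1})"
    by (rule integral_has_real_derivative) (use a in \<open>auto intro: continuous_bump\<close>)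
  then have d: "((\<lambda>u. integral {a..u} (bump h)) has_real_derivative bump h t) (at t)"
    using a by (simp add: at_within_Icc_at)
  show ?thesis
  proof (rule has_field_derivative_transform_within_open[OF d, of "{a<..}"])
    show "integral {a..u} (bump h) = bump_primitive h u" if "u \<in> {a<..}" for u
      using bump_primitive_eq[OF assms a(1), of u] that by simp
  qed (use a in auto)
qed

lemma bump_primitive_outside: "0 \<le> h \<Longrightarrow> t \<le> -h \<Longrightarrow> bump_primitive h t = 0"
  using bump_primitive_eq[of h t t] by simp

lemma bump_primitive_bounded:
  assumes "0 \<le> h" shows "\<exists>B. \<forall>t. \<bar>bump_primitive h t\<bar> \<le> B"
proof -
  have c: "continuous_on S (bump_primitive h)" for S
    by (rule DERIV_continuous_on) (use DERIV_bump_primitive[OF assms] has_field_derivative_at_within in blast)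
  obtain B where "\<forall>x\<in>bump_primitive h ` {-h..h}. norm x \<le> B"
    using compact_imp_bounded[OF compact_continuous_image[OF c, of "{-h..h}"]]
    unfolding bounded_iff by blast
  then have B: "\<bar>bump_primitive h t\<bar> \<le> B" if "t \<in> {-h..h}" for t using that by simp
  have "\<bar>bump_primitive h t\<bar> \<le> max B 0" for t
  proof (cases "t \<le> h")
    case True
    then show ?thesis using B[of t] bump_primitive_outside[OF assms, of t] by (cases "-h \<le> t") auto
  next
    case False
    have "integral {-h..h} (bump h) + integral {h..t} (bump h) = integral {-h..t} (bump h)"
      by (rule Henstock_Kurzweil_Integration.integral_combine)
        (use assms False in \<open>auto intro!: integrable_continuous_real continuous_bump\<close>)
    moreover have "integral {h..t} (bump h) = integral {h..t} (\<lambda>x. 0)"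
      by (rule integral_cong) (use assms in \<open>auto intro!: bump_outside\<close>)
    ultimately have "bump_primitive h t = bump_primitive h h" by (simp add: bump_primitive_def)
    then show ?thesis using B[of h] assms by auto
  qed
  then show ?thesis by blast
qed

lemma kernel_pair_bump_primitive:
  assumes "0 \<le> h" shows "kernel_pair (bump_primitive h) (bump h)"
  unfolding kernel_pair_def
proof (intro conjI)
  show "continuous_on UNIV (bump_primitive h)"
    by (rule DERIV_continuous_on) (use DERIV_bump_primitive[OF assms] has_field_derivative_at_within in blast)
  show "\<exists>B. \<forall>t. \<bar>bump_primitive h t\<bar> \<le> B" by (rule bump_primitive_bounded[OF assms])
  show "\<exists>B. \<forall>t. \<bar>bump h t\<bar> \<le> B" using bump_le bump_nonneg by (intro exI[of _ "h^4"]) simp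
  have "\<bar>bump_primitive h (t + s) - bump_primitive h t - s * bump h t\<bar> \<le> (4 * h * h\<^sup>2) * s\<^sup>2" for t s
  proof (cases "s = 0")
    case False
    define F where "F u = bump_primitive h (t + u) - u * bump h t" for u
    have dF: "(F has_real_derivative (bump h (t + u) - bump h t)) (at u)" for u
      unfolding F_def
      by (auto intro!: derivative_eq_intros DERIV_chain'[OF _ DERIV_bump_primitive[OF assms], of _ 1])
    have "norm (F s - F 0) \<le> (4 * h * h\<^sup>2 * \<bar>s\<bar>) * norm (s - 0)"
    proof (rule field_differentiable_bound[of "cball 0 \<bar>s\<bar>"])
      fix u :: real assume "u \<in> cball 0 \<bar>s\<bar>"
      then have u: "\<bar>u\<bar> \<le> \<bar>s\<bar>" by simp
      show "(F has_field_derivative (bump h (t + u) - bump h t)) (at u within cball 0 \<bar>s\<bar>)"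
        using dF has_field_derivative_at_within by blast
      have "\<bar>bump h (t + u) - bump h t\<bar> \<le> 4 * h * h\<^sup>2 * \<bar>u\<bar>"
        using bump_lipschitz[OF assms, of "t + u" t] by simp
      also have "\<dots> \<le> 4 * h * h\<^sup>2 * \<bar>s\<bar>" using u assms by (intro mult_left_mono) auto
      finally show "norm (bump h (t + u) - bump h t) \<le> 4 * h * h\<^sup>2 * \<bar>s\<bar>" by simp
    qed auto
    also have "\<dots> = (4 * h * h\<^sup>2) * s\<^sup>2" by (simp add: power2_eq_square abs_mult[symmetric] mult.assoc)
    finally show ?thesis by (simp add: F_def algebra_simps)
  qed simp
  then show "\<exists>C. \<forall>t s. \<bar>s\<bar> \<le> 1 \<longrightarrow> \<bar>bump_primitive h (t + s) - bump_primitive h t - s * bump h t\<bar> \<le> C * s\<^sup>2"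
    by blast
qed (rule continuous_bump)

lemma lborel_integral_translate:
  fixes f :: "'a::euclidean_space \<Rightarrow> real"
  assumes "f \<in> borel_measurable borel"
  shows "(LINT z|lborel. f (z - p)) = (LINT z|lborel. f z)"
proof -
  have "(LINT z|lborel. f z) = (LINT z|distr lborel borel ((+) (-p)). f z)"
    by (simp add: lborel_distr_plus)
  also have "\<dots> = (LINT z|lborel. f (-p + z))"
    by (rule integral_distr) (use assms in auto)
  finally show ?thesis by (simp add: algebra_simps)
qed

definition bump_mass :: "real \<Rightarrow> real" where
  "bump_mass h = (LINT z|lborel. bump h ((z::real^2) $ 1) * bump h (z $ 2))"

lemma bump_tensor_measurable: "(\<lambda>z::real^2. bump h (z $ 1) * bump h (z $ 2)) \<in> borel_measurable borel"
  by (intro borel_measurable_continuous_onI continuous_on_mult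
      continuous_on_compose2[OF continuous_bump[of UNIV]] continuous_intros) auto

lemma bump_minus: "bump h (a - b) = bump h (b - a)"
  by (simp add: bump_def power2_commute)

lemma bump_uminus: "bump h (- a) = bump h a"
  by (simp add: bump_def)

lemma bump_mass_translate:
  "(LINT z|lborel. bump h (x - (z::real^2) $ 1) * bump h (y - z $ 2)) = bump_mass h"
proof -
  have "(LINT z|lborel. bump h (x - (z::real^2) $ 1) * bump h (y - z $ 2))
     = (LINT z|lborel. (\<lambda>z. bump h (z $ 1) * bump h (z $ 2)) (z - vec2 (x, y)))"
    by (rule Bochner_Integration.integral_cong) (auto simp: bump_minus[of h x] bump_minus[of h y])
  also have "\<dots> = bump_mass h"
    unfolding bump_mass_def by (rule lborel_integral_translate[OF bump_tensor_measurable])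
  finally show ?thesis .
qed

lemma bump_tensor_integrable:
  assumes "0 \<le> h"
  shows "integrable lborel (\<lambda>z::real^2. bump h (x - z $ 1) * bump h (y - z $ 2))"
proof -
  define S where "S = cbox (vec2 (x - h, y - h)) (vec2 (x + h, y + h))"
  have "integrable lborel (\<lambda>z. indicator S z *\<^sub>R (bump h (x - z $ 1) * bump h (y - z $ 2)))"
    by (rule borel_integrable_compact)
      (auto simp: S_def intro!: continuous_on_mult continuous_on_compose2[OF continuous_bump[of UNIV]] continuous_intros)
  also have "(\<lambda>z. indicator S z *\<^sub>R (bump h (x - z $ 1) * bump h (y - z $ 2)))
     = (\<lambda>z. bump h (x - z $ 1) * bump h (y - z $ 2))"
  proof
    fix z :: "real^2"
    have "bump h (x - z $ 1) * bump h (y - z $ 2) = 0" if "z \<notin> S"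
    proof -
      have "h \<le> \<bar>x - z $ 1\<bar> \<or> h \<le> \<bar>y - z $ 2\<bar>"
        using that by (auto simp: S_def mem_box_cart forall_2)
      then show ?thesis using bump_outside[OF assms] by auto
    qed
    then show "indicator S z *\<^sub>R (bump h (x - z $ 1) * bump h (y - z $ 2)) = bump h (x - z $ 1) * bump h (y - z $ 2)"
      by (auto simp: indicator_def)
  qed
  finally show ?thesis .
qed

lemma bump_mass_pos:
  assumes "0 < h" shows "0 < bump_mass h"
proof -
  have i: "integrable lborel (\<lambda>z::real^2. bump h (z $ 1) * bump h (z $ 2))"
    using bump_tensor_integrable[of h 0 0] assms by (simp add: bump_uminus)
  have n: "bump_mass h \<noteq> 0"
  proof
    assume "bump_mass h = 0"
    then have "AE z::real^2 in lborel. bump h (z $ 1) * bump h (z $ 2) = 0"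
      unfolding bump_mass_def
      by (subst (asm) integral_nonneg_eq_0_iff_AE[OF i]) (auto simp: bump_nonneg)
    then have "AE z::real^2 in lborel. z \<notin> box (vec2 (-h, -h)) (vec2 (h, h))"
    proof (rule AE_mp, intro AE_I2 impI)
      fix z :: "real^2" assume 0: "bump h (z $ 1) * bump h (z $ 2) = 0"
      have "bump h t \<noteq> 0" if "- h < t" "t < h" for t
      proof -
        have "t\<^sup>2 < h\<^sup>2" using that power_strict_mono[of "\<bar>t\<bar>" h 2] by auto
        then show ?thesis by (simp add: bump_def max_def)
      qed
      then show "z \<notin> box (vec2 (-h, -h)) (vec2 (h, h))" using 0 by (auto simp: mem_box_cart forall_2)
    qed
    then have "emeasure lborel (box (vec2 (-h, -h)) (vec2 (h, h))) = 0"
      by (subst (asm) AE_iff_measurable[OF _ refl]) auto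
    moreover have "emeasure lborel (box (vec2 (-h, -h)) (vec2 (h, h))) = ennreal ((2 * h) * (2 * h))"
    proof -
      have "emeasure lborel (box (vec2 (-h, -h)) (vec2 (h, h)))
          = ennreal (\<Prod>b\<in>Basis. (vec2 (h, h) - vec2 (-h, -h)) \<bullet> b)"
        by (rule emeasure_lborel_box) (use assms in \<open>auto simp: Basis_vec_def UNIV_2 inner_axis\<close>)
      then show ?thesis by (simp only: prod_Basis_vec2) simp
    qed
    ultimately show False using assms by simp
  qed
  moreover have "0 \<le> bump_mass h" unfolding bump_mass_def by (rule Bochner_Integration.integral_nonneg) (auto simp: bump_nonneg)
  ultimately show ?thesis by simp
qed

section \<open>Mollified tensors with a weak divergence\<close>

text \<open>
  Test functions are continuously differentiable on the whole plane without a support condition; the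
  fields considered here have bounded support.
\<close>
definition weak_divergence :: "(real^2 \<Rightarrow> real^2) \<Rightarrow> (real^2 \<Rightarrow> real) \<Rightarrow> bool" where
  "weak_divergence P q \<longleftrightarrow> (\<forall>\<psi> g. (\<forall>z. (\<psi> has_derivative (\<lambda>v. g z \<bullet> v)) (at z)) \<longrightarrow> continuous_on UNIV g \<longrightarrow>
     (LINT z|lborel. P z \<bullet> g z) = - (LINT z|lborel. q z * \<psi> z))"

lemma inner_vec2: "(a::real^2) \<bullet> b = a $ 1 * b $ 1 + a $ 2 * b $ 2"
  by (simp add: inner_vec_def sum_2)

lemma continuous_on_vec2:
  assumes "continuous_on S f" "continuous_on S g"
  shows "continuous_on S (\<lambda>z. vec2 (f z, g z))"
proof -
  have "continuous_on S (\<lambda>z. \<chi> i. vec2 (f z, g z) $ i)"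
    by (rule continuous_on_vec_lambda, rule forall_2[THEN iffD2, THEN spec]) (use assms in auto)
  then show ?thesis by simp
qed

text \<open>
  The translated kernel is itself a test function.
\<close>
lemma smear_weak_divergence:
  assumes w: "weak_divergence P q"
    and i: "integrable lborel (\<lambda>z. P z $ 1)" "integrable lborel (\<lambda>z. P z $ 2)"
    and a: "kernel_pair \<alpha> \<alpha>'" and da: "\<And>t. (\<alpha> has_real_derivative \<alpha>' t) (at t)"
    and b: "kernel_pair \<beta> \<beta>'" and db: "\<And>t. (\<beta> has_real_derivative \<beta>' t) (at t)"
  shows "smear (\<lambda>z. P z $ 1) \<alpha>' \<beta> x y + smear (\<lambda>z. P z $ 2) \<alpha> \<beta>' x y = smear q \<alpha> \<beta> x y"
proof -
  define \<psi> where "\<psi> z = \<alpha> (x - z $ 1) * \<beta> (y - z $ 2)" for z :: "real^2"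
  define g where "g z = vec2 (- (\<alpha>' (x - z $ 1) * \<beta> (y - z $ 2)), - (\<alpha> (x - z $ 1) * \<beta>' (y - z $ 2)))" for z :: "real^2"
  note ba = kernel_pair_bounded_continuous[OF a] and bb = kernel_pair_bounded_continuous[OF b]
  have cont: "continuous_on UNIV \<alpha>" "continuous_on UNIV \<alpha>'" "continuous_on UNIV \<beta>" "continuous_on UNIV \<beta>'"
    using a b by (auto simp: kernel_pair_def)
  have "continuous_on UNIV g"
    unfolding g_def
    by (intro continuous_on_vec2 continuous_intros continuous_on_compose2[OF cont(1)]
        continuous_on_compose2[OF cont(2)] continuous_on_compose2[OF cont(3)]
        continuous_on_compose2[OF cont(4)]) auto
  moreover have "(\<psi> has_derivative (\<lambda>v. g z \<bullet> v)) (at z)" for z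
  proof -
    have 1: "((\<lambda>z::real^2. \<alpha> (x - z $ 1)) has_derivative (\<lambda>v. \<alpha>' (x - z $ 1) * (- v $ 1))) (at z)"
      by (rule has_derivative_compose[where f="\<lambda>z. x - z $ 1" and g=\<alpha>,
            OF _ da[unfolded has_field_derivative_def]])
        (auto intro!: derivative_eq_intros bounded_linear.has_derivative[OF bounded_linear_vec_nth])
    have 2: "((\<lambda>z::real^2. \<beta> (y - z $ 2)) has_derivative (\<lambda>v. \<beta>' (y - z $ 2) * (- v $ 2))) (at z)"
      by (rule has_derivative_compose[where f="\<lambda>z. y - z $ 2" and g=\<beta>,
            OF _ db[unfolded has_field_derivative_def]])
        (auto intro!: derivative_eq_intros bounded_linear.has_derivative[OF bounded_linear_vec_nth])
    show ?thesis
      unfolding \<psi>_def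
      by (rule has_derivative_eq_rhs[OF has_derivative_mult[OF 1 2]])
        (auto simp: g_def inner_vec2 algebra_simps)
  qed
  ultimately have "(LINT z|lborel. P z \<bullet> g z) = - (LINT z|lborel. q z * \<psi> z)"
    using w unfolding weak_divergence_def by blast
  moreover have "(LINT z|lborel. P z \<bullet> g z) = (LINT z|lborel. - (P z $ 1 * (\<alpha>' (x - z $ 1) * \<beta> (y - z $ 2)))
      - P z $ 2 * (\<alpha> (x - z $ 1) * \<beta>' (y - z $ 2)))"
    by (rule Bochner_Integration.integral_cong) (auto simp: inner_vec2 g_def)
  moreover have "\<dots> = - smear (\<lambda>z. P z $ 1) \<alpha>' \<beta> x y - smear (\<lambda>z. P z $ 2) \<alpha> \<beta>' x y"
    unfolding smear_def
    using smear_integrable[OF i(1) ba(2) bb(1)] smear_integrable[OF i(2) ba(1) bb(2)] by simp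
  ultimately show ?thesis by (simp add: smear_def \<psi>_def)
qed

lemma smear_vanish:
  assumes "\<And>z. f z \<noteq> 0 \<Longrightarrow> \<alpha> (x - z $ 1) * \<beta> (y - z $ 2) = 0"
  shows "smear f \<alpha> \<beta> x y = 0"
proof -
  have "(\<lambda>z. f z * (\<alpha> (x - z $ 1) * \<beta> (y - z $ 2))) = (\<lambda>z. 0)"
    using assms by force
  then show ?thesis unfolding smear_def by (simp only: Bochner_Integration.integral_zero)
qed

text \<open>
  The potential of a mollified row is the row smeared with the primitive of the kernel in the second
  variable. It vanishes on the left, right and lower sides of the square because the support keeps
  the distance \<open>1 \<ge> h\<close> from the boundary.
\<close>
lemma smeared_plane_estimate:
  fixes P1 P2 :: "real^2 \<Rightarrow> real^2"
  assumes w: "weak_divergence P1 (\<lambda>z. - q1 z)" "weak_divergence P2 (\<lambda>z. - q2 z)"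
    and i: "\<And>j. integrable lborel (\<lambda>z. P1 z $ j)" "\<And>j. integrable lborel (\<lambda>z. P2 z $ j)"
      "integrable lborel q1" "integrable lborel q2"
    and supp: "\<And>z. P1 z \<noteq> 0 \<or> P2 z \<noteq> 0 \<or> q1 z \<noteq> 0 \<or> q2 z \<noteq> 0 \<Longrightarrow> \<bar>z $ 1\<bar> \<le> L - 1 \<and> \<bar>z $ 2\<bar> \<le> L - 1"
    and h: "0 < h" "h \<le> 1" and LK: "1 \<le> L" "0 \<le> K"
  defines "S \<equiv> \<lambda>f. smear f (bump h) (bump h)"
  shows "2 * square_integral L (\<lambda>x y. (K + (x\<^sup>2 + y\<^sup>2) / 2) *
      (S (\<lambda>z. P1 z $ 1) x y * S (\<lambda>z. P2 z $ 2) x y - S (\<lambda>z. P1 z $ 2) x y * S (\<lambda>z. P2 z $ 1) x y))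
     \<le> 8 * L\<^sup>2 * square_integral L (\<lambda>x y. (S (\<lambda>z. P1 z $ 1) x y + S (\<lambda>z. P2 z $ 2) x y)\<^sup>2)
       + plane_const L (K + L\<^sup>2) * square_integral L (\<lambda>x y. (S q1 x y)\<^sup>2 + (S q2 x y)\<^sup>2)"
proof -
  have h0: "0 \<le> h" using h by simp
  note kp = kernel_pair_bump[OF h0] and kpp = kernel_pair_bump_primitive[OF h0]
  note bc = kernel_pair_bounded_continuous[OF kp] kernel_pair_bounded_continuous[OF kpp]
  note D = DERIV_bump[OF h0] DERIV_bump_primitive[OF h0]
  have W1: "smear (\<lambda>z. P1 z $ 2) (bump h) (bump_deriv h) x y
      = - smear q1 (bump h) (bump h) x y - smear (\<lambda>z. P1 z $ 1) (bump_deriv h) (bump h) x y" for x y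
    using smear_weak_divergence[OF w(1) i(1) i(1) kp D(1) kp D(1), of x y] by (simp add: smear_def)
  have W2: "smear (\<lambda>z. P2 z $ 2) (bump h) (bump_deriv h) x y
      = - smear q2 (bump h) (bump h) x y - smear (\<lambda>z. P2 z $ 1) (bump_deriv h) (bump h) x y" for x y
    using smear_weak_divergence[OF w(2) i(2) i(2) kp D(1) kp D(1), of x y] by (simp add: smear_def)
  have V1: "smear (\<lambda>z. P1 z $ 1) (bump_deriv h) (bump_primitive h) x y
      = - smear (\<lambda>z. P1 z $ 2) (bump h) (bump h) x y - smear q1 (bump h) (bump_primitive h) x y" for x y
    using smear_weak_divergence[OF w(1) i(1) i(1) kp D(1) kpp D(2), of x y] by (simp add: smear_def)
  have V2: "smear (\<lambda>z. P2 z $ 1) (bump_deriv h) (bump_primitive h) x y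
      = - smear (\<lambda>z. P2 z $ 2) (bump h) (bump h) x y - smear q2 (bump h) (bump_primitive h) x y" for x y
    using smear_weak_divergence[OF w(2) i(2) i(2) kp D(1) kpp D(2), of x y] by (simp add: smear_def)
  have vx: "smear f (bump h) \<beta> x y = 0" if "\<And>z. f z \<noteq> 0 \<Longrightarrow> \<bar>z $ 1\<bar> \<le> L - 1" "\<bar>x\<bar> = L" for f \<beta> x y
    by (rule smear_vanish, subst bump_outside) (use h that in fastforce)+
  have vy: "smear f \<alpha> (bump h) x y = 0" if "\<And>z. f z \<noteq> 0 \<Longrightarrow> \<bar>z $ 2\<bar> \<le> L - 1" "\<bar>y\<bar> = L" for f \<alpha> x y
    by (rule smear_vanish, subst bump_outside[where t="y - _"]) (use h that in fastforce)+
  have vp: "smear f \<alpha> (bump_primitive h) x (-L) = 0" if "\<And>z. f z \<noteq> 0 \<Longrightarrow> \<bar>z $ 2\<bar> \<le> L - 1" for f \<alpha> x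
    by (rule smear_vanish, subst bump_primitive_outside) (use h that in fastforce)+
  have ne: "P z \<noteq> 0" if "P z $ j \<noteq> 0" for P :: "real^2 \<Rightarrow> real^2" and z j using that by auto
  have s: "\<And>z j. P1 z $ j \<noteq> 0 \<Longrightarrow> \<bar>z $ 1\<bar> \<le> L - 1" "\<And>z j. P2 z $ j \<noteq> 0 \<Longrightarrow> \<bar>z $ 1\<bar> \<le> L - 1"
    "\<And>z j. P1 z $ j \<noteq> 0 \<Longrightarrow> \<bar>z $ 2\<bar> \<le> L - 1" "\<And>z j. P2 z $ j \<noteq> 0 \<Longrightarrow> \<bar>z $ 2\<bar> \<le> L - 1"
    "\<And>z. q1 z \<noteq> 0 \<Longrightarrow> \<bar>z $ 2\<bar> \<le> L - 1" "\<And>z. q2 z \<noteq> 0 \<Longrightarrow> \<bar>z $ 2\<bar> \<le> L - 1"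
    using supp ne by blast+
  have v1: "smear (\<lambda>z. P1 z $ j) (bump h) \<beta> x y = 0" "smear (\<lambda>z. P2 z $ j) (bump h) \<beta> x y = 0"
    if "\<bar>x\<bar> = L" for j \<beta> x y
    by (rule vx[OF s(1) that] vx[OF s(2) that], assumption)+
  have v2: "smear (\<lambda>z. P1 z $ j) \<alpha> (bump h) x y = 0" "smear (\<lambda>z. P2 z $ j) \<alpha> (bump h) x y = 0"
    if "\<bar>y\<bar> = L" for j \<alpha> x y
    by (rule vy[OF s(3) that] vy[OF s(4) that], assumption)+
  have v3: "smear (\<lambda>z. P1 z $ j) \<alpha> (bump_primitive h) x (-L) = 0"
    "smear (\<lambda>z. P2 z $ j) \<alpha> (bump_primitive h) x (-L) = 0"
    "smear q1 \<alpha> (bump_primitive h) x (-L) = 0" "smear q2 \<alpha> (bump_primitive h) x (-L) = 0" for j \<alpha> x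
    by (rule vp[OF s(3)] vp[OF s(4)] vp[OF s(5)] vp[OF s(6)], assumption)+
  show ?thesis
    unfolding S_def
  proof (rule smooth_plane_estimate[where
        ?D1.0 = "smear (\<lambda>z. P1 z $ 1) (bump_deriv h) (bump h)" and
        ?D2.0 = "smear (\<lambda>z. P2 z $ 1) (bump_deriv h) (bump h)" and
        ?f1.0 = "smear (\<lambda>z. P1 z $ 1) (bump h) (bump_primitive h)" and
        ?f2.0 = "smear (\<lambda>z. P2 z $ 1) (bump h) (bump_primitive h)" and
        ?Q1.0 = "smear q1 (bump h) (bump_primitive h)" and
        ?Q2.0 = "smear q2 (bump h) (bump_primitive h)"])
    fix x y
    show "((\<lambda>x. smear (\<lambda>z. P1 z $ 1) (bump h) (bump h) x y) has_real_derivative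
        smear (\<lambda>z. P1 z $ 1) (bump_deriv h) (bump h) x y) (at x)"
      "((\<lambda>x. smear (\<lambda>z. P2 z $ 1) (bump h) (bump h) x y) has_real_derivative
        smear (\<lambda>z. P2 z $ 1) (bump_deriv h) (bump h) x y) (at x)"
      by (rule smear_dx[OF i(1) kp bc(1)] smear_dx[OF i(2) kp bc(1)])+
    show "((\<lambda>y. smear (\<lambda>z. P1 z $ 2) (bump h) (bump h) x y) has_real_derivative
        - smear q1 (bump h) (bump h) x y - smear (\<lambda>z. P1 z $ 1) (bump_deriv h) (bump h) x y) (at y)"
      using smear_dy[OF i(1) kp bc(1), of 2 x y] unfolding W1 .
    show "((\<lambda>y. smear (\<lambda>z. P2 z $ 2) (bump h) (bump h) x y) has_real_derivative
        - smear q2 (bump h) (bump h) x y - smear (\<lambda>z. P2 z $ 1) (bump_deriv h) (bump h) x y) (at y)"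
      using smear_dy[OF i(2) kp bc(1), of 2 x y] unfolding W2 .
    show "((\<lambda>x. smear (\<lambda>z. P1 z $ 1) (bump h) (bump_primitive h) x y) has_real_derivative
        - smear (\<lambda>z. P1 z $ 2) (bump h) (bump h) x y - smear q1 (bump h) (bump_primitive h) x y) (at x)"
      using smear_dx[OF i(1) kp bc(3), of 1 y x] unfolding V1 .
    show "((\<lambda>x. smear (\<lambda>z. P2 z $ 1) (bump h) (bump_primitive h) x y) has_real_derivative
        - smear (\<lambda>z. P2 z $ 2) (bump h) (bump h) x y - smear q2 (bump h) (bump_primitive h) x y) (at x)"
      using smear_dx[OF i(2) kp bc(3), of 1 y x] unfolding V2 .
    show "((\<lambda>y. smear (\<lambda>z. P1 z $ 1) (bump h) (bump_primitive h) x y) has_real_derivative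
        smear (\<lambda>z. P1 z $ 1) (bump h) (bump h) x y) (at y)"
      "((\<lambda>y. smear (\<lambda>z. P2 z $ 1) (bump h) (bump_primitive h) x y) has_real_derivative
        smear (\<lambda>z. P2 z $ 1) (bump h) (bump h) x y) (at y)"
      "((\<lambda>y. smear q1 (bump h) (bump_primitive h) x y) has_real_derivative
        smear q1 (bump h) (bump h) x y) (at y)"
      "((\<lambda>y. smear q2 (bump h) (bump_primitive h) x y) has_real_derivative
        smear q2 (bump h) (bump h) x y) (at y)"
      by (rule smear_dy[OF i(1) kpp bc(1)] smear_dy[OF i(2) kpp bc(1)] smear_dy[OF i(3) kpp bc(1)]
          smear_dy[OF i(4) kpp bc(1)])+
  qed (use LK in \<open>auto intro!: cont2_smear i bc v1 v2 v3\<close>)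
qed

lemma bump_eq_0_dist:
  fixes z p :: "real^2"
  assumes "0 \<le> h" "2 * h \<le> norm (z - p)"
  shows "bump h (p $ 1 - z $ 1) * bump h (p $ 2 - z $ 2) = 0"
proof -
  have "norm (z - p) \<le> \<bar>p $ 1 - z $ 1\<bar> + \<bar>p $ 2 - z $ 2\<bar>"
    using norm_le_l1_cart[of "z - p"] by (simp add: sum_2 abs_minus_commute)
  then have "h \<le> \<bar>p $ 1 - z $ 1\<bar> \<or> h \<le> \<bar>p $ 2 - z $ 2\<bar>" using assms by linarith
  then show ?thesis using bump_outside[OF assms(1)] by auto
qed

lemma smear_bump_bound:
  assumes i: "integrable lborel f" and M: "\<And>z. \<bar>f z\<bar> \<le> M" and h: "0 < h"
  shows "\<bar>smear f (bump h) (bump h) x y / bump_mass h\<bar> \<le> M"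
proof -
  have h0: "0 \<le> h" using h by simp
  note bc = kernel_pair_bounded_continuous(1)[OF kernel_pair_bump[OF h0]]
  have "\<bar>smear f (bump h) (bump h) x y\<bar> \<le> (LINT z|lborel. \<bar>f z * (bump h (x - z $ 1) * bump h (y - z $ 2))\<bar>)"
    unfolding smear_def by (rule integral_abs_bound)
  also have "\<dots> \<le> (LINT z|lborel. M * (bump h (x - (z::real^2) $ 1) * bump h (y - z $ 2)))"
  proof (rule integral_mono)
    show "integrable lborel (\<lambda>z. \<bar>f z * (bump h (x - z $ 1) * bump h (y - z $ 2))\<bar>)"
      by (rule integrable_abs[OF smear_integrable[OF i bc bc]])
    show "integrable lborel (\<lambda>z::real^2. M * (bump h (x - z $ 1) * bump h (y - z $ 2)))"
      using bump_tensor_integrable[OF h0] by (rule integrable_mult_right)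
    show "\<bar>f z * (bump h (x - z $ 1) * bump h (y - z $ 2))\<bar> \<le> M * (bump h (x - z $ 1) * bump h (y - z $ 2))" for z
      unfolding abs_mult[of "f z"] by (subst (2) abs_of_nonneg) (auto intro!: mult_right_mono M mult_nonneg_nonneg bump_nonneg)
  qed
  also have "\<dots> = M * bump_mass h" by (simp add: bump_mass_translate)
  finally show ?thesis using bump_mass_pos[OF h] by (simp add: field_simps)
qed

text \<open>
  The kernel is nonnegative and concentrated within distance \<open>2 h\<close>, so the normalised smeared value is
  an average of values of \<open>f\<close> near \<open>p\<close>.
\<close>
lemma smear_bump_tendsto:
  assumes i: "integrable lborel f" and c: "isCont f p"
    and hn: "\<And>n. 0 < h n" "h \<longlonglongrightarrow> 0"
  shows "(\<lambda>n. smear f (bump (h n)) (bump (h n)) (p $ 1) (p $ 2) / bump_mass (h n)) \<longlonglongrightarrow> f p"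
proof (rule LIMSEQ_I)
  fix e :: real assume e: "0 < e"
  obtain d where d: "d > 0" "\<And>z. dist z p < d \<Longrightarrow> dist (f z) (f p) < e / 2"
    using c e unfolding continuous_at_eps_delta by (metis half_gt_zero)
  obtain N where N: "\<And>n. n \<ge> N \<Longrightarrow> h n < d / 2"
    using LIMSEQ_D[OF hn(2), of "d / 2"] d(1) hn(1) by (auto simp: abs_of_pos)
  have "norm (smear f (bump (h n)) (bump (h n)) (p $ 1) (p $ 2) / bump_mass (h n) - f p) < e" if n: "n \<ge> N" for n
  proof -
    define k where "k z = bump (h n) (p $ 1 - z $ 1) * bump (h n) (p $ 2 - z $ 2)" for z :: "real^2"
    have h0: "0 \<le> h n" using hn(1)[of n] by simp
    note bc = kernel_pair_bounded_continuous(1)[OF kernel_pair_bump[OF h0]]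
    have m: "bump_mass (h n) = (LINT z|lborel. k z)" unfolding k_def by (rule bump_mass_translate[symmetric])
    have mp: "bump_mass (h n) > 0" by (rule bump_mass_pos[OF hn(1)])
    have ik: "integrable lborel k" unfolding k_def by (rule bump_tensor_integrable[OF h0])
    have ifk: "integrable lborel (\<lambda>z. f z * k z)" unfolding k_def by (rule smear_integrable[OF i bc bc])
    have "smear f (bump (h n)) (bump (h n)) (p $ 1) (p $ 2) - f p * bump_mass (h n)
       = (LINT z|lborel. f z * k z - f p * k z)"
      unfolding smear_def m k_def[symmetric] using ik ifk by simp
    then have "\<bar>smear f (bump (h n)) (bump (h n)) (p $ 1) (p $ 2) - f p * bump_mass (h n)\<bar>
       \<le> (LINT z|lborel. \<bar>f z * k z - f p * k z\<bar>)" by (simp only: integral_abs_bound)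
    also have "\<dots> \<le> (LINT z|lborel. (e / 2) * k z)"
    proof (rule integral_mono)
      show "integrable lborel (\<lambda>z. \<bar>f z * k z - f p * k z\<bar>)" using ik ifk by (intro integrable_abs) auto
      show "integrable lborel (\<lambda>z. (e / 2) * k z)" using ik by (rule integrable_mult_right)
      fix z
      have kn: "0 \<le> k z" unfolding k_def by (intro mult_nonneg_nonneg bump_nonneg)
      show "\<bar>f z * k z - f p * k z\<bar> \<le> (e / 2) * k z"
      proof (cases "dist z p < d")
        case True
        have "\<bar>f z * k z - f p * k z\<bar> = \<bar>f z - f p\<bar> * k z"
          using kn by (simp add: left_diff_distrib[symmetric] abs_mult)
        also have "\<dots> \<le> (e / 2) * k z"
          using d(2)[OF True] by (intro mult_right_mono kn) (simp add: dist_real_def)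
        finally show ?thesis .
      next
        case False
        have "k z = 0" unfolding k_def
          by (rule bump_eq_0_dist[OF h0]) (use False N[OF n] in \<open>auto simp: dist_norm\<close>)
        then show ?thesis by simp
      qed
    qed
    also have "\<dots> = (e / 2) * bump_mass (h n)" by (simp add: m)
    finally have *: "\<bar>smear f (bump (h n)) (bump (h n)) (p $ 1) (p $ 2) - f p * bump_mass (h n)\<bar> \<le> (e / 2) * bump_mass (h n)" .
    have "smear f (bump (h n)) (bump (h n)) (p $ 1) (p $ 2) / bump_mass (h n) - f p
       = (smear f (bump (h n)) (bump (h n)) (p $ 1) (p $ 2) - f p * bump_mass (h n)) / bump_mass (h n)"
      using mp by (simp add: field_simps)
    then have "norm (smear f (bump (h n)) (bump (h n)) (p $ 1) (p $ 2) / bump_mass (h n) - f p)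
      = \<bar>smear f (bump (h n)) (bump (h n)) (p $ 1) (p $ 2) - f p * bump_mass (h n)\<bar> / bump_mass (h n)"
      using mp by simp
    also have "\<dots> \<le> e / 2" using * mp by (simp add: field_simps)
    also have "\<dots> < e" using e by simp
    finally show ?thesis .
  qed
  then show "\<exists>N. \<forall>n\<ge>N. norm (smear f (bump (h n)) (bump (h n)) (p $ 1) (p $ 2) / bump_mass (h n) - f p) < e" by blast
qed

section \<open>The weighted determinant inequality for tensors with a weak divergence\<close>

text \<open>
  Dominated convergence on the bounded square.
\<close>
lemma square_integral_tendsto:
  assumes c: "\<And>n. cont2 (F n)" and m: "G \<in> borel_measurable borel"
    and b: "\<And>n x y. \<bar>x\<bar> \<le> L \<Longrightarrow> \<bar>y\<bar> \<le> L \<Longrightarrow> \<bar>F n x y\<bar> \<le> C"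
    and l: "AE z in lborel. (\<lambda>n. F n (z $ 1) (z $ 2)) \<longlonglongrightarrow> G z"
    and supp: "\<And>z. G z \<noteq> 0 \<Longrightarrow> \<bar>z $ 1\<bar> \<le> L \<and> \<bar>z $ 2\<bar> \<le> L"
  shows "(\<lambda>n. square_integral L (F n)) \<longlonglongrightarrow> (LINT z|lborel. G (z::real^2))"
proof -
  define S where "S = cbox (vec2 (-L, -L)) (vec2 (L, L))"
  have inS: "z \<in> S \<longleftrightarrow> \<bar>z $ 1\<bar> \<le> L \<and> \<bar>z $ 2\<bar> \<le> L" for z
    by (auto simp: S_def mem_box_cart forall_2)
  have G: "(LINT z|lborel. G z) = (LINT z|lborel. indicator S z * G z)"
    by (rule Bochner_Integration.integral_cong) (use supp inS in \<open>auto simp: indicator_def\<close>)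
  have mS: "S \<in> sets borel" by (simp add: S_def)
  show ?thesis
    unfolding square_integral_LINT[OF c] G S_def[symmetric]
  proof (rule integral_dominated_convergence[where w="\<lambda>z. indicator S z * \<bar>C\<bar>"])
    show "(\<lambda>z. indicator S z * G z) \<in> borel_measurable lborel" using m mS by measurable
    show "(\<lambda>z. indicator S z * F n (z $ 1) (z $ 2)) \<in> borel_measurable lborel" for n
    proof -
      have "continuous_on UNIV (\<lambda>z::real^2. F n (z $ 1) (z $ 2))"
        by (rule cont2_compose[OF c]) (intro continuous_intros)+
      then have "(\<lambda>z::real^2. F n (z $ 1) (z $ 2)) \<in> borel_measurable borel"
        by (rule borel_measurable_continuous_onI)
      then show ?thesis using mS by measurable
    qed
    show "integrable lborel (\<lambda>z. indicator S z * \<bar>C\<bar>)"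
      by (intro integrable_mult_left integrable_real_indicator)
        (use emeasure_bounded_finite[OF bounded_cbox, of "vec2 (-L, -L)" "vec2 (L, L)"]
          in \<open>auto simp: S_def infinity_ennreal_def\<close>)
    show "AE z in lborel. (\<lambda>n. indicator S z * F n (z $ 1) (z $ 2)) \<longlonglongrightarrow> indicator S z * G z"
      using l by eventually_elim (intro tendsto_intros)
    show "AE z in lborel. norm (indicator S z * F n (z $ 1) (z $ 2)) \<le> indicator S z * \<bar>C\<bar>" for n
    proof (rule AE_I2)
      fix z :: "real^2"
      show "norm (indicator S z * F n (z $ 1) (z $ 2)) \<le> indicator S z * \<bar>C\<bar>"
        using b[of "z $ 1" "z $ 2" n] inS[of z] by (cases "z \<in> S") auto
    qed
  qed
qed

lemma cancel_common_factor:
  fixes m X Y Z c d :: real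
  assumes "2 * (m * X) \<le> c * (m * Y) + d * (m * Z)" "0 < m"
  shows "2 * X \<le> c * Y + d * Z"
proof -
  have "m * (2 * X) \<le> m * (c * Y + d * Z)"
    using assms(1) by (simp add: algebra_simps)
  then show ?thesis using assms(2) by (simp only: mult_le_cancel_left_pos)
qed

text \<open>
  Both sides of the smooth inequality pass to the limit by dominated convergence, since the fields are
  bounded, supported in the square and continuous almost everywhere, as piecewise continuous fields are.
\<close>
theorem plane_estimate:
  fixes P1 P2 :: "real^2 \<Rightarrow> real^2"
  assumes w: "weak_divergence P1 (\<lambda>z. - q1 z)" "weak_divergence P2 (\<lambda>z. - q2 z)"
    and meas: "\<And>j. (\<lambda>z. P1 z $ j) \<in> borel_measurable borel" "\<And>j. (\<lambda>z. P2 z $ j) \<in> borel_measurable borel"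
      "q1 \<in> borel_measurable borel" "q2 \<in> borel_measurable borel"
    and bd: "\<And>z j. \<bar>P1 z $ j\<bar> \<le> M" "\<And>z j. \<bar>P2 z $ j\<bar> \<le> M" "\<And>z. \<bar>q1 z\<bar> \<le> M" "\<And>z. \<bar>q2 z\<bar> \<le> M"
    and cont: "AE z in lborel. isCont P1 z \<and> isCont P2 z \<and> isCont q1 z \<and> isCont q2 z"
    and supp: "\<And>z. P1 z \<noteq> 0 \<or> P2 z \<noteq> 0 \<or> q1 z \<noteq> 0 \<or> q2 z \<noteq> 0 \<Longrightarrow> \<bar>z $ 1\<bar> \<le> L - 1 \<and> \<bar>z $ 2\<bar> \<le> L - 1"
    and LK: "1 \<le> L" "0 \<le> K"
  shows "2 * (LINT z|lborel. (K + ((z $ 1)\<^sup>2 + (z $ 2)\<^sup>2) / 2) * (P1 z $ 1 * P2 z $ 2 - P1 z $ 2 * P2 z $ 1))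
     \<le> 8 * L\<^sup>2 * (LINT z|lborel. (P1 z $ 1 + P2 z $ 2)\<^sup>2)
       + plane_const L (K + L\<^sup>2) * (LINT z|lborel. (q1 z)\<^sup>2 + (q2 z)\<^sup>2)"
proof -
  define S where "S = cbox (vec2 (-L, -L)) (vec2 (L, L))"
  have inS: "z \<in> S" if "\<bar>z $ 1\<bar> \<le> L - 1 \<and> \<bar>z $ 2\<bar> \<le> L - 1" for z
    using that by (auto simp: S_def mem_box_cart forall_2)
  have M0: "0 \<le> M" using order_trans[OF abs_ge_zero bd(3)] .
  have int: "integrable lborel f"
    if f: "f \<in> borel_measurable borel" "\<And>z. \<bar>f z\<bar> \<le> M" "\<And>z. f z \<noteq> 0 \<Longrightarrow> \<bar>z $ 1\<bar> \<le> L - 1 \<and> \<bar>z $ 2\<bar> \<le> L - 1"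
    for f :: "real^2 \<Rightarrow> real"
  proof (rule Bochner_Integration.integrable_bound)
    show "integrable lborel (\<lambda>z. indicator S z * M)"
      by (intro integrable_mult_left integrable_real_indicator)
        (use emeasure_bounded_finite[OF bounded_cbox, of "vec2 (-L, -L)" "vec2 (L, L)"]
          in \<open>auto simp: S_def infinity_ennreal_def\<close>)
    show "f \<in> borel_measurable lborel" using f(1) by simp
    show "AE z in lborel. norm (f z) \<le> norm (indicator S z * M)"
    proof (rule AE_I2)
      fix z show "norm (f z) \<le> norm (indicator S z * M)"
        using f(2)[of z] f(3)[of z] inS[of z] M0 by (cases "f z = 0") auto
    qed
  qed
  have ne: "P z \<noteq> 0" if "P z $ j \<noteq> 0" for P :: "real^2 \<Rightarrow> real^2" and z j using that by auto
  have i: "integrable lborel (\<lambda>z. P1 z $ j)" "integrable lborel (\<lambda>z. P2 z $ j)"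
    "integrable lborel q1" "integrable lborel q2" for j
    by (rule int; use meas bd supp ne in blast)+
  \<comment> \<open>Mollification radii: at most 1, so that the support stays inside the square.\<close>
  define h where "h n = inverse (real (Suc n))" for n
  have h: "0 < h n" "h n \<le> 1" for n by (auto simp: h_def inverse_le_1_iff)
  have hlim: "h \<longlonglongrightarrow> 0" unfolding h_def by (rule LIMSEQ_inverse_real_of_nat)
  define A where "A f n x y = smear f (bump (h n)) (bump (h n)) x y / bump_mass (h n)" for f n x y
  have mp: "bump_mass (h n) > 0" for n by (rule bump_mass_pos[OF h(1)])
  have SA: "smear f (bump (h n)) (bump (h n)) x y = bump_mass (h n) * A f n x y" for f n x y
    using mp[of n] by (simp add: A_def)
  have cA: "cont2 (A f n)" if "integrable lborel f" for f n
  proof -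
    have "cont2 (smear f (bump (h n)) (bump (h n)))"
      using h(1)[of n] kernel_pair_bounded_continuous(1)[OF kernel_pair_bump[of "h n"]]
      by (intro cont2_smear that) auto
    then show ?thesis unfolding A_def using mp[of n] by (intro continuous_intros) auto
  qed
  have bA: "\<bar>A f n x y\<bar> \<le> M" if "integrable lborel f" "\<And>z. \<bar>f z\<bar> \<le> M" for f n x y
    unfolding A_def by (rule smear_bump_bound[OF that h(1)])
  have lA: "(\<lambda>n. A f n (p $ 1) (p $ 2)) \<longlonglongrightarrow> f p" if "integrable lborel f" "isCont f p" for f p
    unfolding A_def by (rule smear_bump_tendsto[OF that h(1) hlim])
  let ?a = "\<lambda>n x y. A (\<lambda>z. P1 z $ 1) n x y" and ?b = "\<lambda>n x y. A (\<lambda>z. P1 z $ 2) n x y"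
  let ?c = "\<lambda>n x y. A (\<lambda>z. P2 z $ 1) n x y" and ?d = "\<lambda>n x y. A (\<lambda>z. P2 z $ 2) n x y"
  let ?w = "\<lambda>x y. K + (x\<^sup>2 + y\<^sup>2) / 2"
  have est: "2 * square_integral L (\<lambda>x y. ?w x y * (?a n x y * ?d n x y - ?b n x y * ?c n x y))
     \<le> 8 * L\<^sup>2 * square_integral L (\<lambda>x y. (?a n x y + ?d n x y)\<^sup>2)
       + plane_const L (K + L\<^sup>2) * square_integral L (\<lambda>x y. (A q1 n x y)\<^sup>2 + (A q2 n x y)\<^sup>2)" for n
  proof -
    define m where "m = (bump_mass (h n))\<^sup>2"
    have m: "m > 0" using mp[of n] by (simp add: m_def)
    have e: "v * (bump_mass (h n) * a * (bump_mass (h n) * d) - bump_mass (h n) * b * (bump_mass (h n) * c))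
        = m * (v * (a * d - b * c))"
      "(bump_mass (h n) * a + bump_mass (h n) * d)\<^sup>2 = m * (a + d)\<^sup>2"
      "(bump_mass (h n) * a)\<^sup>2 + (bump_mass (h n) * d)\<^sup>2 = m * (a\<^sup>2 + d\<^sup>2)" for v a b c d :: real
      by (simp_all add: m_def power2_eq_square algebra_simps)
    have "2 * (m * square_integral L (\<lambda>x y. ?w x y * (?a n x y * ?d n x y - ?b n x y * ?c n x y)))
     \<le> 8 * L\<^sup>2 * (m * square_integral L (\<lambda>x y. (?a n x y + ?d n x y)\<^sup>2))
       + plane_const L (K + L\<^sup>2) * (m * square_integral L (\<lambda>x y. (A q1 n x y)\<^sup>2 + (A q2 n x y)\<^sup>2))"
      using smeared_plane_estimate[OF w i supp h[of n] LK]
      unfolding SA e square_integral_cmult .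
    then show ?thesis using m by (rule cancel_common_factor)
  qed
  note cc = cA[OF i(1)] cA[OF i(2)] cA[OF i(3)] cA[OF i(4)]
  note bb = bA[OF i(1) bd(1)] bA[OF i(2) bd(2)] bA[OF i(3) bd(3)] bA[OF i(4) bd(4)]
  have pb: "\<bar>a * b\<bar> \<le> M\<^sup>2" if "\<bar>a\<bar> \<le> M" "\<bar>b\<bar> \<le> M" for a b
    unfolding abs_mult power2_eq_square by (intro mult_mono that M0 abs_ge_zero)
  have lim: "(\<lambda>n. ?a n (z $ 1) (z $ 2)) \<longlonglongrightarrow> P1 z $ 1" "(\<lambda>n. ?b n (z $ 1) (z $ 2)) \<longlonglongrightarrow> P1 z $ 2"
    "(\<lambda>n. ?c n (z $ 1) (z $ 2)) \<longlonglongrightarrow> P2 z $ 1" "(\<lambda>n. ?d n (z $ 1) (z $ 2)) \<longlonglongrightarrow> P2 z $ 2"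
    "(\<lambda>n. A q1 n (z $ 1) (z $ 2)) \<longlonglongrightarrow> q1 z" "(\<lambda>n. A q2 n (z $ 1) (z $ 2)) \<longlonglongrightarrow> q2 z"
    if c: "isCont P1 z \<and> isCont P2 z \<and> isCont q1 z \<and> isCont q2 z" for z
  proof -
    have "isCont (\<lambda>z. P1 z $ j) z" "isCont (\<lambda>z. P2 z $ j) z" for j
      using c by (auto intro!: continuous_intros)
    then show "(\<lambda>n. ?a n (z $ 1) (z $ 2)) \<longlonglongrightarrow> P1 z $ 1" "(\<lambda>n. ?b n (z $ 1) (z $ 2)) \<longlonglongrightarrow> P1 z $ 2"
      "(\<lambda>n. ?c n (z $ 1) (z $ 2)) \<longlonglongrightarrow> P2 z $ 1" "(\<lambda>n. ?d n (z $ 1) (z $ 2)) \<longlonglongrightarrow> P2 z $ 2"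
      using lA[OF i(1)[of 1], of z] lA[OF i(1)[of 2], of z] lA[OF i(2)[of 1], of z] lA[OF i(2)[of 2], of z]
      by blast+
    show "(\<lambda>n. A q1 n (z $ 1) (z $ 2)) \<longlonglongrightarrow> q1 z" "(\<lambda>n. A q2 n (z $ 1) (z $ 2)) \<longlonglongrightarrow> q2 z"
      using lA[OF i(3), of z] lA[OF i(4), of z] c by blast+
  qed
  have suppP: "\<bar>z $ 1\<bar> \<le> L \<and> \<bar>z $ 2\<bar> \<le> L"
    if "P1 z \<noteq> 0 \<or> P2 z \<noteq> 0 \<or> q1 z \<noteq> 0 \<or> q2 z \<noteq> 0" for z
    using supp[OF that] by linarith
  have l1: "(\<lambda>n. square_integral L (\<lambda>x y. ?w x y * (?a n x y * ?d n x y - ?b n x y * ?c n x y)))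
     \<longlonglongrightarrow> (LINT z|lborel. (K + ((z $ 1)\<^sup>2 + (z $ 2)\<^sup>2) / 2) * (P1 z $ 1 * P2 z $ 2 - P1 z $ 2 * P2 z $ 1))"
  proof (rule square_integral_tendsto)
    show "cont2 (\<lambda>x y. ?w x y * (?a n x y * ?d n x y - ?b n x y * ?c n x y))" for n
      by (intro continuous_intros cc) auto
    show "(\<lambda>z. (K + ((z $ 1)\<^sup>2 + (z $ 2)\<^sup>2) / 2) * (P1 z $ 1 * P2 z $ 2 - P1 z $ 2 * P2 z $ 1)) \<in> borel_measurable borel"
    proof -
      have "(\<lambda>z::real^2. K + ((z $ 1)\<^sup>2 + (z $ 2)\<^sup>2) / 2) \<in> borel_measurable borel"
        by (intro borel_measurable_continuous_onI continuous_intros) auto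
      then show ?thesis using meas by measurable
    qed
    show "\<bar>?w x y * (?a n x y * ?d n x y - ?b n x y * ?c n x y)\<bar> \<le> (K + L\<^sup>2) * (2 * M\<^sup>2)"
      if "\<bar>x\<bar> \<le> L" "\<bar>y\<bar> \<le> L" for n x y
    proof -
      have x2: "x\<^sup>2 \<le> L\<^sup>2" and y2: "y\<^sup>2 \<le> L\<^sup>2"
        using that abs_le_square_iff[of x L] abs_le_square_iff[of y L] by auto
      have "\<bar>?a n x y * ?d n x y - ?b n x y * ?c n x y\<bar> \<le> 2 * M\<^sup>2"
        using pb[OF bb(1)[of 1 n x y] bb(2)[of 2 n x y]] pb[OF bb(1)[of 2 n x y] bb(2)[of 1 n x y]] by linarith
      moreover have "\<bar>?w x y\<bar> \<le> K + L\<^sup>2" using x2 y2 LK by simp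
      ultimately show ?thesis unfolding abs_mult[of "?w x y"] using LK by (intro mult_mono) auto
    qed
    show "AE z in lborel. (\<lambda>n. ?w (z $ 1) (z $ 2) * (?a n (z $ 1) (z $ 2) * ?d n (z $ 1) (z $ 2) - ?b n (z $ 1) (z $ 2) * ?c n (z $ 1) (z $ 2)))
        \<longlonglongrightarrow> (K + ((z $ 1)\<^sup>2 + (z $ 2)\<^sup>2) / 2) * (P1 z $ 1 * P2 z $ 2 - P1 z $ 2 * P2 z $ 1)"
      using cont by eventually_elim (intro tendsto_intros lim)
    show "\<bar>z $ 1\<bar> \<le> L \<and> \<bar>z $ 2\<bar> \<le> L"
      if "(K + ((z $ 1)\<^sup>2 + (z $ 2)\<^sup>2) / 2) * (P1 z $ 1 * P2 z $ 2 - P1 z $ 2 * P2 z $ 1) \<noteq> 0" for z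
      by (rule suppP) (use that in auto)
  qed
  have l2: "(\<lambda>n. square_integral L (\<lambda>x y. (?a n x y + ?d n x y)\<^sup>2)) \<longlonglongrightarrow> (LINT z|lborel. (P1 z $ 1 + P2 z $ 2)\<^sup>2)"
  proof (rule square_integral_tendsto)
    show "cont2 (\<lambda>x y. (?a n x y + ?d n x y)\<^sup>2)" for n by (intro continuous_intros cc)
    show "(\<lambda>z. (P1 z $ 1 + P2 z $ 2)\<^sup>2) \<in> borel_measurable borel" using meas by measurable
    show "\<bar>(?a n x y + ?d n x y)\<^sup>2\<bar> \<le> (2 * M)\<^sup>2" for n x y
    proof -
      have "\<bar>?a n x y + ?d n x y\<bar> \<le> \<bar>2 * M\<bar>" using bb(1)[of 1 n x y] bb(2)[of 2 n x y] by linarith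
      then show ?thesis by (simp only: abs_power2 abs_le_square_iff)
    qed
    show "AE z in lborel. (\<lambda>n. (?a n (z $ 1) (z $ 2) + ?d n (z $ 1) (z $ 2))\<^sup>2) \<longlonglongrightarrow> (P1 z $ 1 + P2 z $ 2)\<^sup>2"
      using cont by eventually_elim (intro tendsto_intros lim)
    show "\<bar>z $ 1\<bar> \<le> L \<and> \<bar>z $ 2\<bar> \<le> L" if "(P1 z $ 1 + P2 z $ 2)\<^sup>2 \<noteq> 0" for z
      by (rule suppP) (use that in auto)
  qed
  have l3: "(\<lambda>n. square_integral L (\<lambda>x y. (A q1 n x y)\<^sup>2 + (A q2 n x y)\<^sup>2)) \<longlonglongrightarrow> (LINT z|lborel. (q1 z)\<^sup>2 + (q2 z)\<^sup>2)"
  proof (rule square_integral_tendsto)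
    show "cont2 (\<lambda>x y. (A q1 n x y)\<^sup>2 + (A q2 n x y)\<^sup>2)" for n by (intro continuous_intros cc)
    show "(\<lambda>z. (q1 z)\<^sup>2 + (q2 z)\<^sup>2) \<in> borel_measurable borel" using meas by measurable
    show "\<bar>(A q1 n x y)\<^sup>2 + (A q2 n x y)\<^sup>2\<bar> \<le> 2 * M\<^sup>2" for n x y
      using pb[OF bb(3)[of n x y] bb(3)[of n x y]] pb[OF bb(4)[of n x y] bb(4)[of n x y]]
      by (simp add: power2_eq_square)
    show "AE z in lborel. (\<lambda>n. (A q1 n (z $ 1) (z $ 2))\<^sup>2 + (A q2 n (z $ 1) (z $ 2))\<^sup>2) \<longlonglongrightarrow> (q1 z)\<^sup>2 + (q2 z)\<^sup>2"
      using cont by eventually_elim (intro tendsto_intros lim)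
    show "\<bar>z $ 1\<bar> \<le> L \<and> \<bar>z $ 2\<bar> \<le> L" if "(q1 z)\<^sup>2 + (q2 z)\<^sup>2 \<noteq> 0" for z
      by (rule suppP) (use that in auto)
  qed
  show ?thesis
    by (rule LIMSEQ_le[OF tendsto_mult_left[OF l1] tendsto_add[OF tendsto_mult_left[OF l2] tendsto_mult_left[OF l3]]])
      (use est in auto)
qed

section \<open>Integrals of gradients over a triangle\<close>

text \<open>
  The determinant of the matrix with columns \<open>u\<close> and \<open>v\<close>.
\<close>
definition cross2 :: "real^2 \<Rightarrow> real^2 \<Rightarrow> real" where
  "cross2 u v = u $ 1 * v $ 2 - u $ 2 * v $ 1"

definition unit_simplex :: "(real^2) set" where
  "unit_simplex = {x. 0 \<le> x $ 1 \<and> 0 \<le> x $ 2 \<and> x $ 1 + x $ 2 \<le> 1}"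

lemma compact_unit_simplex: "compact unit_simplex"
proof -
  have "closed unit_simplex" unfolding unit_simplex_def
    by (intro closed_Collect_conj closed_Collect_le continuous_intros)
  moreover have "unit_simplex \<subseteq> cbox (vec2 (0, 0)) (vec2 (1, 1))"
    by (auto simp: unit_simplex_def mem_box_cart forall_2)
  ultimately show ?thesis using bounded_cbox bounded_subset compact_eq_bounded_closed by blast
qed

lemma unit_simplex_integral_dx:
  assumes c: "cont2 F'" and F: "\<And>s t. ((\<lambda>s. F s t) has_real_derivative F' s t) (at s)"
    and cF: "cont2 F"
  shows "(LINT z|lborel. indicator unit_simplex z * F' (z $ 1) (z $ 2))
    = integral {0..1} (\<lambda>t. F (1 - t) t) - integral {0..1} (\<lambda>t. F 0 t)"
proof -
  define D where "D = {p::real \<times> real. 0 \<le> fst p \<and> 0 \<le> snd p \<and> fst p + snd p \<le> 1}"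
  have D: "vec2 p \<in> unit_simplex \<longleftrightarrow> p \<in> D" for p by (simp add: D_def unit_simplex_def)
  have clD: "closed D" unfolding D_def
    by (intro closed_Collect_conj closed_Collect_le continuous_intros)
  have "D \<subseteq> cbox (0,0) (1,1)" by (auto simp: D_def cbox_Pair_eq)
  then have cD: "compact D" using clD bounded_cbox bounded_subset compact_eq_bounded_closed by blast
  have m: "(\<lambda>z::real^2. indicator unit_simplex z * F' (z $ 1) (z $ 2)) \<in> borel_measurable borel"
  proof -
    have "continuous_on UNIV (\<lambda>z::real^2. F' (z $ 1) (z $ 2))"
      by (rule cont2_compose[OF c]) (intro continuous_intros)+
    then have "(\<lambda>z::real^2. F' (z $ 1) (z $ 2)) \<in> borel_measurable borel"
      by (rule borel_measurable_continuous_onI)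
    moreover have "unit_simplex \<in> sets borel" using compact_unit_simplex by (simp add: borel_closed compact_imp_closed)
    ultimately show ?thesis by measurable
  qed
  have "(LINT z|lborel. indicator unit_simplex z * F' (z $ 1) (z $ 2))
     = (LINT p|lborel. indicator unit_simplex (vec2 p) * F' (vec2 p $ 1) (vec2 p $ 2))"
    unfolding lborel_vec2[symmetric] by (rule integral_distr) (use m in auto)
  also have "\<dots> = (LINT p|lborel. indicator D p * F' (fst p) (snd p))"
    by (rule Bochner_Integration.integral_cong) (auto simp: indicator_def D)
  also have "\<dots> = (LINT p|(lborel \<Otimes>\<^sub>M lborel). indicator D p * F' (fst p) (snd p))"
    by (simp only: lborel_prod)
  also have "\<dots> = (LINT t|lborel. LINT s|lborel. indicator D (s, t) * F' s t)"
  proof -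
    have "integrable lborel (\<lambda>p. indicator D p *\<^sub>R F' (fst p) (snd p))"
      by (rule borel_integrable_compact[OF cD]) (rule continuous_on_subset[OF c], simp)
    moreover have e: "(\<lambda>p. indicator D p *\<^sub>R F' (fst p) (snd p)) = (\<lambda>(s, t). indicator D (s, t) * F' s t)"
      by (auto simp: fun_eq_iff)
    ultimately have "integrable (lborel \<Otimes>\<^sub>M lborel) (\<lambda>(s, t). indicator D (s, t) * F' s t)"
      by (simp only: lborel_prod)
    from lborel_pair.integral_snd[OF this] show ?thesis
      using e by (simp only: real_scaleR_def)
  qed
  also have "\<dots> = (LINT t|lborel. indicator {0..1} t * (F (1 - t) t - F 0 t))"
  proof (rule Bochner_Integration.integral_cong[OF refl])
    fix t :: real
    show "(LINT s|lborel. indicator D (s, t) * F' s t) = indicator {0..1} t * (F (1 - t) t - F 0 t)"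
    proof (cases "t \<in> {0..1}")
      case True
      have "(LINT s|lborel. indicator D (s, t) * F' s t) = (LINT s|lborel. indicator {0..1 - t} s *\<^sub>R F' s t)"
        by (rule Bochner_Integration.integral_cong) (use True in \<open>auto simp: indicator_def D_def\<close>)
      also have "\<dots> = F (1 - t) t - F 0 t"
        by (rule integral_FTC_atLeastAtMost)
          (use True F in \<open>auto intro!: cont2_compose[OF c] continuous_intros
            simp: has_real_derivative_iff_has_vector_derivative[symmetric]
            intro: has_field_derivative_at_within\<close>)
      finally show ?thesis using True by simp
    next
      case False
      then have "(\<lambda>s. indicator D (s, t) * F' s t) = (\<lambda>s. 0)" by (auto simp: D_def indicator_def)
      then show ?thesis using False by (simp only: Bochner_Integration.integral_zero) simp
    qed
  qed
  also have "\<dots> = integral {0..1} (\<lambda>t. F (1 - t) t - F 0 t)"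
  proof -
    have "continuous_on {0..1} (\<lambda>t. F (1 - t) t - F 0 t)"
      by (intro continuous_intros cont2_compose[OF cF])
    then have "set_integrable lborel {0..1} (\<lambda>t. F (1 - t) t - F 0 t)"
      by (rule borel_integrable_atLeastAtMost')
    from set_borel_integral_eq_integral(2)[OF this] show ?thesis
      by (simp add: set_lebesgue_integral_def)
  qed
  also have "\<dots> = integral {0..1} (\<lambda>t. F (1 - t) t) - integral {0..1} (\<lambda>t. F 0 t)"
    by (rule Henstock_Kurzweil_Integration.integral_diff)
      (intro integrable_continuous_real cont2_compose[OF cF] continuous_intros)+
  finally show ?thesis .
qed

text \<open>
  The parametrisation has constant speed, so this is the mean with respect to arc length.
\<close>
definition segment_mean :: "real^2 \<Rightarrow> real^2 \<Rightarrow> (real^2 \<Rightarrow> 'b::euclidean_space) \<Rightarrow> 'b" where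
  "segment_mean a b f = integral {0..1} (\<lambda>t. f (linepath a b t))"

lemma segment_mean_commute: "segment_mean a b f = segment_mean b a f"
proof -
  define F where "F t = f (linepath a b t)" for t
  have "integral {0..1} (\<lambda>t. F (1 - t)) = integral {0..1} (\<lambda>t. (\<lambda>s. F (1 + s)) (- t))" by simp
  also have "\<dots> = integral {-1..0} (\<lambda>s. F (1 + s))"
    using Henstock_Kurzweil_Integration.integral_reflect_real[of 0 "-1" "\<lambda>s. F (1 + s)"] by simp
  also have "\<dots> = integral {0..1} F"
    using integral_shift_real_ivl[of 0 1 1 F] by (simp add: add.commute)
  finally show ?thesis unfolding segment_mean_def F_def
    by (simp add: linepath_def algebra_simps)
qed

lemma triangle_image: "convex hull {a, b, c} = (\<lambda>x. a + (x $ 1 *\<^sub>R (b - a) + x $ 2 *\<^sub>R (c - a))) ` unit_simplex"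
  for a b c :: "real^2"
  unfolding convex_hull_3_alt unit_simplex_def
proof (safe)
  fix u v :: real assume "0 \<le> u" "0 \<le> v" "u + v \<le> 1"
  then show "a + u *\<^sub>R (b - a) + v *\<^sub>R (c - a) \<in> (\<lambda>x. a + (x $ 1 *\<^sub>R (b - a) + x $ 2 *\<^sub>R (c - a))) `
      {x::real^2. 0 \<le> x $ 1 \<and> 0 \<le> x $ 2 \<and> x $ 1 + x $ 2 \<le> 1}"
    by (intro image_eqI[of _ _ "vec2 (u, v)"]) auto
qed (metis add.assoc)

lemma integral_triangle:
  fixes g :: "real^2 \<Rightarrow> real^2"
  assumes "cross2 (b - a) (c - a) \<noteq> 0" and g: "continuous_on UNIV g"
  shows "(LINT x:convex hull {a, b, c}|lborel. g x)
    = \<bar>cross2 (b - a) (c - a)\<bar> *\<^sub>R (LINT x:unit_simplex|lborel. g (a + (x $ 1 *\<^sub>R (b - a) + x $ 2 *\<^sub>R (c - a))))"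
proof -
  define u v where "u = b - a" and "v = c - a"
  define l where "l x = x $ 1 *\<^sub>R u + x $ 2 *\<^sub>R v" for x :: "real^2"
  have lin: "linear l" unfolding l_def
    by (auto intro!: linearI simp: algebra_simps)
  have det: "det (matrix l) = cross2 u v"
    by (simp add: det_2 matrix_def l_def cross2_def axis_def)
  have inj: "inj l" using det_nz_iff_inj[OF lin] det assms by (simp add: u_def v_def)
  let ?h = "\<lambda>x. a + l x"
  have T: "convex hull {a, b, c} = ?h ` unit_simplex"
    unfolding triangle_image by (simp add: l_def u_def v_def)
  have cT: "compact (convex hull {a, b, c})" by (rule finite_imp_compact_convex_hull) simp
  have gT: "set_integrable lborel (convex hull {a, b, c}) g"
    unfolding set_integrable_def by (rule borel_integrable_compact[OF cT]) (rule continuous_on_subset[OF g], simp)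
  then have "set_integrable lebesgue (convex hull {a, b, c}) g"
    unfolding set_integrable_def by (subst integrable_completion) (auto dest: borel_measurable_integrable)
  then have gai: "g absolutely_integrable_on ?h ` unit_simplex" unfolding T .
  have ch: "continuous_on UNIV ?h"
    by (intro continuous_intros linear_continuous_on linear_linear[THEN iffD2] lin)
  have gS: "set_integrable lborel unit_simplex (\<lambda>x. g (?h x))"
    unfolding set_integrable_def
    by (rule borel_integrable_compact[OF compact_unit_simplex], rule continuous_on_compose2[OF g])
      (use continuous_on_subset[OF ch] in auto)
  have d: "(?h has_derivative l) (at x within unit_simplex)" for x
    using lin by (auto intro!: derivative_eq_intros linear_imp_has_derivative)
  have "unit_simplex \<in> sets lebesgue"
    using compact_unit_simplex by (simp add: borel_closed compact_imp_closed)
  from has_absolute_integral_change_of_variables[OF this d inj_on_subset[of ?h UNIV unit_simplex],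
      of g "integral (?h ` unit_simplex) g"]
  have "integral unit_simplex (\<lambda>x. \<bar>det (matrix l)\<bar> *\<^sub>R g (?h x)) = integral (?h ` unit_simplex) g"
    using gai inj by (auto simp: inj_on_def)
  then show ?thesis
    unfolding T set_borel_integral_eq_integral(2)[OF gS[unfolded l_def u_def v_def]]
    using set_borel_integral_eq_integral(2)[OF gT] 
    by (simp add: T det u_def v_def l_def)
qed

text \<open>
  Rotation by a right angle clockwise: it turns an edge of a counterclockwise triangle into an outward
  normal of the same length.
\<close>
definition rot :: "real^2 \<Rightarrow> real^2" where
  "rot e = vec2 (e $ 2, - e $ 1)"

lemma rot_nth [simp]: "rot e $ 1 = e $ 2" "rot e $ 2 = - e $ 1"
  by (simp_all add: rot_def)

lemma vec_eq_2: "(u::real^2) = v \<longleftrightarrow> u $ 1 = v $ 1 \<and> u $ 2 = v $ 2"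
  by (simp add: vec_eq_iff forall_2)

lemma triangle_set_integrable:
  fixes f :: "real^2 \<Rightarrow> 'b::euclidean_space"
  assumes "continuous_on UNIV f"
  shows "set_integrable lborel (convex hull {a, b, c :: real^2}) f"
  unfolding set_integrable_def
  by (rule borel_integrable_compact[OF finite_imp_compact_convex_hull])
    (auto intro: continuous_on_subset[OF assms])

text \<open>
  In the coordinates of the reference simplex, with \<open>b - a\<close> as first axis, this is an integration along
  horizontal lines from the side \<open>a c\<close> to the side \<open>b c\<close>.
\<close>
lemma triangle_gauss_direction:
  assumes D: "cross2 (b - a) (c - a) \<noteq> 0" and g: "continuous_on UNIV g"
    and \<psi>: "\<And>z. (\<psi> has_derivative (\<lambda>v. g z \<bullet> v)) (at z)"
  shows "(LINT x:convex hull {a, b, c}|lborel. g x) \<bullet> (b - a)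
    = \<bar>cross2 (b - a) (c - a)\<bar> * (segment_mean b c \<psi> - segment_mean a c (\<psi> :: real^2 \<Rightarrow> real))"
proof -
  define u v where "u = b - a" and "v = c - a"
  define F where "F s t = \<psi> (a + (s *\<^sub>R u + t *\<^sub>R v))" for s t
  define F' where "F' s t = g (a + (s *\<^sub>R u + t *\<^sub>R v)) \<bullet> u" for s t
  have c\<psi>: "continuous_on UNIV \<psi>"
    using \<psi> by (meson continuous_at_imp_continuous_on has_derivative_continuous)
  have cF: "cont2 F" unfolding F_def
    by (rule continuous_on_compose2[OF c\<psi>]) (auto intro!: continuous_intros)
  have cF': "cont2 F'" unfolding F'_def
    by (intro continuous_on_inner continuous_on_compose2[OF g] continuous_intros) auto
  have dF: "((\<lambda>s. F s t) has_real_derivative F' s t) (at s)" for s t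
  proof -
    have 1: "((\<lambda>s. a + (s *\<^sub>R u + t *\<^sub>R v)) has_derivative (\<lambda>h. h *\<^sub>R u)) (at s)"
      by (auto intro!: derivative_eq_intros)
    have "((\<lambda>s. \<psi> (a + (s *\<^sub>R u + t *\<^sub>R v))) has_derivative (\<lambda>h. g (a + (s *\<^sub>R u + t *\<^sub>R v)) \<bullet> (h *\<^sub>R u))) (at s)"
      by (rule has_derivative_compose[OF 1 \<psi>])
    then show ?thesis unfolding F_def F'_def has_field_derivative_def
      by (simp add: mult.commute[of _ "g _ \<bullet> u"])
  qed
  have gS: "set_integrable lborel unit_simplex (\<lambda>x. g (a + (x $ 1 *\<^sub>R u + x $ 2 *\<^sub>R v)))"
    unfolding set_integrable_def
    by (rule borel_integrable_compact[OF compact_unit_simplex], rule continuous_on_compose2[OF g])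
      (auto intro!: continuous_intros)
  have "(LINT x:convex hull {a, b, c}|lborel. g x) \<bullet> u
     = \<bar>cross2 u v\<bar> * ((LINT x:unit_simplex|lborel. g (a + (x $ 1 *\<^sub>R u + x $ 2 *\<^sub>R v))) \<bullet> u)"
    unfolding integral_triangle[OF D g] u_def v_def by simp
  also have "(LINT x:unit_simplex|lborel. g (a + (x $ 1 *\<^sub>R u + x $ 2 *\<^sub>R v))) \<bullet> u
      = (LINT z|lborel. indicator unit_simplex z * F' (z $ 1) (z $ 2))"
    unfolding set_lebesgue_integral_def
    using gS by (subst integral_inner_left[symmetric]) (auto simp: set_integrable_def F'_def)
  also have "\<dots> = integral {0..1} (\<lambda>t. F (1 - t) t) - integral {0..1} (\<lambda>t. F 0 t)"
    by (rule unit_simplex_integral_dx[OF cF' dF cF])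
  also have "(\<lambda>t. F (1 - t) t) = (\<lambda>t. \<psi> (linepath b c t))"
    by (auto simp: fun_eq_iff F_def linepath_def u_def v_def algebra_simps)
  also have "(\<lambda>t. F 0 t) = (\<lambda>t. \<psi> (linepath a c t))"
    by (auto simp: fun_eq_iff F_def linepath_def u_def v_def algebra_simps)
  finally show ?thesis by (simp add: segment_mean_def u_def v_def)
qed

lemma eq_if_inner_eq:
  fixes X Y u v :: "real^2"
  assumes "cross2 u v \<noteq> 0" "X \<bullet> u = Y \<bullet> u" "X \<bullet> v = Y \<bullet> v"
  shows "X = Y"
proof -
  have 1: "(X $ 1 - Y $ 1) * u $ 1 + (X $ 2 - Y $ 2) * u $ 2 = 0"
    and 2: "(X $ 1 - Y $ 1) * v $ 1 + (X $ 2 - Y $ 2) * v $ 2 = 0"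
    using assms(2,3) by (simp_all add: inner_vec2 algebra_simps)
  have "(X $ 1 - Y $ 1) * cross2 u v = 0" "(X $ 2 - Y $ 2) * cross2 u v = 0"
    using 1 2 unfolding cross2_def by algebra+
  then show ?thesis using assms(1) by (simp add: vec_eq_2)
qed

text \<open>
  Both sides have the same inner product with \<open>b - a\<close> and with \<open>c - a\<close>, by \<open>triangle_gauss_direction\<close>.
\<close>
theorem triangle_gauss:
  fixes \<psi> :: "real^2 \<Rightarrow> real"
  assumes D: "cross2 (b - a) (c - a) > 0" and g: "continuous_on UNIV g"
    and \<psi>: "\<And>z. (\<psi> has_derivative (\<lambda>v. g z \<bullet> v)) (at z)"
  shows "(LINT x:convex hull {a, b, c}|lborel. g x)
    = segment_mean b c \<psi> *\<^sub>R rot (c - b) + segment_mean c a \<psi> *\<^sub>R rot (a - c) + segment_mean a b \<psi> *\<^sub>R rot (b - a)"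
proof (rule eq_if_inner_eq[of "b - a" "c - a"])
  show "cross2 (b - a) (c - a) \<noteq> 0" using D by simp
  have "(LINT x:convex hull {a, b, c}|lborel. g x) \<bullet> (b - a)
    = cross2 (b - a) (c - a) * (segment_mean b c \<psi> - segment_mean c a \<psi>)"
    using triangle_gauss_direction[OF _ g \<psi>, of b a c] D by (simp add: segment_mean_commute[of c a])
  then show "(LINT x:convex hull {a, b, c}|lborel. g x) \<bullet> (b - a)
    = (segment_mean b c \<psi> *\<^sub>R rot (c - b) + segment_mean c a \<psi> *\<^sub>R rot (a - c) + segment_mean a b \<psi> *\<^sub>R rot (b - a)) \<bullet> (b - a)"
    by (simp add: inner_vec2 cross2_def algebra_simps)
  have D': "cross2 (c - a) (b - a) = - cross2 (b - a) (c - a)" by (simp add: cross2_def algebra_simps)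
  have "(LINT x:convex hull {a, c, b}|lborel. g x) \<bullet> (c - a)
    = cross2 (b - a) (c - a) * (segment_mean b c \<psi> - segment_mean a b \<psi>)"
    using triangle_gauss_direction[OF _ g \<psi>, of c a b] D D' by (simp add: segment_mean_commute[of c b])
  then show "(LINT x:convex hull {a, b, c}|lborel. g x) \<bullet> (c - a)
    = (segment_mean b c \<psi> *\<^sub>R rot (c - b) + segment_mean c a \<psi> *\<^sub>R rot (a - c) + segment_mean a b \<psi> *\<^sub>R rot (b - a)) \<bullet> (c - a)"
    by (simp add: inner_vec2 cross2_def algebra_simps insert_commute)
qed

text \<open>
  Gauss' theorem for the products of \<open>\<psi>\<close> with the components of \<open>x - a\<close>. The two sides at \<open>a\<close>
  contribute nothing because \<open>x - a\<close> is tangential there, and on the opposite side its normal component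
  is constant.
\<close>
lemma triangle_moment:
  fixes \<psi> :: "real^2 \<Rightarrow> real"
  assumes D: "cross2 (b - a) (c - a) > 0" and g: "continuous_on UNIV g"
    and \<psi>: "\<And>z. (\<psi> has_derivative (\<lambda>v. g z \<bullet> v)) (at z)"
  shows "(LINT x:convex hull {a, b, c}|lborel. (x - a) \<bullet> g x)
    = cross2 (b - a) (c - a) * segment_mean b c \<psi> - 2 * (LINT x:convex hull {a, b, c}|lborel. \<psi> x)"
proof -
  let ?T = "convex hull {a, b, c}"
  define F where "F j x = (x $ j - a $ j) * \<psi> x" for j :: 2 and x
  define G where "G j x = (x $ j - a $ j) *\<^sub>R g x + \<psi> x *\<^sub>R axis j 1" for j :: 2 and x
  have c\<psi>: "continuous_on UNIV \<psi>"
    using \<psi> by (meson continuous_at_imp_continuous_on has_derivative_continuous)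
  have cG: "continuous_on UNIV (G j)" for j unfolding G_def by (intro continuous_intros g c\<psi>)
  have dF: "(F j has_derivative (\<lambda>v. G j z \<bullet> v)) (at z)" for j z
  proof -
    have 1: "((\<lambda>x::real^2. x $ j - a $ j) has_derivative (\<lambda>v. v $ j)) (at z)"
      by (auto intro!: derivative_eq_intros bounded_linear.has_derivative[OF bounded_linear_vec_nth])
    show ?thesis unfolding F_def
      by (rule has_derivative_eq_rhs[OF has_derivative_mult[OF 1 \<psi>]])
        (auto simp: G_def inner_add_left inner_axis inner_commute[of "axis j 1"] algebra_simps)
  qed
  note gauss = triangle_gauss[OF D cG dF]
  have iG: "set_integrable lborel ?T (G j)" for j by (rule triangle_set_integrable[OF cG])
  have "(LINT x:?T|lborel. G 1 x) $ 1 + (LINT x:?T|lborel. G 2 x) $ 2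
     = (LINT x:?T|lborel. G 1 x $ 1 + G 2 x $ 2)"
  proof -
    have n: "(LINT x:?T|lborel. G j x) $ j = (LINT x:?T|lborel. G j x $ j)" and i: "set_integrable lborel ?T (\<lambda>x. G j x $ j)" for j
    proof -
      have "(LINT x:?T|lborel. G j x) \<bullet> axis j 1 = (LINT x:?T|lborel. G j x \<bullet> axis j 1)"
        unfolding set_lebesgue_integral_def using iG[of j]
        by (subst integral_inner_left[symmetric]) (auto simp: set_integrable_def)
      then show "(LINT x:?T|lborel. G j x) $ j = (LINT x:?T|lborel. G j x $ j)"
        by (simp add: inner_axis)
      show "set_integrable lborel ?T (\<lambda>x. G j x $ j)"
        by (rule triangle_set_integrable) (intro continuous_intros cG)
    qed
    show ?thesis unfolding n by (rule set_integral_add(2)[OF i i, symmetric])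
  qed
  also have "(\<lambda>x. G 1 x $ 1 + G 2 x $ 2) = (\<lambda>x. (x - a) \<bullet> g x + 2 * \<psi> x)"
    by (auto simp: G_def inner_vec2 axis_def)
  also have "(LINT x:?T|lborel. (x - a) \<bullet> g x + 2 * \<psi> x)
      = (LINT x:?T|lborel. (x - a) \<bullet> g x) + 2 * (LINT x:?T|lborel. \<psi> x)"
    by (subst set_integral_add(2))
      (auto intro!: triangle_set_integrable continuous_intros g c\<psi>)
  finally have L: "(LINT x:?T|lborel. (x - a) \<bullet> g x) + 2 * (LINT x:?T|lborel. \<psi> x)
     = (LINT x:?T|lborel. G 1 x) $ 1 + (LINT x:?T|lborel. G 2 x) $ 2" by simp
  have sm: "segment_mean p q (F 1) * e $ 1 + segment_mean p q (F 2) * e $ 2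
      = segment_mean p q (\<lambda>x. ((x - a) \<bullet> e) * \<psi> x)" for p q e
  proof -
    have c: "continuous_on {0..1} (\<lambda>t. F j (linepath p q t))" for j
      unfolding F_def by (intro continuous_intros continuous_on_compose2[OF c\<psi>]) auto
    have "segment_mean p q (F 1) * e $ 1 + segment_mean p q (F 2) * e $ 2
      = integral {0..1} (\<lambda>t. F 1 (linepath p q t) * e $ 1 + F 2 (linepath p q t) * e $ 2)"
      unfolding segment_mean_def
      by (subst Henstock_Kurzweil_Integration.integral_add)
        (auto intro!: integrable_continuous_real continuous_intros c)
    also have "\<dots> = integral {0..1} (\<lambda>t. ((linepath p q t - a) \<bullet> e) * \<psi> (linepath p q t))"
      by (rule Henstock_Kurzweil_Integration.integral_cong) (simp add: F_def inner_vec2 algebra_simps)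
    finally show ?thesis unfolding segment_mean_def .
  qed
  have "(LINT x:?T|lborel. G 1 x) $ 1 + (LINT x:?T|lborel. G 2 x) $ 2
     = segment_mean b c (\<lambda>x. ((x - a) \<bullet> rot (c - b)) * \<psi> x)
       + segment_mean c a (\<lambda>x. ((x - a) \<bullet> rot (a - c)) * \<psi> x)
       + segment_mean a b (\<lambda>x. ((x - a) \<bullet> rot (b - a)) * \<psi> x)"
    unfolding gauss sm[symmetric] by (simp add: algebra_simps)
  also have "segment_mean c a (\<lambda>x. ((x - a) \<bullet> rot (a - c)) * \<psi> x) = 0"
    unfolding segment_mean_def
    by (subst Henstock_Kurzweil_Integration.integral_cong[where g="\<lambda>t. 0"])
      (auto simp: inner_vec2 linepath_def algebra_simps)
  also have "segment_mean a b (\<lambda>x. ((x - a) \<bullet> rot (b - a)) * \<psi> x) = 0"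
    unfolding segment_mean_def
    by (subst Henstock_Kurzweil_Integration.integral_cong[where g="\<lambda>t. 0"])
      (auto simp: inner_vec2 linepath_def algebra_simps)
  also have "segment_mean b c (\<lambda>x. ((x - a) \<bullet> rot (c - b)) * \<psi> x) = cross2 (b - a) (c - a) * segment_mean b c \<psi>"
  proof -
    have "(linepath b c t - a) \<bullet> rot (c - b) = cross2 (b - a) (c - a)" for t
      by (simp add: inner_vec2 linepath_def cross2_def algebra_simps)
    then show ?thesis unfolding segment_mean_def by simp
  qed
  finally show ?thesis using L by simp
qed

section \<open>Local functionals of a Crouzeix-Raviart field\<close>

lemma sum3: "(\<Sum>k<(3::nat). f k) = f 0 + f 1 + (f 2 :: 'b::comm_monoid_add)"
  by (simp add: numeral_3_eq_3 numeral_2_eq_2 add.assoc)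

lemma less_3_cases: "(k::nat) < 3 \<Longrightarrow> k = 0 \<or> k = 1 \<or> k = 2" by linarith

text \<open>
  Counterclockwise vertices with indices modulo \<open>3\<close>, so that the side opposite to vertex \<open>k\<close> joins the
  vertices \<open>k + 1\<close> and \<open>k + 2\<close>.
\<close>
definition vertex_labelling :: "(real^2) set \<Rightarrow> (nat \<Rightarrow> real^2) \<Rightarrow> bool" where
  "vertex_labelling T p \<longleftrightarrow> T = convex hull {p 0, p 1, p 2} \<and> cross2 (p 1 - p 0) (p 2 - p 0) > 0 \<and>
     (\<forall>k. p (k + 3) = p k)"

text \<open>
  One fixed labelling for each triangle.
\<close>
definition vtx :: "(real^2) set \<Rightarrow> nat \<Rightarrow> real^2" where
  "vtx T = (SOME p. vertex_labelling T p)"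

definition oriented_triangle :: "(real^2) set \<Rightarrow> bool" where
  "oriented_triangle T \<longleftrightarrow> vertex_labelling T (vtx T)"

definition edge_vec :: "(real^2) set \<Rightarrow> nat \<Rightarrow> real^2" where
  "edge_vec T k = vtx T (k + 2) - vtx T (k + 1)"

definition side :: "(real^2) set \<Rightarrow> nat \<Rightarrow> (real^2) set" where
  "side T k = closed_segment (vtx T (k + 1)) (vtx T (k + 2))"

definition area :: "(real^2) set \<Rightarrow> real" where
  "area T = cross2 (vtx T 1 - vtx T 0) (vtx T 2 - vtx T 0) / 2"

lemma vtx_periodic:
  assumes "oriented_triangle T"
  shows "vtx T 3 = vtx T 0" "vtx T 4 = vtx T 1" "vtx T (Suc (Suc (Suc k))) = vtx T k"
proof -
  have p: "vtx T (k + 3) = vtx T k" for k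
    using assms by (simp add: oriented_triangle_def vertex_labelling_def)
  show "vtx T 3 = vtx T 0" "vtx T 4 = vtx T 1" using p[of 0] p[of 1] by simp_all
  show "vtx T (Suc (Suc (Suc k))) = vtx T k" using p[of k] by (simp add: numeral_3_eq_3)
qed

lemma triangle_eq: "oriented_triangle T \<Longrightarrow> T = convex hull {vtx T 0, vtx T 1, vtx T 2}"
  by (simp add: oriented_triangle_def vertex_labelling_def)

lemma area_pos: "oriented_triangle T \<Longrightarrow> 0 < area T"
  by (simp add: oriented_triangle_def vertex_labelling_def area_def)

lemma edge_vec_simps:
  assumes "oriented_triangle T"
  shows "edge_vec T 0 = vtx T 2 - vtx T 1" "edge_vec T 1 = vtx T 0 - vtx T 2" "edge_vec T 2 = vtx T 1 - vtx T 0"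
  using vtx_periodic(3)[OF assms] by (simp_all add: edge_vec_def numeral_2_eq_2)

lemma side_simps:
  assumes "oriented_triangle T"
  shows "side T 0 = closed_segment (vtx T 1) (vtx T 2)" "side T 1 = closed_segment (vtx T 2) (vtx T 0)"
    "side T 2 = closed_segment (vtx T 0) (vtx T 1)"
  using vtx_periodic(3)[OF assms] by (simp_all add: side_def numeral_2_eq_2)

lemma cross2_edge_vec:
  assumes "oriented_triangle T"
  shows "cross2 (edge_vec T 0) (edge_vec T 1) = 2 * area T" "cross2 (edge_vec T 1) (edge_vec T 2) = 2 * area T"
    "cross2 (edge_vec T 2) (edge_vec T 0) = 2 * area T"
  unfolding edge_vec_simps[OF assms] area_def by (simp_all add: cross2_def algebra_simps)

lemma cross2_le_norm: "\<bar>cross2 u v\<bar> \<le> norm u * norm v"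
proof -
  have "cross2 u v = rot v \<bullet> u" by (simp add: cross2_def inner_vec2 algebra_simps)
  then have "\<bar>cross2 u v\<bar> \<le> norm (rot v) * norm u" by (simp add: Cauchy_Schwarz_ineq2)
  also have "norm (rot v) = norm v" by (simp add: norm_eq_sqrt_inner inner_vec2 add.commute)
  finally show ?thesis by (simp add: mult.commute)
qed

lemma norm_rot [simp]: "norm (rot v) = norm v"
  by (simp add: norm_eq_sqrt_inner inner_vec2 add.commute)

lemma edge_vec_nonzero:
  assumes "oriented_triangle T" "k < 3"
  shows "edge_vec T k \<noteq> 0"
proof
  assume z: "edge_vec T k = 0"
  have "cross2 0 v = 0" "cross2 v 0 = 0" for v by (simp_all add: cross2_def)
  then show False using cross2_edge_vec[OF assms(1)] area_pos[OF assms(1)] less_3_cases[OF assms(2)] z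
    by auto
qed

lemma area_le_edges:
  assumes "oriented_triangle T"
  shows "2 * area T \<le> norm (edge_vec T 0) * norm (edge_vec T 1)" "2 * area T \<le> norm (edge_vec T 1) * norm (edge_vec T 2)"
    "2 * area T \<le> norm (edge_vec T 0) * norm (edge_vec T 2)"
  using cross2_edge_vec[OF assms] cross2_le_norm[of "edge_vec T 0" "edge_vec T 1"]
    cross2_le_norm[of "edge_vec T 1" "edge_vec T 2"] cross2_le_norm[of "edge_vec T 2" "edge_vec T 0"]
  by (auto simp: mult.commute)

text \<open>
  The divergence on \<open>T\<close> of the affine field with the values \<open>m\<close> at the midpoints of the sides.
\<close>
definition elt_div :: "(real^2) set \<Rightarrow> ((real^2) set \<Rightarrow> real^2) \<Rightarrow> real" where
  "elt_div T m = (\<Sum>k<3. m (side T k) \<bullet> rot (edge_vec T k)) / area T"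

text \<open>
  The derivative of that affine field in the direction \<open>e\<close>; the gradient of the basis function of side
  \<open>k\<close> is \<open>rot (edge_vec T k) / area T\<close>.
\<close>
definition elt_grad :: "(real^2) set \<Rightarrow> ((real^2) set \<Rightarrow> real^2) \<Rightarrow> real^2 \<Rightarrow> real^2" where
  "elt_grad T m e = (1 / area T) *\<^sub>R (\<Sum>k<3. (rot (edge_vec T k) \<bullet> e) *\<^sub>R m (side T k))"

text \<open>
  The change of the normal component of the affine field along side \<open>i\<close>. On an interior edge the jump
  is zero at the midpoint, so its size is governed by the slopes of the two neighbours.
\<close>
definition slope :: "(real^2) set \<Rightarrow> nat \<Rightarrow> ((real^2) set \<Rightarrow> real^2) \<Rightarrow> real" where
  "slope T i m = (rot (edge_vec T i) \<bullet> elt_grad T m (edge_vec T i)) / norm (edge_vec T i)"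

text \<open>
  The matrix \<open>M\<close> with \<open>area T * (M : \<nabla>r) = \<Sum>i. \<mu> i * slope T i r\<close> for affine fields \<open>r\<close>. It represents
  the slope terms of the normal equations as a constant tensor. Each summand is a multiple of an outer
  product of orthogonal vectors, so the trace is zero.
\<close>
definition slope_matrix :: "(real^2) set \<Rightarrow> (nat \<Rightarrow> real) \<Rightarrow> 2 \<Rightarrow> 2 \<Rightarrow> real" where
  "slope_matrix T \<mu> j l = (\<Sum>i<3. \<mu> i / (area T * norm (edge_vec T i)) * (rot (edge_vec T i) $ j * edge_vec T i $ l))"

lemma slope_matrix_trace: "slope_matrix T \<mu> 1 1 + slope_matrix T \<mu> 2 2 = 0"
  unfolding slope_matrix_def sum.distrib[symmetric] by (rule sum.neutral) (auto simp: algebra_simps)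

text \<open>
  The determinant of a sum of three rank-one matrices contains only mixed products \<open>\<mu> i * \<mu> j\<close>. Two
  edge vectors span twice the area, so the factor of \<open>\<mu> i * \<mu> j\<close> is \<open>4 / (|e_i| |e_j|)\<close>. Since
  \<open>2 |T| \<le> |e_i| |e_j|\<close>, its product with \<open>|T|\<close> is at most \<open>2\<close>, whatever the angles of \<open>T\<close>.
\<close>
lemma slope_matrix_det:
  assumes T: "oriented_triangle T"
  shows "area T * \<bar>slope_matrix T \<mu> 1 1 * slope_matrix T \<mu> 2 2 - slope_matrix T \<mu> 1 2 * slope_matrix T \<mu> 2 1\<bar>
    \<le> 2 * (\<Sum>i<3. (\<mu> i)\<^sup>2)"
proof -
  define t where "t i = \<mu> i / (area T * norm (edge_vec T i))" for i
  have A: "area T > 0" by (rule area_pos[OF T])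
  have c: "edge_vec T 0 $ 1 * edge_vec T 1 $ 2 - edge_vec T 0 $ 2 * edge_vec T 1 $ 1 = 2 * area T"
    "edge_vec T 1 $ 1 * edge_vec T 2 $ 2 - edge_vec T 1 $ 2 * edge_vec T 2 $ 1 = 2 * area T"
    "edge_vec T 2 $ 1 * edge_vec T 0 $ 2 - edge_vec T 2 $ 2 * edge_vec T 0 $ 1 = 2 * area T"
    using cross2_edge_vec[OF T] by (simp_all add: cross2_def)
  have "slope_matrix T \<mu> 1 1 * slope_matrix T \<mu> 2 2 - slope_matrix T \<mu> 1 2 * slope_matrix T \<mu> 2 1
    = t 0 * t 1 * (edge_vec T 0 $ 1 * edge_vec T 1 $ 2 - edge_vec T 0 $ 2 * edge_vec T 1 $ 1)\<^sup>2
    + t 1 * t 2 * (edge_vec T 1 $ 1 * edge_vec T 2 $ 2 - edge_vec T 1 $ 2 * edge_vec T 2 $ 1)\<^sup>2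
    + t 2 * t 0 * (edge_vec T 2 $ 1 * edge_vec T 0 $ 2 - edge_vec T 2 $ 2 * edge_vec T 0 $ 1)\<^sup>2"
    unfolding slope_matrix_def t_def[symmetric] sum3 rot_nth by algebra
  also have "\<dots> = (t 0 * t 1 + t 1 * t 2 + t 2 * t 0) * (2 * area T)\<^sup>2"
    unfolding c by (simp add: algebra_simps)
  finally have d: "slope_matrix T \<mu> 1 1 * slope_matrix T \<mu> 2 2 - slope_matrix T \<mu> 1 2 * slope_matrix T \<mu> 2 1
     = (t 0 * t 1 + t 1 * t 2 + t 2 * t 0) * (2 * area T)\<^sup>2" .
  have tt: "\<bar>t i * t j\<bar> * (area T * (2 * area T)\<^sup>2) \<le> 2 * \<bar>\<mu> i * \<mu> j\<bar>"
    if "2 * area T \<le> norm (edge_vec T i) * norm (edge_vec T j)" for i j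
  proof -
    have n: "norm (edge_vec T i) * norm (edge_vec T j) > 0" using that A by linarith
    have "\<bar>t i * t j\<bar> = \<bar>\<mu> i * \<mu> j\<bar> / ((area T)\<^sup>2 * (norm (edge_vec T i) * norm (edge_vec T j)))"
      using A by (simp add: t_def abs_mult power2_eq_square field_simps)
    then have "\<bar>t i * t j\<bar> * (area T * (2 * area T)\<^sup>2)
      = (2 * \<bar>\<mu> i * \<mu> j\<bar>) * (2 * area T / (norm (edge_vec T i) * norm (edge_vec T j)))"
      using A n by (simp add: power2_eq_square field_simps)
    also have "\<dots> \<le> (2 * \<bar>\<mu> i * \<mu> j\<bar>) * 1"
      using that n by (intro mult_left_mono) auto
    finally show ?thesis by simp
  qed
  have y: "2 * \<bar>x * y\<bar> \<le> x\<^sup>2 + y\<^sup>2" for x y :: real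
  proof -
    have "0 \<le> (\<bar>x\<bar> - \<bar>y\<bar>)\<^sup>2" by simp
    then show ?thesis by (simp add: power2_diff abs_mult)
  qed
  have "area T * \<bar>slope_matrix T \<mu> 1 1 * slope_matrix T \<mu> 2 2 - slope_matrix T \<mu> 1 2 * slope_matrix T \<mu> 2 1\<bar>
     = \<bar>t 0 * t 1 + t 1 * t 2 + t 2 * t 0\<bar> * (area T * (2 * area T)\<^sup>2)"
    unfolding d abs_mult using A by (simp add: algebra_simps)
  also have "\<dots> \<le> (\<bar>t 0 * t 1\<bar> + \<bar>t 1 * t 2\<bar> + \<bar>t 2 * t 0\<bar>) * (area T * (2 * area T)\<^sup>2)"
    using A by (intro mult_right_mono) (auto intro: order_trans[OF abs_triangle_ineq add_mono] abs_triangle_ineq)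
  also have "\<dots> \<le> 2 * \<bar>\<mu> 0 * \<mu> 1\<bar> + 2 * \<bar>\<mu> 1 * \<mu> 2\<bar> + 2 * \<bar>\<mu> 2 * \<mu> 0\<bar>"
    unfolding distrib_right using area_le_edges[OF T]
    by (intro add_mono tt) (auto simp: mult.commute)
  also have "\<dots> \<le> 2 * (\<Sum>i<3. (\<mu> i)\<^sup>2)"
    using y[of "\<mu> 0" "\<mu> 1"] y[of "\<mu> 1" "\<mu> 2"] y[of "\<mu> 2" "\<mu> 0"] by (simp add: sum3)
  finally show ?thesis .
qed

text \<open>
  The linear function \<open>x \<bullet> rot (edge_vec T i)\<close> takes on \<open>T\<close> its extreme values at the vertices: one on side
  \<open>i\<close>, the other, smaller by twice the area, at the opposite vertex.
\<close>
lemma rot_edge_width: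
  assumes T: "oriented_triangle T" and i: "i < 3" and x: "x \<in> T" and y: "y \<in> T"
  shows "\<bar>(x - y) \<bullet> rot (edge_vec T i)\<bar> \<le> 2 * area T"
proof -
  let ?r = "rot (edge_vec T i)"
  define c where "c = ?r \<bullet> vtx T (if i = 0 then 1 else if i = 1 then 2 else 0)"
  have c: "c - 2 * area T \<le> ?r \<bullet> v \<and> ?r \<bullet> v \<le> c" if v: "v \<in> {vtx T 0, vtx T 1, vtx T 2}" for v
  proof -
    have A: "0 < area T" by (rule area_pos[OF T])
    have "?r \<bullet> v = c \<or> ?r \<bullet> v = c - cross2 (vtx T 1 - vtx T 0) (vtx T 2 - vtx T 0)"
      using v less_3_cases[OF i] unfolding c_def
      by (elim disjE insertE emptyE; simp add: edge_vec_simps[OF T] inner_vec2 cross2_def algebra_simps del: One_nat_def)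
    moreover have "cross2 (vtx T 1 - vtx T 0) (vtx T 2 - vtx T 0) = 2 * area T" by (simp add: area_def)
    ultimately show ?thesis using A by linarith
  qed
  have h: "c - 2 * area T \<le> ?r \<bullet> z \<and> ?r \<bullet> z \<le> c" if "z \<in> T" for z
  proof -
    have "convex ({z. ?r \<bullet> z \<ge> c - 2 * area T} \<inter> {z. ?r \<bullet> z \<le> c})"
      by (intro convex_Int convex_halfspace_ge convex_halfspace_le)
    then have "convex hull {vtx T 0, vtx T 1, vtx T 2} \<subseteq> {z. ?r \<bullet> z \<ge> c - 2 * area T} \<inter> {z. ?r \<bullet> z \<le> c}"
      by (intro hull_minimal) (use c in auto)
    then show ?thesis using that triangle_eq[OF T] by auto
  qed
  show ?thesis using h[OF x] h[OF y] unfolding inner_commute[of _ ?r] inner_diff_right by (simp add: abs_le_iff)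
qed

lemma vtx_in: "oriented_triangle T \<Longrightarrow> k < 3 \<Longrightarrow> vtx T k \<in> T"
  using less_3_cases[of k] by (subst triangle_eq) (auto intro: hull_inc)

text \<open>
  A row of the affine tensor \<open>D\<close>. By \<open>triangle_moment\<close>, integrating it against a gradient gives the
  midpoint term of the normal equations up to a zero-order term.
\<close>
definition moment_field :: "(real^2) set \<Rightarrow> ((real^2) set \<Rightarrow> real^2) \<Rightarrow> 2 \<Rightarrow> real^2 \<Rightarrow> real^2" where
  "moment_field T m j x = (1/6) *\<^sub>R (\<Sum>k<3. m (side T k) $ j *\<^sub>R (x - vtx T k))"

lemma moment_field_rot:
  "(\<chi> j. moment_field T m j x \<bullet> r) = (1/6) *\<^sub>R (\<Sum>k<3. ((x - vtx T k) \<bullet> r) *\<^sub>R m (side T k))"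
  by (simp add: vec_eq_iff moment_field_def sum3 inner_add_left algebra_simps)

text \<open>
  The bilinear part of \<open>det (M + D)\<close>. Large entries of \<open>M\<close>, which contain \<open>1 / |T|\<close>, are paired only with
  \<open>D\<close> applied to the normal of an edge, and those vectors are small by \<open>rot_edge_width\<close>.
\<close>
lemma slope_matrix_moment_field:
  fixes m :: "(real^2) set \<Rightarrow> real^2" and \<mu> :: "nat \<Rightarrow> real"
  assumes T: "oriented_triangle T" and x: "x \<in> T"
  defines "d \<equiv> \<lambda>j l. moment_field T m j x $ l" and "M \<equiv> slope_matrix T \<mu>"
  shows "\<bar>M 1 1 * d 2 2 + M 2 2 * d 1 1 - M 1 2 * d 2 1 - M 2 1 * d 1 2\<bar>
    \<le> (1/3) * (\<Sum>i<3. \<bar>\<mu> i\<bar>) * (\<Sum>k<3. norm (m (side T k)))"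
proof -
  have A: "area T > 0" by (rule area_pos[OF T])
  define t where "t i = \<mu> i / (area T * norm (edge_vec T i))" for i
  define D where "D i = (\<chi> j. moment_field T m j x \<bullet> rot (edge_vec T i))" for i
  have "M 1 1 * d 2 2 + M 2 2 * d 1 1 - M 1 2 * d 2 1 - M 2 1 * d 1 2
     = - (\<Sum>i<3. t i * (edge_vec T i \<bullet> D i))"
    unfolding M_def slope_matrix_def t_def[symmetric] d_def D_def sum3 inner_vec2 rot_nth
    by (simp add: algebra_simps)
  also have "\<bar>\<dots>\<bar> \<le> (\<Sum>i<3. \<bar>t i * (edge_vec T i \<bullet> D i)\<bar>)" by (simp add: sum_abs)
  also have "\<dots> \<le> (\<Sum>i<3. \<bar>\<mu> i\<bar> * ((1/3) * (\<Sum>k<3. norm (m (side T k)))))"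
  proof (rule sum_mono)
    fix i :: nat assume "i \<in> {..<3}"
    then have i: "i < 3" by simp
    have n: "norm (edge_vec T i) > 0" using edge_vec_nonzero[OF T i] by simp
    have "norm (D i) \<le> (1/6) * (\<Sum>k<3. \<bar>(x - vtx T k) \<bullet> rot (edge_vec T i)\<bar> * norm (m (side T k)))"
      unfolding D_def moment_field_rot norm_scaleR by (auto intro!: mult_left_mono order_trans[OF norm_sum])
    also have "\<dots> \<le> (1/6) * (\<Sum>k<3. (2 * area T) * norm (m (side T k)))"
      by (intro mult_left_mono sum_mono mult_right_mono rot_edge_width[OF T i x] vtx_in[OF T]) auto
    finally have D: "norm (D i) \<le> (1/3) * area T * (\<Sum>k<3. norm (m (side T k)))"
      by (simp add: sum_distrib_left)
    have "\<bar>t i * (edge_vec T i \<bullet> D i)\<bar> \<le> \<bar>t i\<bar> * (norm (edge_vec T i) * ((1/3) * area T * (\<Sum>k<3. norm (m (side T k)))))"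
      unfolding abs_mult by (intro mult_left_mono order_trans[OF Cauchy_Schwarz_ineq2] D) auto
    also have "\<dots> = \<bar>\<mu> i\<bar> * ((1/3) * (\<Sum>k<3. norm (m (side T k))))"
      using A n by (simp add: t_def abs_mult field_simps)
    finally show "\<bar>t i * (edge_vec T i \<bullet> D i)\<bar> \<le> \<bar>\<mu> i\<bar> * ((1/3) * (\<Sum>k<3. norm (m (side T k))))" .
  qed
  also have "\<dots> = (1/3) * (\<Sum>i<3. \<bar>\<mu> i\<bar>) * (\<Sum>k<3. norm (m (side T k)))"
    by (simp add: sum3 algebra_simps)
  finally show ?thesis .
qed

text \<open>
  The endpoints are chosen as in the definition of the edge integral.
\<close>
definition edge_mean :: "(real^2) set \<Rightarrow> (real^2 \<Rightarrow> 'b::euclidean_space) \<Rightarrow> 'b" where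
  "edge_mean e f = (let (a, b) = (SOME (a, b). e = closed_segment a b) in segment_mean a b f)"

lemma segment_ends_SOME:
  fixes a b :: "real^2"
  obtains p q where "(SOME (p, q). closed_segment a b = closed_segment p q) = (p, q)"
    "(p = a \<and> q = b) \<or> (p = b \<and> q = a)"
proof -
  obtain p q where pq: "(SOME (p, q). closed_segment a b = closed_segment p q) = (p, q)" by fastforce
  have "case (SOME (p, q). closed_segment a b = closed_segment p q) of (p, q) \<Rightarrow> closed_segment a b = closed_segment p q"
    by (rule someI[of "\<lambda>(p, q). closed_segment a b = closed_segment p q" "(a, b)"]) simp
  then have "closed_segment a b = closed_segment p q" unfolding pq by (simp only: prod.case)
  then have "{a, b} = {p, q}" by (simp add: closed_segment_eq)
  then show ?thesis using that[OF pq] by (auto simp: doubleton_eq_iff)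
qed

lemma edge_mean_segment: "edge_mean (closed_segment a b) f = segment_mean a b f"
  by (rule segment_ends_SOME[of a b]) (auto simp: edge_mean_def segment_mean_commute)

lemma triangle_gauss_elt:
  fixes \<psi> :: "real^2 \<Rightarrow> real"
  assumes T: "oriented_triangle T" and g: "continuous_on UNIV g"
    and \<psi>: "\<And>z. (\<psi> has_derivative (\<lambda>v. g z \<bullet> v)) (at z)"
  shows "(LINT x:T|lborel. g x) = (\<Sum>k<3. edge_mean (side T k) \<psi> *\<^sub>R rot (edge_vec T k))"
proof -
  have D: "cross2 (vtx T 1 - vtx T 0) (vtx T 2 - vtx T 0) > 0" using area_pos[OF T] by (simp add: area_def)
  show ?thesis
    using triangle_gauss[OF D g \<psi>] triangle_eq[OF T, symmetric]
    by (simp add: sum3 side_simps[OF T] edge_vec_simps[OF T] edge_mean_segment del: One_nat_def)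
qed

lemma triangle_moment_elt:
  fixes \<psi> :: "real^2 \<Rightarrow> real"
  assumes T: "oriented_triangle T" and g: "continuous_on UNIV g"
    and \<psi>: "\<And>z. (\<psi> has_derivative (\<lambda>v. g z \<bullet> v)) (at z)" and k: "k < 3"
  shows "(LINT x:T|lborel. (x - vtx T k) \<bullet> g x)
    = 2 * area T * edge_mean (side T k) \<psi> - 2 * (LINT x:T|lborel. \<psi> x)"
proof -
  have D: "cross2 (vtx T 1 - vtx T 0) (vtx T 2 - vtx T 0) > 0"
    "cross2 (vtx T 2 - vtx T 1) (vtx T 0 - vtx T 1) = cross2 (vtx T 1 - vtx T 0) (vtx T 2 - vtx T 0)"
    "cross2 (vtx T 0 - vtx T 2) (vtx T 1 - vtx T 2) = cross2 (vtx T 1 - vtx T 0) (vtx T 2 - vtx T 0)"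
    using area_pos[OF T] by (simp_all add: area_def cross2_def algebra_simps)
  have T': "convex hull {vtx T 0, vtx T 1, vtx T 2} = T" "convex hull {vtx T 1, vtx T 2, vtx T 0} = T"
    "convex hull {vtx T 2, vtx T 0, vtx T 1} = T"
    using triangle_eq[OF T] by (simp_all add: insert_commute)
  have a: "cross2 (vtx T 1 - vtx T 0) (vtx T 2 - vtx T 0) = 2 * area T" by (simp add: area_def)
  show ?thesis
    using less_3_cases[OF k] triangle_moment[OF _ g \<psi>, of "vtx T 1" "vtx T 0" "vtx T 2"]
      triangle_moment[OF _ g \<psi>, of "vtx T 2" "vtx T 1" "vtx T 0"]
      triangle_moment[OF _ g \<psi>, of "vtx T 0" "vtx T 2" "vtx T 1"] D a
    unfolding T'
    by (elim disjE; simp add: side_simps[OF T] edge_mean_segment del: One_nat_def)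
qed

text \<open>
  Row \<open>j\<close> of the tensor \<open>\<lambda> I - M - D\<close> on one element.
\<close>
definition elt_flux :: "(real^2) set \<Rightarrow> real \<Rightarrow> (nat \<Rightarrow> real) \<Rightarrow> ((real^2) set \<Rightarrow> real^2) \<Rightarrow> 2 \<Rightarrow> real^2 \<Rightarrow> real^2" where
  "elt_flux T l \<mu> m j x = l *\<^sub>R axis j 1 - (\<chi> i. slope_matrix T \<mu> j i) - moment_field T m j x"

definition elt_mean :: "(real^2) set \<Rightarrow> ((real^2) set \<Rightarrow> real^2) \<Rightarrow> 2 \<Rightarrow> real" where
  "elt_mean T m j = (\<Sum>k<3. m (side T k) $ j) / 3"

lemma continuous_moment_field: "continuous_on S (moment_field T m j)"
  unfolding moment_field_def by (intro continuous_intros)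

lemma continuous_elt_flux: "continuous_on S (elt_flux T l \<mu> m j)"
  unfolding elt_flux_def by (intro continuous_intros continuous_moment_field)

lemma triangle_integrable_elt:
  fixes f :: "real^2 \<Rightarrow> 'b::euclidean_space"
  assumes T: "oriented_triangle T" and f: "continuous_on UNIV f"
  shows "set_integrable lborel T f"
  using triangle_set_integrable[OF f] triangle_eq[OF T] by metis

text \<open>
  Gauss' theorem turns the constant part of the tensor into the functionals \<open>elt_div\<close> and \<open>slope\<close> of the edge
  means of \<open>\<psi>\<close>, and \<open>triangle_moment\<close> turns \<open>D\<close> into the midpoint term. Summed over the mesh the right-hand side is
  the normal equation plus the zero-order term.
\<close>
lemma elt_flux_weak:
  fixes \<psi> :: "real^2 \<Rightarrow> real" and j :: 2
  assumes T: "oriented_triangle T" and g: "continuous_on UNIV g"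
    and \<psi>: "\<And>z. (\<psi> has_derivative (\<lambda>v. g z \<bullet> v)) (at z)"
  defines "y \<equiv> \<lambda>e. edge_mean e \<psi> *\<^sub>R axis j (1::real)"
  shows "(LINT x:T|lborel. elt_flux T l \<mu> m j x \<bullet> g x)
    = area T * l * elt_div T y - (\<Sum>i<3. \<mu> i * slope T i y)
      - (area T / 3) * (\<Sum>k<3. m (side T k) \<bullet> y (side T k)) + (LINT x:T|lborel. elt_mean T m j * \<psi> x)"
proof -
  have A: "area T > 0" by (rule area_pos[OF T])
  define G where "G = (LINT x:T|lborel. g x)"
  have c\<psi>: "continuous_on UNIV \<psi>"
    using \<psi> by (meson continuous_at_imp_continuous_on has_derivative_continuous)
  note gauss = triangle_gauss_elt[OF T g \<psi>, folded G_def]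
  have ip: "(LINT x:T|lborel. c \<bullet> g x) = c \<bullet> G" for c
    unfolding G_def set_lebesgue_integral_def
    using triangle_integrable_elt[OF T g]
    by (subst integral_inner_right[symmetric]) (auto simp: set_integrable_def)
  have "area T * elt_div T y = (\<Sum>k<3. y (side T k) \<bullet> rot (edge_vec T k))"
    using A by (simp add: elt_div_def)
  also have "\<dots> = G $ j"
    unfolding gauss y_def by (simp add: sum3 inner_axis')
  finally have div: "area T * elt_div T y = G $ j" .
  have gr: "elt_grad T y e = (1 / area T) *\<^sub>R ((G \<bullet> e) *\<^sub>R axis j 1)" for e
    unfolding elt_grad_def gauss y_def by (simp add: sum3 inner_add_left algebra_simps)
  have sl: "slope T i y = (rot (edge_vec T i) $ j * (G \<bullet> edge_vec T i)) / (area T * norm (edge_vec T i))" for i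
    unfolding slope_def gr using A by (simp add: inner_axis field_simps)
  have M: "(\<chi> i. slope_matrix T \<mu> j i) \<bullet> G = (\<Sum>i<3. \<mu> i * slope T i y)"
    unfolding sl slope_matrix_def by (simp add: inner_vec2 sum3 algebra_simps add_divide_distrib)
  have D: "(LINT x:T|lborel. moment_field T m j x \<bullet> g x)
      = (area T / 3) * (\<Sum>k<3. m (side T k) \<bullet> y (side T k)) - (LINT x:T|lborel. elt_mean T m j * \<psi> x)"
  proof -
    have i: "set_integrable lborel T (\<lambda>x. c * ((x - v) \<bullet> g x))" for v and c :: real
      by (rule triangle_integrable_elt[OF T]) (intro continuous_intros g)
    have i2: "set_integrable lborel T (\<lambda>x. c * ((x - v) \<bullet> g x) + c' * ((x - v') \<bullet> g x))" for v v' and c c' :: real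
      by (rule triangle_integrable_elt[OF T]) (intro continuous_intros g)
    have "(LINT x:T|lborel. moment_field T m j x \<bullet> g x)
      = (LINT x:T|lborel. (m (side T 0) $ j / 6 * ((x - vtx T 0) \<bullet> g x) + m (side T 1) $ j / 6 * ((x - vtx T 1) \<bullet> g x))
           + m (side T 2) $ j / 6 * ((x - vtx T 2) \<bullet> g x))"
    proof (rule arg_cong[where f="set_lebesgue_integral lborel T"], rule ext)
      fix x
      show "moment_field T m j x \<bullet> g x = (m (side T 0) $ j / 6 * ((x - vtx T 0) \<bullet> g x) + m (side T 1) $ j / 6 * ((x - vtx T 1) \<bullet> g x))
           + m (side T 2) $ j / 6 * ((x - vtx T 2) \<bullet> g x)"
        unfolding moment_field_def sum3 inner_scaleR_left inner_add_left by (simp add: field_simps)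
    qed
    also have "\<dots> = m (side T 0) $ j / 6 * (LINT x:T|lborel. (x - vtx T 0) \<bullet> g x)
        + m (side T 1) $ j / 6 * (LINT x:T|lborel. (x - vtx T 1) \<bullet> g x)
        + m (side T 2) $ j / 6 * (LINT x:T|lborel. (x - vtx T 2) \<bullet> g x)"
      by (simp only: set_integral_add(2)[OF i2 i] set_integral_add(2)[OF i i] set_integral_mult_right)
    also have "\<dots> = (area T / 3) * (\<Sum>k<3. m (side T k) \<bullet> y (side T k)) - elt_mean T m j * (LINT x:T|lborel. \<psi> x)"
    proof -
      have k: "(0::nat) < 3" "(1::nat) < 3" "(2::nat) < 3" by simp_all
      show ?thesis
        unfolding triangle_moment_elt[OF T g \<psi> k(1)] triangle_moment_elt[OF T g \<psi> k(2)] triangle_moment_elt[OF T g \<psi> k(3)]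
        by (simp add: sum3 y_def inner_axis elt_mean_def field_simps del: One_nat_def)
    qed
    also have "elt_mean T m j * (LINT x:T|lborel. \<psi> x) = (LINT x:T|lborel. elt_mean T m j * \<psi> x)"
      by (simp only: set_integral_mult_right)
    finally show ?thesis .
  qed
  have "(LINT x:T|lborel. elt_flux T l \<mu> m j x \<bullet> g x)
    = (LINT x:T|lborel. (l *\<^sub>R axis j 1 - (\<chi> i. slope_matrix T \<mu> j i)) \<bullet> g x - moment_field T m j x \<bullet> g x)"
    unfolding elt_flux_def inner_diff_left by simp
  also have "\<dots> = (LINT x:T|lborel. (l *\<^sub>R axis j 1 - (\<chi> i. slope_matrix T \<mu> j i)) \<bullet> g x)
      - (LINT x:T|lborel. moment_field T m j x \<bullet> g x)"
    by (rule set_integral_diff(2))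
      (rule triangle_integrable_elt[OF T], intro continuous_intros g continuous_moment_field)+
  also have "(LINT x:T|lborel. (l *\<^sub>R axis j 1 - (\<chi> i. slope_matrix T \<mu> j i)) \<bullet> g x)
      = l * G $ j - (\<Sum>i<3. \<mu> i * slope T i y)"
    unfolding ip unfolding inner_diff_left M by (simp add: inner_axis')
  finally show ?thesis unfolding D using div by (simp add: algebra_simps)
qed

section \<open>The residual of the projection\<close>

definition triangle_mesh :: "(real^2) set set \<Rightarrow> bool" where
  "triangle_mesh \<T> \<longleftrightarrow> finite \<T> \<and> (\<forall>T\<in>\<T>. oriented_triangle T) \<and>
     (\<forall>T\<in>\<T>. \<forall>T'\<in>\<T>. T \<noteq> T' \<longrightarrow> interior T \<inter> interior T' = {})"

lemma triangle_facts:
  assumes T: "oriented_triangle T"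
  shows "compact T" "convex T" "closed T" "T \<in> sets borel" "frontier T \<in> null_sets lborel"
proof -
  show c: "compact T"
    by (subst triangle_eq[OF T]) (simp add: finite_imp_compact_convex_hull)
  show cv: "convex T" by (subst triangle_eq[OF T]) (rule convex_convex_hull)
  show cl: "closed T" using c by (rule compact_imp_closed)
  show "T \<in> sets borel" using cl by (rule borel_closed)
  have "frontier T \<in> null_sets lebesgue"
    using negligible_convex_frontier[OF cv] by (simp add: negligible_iff_null_sets)
  then show "frontier T \<in> null_sets lborel"
    by (simp add: null_sets_completion_iff)
qed

lemma triangle_measure:
  assumes T: "oriented_triangle T"
  shows "measure lborel T = area T" "emeasure lborel T < \<infinity>"
proof -
  show "measure lborel T = area T"
    using content_triangle[of "vtx T 0" "vtx T 1" "vtx T 2"] triangle_eq[OF T] area_pos[OF T]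
    by (simp add: area_def cross2_def abs_minus_commute algebra_simps)
  show "emeasure lborel T < \<infinity>"
    by (rule emeasure_bounded_finite[OF compact_imp_bounded[OF triangle_facts(1)[OF T]]])
qed

lemma interior_integral:
  fixes f :: "real^2 \<Rightarrow> 'b::euclidean_space"
  assumes T: "oriented_triangle T" and f: "set_integrable lborel T f"
  shows "set_integrable lborel (interior T) f" "(LINT z:interior T|lborel. f z) = (LINT z:T|lborel. f z)"
proof -
  show i: "set_integrable lborel (interior T) f"
    by (rule set_integrable_subset[OF f]) (use interior_subset in auto)
  have ae: "AE z in lborel. z \<notin> frontier T" by (rule AE_not_in[OF triangle_facts(5)[OF T]])
  show "(LINT z:interior T|lborel. f z) = (LINT z:T|lborel. f z)"
    unfolding set_lebesgue_integral_def
  proof (rule integral_cong_AE)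
    show "AE z in lborel. indicat_real (interior T) z *\<^sub>R f z = indicat_real T z *\<^sub>R f z"
      using ae by eventually_elim (use interior_subset closure_subset in \<open>auto simp: frontier_def indicator_def\<close>)
  qed (use i f in \<open>auto simp: set_integrable_def dest: borel_measurable_integrable\<close>)
qed

text \<open>
  Zero on the skeleton of the mesh and outside of it.
\<close>
definition glue :: "(real^2) set set \<Rightarrow> ((real^2) set \<Rightarrow> real^2 \<Rightarrow> 'b::real_vector) \<Rightarrow> real^2 \<Rightarrow> 'b" where
  "glue \<T> F z = (\<Sum>T\<in>\<T>. indicat_real (interior T) z *\<^sub>R F T z)"

lemma glue_interior:
  assumes m: "triangle_mesh \<T>" and T: "T \<in> \<T>" and z: "z \<in> interior T"
  shows "glue \<T> F z = F T z"
proof -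
  have fin: "finite \<T>" using m by (simp add: triangle_mesh_def)
  have "indicat_real (interior T') z *\<^sub>R F T' z = (if T' = T then F T z else 0)" if "T' \<in> \<T>" for T'
    using m T z that by (auto simp: triangle_mesh_def indicator_def)
  then have "glue \<T> F z = (\<Sum>T'\<in>\<T>. if T' = T then F T z else 0)"
    unfolding glue_def by (rule sum.cong[OF refl])
  also have "\<dots> = F T z" using fin T by simp
  finally show ?thesis .
qed

lemma glue_outside: "(\<And>T. T \<in> \<T> \<Longrightarrow> z \<notin> interior T) \<Longrightarrow> glue \<T> F z = 0"
  unfolding glue_def by (rule sum.neutral) auto

lemma glue_cases:
  assumes "triangle_mesh \<T>"
  obtains T where "T \<in> \<T>" "z \<in> interior T" "\<And>F :: (real^2) set \<Rightarrow> real^2 \<Rightarrow> 'b::real_vector. glue \<T> F z = F T z"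
  | "\<And>T. T \<in> \<T> \<Longrightarrow> z \<notin> interior T" "\<And>F :: (real^2) set \<Rightarrow> real^2 \<Rightarrow> 'b. glue \<T> F z = 0"
  using glue_interior[OF assms] glue_outside by metis

lemma glue_measurable:
  fixes F :: "(real^2) set \<Rightarrow> real^2 \<Rightarrow> 'b::euclidean_space"
  assumes "\<And>T. T \<in> \<T> \<Longrightarrow> continuous_on UNIV (F T)"
  shows "glue \<T> F \<in> borel_measurable borel"
proof -
  have "(\<lambda>z. indicat_real (interior T) z *\<^sub>R F T z) \<in> borel_measurable borel" if "T \<in> \<T>" for T
    using borel_measurable_continuous_onI[OF assms[OF that]]
    by (intro borel_measurable_scaleR borel_measurable_indicator) auto
  then have "(\<lambda>z. \<Sum>T\<in>\<T>. indicat_real (interior T) z *\<^sub>R F T z) \<in> borel_measurable borel"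
    by (rule borel_measurable_sum)
  then show ?thesis by (simp add: glue_def[abs_def])
qed

lemma glue_isCont:
  fixes F :: "(real^2) set \<Rightarrow> real^2 \<Rightarrow> 'b::euclidean_space"
  assumes "\<And>T. T \<in> \<T> \<Longrightarrow> continuous_on UNIV (F T)" and z: "\<And>T. T \<in> \<T> \<Longrightarrow> z \<notin> frontier T"
  shows "isCont (glue \<T> F) z"
proof -
  have "isCont (\<lambda>z. indicat_real (interior T) z *\<^sub>R F T z) z" if T: "T \<in> \<T>" for T
  proof -
    have c: "isCont (F T) z" using assms(1)[OF T] by (simp add: continuous_on_eq_continuous_at)
    show ?thesis
    proof (cases "z \<in> interior T")
      case True
      have "eventually (\<lambda>x. x \<in> interior T) (nhds z)"
        using True by (simp add: eventually_nhds_in_open)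
      then have "eventually (\<lambda>x. indicat_real (interior T) x *\<^sub>R F T x = F T x) (nhds z)"
        by eventually_elim simp
      then show ?thesis using c by (simp add: isCont_cong)
    next
      case False
      then have "z \<in> - closure T" using z[OF T] by (auto simp: frontier_def)
      then have "eventually (\<lambda>x. x \<in> - closure T) (nhds z)"
        by (intro eventually_nhds_in_open) auto
      then have "eventually (\<lambda>x. indicat_real (interior T) x *\<^sub>R F T x = 0) (nhds z)"
        by eventually_elim (use interior_subset closure_subset in \<open>auto simp: indicator_def\<close>)
      from isCont_cong[OF this] show ?thesis by simp
    qed
  qed
  then show ?thesis unfolding glue_def[abs_def] by (rule continuous_sum)
qed

lemma glue_integral:
  fixes F :: "(real^2) set \<Rightarrow> real^2 \<Rightarrow> 'b::euclidean_space"
  assumes m: "triangle_mesh \<T>" and F: "\<And>T. T \<in> \<T> \<Longrightarrow> continuous_on UNIV (F T)"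
  shows "integrable lborel (glue \<T> F)" "(LINT z|lborel. glue \<T> F z) = (\<Sum>T\<in>\<T>. LINT z:T|lborel. F T z)"
proof -
  have i: "set_integrable lborel T (F T)" if "T \<in> \<T>" for T
    using m that by (intro triangle_integrable_elt F) (auto simp: triangle_mesh_def)
  have o: "oriented_triangle T" if "T \<in> \<T>" for T using m that by (auto simp: triangle_mesh_def)
  have i2: "integrable lborel (\<lambda>z. indicat_real (interior T) z *\<^sub>R F T z)" if "T \<in> \<T>" for T
    using interior_integral(1)[OF o i, OF that that] by (simp add: set_integrable_def)
  show "integrable lborel (glue \<T> F)"
    unfolding glue_def[abs_def] by (rule Bochner_Integration.integrable_sum[OF i2])
  have "(LINT z|lborel. glue \<T> F z) = (\<Sum>T\<in>\<T>. LINT z|lborel. indicat_real (interior T) z *\<^sub>R F T z)"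
    unfolding glue_def by (rule Bochner_Integration.integral_sum[OF i2])
  also have "\<dots> = (\<Sum>T\<in>\<T>. LINT z:T|lborel. F T z)"
    by (rule sum.cong[OF refl])
      (use interior_integral(2)[OF o i] in \<open>simp add: set_lebesgue_integral_def\<close>)
  finally show "(LINT z|lborel. glue \<T> F z) = (\<Sum>T\<in>\<T>. LINT z:T|lborel. F T z)" .
qed

lemma glue_bounded:
  fixes F :: "(real^2) set \<Rightarrow> real^2 \<Rightarrow> 'b::euclidean_space"
  assumes m: "triangle_mesh \<T>" and F: "\<And>T. T \<in> \<T> \<Longrightarrow> continuous_on UNIV (F T)"
  shows "\<exists>M. \<forall>z. norm (glue \<T> F z) \<le> M"
proof -
  have fin: "finite \<T>" using m by (simp add: triangle_mesh_def)
  have "\<exists>B. \<forall>z\<in>T. norm (F T z) \<le> B" if "T \<in> \<T>" for T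
  proof -
    have "compact T" using m that triangle_facts(1) by (auto simp: triangle_mesh_def)
    then have "compact (F T ` T)" by (rule compact_continuous_image[rotated]) (rule continuous_on_subset[OF F[OF that]], simp)
    then have "bounded (F T ` T)" by (rule compact_imp_bounded)
    then show ?thesis unfolding bounded_iff by blast
  qed
  then obtain B where B: "\<And>T z. T \<in> \<T> \<Longrightarrow> z \<in> T \<Longrightarrow> norm (F T z) \<le> B T" by metis
  define M where "M = (\<Sum>T\<in>\<T>. \<bar>B T\<bar>)"
  have "norm (glue \<T> F z) \<le> M" for z
  proof (rule glue_cases[OF m, of z])
    fix T assume T: "T \<in> \<T>" "z \<in> interior T" "\<And>F :: (real^2) set \<Rightarrow> real^2 \<Rightarrow> 'b. glue \<T> F z = F T z"
    have "norm (glue \<T> F z) \<le> B T" unfolding T(3) using B[OF T(1)] T(2) interior_subset by blast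
    also have "\<dots> \<le> \<bar>B T\<bar>" by simp
    also have "\<dots> \<le> M" unfolding M_def by (rule member_le_sum) (use T fin in auto)
    finally show ?thesis .
  next
    assume "\<And>F :: (real^2) set \<Rightarrow> real^2 \<Rightarrow> 'b. glue \<T> F z = 0"
    then show ?thesis by (simp add: M_def sum_nonneg)
  qed
  then show ?thesis by blast
qed

text \<open>
  The pointwise algebra for \<open>P = l I - M - D\<close> with \<open>tr M = 0\<close>: \<open>det P\<close> is \<open>l\<^sup>2 - l tr D + det M + M:cof D +
  det D\<close> and \<open>tr P = 2 l - tr D\<close>. The term \<open>(tr P)\<^sup>2\<close> costs \<open>64 L\<^sup>2 l\<^sup>2\<close> and \<open>l tr D\<close> costs another \<open>l\<^sup>2\<close>.
\<close>
lemma elt_determinant_estimate: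
  fixes l K W L dl :: real
  assumes tr: "m11 + m22 = 0" and w: "K \<le> w" "w \<le> W" "0 \<le> K"
    and c: "\<bar>m11 * d22 + m22 * d11 - m12 * d21 - m21 * d12\<bar> \<le> cb"
    and d: "\<bar>d11\<bar> \<le> dl" "\<bar>d12\<bar> \<le> dl" "\<bar>d21\<bar> \<le> dl" "\<bar>d22\<bar> \<le> dl"
  shows "(2 * K - 64 * L\<^sup>2 - 1) * l\<^sup>2 \<le>
     2 * (w * ((l - m11 - d11) * (l - m22 - d22) - (- m12 - d12) * (- m21 - d21)))
       - 8 * L\<^sup>2 * ((l - m11 - d11) + (l - m22 - d22))\<^sup>2
     + (2 * W * \<bar>m11 * m22 - m12 * m21\<bar> + 2 * W * cb + (4 * W\<^sup>2 + 4 * W + 64 * L\<^sup>2) * dl\<^sup>2)"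
proof -
  define t where "t = d11 + d22"
  define dM where "dM = m11 * m22 - m12 * m21"
  define cc where "cc = m11 * d22 + m22 * d11 - m12 * d21 - m21 * d12"
  define dD where "dD = d11 * d22 - d12 * d21"
  have W0: "0 \<le> W" "0 \<le> w" using w by linarith+
  have dl0: "0 \<le> dl" using d(1) by linarith
  have det: "(l - m11 - d11) * (l - m22 - d22) - (- m12 - d12) * (- m21 - d21) = l\<^sup>2 - l * t + dM + cc + dD"
    using tr unfolding t_def dM_def cc_def dD_def by algebra
  have trP: "(l - m11 - d11) + (l - m22 - d22) = 2 * l - t" using tr by (simp add: t_def)
  have t: "\<bar>t\<bar> \<le> 2 * dl" using d unfolding t_def by linarith
  have t2: "t\<^sup>2 \<le> 4 * dl\<^sup>2"
    using abs_le_square_iff[of t "2 * dl"] t dl0 by (simp add: power_mult_distrib)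
  have pr: "\<bar>a * b\<bar> \<le> dl\<^sup>2" if "\<bar>a\<bar> \<le> dl" "\<bar>b\<bar> \<le> dl" for a b
    unfolding abs_mult power2_eq_square using that dl0 by (intro mult_mono) auto
  have dD: "\<bar>dD\<bar> \<le> 2 * dl\<^sup>2" unfolding dD_def using pr[OF d(1) d(4)] pr[OF d(2) d(3)] by linarith
  have e1: "2 * w * (l * t) \<le> l\<^sup>2 + W\<^sup>2 * (4 * dl\<^sup>2)"
  proof -
    have "0 \<le> (l - w * t)\<^sup>2" by simp
    then have "2 * w * (l * t) \<le> l\<^sup>2 + w\<^sup>2 * t\<^sup>2" by (simp add: power2_eq_square algebra_simps)
    also have "w\<^sup>2 * t\<^sup>2 \<le> W\<^sup>2 * (4 * dl\<^sup>2)" using w W0 t2 by (intro mult_mono power_mono) auto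
    finally show ?thesis by simp
  qed
  have e2: "- (2 * w * dM) \<le> 2 * W * \<bar>dM\<bar>"
  proof -
    have "- (2 * w * dM) \<le> \<bar>2 * w * dM\<bar>" by simp
    also have "\<dots> = 2 * w * \<bar>dM\<bar>" using W0 by (simp add: abs_mult)
    also have "\<dots> \<le> 2 * W * \<bar>dM\<bar>" using w by (intro mult_right_mono) auto
    finally show ?thesis .
  qed
  have e3: "- (2 * w * cc) \<le> 2 * W * cb"
  proof -
    have "- (2 * w * cc) \<le> \<bar>2 * w * cc\<bar>" by simp
    also have "\<dots> = 2 * w * \<bar>cc\<bar>" using W0 by (simp add: abs_mult)
    also have "\<dots> \<le> 2 * W * cb" using w W0 c unfolding cc_def by (intro mult_mono) auto
    finally show ?thesis .
  qed
  have e4: "- (2 * w * dD) \<le> 4 * W * dl\<^sup>2"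
  proof -
    have "- (2 * w * dD) \<le> \<bar>2 * w * dD\<bar>" by simp
    also have "\<dots> = 2 * w * \<bar>dD\<bar>" using W0 by (simp add: abs_mult)
    also have "\<dots> \<le> 2 * W * (2 * dl\<^sup>2)" using w W0 dD by (intro mult_mono) auto
    finally show ?thesis by simp
  qed
  have e5: "8 * L\<^sup>2 * (2 * l - t)\<^sup>2 \<le> 64 * L\<^sup>2 * l\<^sup>2 + 64 * L\<^sup>2 * dl\<^sup>2"
  proof -
    have "0 \<le> (2 * l + t)\<^sup>2" by simp
    then have "(2 * l - t)\<^sup>2 \<le> 8 * l\<^sup>2 + 2 * t\<^sup>2" by (simp add: power2_eq_square algebra_simps)
    also have "\<dots> \<le> 8 * l\<^sup>2 + 8 * dl\<^sup>2" using t2 by simp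
    finally have "8 * L\<^sup>2 * (2 * l - t)\<^sup>2 \<le> 8 * L\<^sup>2 * (8 * l\<^sup>2 + 8 * dl\<^sup>2)" by (intro mult_left_mono) auto
    then show ?thesis by (simp add: algebra_simps)
  qed
  have e6: "2 * K * l\<^sup>2 \<le> 2 * w * l\<^sup>2" using w by (intro mult_right_mono) auto
  have "2 * (w * (l\<^sup>2 - l * t + dM + cc + dD)) = 2 * w * l\<^sup>2 - 2 * w * (l * t) + 2 * w * dM + 2 * w * cc + 2 * w * dD"
    by (simp add: algebra_simps)
  moreover have "(2 * K - 64 * L\<^sup>2 - 1) * l\<^sup>2 = 2 * K * l\<^sup>2 - 64 * L\<^sup>2 * l\<^sup>2 - l\<^sup>2" by (simp add: algebra_simps)
  moreover have "(4 * W\<^sup>2 + 4 * W + 64 * L\<^sup>2) * dl\<^sup>2 = W\<^sup>2 * (4 * dl\<^sup>2) + 4 * W * dl\<^sup>2 + 64 * L\<^sup>2 * dl\<^sup>2" by (simp add: algebra_simps)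
  ultimately show ?thesis unfolding det trP dM_def[symmetric] using e1 e2 e3 e4 e5 e6 by linarith
qed

text \<open>
  The choice of \<open>K\<close> makes the factor \<open>2 K - 64 L\<^sup>2 - 1\<close> of \<open>elt_determinant_estimate\<close> equal to \<open>1\<close>.
\<close>
definition residual_const :: "real \<Rightarrow> real" where
  "residual_const L = (let K = 32 * L\<^sup>2 + 1; W = K + L\<^sup>2 in
     4 * W + 4 * W * L\<^sup>2 + 3 * W + (4 * W\<^sup>2 + 4 * W + 64 * L\<^sup>2) * L\<^sup>2 + plane_const L W)"

definition energy :: "(real^2) set set \<Rightarrow> ((real^2) set \<Rightarrow> real^2) \<Rightarrow> real" where
  "energy \<T> m = (\<Sum>T\<in>\<T>. (\<Sum>i<3. (slope T i m)\<^sup>2) + area T / 3 * (\<Sum>k<3. (norm (m (side T k)))\<^sup>2))"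

lemma square_sum3_le: "(\<Sum>i<3. f i)\<^sup>2 \<le> 3 * (\<Sum>i<(3::nat). (f i)\<^sup>2)" for f :: "nat \<Rightarrow> real"
proof -
  have "0 \<le> (f 0 - f 1)\<^sup>2 + (f 1 - f 2)\<^sup>2 + (f 2 - f 0)\<^sup>2" by simp
  then show ?thesis unfolding sum3 by (simp add: power2_eq_square algebra_simps)
qed

text \<open>
  The assumption \<open>star\<close> is the normal equation. With \<open>y\<close> the edge means of \<open>\<psi>\<close> times a unit vector it says that
  the rows of the glued tensor have the weak divergence \<open>- q\<close>, where \<open>q\<close> consists of means of midpoint
  values. The weighted determinant inequality for this tensor and the pointwise algebra on each element
  give the claim.
\<close>
lemma projection_residual_bound:
  assumes m: "triangle_mesh \<T>" and L: "1 \<le> L"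
    and box: "\<And>T z. T \<in> \<T> \<Longrightarrow> z \<in> T \<Longrightarrow> \<bar>z $ 1\<bar> \<le> L - 1 \<and> \<bar>z $ 2\<bar> \<le> L - 1"
    and star: "\<And>y. (\<Sum>T\<in>\<T>. area T * l T * elt_div T y - (\<Sum>i<3. slope T i m * slope T i y))
      = (\<Sum>T\<in>\<T>. area T / 3 * (\<Sum>k<3. m (side T k) \<bullet> y (side T k)))"
  shows "(\<Sum>T\<in>\<T>. area T * (l T)\<^sup>2) \<le> residual_const L * energy \<T> m"
proof -
  define K where "K = 32 * L\<^sup>2 + 1"
  define W where "W = K + L\<^sup>2"
  have fin: "finite \<T>" and or: "\<And>T. T \<in> \<T> \<Longrightarrow> oriented_triangle T" using m by (auto simp: triangle_mesh_def)
  have K0: "0 \<le> K" and W0: "0 \<le> W" by (auto simp: K_def W_def)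
  define \<mu> where "\<mu> T i = slope T i m" for T i
  define F where "F j T = elt_flux T (l T) (\<mu> T) m j" for j T
  define Q where "Q j T = (\<lambda>z::real^2. elt_mean T m j)" for j T
  define P where "P j = glue \<T> (F j)" for j
  define q where "q j = glue \<T> (Q j)" for j
  have cF: "continuous_on UNIV (F j T)" for j T unfolding F_def by (rule continuous_elt_flux)
  have cQ: "continuous_on UNIV (Q j T)" for j T unfolding Q_def by (rule continuous_on_const)
  \<comment> \<open>The edge means of \<open>\<psi>\<close> depend only on the edge, so they form an admissible test field \<open>y\<close>: here the sums over
     the elements combine to the normal equation.\<close>
  have weak: "weak_divergence (P j) (\<lambda>z. - q j z)" for j
    unfolding weak_divergence_def
  proof (intro allI impI)
    fix \<psi> :: "real^2 \<Rightarrow> real" and g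
    assume d\<psi>: "\<forall>z. (\<psi> has_derivative (\<lambda>v. g z \<bullet> v)) (at z)" and g: "continuous_on UNIV g"
    then have \<psi>: "\<And>z. (\<psi> has_derivative (\<lambda>v. g z \<bullet> v)) (at z)" by blast
    have c\<psi>: "continuous_on UNIV \<psi>"
      using \<psi> by (meson continuous_at_imp_continuous_on has_derivative_continuous)
    define y where "y e = edge_mean e \<psi> *\<^sub>R axis j (1::real)" for e
    have "(LINT z|lborel. P j z \<bullet> g z) = (LINT z|lborel. glue \<T> (\<lambda>T z. F j T z \<bullet> g z) z)"
      by (simp add: P_def glue_def inner_sum_left)
    also have "\<dots> = (\<Sum>T\<in>\<T>. LINT z:T|lborel. F j T z \<bullet> g z)"
      by (rule glue_integral(2)[OF m]) (intro continuous_intros cF g)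
    also have "\<dots> = (\<Sum>T\<in>\<T>. (area T * l T * elt_div T y - (\<Sum>i<3. slope T i m * slope T i y))
        - area T / 3 * (\<Sum>k<3. m (side T k) \<bullet> y (side T k)) + (LINT x:T|lborel. Q j T x * \<psi> x))"
      unfolding F_def Q_def \<mu>_def y_def[abs_def]
      by (rule sum.cong[OF refl], rule elt_flux_weak[OF or g \<psi>])
    also have "\<dots> = (\<Sum>T\<in>\<T>. LINT x:T|lborel. Q j T x * \<psi> x)"
      using star[of y] by (simp add: sum.distrib sum_subtractf)
    also have "\<dots> = (LINT z|lborel. glue \<T> (\<lambda>T z. Q j T z * \<psi> z) z)"
      by (rule glue_integral(2)[OF m, symmetric]) (intro continuous_intros cQ c\<psi>)
    also have "\<dots> = (LINT z|lborel. q j z * \<psi> z)"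
      by (simp add: q_def glue_def sum_distrib_right mult.assoc)
    finally show "(LINT z|lborel. P j z \<bullet> g z) = - (LINT z|lborel. - q j z * \<psi> z)" by simp
  qed
  have "\<exists>B. \<forall>z. norm (P 1 z) \<le> B" unfolding P_def by (rule glue_bounded[OF m cF])
  then obtain M1 where M1: "\<And>z. norm (P 1 z) \<le> M1" by blast
  have "\<exists>B. \<forall>z. norm (P 2 z) \<le> B" unfolding P_def by (rule glue_bounded[OF m cF])
  then obtain M2 where M2: "\<And>z. norm (P 2 z) \<le> M2" by blast
  have "\<exists>B. \<forall>z. norm (q 1 z) \<le> B" unfolding q_def by (rule glue_bounded[OF m cQ])
  then obtain M3 where M3: "\<And>z. norm (q 1 z) \<le> M3" by blast
  have "\<exists>B. \<forall>z. norm (q 2 z) \<le> B" unfolding q_def by (rule glue_bounded[OF m cQ])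
  then obtain M4 where M4: "\<And>z. norm (q 2 z) \<le> M4" by blast
  define M where "M = \<bar>M1\<bar> + \<bar>M2\<bar> + \<bar>M3\<bar> + \<bar>M4\<bar>"
  have outsideP: "P j z = 0" and outsideq: "q j z = 0" if "\<not> (\<bar>z $ 1\<bar> \<le> L - 1 \<and> \<bar>z $ 2\<bar> \<le> L - 1)" for j z
    unfolding P_def q_def
    by (rule glue_outside; use box interior_subset that in blast)+
  have ae: "AE z in lborel. \<forall>T\<in>\<T>. z \<notin> frontier T"
    using fin triangle_facts(5)[OF or] by (simp add: AE_finite_all AE_not_in)
  have PE: "2 * (LINT z|lborel. (K + ((z $ 1)\<^sup>2 + (z $ 2)\<^sup>2) / 2) * (P 1 z $ 1 * P 2 z $ 2 - P 1 z $ 2 * P 2 z $ 1))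
     \<le> 8 * L\<^sup>2 * (LINT z|lborel. (P 1 z $ 1 + P 2 z $ 2)\<^sup>2)
       + plane_const L (K + L\<^sup>2) * (LINT z|lborel. (q 1 z)\<^sup>2 + (q 2 z)\<^sup>2)"
  proof (rule plane_estimate[OF weak weak])
    show "(\<lambda>z. P 1 z $ j) \<in> borel_measurable borel" "(\<lambda>z. P 2 z $ j) \<in> borel_measurable borel" for j
    proof -
      have "(\<lambda>z. P i z \<bullet> axis j 1) \<in> borel_measurable borel" for i
        unfolding P_def by (intro borel_measurable_inner glue_measurable cF borel_measurable_const)
      then show "(\<lambda>z. P 1 z $ j) \<in> borel_measurable borel" "(\<lambda>z. P 2 z $ j) \<in> borel_measurable borel"
        by (simp_all add: inner_axis)
    qed
    show "q 1 \<in> borel_measurable borel" "q 2 \<in> borel_measurable borel"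
      unfolding q_def by (rule glue_measurable[OF cQ])+
    show "\<bar>P 1 z $ j\<bar> \<le> M" "\<bar>P 2 z $ j\<bar> \<le> M" for z j
      using component_le_norm_cart[of "P 1 z" j] component_le_norm_cart[of "P 2 z" j] M1[of z] M2[of z]
      unfolding M_def by linarith+
    show "\<bar>q 1 z\<bar> \<le> M" "\<bar>q 2 z\<bar> \<le> M" for z
      using M3[of z] M4[of z] unfolding M_def real_norm_def by linarith+
    show "AE z in lborel. isCont (P 1) z \<and> isCont (P 2) z \<and> isCont (q 1) z \<and> isCont (q 2) z"
      using ae by eventually_elim (auto simp: P_def q_def intro!: glue_isCont cF cQ)
    show "\<bar>z $ 1\<bar> \<le> L - 1 \<and> \<bar>z $ 2\<bar> \<le> L - 1" if "P 1 z \<noteq> 0 \<or> P 2 z \<noteq> 0 \<or> q 1 z \<noteq> 0 \<or> q 2 z \<noteq> 0" for z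
      using that outsideP[of z] outsideq[of z] by blast
  qed (use L K0 in auto)
  define det where "det T z = (K + ((z $ 1)\<^sup>2 + (z $ 2)\<^sup>2) / 2) * (F 1 T z $ 1 * F 2 T z $ 2 - F 1 T z $ 2 * F 2 T z $ 1)" for T z
  define tr where "tr T z = (F 1 T z $ 1 + F 2 T z $ 2)\<^sup>2" for T z
  define qq where "qq T = (\<lambda>z::real^2. (elt_mean T m 1)\<^sup>2 + (elt_mean T m 2)\<^sup>2)" for T
  have cdet: "continuous_on UNIV (det T)" for T
    unfolding det_def by (intro continuous_intros cF) auto
  have ctr: "continuous_on UNIV (tr T)" for T unfolding tr_def by (intro continuous_intros cF)
  have cqq: "continuous_on UNIV (qq T)" for T unfolding qq_def by (rule continuous_on_const)
  have gl: "(K + ((z $ 1)\<^sup>2 + (z $ 2)\<^sup>2) / 2) * (P 1 z $ 1 * P 2 z $ 2 - P 1 z $ 2 * P 2 z $ 1) = glue \<T> det z"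
    "(P 1 z $ 1 + P 2 z $ 2)\<^sup>2 = glue \<T> tr z" "(q 1 z)\<^sup>2 + (q 2 z)\<^sup>2 = glue \<T> qq z" for z
  proof -
    consider T where "T \<in> \<T>" "z \<in> interior T" | "\<And>T. T \<in> \<T> \<Longrightarrow> z \<notin> interior T" by blast
    then have "(K + ((z $ 1)\<^sup>2 + (z $ 2)\<^sup>2) / 2) * (P 1 z $ 1 * P 2 z $ 2 - P 1 z $ 2 * P 2 z $ 1) = glue \<T> det z \<and>
      (P 1 z $ 1 + P 2 z $ 2)\<^sup>2 = glue \<T> tr z \<and> (q 1 z)\<^sup>2 + (q 2 z)\<^sup>2 = glue \<T> qq z"
    proof cases
      case 1
      then show ?thesis
        unfolding P_def q_def glue_interior[OF m 1] det_def tr_def qq_def Q_def by simp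
    next
      case 2
      then show ?thesis unfolding P_def q_def by (simp add: glue_outside)
    qed
    then show "(K + ((z $ 1)\<^sup>2 + (z $ 2)\<^sup>2) / 2) * (P 1 z $ 1 * P 2 z $ 2 - P 1 z $ 2 * P 2 z $ 1) = glue \<T> det z"
    "(P 1 z $ 1 + P 2 z $ 2)\<^sup>2 = glue \<T> tr z" "(q 1 z)\<^sup>2 + (q 2 z)\<^sup>2 = glue \<T> qq z" by blast+
  qed
  have PE2: "2 * (\<Sum>T\<in>\<T>. LINT z:T|lborel. det T z) \<le> 8 * L\<^sup>2 * (\<Sum>T\<in>\<T>. LINT z:T|lborel. tr T z)
       + plane_const L W * (\<Sum>T\<in>\<T>. LINT z:T|lborel. qq T z)"
    using PE unfolding gl glue_integral(2)[OF m cdet] glue_integral(2)[OF m ctr] glue_integral(2)[OF m cqq] W_def .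
  define s where "s T = area T / 3 * (\<Sum>k<3. (norm (m (side T k)))\<^sup>2)" for T
  define u where "u T = (\<Sum>i<3. (\<mu> T i)\<^sup>2)" for T
  have elt: "area T * (l T)\<^sup>2 \<le> 2 * (LINT z:T|lborel. det T z) - 8 * L\<^sup>2 * (LINT z:T|lborel. tr T z)
      + (4 * W * u T + 2 * W * (2 * L\<^sup>2 * u T + (3/2) * s T) + (4 * W\<^sup>2 + 4 * W + 64 * L\<^sup>2) * (L\<^sup>2 * s T))"
    if T: "T \<in> \<T>" for T
  proof -
    note oT = or[OF T]
    have A: "0 < area T" by (rule area_pos[OF oT])
    define Y where "Y = (\<Sum>k<3. norm (m (side T k)))"
    define X where "X = (\<Sum>i<3. \<bar>\<mu> T i\<bar>)"
    define dM where "dM = slope_matrix T (\<mu> T) 1 1 * slope_matrix T (\<mu> T) 2 2 - slope_matrix T (\<mu> T) 1 2 * slope_matrix T (\<mu> T) 2 1"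
    define R where "R = 2 * W * \<bar>dM\<bar> + 2 * W * ((1/3) * X * Y) + (4 * W\<^sup>2 + 4 * W + 64 * L\<^sup>2) * (L / 3 * Y)\<^sup>2"
    have Y2: "Y\<^sup>2 \<le> 3 * (\<Sum>k<3. (norm (m (side T k)))\<^sup>2)" unfolding Y_def by (rule square_sum3_le)
    have X2: "X\<^sup>2 \<le> 3 * u T" using square_sum3_le[of "\<lambda>i. \<bar>\<mu> T i\<bar>"] by (simp add: X_def u_def)
    have pt: "(l T)\<^sup>2 \<le> 2 * det T z - 8 * L\<^sup>2 * tr T z + R" if z: "z \<in> T" for z
    proof -
      have zb: "\<bar>z $ j\<bar> \<le> L - 1" for j using box[OF T z] exhaust_2[of j] by auto
      have x2: "(z $ 1)\<^sup>2 \<le> L\<^sup>2" and y2: "(z $ 2)\<^sup>2 \<le> L\<^sup>2"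
        using zb[of 1] zb[of 2] L abs_le_square_iff[of "z $ 1" L] abs_le_square_iff[of "z $ 2" L] by auto
      have dl: "\<bar>moment_field T m j z $ i\<bar> \<le> L / 3 * Y" for j i
      proof -
        have "\<bar>moment_field T m j z $ i\<bar> = (1/6) * \<bar>\<Sum>k<3. m (side T k) $ j * (z $ i - vtx T k $ i)\<bar>"
          by (simp add: moment_field_def abs_mult)
        also have "\<dots> \<le> (1/6) * (\<Sum>k<3. norm (m (side T k)) * (2 * L))"
        proof (intro mult_left_mono order_trans[OF sum_abs sum_mono])
          fix k :: nat assume "k \<in> {..<3}"
          then have "vtx T k \<in> T" by (intro vtx_in[OF oT]) simp
          then have "\<bar>vtx T k $ i\<bar> \<le> L - 1" using box[OF T] exhaust_2[of i] by auto
          then have "\<bar>z $ i - vtx T k $ i\<bar> \<le> 2 * L" using zb[of i] by linarith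
          then show "\<bar>m (side T k) $ j * (z $ i - vtx T k $ i)\<bar> \<le> norm (m (side T k)) * (2 * L)"
            unfolding abs_mult by (intro mult_mono component_le_norm_cart) auto
        qed simp
        also have "\<dots> = L / 3 * Y" by (simp add: Y_def sum_distrib_right[symmetric])
        finally show ?thesis .
      qed
      have e: "F 1 T z $ 1 = l T - slope_matrix T (\<mu> T) 1 1 - moment_field T m 1 z $ 1"
        "F 1 T z $ 2 = - slope_matrix T (\<mu> T) 1 2 - moment_field T m 1 z $ 2"
        "F 2 T z $ 1 = - slope_matrix T (\<mu> T) 2 1 - moment_field T m 2 z $ 1"
        "F 2 T z $ 2 = l T - slope_matrix T (\<mu> T) 2 2 - moment_field T m 2 z $ 2"
        by (simp_all add: F_def elt_flux_def axis_def)
      have "(2 * K - 64 * L\<^sup>2 - 1) * (l T)\<^sup>2 \<le> 2 * det T z - 8 * L\<^sup>2 * tr T z + R"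
        unfolding det_def tr_def e R_def dM_def X_def Y_def[symmetric]
        by (rule elt_determinant_estimate[OF slope_matrix_trace _ _ K0 slope_matrix_moment_field[OF oT z, of "\<mu> T" m, folded Y_def] dl dl dl dl])
          (use x2 y2 in \<open>auto simp: W_def\<close>)
      then show ?thesis by (simp add: K_def)
    qed
    have const: "(LINT z:T|lborel. c) = area T * c" for c :: real
      using triangle_measure[OF oT] by (simp add: set_lebesgue_integral_def)
    have i1: "set_integrable lborel T (\<lambda>z. 2 * det T z - 8 * L\<^sup>2 * tr T z + R)"
      "set_integrable lborel T (\<lambda>z. (l T)\<^sup>2)" "set_integrable lborel T (\<lambda>z. 2 * det T z - 8 * L\<^sup>2 * tr T z)"
      "set_integrable lborel T (\<lambda>z. R)" "set_integrable lborel T (\<lambda>z. 2 * det T z)" "set_integrable lborel T (\<lambda>z. 8 * L\<^sup>2 * tr T z)"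
      by (rule triangle_integrable_elt[OF oT], intro continuous_intros cdet ctr)+
    have "area T * (l T)\<^sup>2 = (LINT z:T|lborel. (l T)\<^sup>2)" by (simp only: const)
    also have "\<dots> \<le> (LINT z:T|lborel. 2 * det T z - 8 * L\<^sup>2 * tr T z + R)"
      by (rule set_integral_mono[OF i1(2) i1(1) pt])
    also have "\<dots> = 2 * (LINT z:T|lborel. det T z) - 8 * L\<^sup>2 * (LINT z:T|lborel. tr T z) + area T * R"
      by (simp only: set_integral_add(2)[OF i1(3) i1(4)] set_integral_diff(2)[OF i1(5) i1(6)] const set_integral_mult_right)
    also have "area T * R \<le> 4 * W * u T + 2 * W * (2 * L\<^sup>2 * u T + (3/2) * s T) + (4 * W\<^sup>2 + 4 * W + 64 * L\<^sup>2) * (L\<^sup>2 * s T)"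
    proof -
      have a4: "area T \<le> 4 * L\<^sup>2"
      proof -
        have vb: "\<bar>vtx T k $ j\<bar> \<le> L - 1" if "k < 3" for k j
          using box[OF T vtx_in[OF oT that]] exhaust_2[of j] by auto
        have d: "\<bar>(vtx T k - vtx T 0) $ j\<bar> \<le> 2 * L" if "k < 3" for k j
          using vb[of k j] vb[of 0 j] that by (simp del: One_nat_def)
        have p: "\<bar>a * b\<bar> \<le> 4 * L\<^sup>2" if "\<bar>a\<bar> \<le> 2 * L" "\<bar>b\<bar> \<le> 2 * L" for a b
        proof -
          have "\<bar>a * b\<bar> \<le> (2 * L) * (2 * L)" unfolding abs_mult using that L by (intro mult_mono) auto
          then show ?thesis by (simp add: power2_eq_square)
        qed
        have "2 * area T \<le> 4 * L\<^sup>2 + 4 * L\<^sup>2"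
          using p[OF d[of 1 1] d[of 2 2]] p[OF d[of 1 2] d[of 2 1]] unfolding area_def cross2_def
          by (simp del: One_nat_def)
        then show ?thesis by simp
      qed
      have t1: "area T * \<bar>dM\<bar> \<le> 2 * u T" unfolding dM_def u_def by (rule slope_matrix_det[OF oT])
      have t2: "area T * ((1/3) * X * Y) \<le> 2 * L\<^sup>2 * u T + (3/2) * s T"
      proof -
        have "0 \<le> (2 * L * X - area T * Y / (2 * L))\<^sup>2" by simp
        then have "2 * (area T * X * Y) \<le> 4 * L\<^sup>2 * X\<^sup>2 + (area T)\<^sup>2 * Y\<^sup>2 / (4 * L\<^sup>2)"
          using L by (simp add: power2_eq_square field_simps)
        also have "(area T)\<^sup>2 * Y\<^sup>2 / (4 * L\<^sup>2) \<le> area T * Y\<^sup>2"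
        proof -
          have "(area T)\<^sup>2 * Y\<^sup>2 \<le> (area T * (4 * L\<^sup>2)) * Y\<^sup>2"
            unfolding power2_eq_square[of "area T"] using a4 A by (intro mult_right_mono mult_left_mono) auto
          then show ?thesis using L by (simp add: field_simps)
        qed
        also have "4 * L\<^sup>2 * X\<^sup>2 + area T * Y\<^sup>2 \<le> 4 * L\<^sup>2 * (3 * u T) + area T * (3 * (\<Sum>k<3. (norm (m (side T k)))\<^sup>2))"
          using X2 Y2 A by (intro add_mono mult_left_mono) auto
        finally show ?thesis by (simp add: s_def)
      qed
      have t3: "area T * (L / 3 * Y)\<^sup>2 \<le> L\<^sup>2 * s T"
      proof -
        have "area T * (L / 3 * Y)\<^sup>2 = (area T * L\<^sup>2 / 9) * Y\<^sup>2" by (simp add: power_mult_distrib power_divide)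
        also have "\<dots> \<le> (area T * L\<^sup>2 / 9) * (3 * (\<Sum>k<3. (norm (m (side T k)))\<^sup>2))"
          using Y2 A by (intro mult_left_mono) auto
        also have "\<dots> = L\<^sup>2 * s T" by (simp add: s_def)
        finally show ?thesis .
      qed
      have "area T * R = 2 * W * (area T * \<bar>dM\<bar>) + 2 * W * (area T * ((1/3) * X * Y)) + (4 * W\<^sup>2 + 4 * W + 64 * L\<^sup>2) * (area T * (L / 3 * Y)\<^sup>2)"
        unfolding R_def by (simp add: algebra_simps)
      also have "\<dots> \<le> 2 * W * (2 * u T) + 2 * W * (2 * L\<^sup>2 * u T + (3/2) * s T) + (4 * W\<^sup>2 + 4 * W + 64 * L\<^sup>2) * (L\<^sup>2 * s T)"
        using W0 by (intro add_mono mult_left_mono t1 t2 t3) auto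
      finally show ?thesis by simp
    qed
    finally show ?thesis by simp
  qed
  have qle: "(LINT z:T|lborel. qq T z) \<le> s T" if T: "T \<in> \<T>" for T
  proof -
    note oT = or[OF T]
    have A: "0 < area T" by (rule area_pos[OF oT])
    have "(LINT z:T|lborel. qq T z) = area T * ((elt_mean T m 1)\<^sup>2 + (elt_mean T m 2)\<^sup>2)"
      using triangle_measure[OF oT] by (simp add: set_lebesgue_integral_def qq_def)
    also have "\<dots> \<le> area T * ((\<Sum>k<3. (norm (m (side T k)))\<^sup>2) / 3)"
    proof (rule mult_left_mono)
      have "(elt_mean T m j)\<^sup>2 \<le> (\<Sum>k<3. (m (side T k) $ j)\<^sup>2) / 3" for j
        using square_sum3_le[of "\<lambda>k. m (side T k) $ j"] by (simp add: elt_mean_def power_divide)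
      note this[of 1] this[of 2]
      moreover have "(norm (m (side T k)))\<^sup>2 = (m (side T k) $ 1)\<^sup>2 + (m (side T k) $ 2)\<^sup>2" for k
        unfolding power2_norm_eq_inner inner_vec2 by (simp add: power2_eq_square)
      ultimately show "(elt_mean T m 1)\<^sup>2 + (elt_mean T m 2)\<^sup>2 \<le> (\<Sum>k<3. (norm (m (side T k)))\<^sup>2) / 3"
        by (simp add: sum.distrib add_divide_distrib)
    qed (use A in simp)
    finally show ?thesis by (simp add: s_def)
  qed
  have "(\<Sum>T\<in>\<T>. area T * (l T)\<^sup>2) \<le> (\<Sum>T\<in>\<T>. 2 * (LINT z:T|lborel. det T z) - 8 * L\<^sup>2 * (LINT z:T|lborel. tr T z)
      + (4 * W * u T + 2 * W * (2 * L\<^sup>2 * u T + (3/2) * s T) + (4 * W\<^sup>2 + 4 * W + 64 * L\<^sup>2) * (L\<^sup>2 * s T)))"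
    by (rule sum_mono[OF elt])
  also have "\<dots> = 2 * (\<Sum>T\<in>\<T>. LINT z:T|lborel. det T z) - 8 * L\<^sup>2 * (\<Sum>T\<in>\<T>. LINT z:T|lborel. tr T z)
      + (\<Sum>T\<in>\<T>. (4 * W * u T + 2 * W * (2 * L\<^sup>2 * u T + (3/2) * s T) + (4 * W\<^sup>2 + 4 * W + 64 * L\<^sup>2) * (L\<^sup>2 * s T)))"
    by (simp only: sum.distrib sum_subtractf sum_distrib_left)
  also have "\<dots> \<le> plane_const L W * (\<Sum>T\<in>\<T>. LINT z:T|lborel. qq T z)
      + (\<Sum>T\<in>\<T>. (4 * W * u T + 2 * W * (2 * L\<^sup>2 * u T + (3/2) * s T) + (4 * W\<^sup>2 + 4 * W + 64 * L\<^sup>2) * (L\<^sup>2 * s T)))"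
    using PE2 by linarith
  also have "\<dots> \<le> plane_const L W * (\<Sum>T\<in>\<T>. s T)
      + (\<Sum>T\<in>\<T>. (4 * W * u T + 2 * W * (2 * L\<^sup>2 * u T + (3/2) * s T) + (4 * W\<^sup>2 + 4 * W + 64 * L\<^sup>2) * (L\<^sup>2 * s T)))"
    using L W0 by (intro add_right_mono mult_left_mono sum_mono qle) (auto simp: plane_const_def)
  also have "\<dots> = (\<Sum>T\<in>\<T>. (4 * W + 4 * W * L\<^sup>2) * u T + (plane_const L W + 3 * W + (4 * W\<^sup>2 + 4 * W + 64 * L\<^sup>2) * L\<^sup>2) * s T)"
    by (subst sum_distrib_left, subst sum.distrib[symmetric], rule sum.cong[OF refl], simp add: algebra_simps)
  also have "\<dots> \<le> (\<Sum>T\<in>\<T>. residual_const L * (u T + s T))"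
  proof (rule sum_mono)
    fix T assume T: "T \<in> \<T>"
    have us: "0 \<le> u T" "0 \<le> s T" using area_pos[OF or[OF T]] by (auto simp: u_def s_def intro!: sum_nonneg mult_nonneg_nonneg)
    have pc: "0 \<le> plane_const L W" using L W0 by (auto simp: plane_const_def)
    have cc: "residual_const L = 4 * W + 4 * W * L\<^sup>2 + 3 * W + (4 * W\<^sup>2 + 4 * W + 64 * L\<^sup>2) * L\<^sup>2 + plane_const L W"
      by (simp add: residual_const_def Let_def K_def W_def)
    have a: "4 * W + 4 * W * L\<^sup>2 \<le> residual_const L" "plane_const L W + 3 * W + (4 * W\<^sup>2 + 4 * W + 64 * L\<^sup>2) * L\<^sup>2 \<le> residual_const L"
      unfolding cc using W0 pc by auto
    show "(4 * W + 4 * W * L\<^sup>2) * u T + (plane_const L W + 3 * W + (4 * W\<^sup>2 + 4 * W + 64 * L\<^sup>2) * L\<^sup>2) * s T \<le> residual_const L * (u T + s T)"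
      unfolding distrib_left by (intro add_mono mult_right_mono a us)
  qed
  also have "\<dots> = residual_const L * energy \<T> m"
    by (simp add: energy_def u_def s_def \<mu>_def sum_distrib_left)
  finally show ?thesis .
qed

section \<open>Lifting a piecewise constant function\<close>

text \<open>
  The assumptions express that \<open>f\<close> is a linear functional on vector-valued functions.
\<close>
lemma linear_functional_sum:
  fixes f :: "('e \<Rightarrow> real^2) \<Rightarrow> real"
  assumes "f (\<lambda>e. 0) = 0" "\<And>m y. f (\<lambda>e. m e + y e) = f m + f y" "\<And>c m. f (\<lambda>e. c *\<^sub>R m e) = c * f m"
    and "finite I"
  shows "f (\<lambda>e. \<Sum>i\<in>I. c i *\<^sub>R b i e) = (\<Sum>i\<in>I. c i * f (b i))"
  using assms(4) by induction (simp_all add: assms(1-3))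

lemma elt_div_linear:
  "elt_div T (\<lambda>e. 0) = 0" "elt_div T (\<lambda>e. m e + y e) = elt_div T m + elt_div T y"
  "elt_div T (\<lambda>e. c *\<^sub>R m e) = c * elt_div T m"
  by (simp_all add: elt_div_def sum.distrib inner_add_left add_divide_distrib sum_distrib_left)

lemma elt_grad_linear:
  "elt_grad T (\<lambda>e. 0) v = 0" "elt_grad T (\<lambda>e. m e + y e) v = elt_grad T m v + elt_grad T y v"
  "elt_grad T (\<lambda>e. c *\<^sub>R m e) v = c *\<^sub>R elt_grad T m v"
  by (simp_all add: elt_grad_def sum.distrib scaleR_add_right scaleR_sum_right mult_ac)

lemma slope_linear:
  "slope T i (\<lambda>e. 0) = 0" "slope T i (\<lambda>e. m e + y e) = slope T i m + slope T i y"
  "slope T i (\<lambda>e. c *\<^sub>R m e) = c * slope T i m"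
  by (simp_all add: slope_def elt_grad_linear inner_add_right add_divide_distrib)

lemma elt_div_cong: "(\<And>k. k < 3 \<Longrightarrow> m (side T k) = y (side T k)) \<Longrightarrow> elt_div T m = elt_div T y"
  by (simp add: elt_div_def)

lemma slope_cong: "(\<And>k. k < 3 \<Longrightarrow> m (side T k) = y (side T k)) \<Longrightarrow> slope T i m = slope T i y"
  by (simp add: slope_def elt_grad_def)

text \<open>
  Least squares with the midpoint values as unknowns. There is one row for each divergence, with target
  \<open>u\<close>, and one row with target \<open>0\<close> for each slope and each component of a midpoint value; the square
  roots of the areas are the weights.
\<close>
lemma discrete_projection:
  assumes fin: "finite \<T>" and area: "\<And>T. T \<in> \<T> \<Longrightarrow> 0 < area T"
  obtains m where "\<And>y. (\<Sum>T\<in>\<T>. area T * (u T - elt_div T m) * elt_div T y - (\<Sum>i<3. slope T i m * slope T i y))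
      = (\<Sum>T\<in>\<T>. area T / 3 * (\<Sum>k<3. m (side T k) \<bullet> y (side T k)))"
proof -
  define E where "E = (\<Union>T\<in>\<T>. side T ` {..<3})"
  define I where "I = E \<times> (UNIV :: 2 set)"
  \<comment> \<open>The unknowns are the components of the midpoint values; b i is the unit field of the unknown i.\<close>
  define b where "b i e = (if e = fst i then axis (snd i) (1::real) else 0)" for i :: "(real^2) set \<times> 2" and e
  define R where "R = \<T> <+> (\<T> \<times> {..<(3::nat)}) <+> (\<T> \<times> {..<(3::nat)} \<times> (UNIV :: 2 set))"
  define row where "row r = (case r of Inl T \<Rightarrow> (\<lambda>m. sqrt (area T) * elt_div T m)
     | Inr (Inl (T, i)) \<Rightarrow> slope T i
     | Inr (Inr (T, k, j)) \<Rightarrow> (\<lambda>m. sqrt (area T / 3) * m (side T k) $ j))" for r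
  define f where "f r = (case r of Inl T \<Rightarrow> sqrt (area T) * u T | Inr s \<Rightarrow> 0)"
    for r :: "(real^2) set + (real^2) set \<times> nat + (real^2) set \<times> nat \<times> 2"
  have finE: "finite E" and finI: "finite I" unfolding I_def E_def using fin by auto
  have lin: "row r (\<lambda>e. 0) = 0" "row r (\<lambda>e. m e + y e) = row r m + row r y" "row r (\<lambda>e. c *\<^sub>R m e) = c * row r m" for r m y c
    unfolding row_def by (simp_all add: elt_div_linear slope_linear algebra_simps split: sum.split)
  have basis: "row r y = (\<Sum>i\<in>I. y (fst i) $ snd i * row r (b i))" if r: "r \<in> R" for r y
  proof -
    have "(\<Sum>i\<in>I. y (fst i) $ snd i *\<^sub>R b i e) = y e" if e: "e \<in> E" for e
    proof -
      have "(\<Sum>i\<in>I. y (fst i) $ snd i *\<^sub>R b i e) = (\<Sum>e'\<in>E. \<Sum>j\<in>UNIV. y e' $ j *\<^sub>R b (e', j) e)"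
        unfolding I_def by (simp add: sum.cartesian_product case_prod_unfold)
      also have "\<dots> = (\<Sum>e'\<in>E. if e' = e then (\<Sum>j\<in>UNIV. y e $ j *\<^sub>R axis j (1::real)) else 0)"
        by (rule sum.cong[OF refl]) (auto simp: b_def)
      also have "\<dots> = (\<Sum>j\<in>UNIV. y e $ j *\<^sub>R axis j (1::real))" using finE e by simp
      also have "\<dots> = y e" by (simp add: vec_eq_iff forall_2 sum_2 axis_def)
      finally show ?thesis .
    qed
    then have s: "(\<Sum>i\<in>I. y (fst i) $ snd i *\<^sub>R b i (side T k)) = y (side T k)" if "T \<in> \<T>" "k < 3" for T k
      using that by (auto simp: E_def)
    have "row r y = row r (\<lambda>e. \<Sum>i\<in>I. y (fst i) $ snd i *\<^sub>R b i e)"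
      using r unfolding R_def row_def
      by (auto intro!: elt_div_cong slope_cong simp: s simp del: sum_component)
    also have "\<dots> = (\<Sum>i\<in>I. y (fst i) $ snd i * row r (b i))"
      by (rule linear_functional_sum[OF lin finI])
    finally show ?thesis .
  qed
  define v where "v i r = row r (b i)" for i r
  obtain x where x': "\<forall>i\<in>I. (\<Sum>r\<in>R. (f r - (\<Sum>j\<in>I. x j * v j r)) * v i r) = 0"
    by (rule exE[OF least_squares_normal_equations[OF finI, where R=R and f=f and v=v]])
  note x = bspec[OF x', unfolded v_def]
  define m :: "(real^2) set \<Rightarrow> real^2" where "m e = (\<chi> j. x (e, j))" for e
  have rm: "row r m = (\<Sum>j\<in>I. x j * row r (b j))" if "r \<in> R" for r
    using basis[OF that, of m] by (simp add: m_def)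
  have orth: "(\<Sum>r\<in>R. (f r - row r m) * row r y) = 0" for y
  proof -
    have "(\<Sum>r\<in>R. (f r - row r m) * row r y) = (\<Sum>r\<in>R. \<Sum>i\<in>I. y (fst i) $ snd i * ((f r - row r m) * row r (b i)))"
    proof (rule sum.cong[OF refl])
      fix r assume "r \<in> R"
      from basis[OF this, of y] show "(f r - row r m) * row r y = (\<Sum>i\<in>I. y (fst i) $ snd i * ((f r - row r m) * row r (b i)))"
        by (simp only: sum_distrib_left mult_ac)
    qed
    also have "\<dots> = (\<Sum>i\<in>I. y (fst i) $ snd i * (\<Sum>r\<in>R. (f r - row r m) * row r (b i)))"
      by (subst sum.swap) (simp only: sum_distrib_left)
    also have "\<dots> = 0"
    proof (rule sum.neutral, rule ballI)
      fix i assume "i \<in> I"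
      have "(\<Sum>r\<in>R. (f r - row r m) * row r (b i)) = (\<Sum>r\<in>R. (f r - (\<Sum>j\<in>I. x j * row r (b j))) * row r (b i))"
        by (rule sum.cong[OF refl]) (simp only: rm)
      then show "y (fst i) $ snd i * (\<Sum>r\<in>R. (f r - row r m) * row r (b i)) = 0"
        using x[OF \<open>i \<in> I\<close>] by simp
    qed
    finally show ?thesis .
  qed
  have "(\<Sum>T\<in>\<T>. area T * (u T - elt_div T m) * elt_div T y - (\<Sum>i<3. slope T i m * slope T i y))
      = (\<Sum>T\<in>\<T>. area T / 3 * (\<Sum>k<3. m (side T k) \<bullet> y (side T k)))" for y
  proof -
    have "(\<Sum>r\<in>R. (f r - row r m) * row r y)
      = (\<Sum>T\<in>\<T>. (sqrt (area T) * u T - sqrt (area T) * elt_div T m) * (sqrt (area T) * elt_div T y))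
       + ((\<Sum>T\<in>\<T>. \<Sum>i<3. - slope T i m * slope T i y)
       + (\<Sum>T\<in>\<T>. \<Sum>k<3. \<Sum>j\<in>UNIV. - (sqrt (area T / 3) * m (side T k) $ j) * (sqrt (area T / 3) * y (side T k) $ j)))"
      unfolding R_def using fin
      by (simp add: sum.Plus sum.cartesian_product f_def row_def case_prod_unfold)
    also have "(\<Sum>T\<in>\<T>. (sqrt (area T) * u T - sqrt (area T) * elt_div T m) * (sqrt (area T) * elt_div T y))
       = (\<Sum>T\<in>\<T>. area T * (u T - elt_div T m) * elt_div T y)"
    proof (rule sum.cong[OF refl])
      have g: "(s * a - s * b) * (s * c) = (s * s) * (a - b) * c" for s a b c :: real by algebra
      fix T assume "T \<in> \<T>"
      then have "sqrt (area T) * sqrt (area T) = area T" using area by (simp add: less_imp_le)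
      then show "(sqrt (area T) * u T - sqrt (area T) * elt_div T m) * (sqrt (area T) * elt_div T y)
          = area T * (u T - elt_div T m) * elt_div T y"
        unfolding g by (simp only:)
    qed
    also have "(\<Sum>T\<in>\<T>. \<Sum>k<3. \<Sum>j\<in>UNIV. - (sqrt (area T / 3) * m (side T k) $ j) * (sqrt (area T / 3) * y (side T k) $ j))
       = - (\<Sum>T\<in>\<T>. area T / 3 * (\<Sum>k<3. m (side T k) \<bullet> y (side T k)))"
      unfolding sum_negf[symmetric]
    proof (rule sum.cong[OF refl])
      fix T assume "T \<in> \<T>"
      then have s: "sqrt (area T / 3) * sqrt (area T / 3) = area T / 3" using area[of T] by simp
      have t: "- (sqrt (area T / 3) * c) * (sqrt (area T / 3) * d) = - (area T / 3 * (c * d))" for c d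
      proof -
        have "- (r * c) * (r * d) = - (r * r * (c * d))" for r by algebra
        from this[of "sqrt (area T / 3)", unfolded s] show ?thesis .
      qed
      show "(\<Sum>k<3. \<Sum>j\<in>UNIV. - (sqrt (area T / 3) * m (side T k) $ j) * (sqrt (area T / 3) * y (side T k) $ j))
          = - (area T / 3 * (\<Sum>k<3. m (side T k) \<bullet> y (side T k)))"
        unfolding t by (simp only: sum_negf sum_distrib_left inner_vec_def inner_real_def)
    qed
    finally show ?thesis unfolding orth by (simp add: sum_negf sum_subtractf)
  qed
  then show ?thesis by (rule that)
qed

lemma residual_const_nonneg: "1 \<le> L \<Longrightarrow> 0 \<le> residual_const L"
  by (auto simp: residual_const_def Let_def plane_const_def)

text \<open>
  Testing the normal equations with \<open>m\<close> itself gives the identity; the upper bound holds since the squared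
  residual is nonnegative, and the lower bound since \<open>u = \<lambda> + div m\<close> and \<open>\<lambda>\<close> is bounded by the energy.
\<close>
theorem discrete_lifting:
  assumes m: "triangle_mesh \<T>" and L: "1 \<le> L"
    and box: "\<And>T z. T \<in> \<T> \<Longrightarrow> z \<in> T \<Longrightarrow> \<bar>z $ 1\<bar> \<le> L - 1 \<and> \<bar>z $ 2\<bar> \<le> L - 1"
  obtains m where
    "energy \<T> m + (\<Sum>T\<in>\<T>. area T * (elt_div T m)\<^sup>2) = (\<Sum>T\<in>\<T>. area T * (u T * elt_div T m))"
    "(\<Sum>T\<in>\<T>. area T * (u T * elt_div T m)) \<le> (\<Sum>T\<in>\<T>. area T * (u T)\<^sup>2)"
    "(\<Sum>T\<in>\<T>. area T * (u T)\<^sup>2) \<le> 2 * (residual_const L + 1) * (\<Sum>T\<in>\<T>. area T * (u T * elt_div T m))"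
proof -
  have fin: "finite \<T>" and A: "\<And>T. T \<in> \<T> \<Longrightarrow> 0 < area T" using m area_pos by (auto simp: triangle_mesh_def)
  obtain m' where star: "\<And>y. (\<Sum>T\<in>\<T>. area T * (u T - elt_div T m') * elt_div T y - (\<Sum>i<3. slope T i m' * slope T i y))
      = (\<Sum>T\<in>\<T>. area T / 3 * (\<Sum>k<3. m' (side T k) \<bullet> y (side T k)))"
    using discrete_projection[OF fin A, of u] by blast
  define e where "e = energy \<T> m'"
  define d where "d = (\<Sum>T\<in>\<T>. area T * (elt_div T m')\<^sup>2)"
  define b where "b = (\<Sum>T\<in>\<T>. area T * (u T * elt_div T m'))"
  define S where "S = (\<Sum>T\<in>\<T>. area T * (u T)\<^sup>2)"
  define l where "l = (\<Sum>T\<in>\<T>. area T * (u T - elt_div T m')\<^sup>2)"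
  have e0: "0 \<le> e" unfolding e_def energy_def using A
    by (intro sum_nonneg add_nonneg_nonneg mult_nonneg_nonneg) (auto intro: less_imp_le)
  have d0: "0 \<le> d" unfolding d_def using A by (intro sum_nonneg mult_nonneg_nonneg) (auto intro: less_imp_le)
  have l0: "0 \<le> l" unfolding l_def using A by (intro sum_nonneg mult_nonneg_nonneg) (auto intro: less_imp_le)
  have bal: "e + d = b"
    using star[of m'] unfolding e_def d_def b_def energy_def power2_norm_eq_inner
    by (simp add: sum.distrib sum_subtractf algebra_simps power2_eq_square)
  have ll: "l = S - 2 * b + d" unfolding l_def S_def b_def d_def
    by (simp add: sum.distrib[symmetric] sum_subtractf[symmetric] sum_distrib_left power2_eq_square algebra_simps)
  have core: "l \<le> residual_const L * e"
    unfolding l_def e_def by (rule projection_residual_bound[OF m L box star])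
  have c0: "0 \<le> residual_const L" by (rule residual_const_nonneg[OF L])
  have "S \<le> 2 * (residual_const L + 1) * b"
  proof -
    have "S \<le> 2 * l + 2 * d"
    proof -
      have "S \<le> (\<Sum>T\<in>\<T>. 2 * (area T * (u T - elt_div T m')\<^sup>2) + 2 * (area T * (elt_div T m')\<^sup>2))"
        unfolding S_def
      proof (rule sum_mono)
        fix T assume T: "T \<in> \<T>"
        have "0 \<le> area T * (u T - 2 * elt_div T m')\<^sup>2" using A[OF T] by simp
        then show "area T * (u T)\<^sup>2 \<le> 2 * (area T * (u T - elt_div T m')\<^sup>2) + 2 * (area T * (elt_div T m')\<^sup>2)"
          by (simp add: power2_eq_square algebra_simps)
      qed
      then show ?thesis by (simp add: l_def d_def sum.distrib sum_distrib_left)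
    qed
    also have "\<dots> \<le> 2 * (residual_const L * b) + 2 * b"
    proof -
      have "residual_const L * e \<le> residual_const L * b" using bal d0 c0 by (intro mult_left_mono) auto
      then show ?thesis using core bal e0 by linarith
    qed
    also have "\<dots> = 2 * (residual_const L + 1) * b" by (simp add: algebra_simps)
    finally show ?thesis .
  qed
  moreover have "b \<le> S" using ll l0 bal e0 by linarith
  ultimately show ?thesis
    using bal unfolding e_def d_def b_def S_def by (intro that[of m'])
qed

section \<open>Geometry of a conforming triangulation\<close>

lemma collinear_iff_cross2: "collinear {a, b, c} \<longleftrightarrow> cross2 (b - a) (c - a) = 0"
proof -
  have "collinear {a, b, c} \<longleftrightarrow> collinear {b, a, c}" by (simp add: insert_commute)
  also have "\<dots> \<longleftrightarrow> collinear {0, b - a, c - a}" by (rule collinear_3) simp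
  also have "\<dots> \<longleftrightarrow> cross2 (b - a) (c - a) = 0"
  proof
    assume "collinear {0, b - a, c - a}"
    then consider "b - a = 0" | "c - a = 0" | t where "c - a = t *\<^sub>R (b - a)" unfolding collinear_lemma by blast
    then show "cross2 (b - a) (c - a) = 0"
    proof cases
      case 3 then show ?thesis by (simp only: cross2_def) (simp add: algebra_simps)
    qed (simp_all only: cross2_def, simp_all)
  next
    assume z: "cross2 (b - a) (c - a) = 0"
    define x where "x = b - a"
    define y where "y = c - a"
    have "y = ((x \<bullet> y) / (x \<bullet> x)) *\<^sub>R x" if "x \<noteq> 0"
    proof -
      have n: "x \<bullet> x \<noteq> 0" using that by simp
      have "x $ 1 * y $ 2 = x $ 2 * y $ 1" using z by (simp add: cross2_def x_def y_def algebra_simps)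
      then have "(x \<bullet> x) *\<^sub>R y = (x \<bullet> y) *\<^sub>R x"
        by (simp add: vec_eq_2 inner_vec2 algebra_simps)
      then have "(1 / (x \<bullet> x)) *\<^sub>R ((x \<bullet> x) *\<^sub>R y) = (1 / (x \<bullet> x)) *\<^sub>R ((x \<bullet> y) *\<^sub>R x)" by simp
      then show ?thesis using n by simp
    qed
    then show "collinear {0, b - a, c - a}" unfolding collinear_lemma x_def y_def by blast
  qed
  finally show ?thesis .
qed

text \<open>
  Exchanging two vertices changes the sign of \<open>cross2\<close>, which is not zero for affinely independent
  vertices.
\<close>
lemma simplex_oriented_triangle:
  assumes "2 simplex T"
  shows "oriented_triangle T"
proof -
  obtain C where C: "\<not> affine_dependent C" "int (card C) = 2 + 1" "T = convex hull C"
    using assms unfolding simplex_def by blast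
  have "card C = 3" using C(2) by simp
  then obtain a b c where abc: "C = {a, b, c}" "a \<noteq> b" "b \<noteq> c" "a \<noteq> c" unfolding card_3_iff by auto
  have "\<not> collinear {a, b, c}" using C(1) abc collinear_3_eq_affine_dependent[of a b c] by simp
  then have nz: "cross2 (b - a) (c - a) \<noteq> 0" by (simp add: collinear_iff_cross2)
  have sw: "cross2 (c - a) (b - a) = - cross2 (b - a) (c - a)" by (simp add: cross2_def)
  obtain b' c' where bc: "{a, b, c} = {a, b', c'}" "cross2 (b' - a) (c' - a) > 0"
  proof (cases "cross2 (b - a) (c - a) > 0")
    case True then show ?thesis using that[of b c] by simp
  next
    case False then show ?thesis using that[of c b] nz sw by (simp add: insert_commute)
  qed
  define p where "p k = (if k mod 3 = 0 then a else if k mod 3 = 1 then b' else c')" for k :: nat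
  have "vertex_labelling T p" unfolding vertex_labelling_def C(3) abc(1) bc(1) using bc(2) by (simp add: p_def)
  then show ?thesis unfolding oriented_triangle_def vtx_def by (rule someI[where P="vertex_labelling T"])
qed

lemma triangle_independent:
  assumes T: "oriented_triangle T"
  shows "\<not> affine_dependent {vtx T 0, vtx T 1, vtx T 2}"
    and "vtx T 0 \<noteq> vtx T 1" "vtx T 1 \<noteq> vtx T 2" "vtx T 2 \<noteq> vtx T 0"
proof -
  have "\<not> collinear {vtx T 0, vtx T 1, vtx T 2}"
    using area_pos[OF T] unfolding collinear_iff_cross2 area_def by simp
  then show "\<not> affine_dependent {vtx T 0, vtx T 1, vtx T 2}"
    and "vtx T 0 \<noteq> vtx T 1" "vtx T 1 \<noteq> vtx T 2" "vtx T 2 \<noteq> vtx T 0"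
    by (metis collinear_3_eq_affine_dependent)+
qed

lemma facet_of_triangle:
  assumes T: "oriented_triangle T"
  shows "e facet_of T \<longleftrightarrow> (\<exists>k<3. e = side T k)"
proof -
  note ind = triangle_independent[OF T]
  have "e facet_of T \<longleftrightarrow> e \<noteq> {} \<and> (\<exists>u. u \<in> {vtx T 0, vtx T 1, vtx T 2} \<and> e = convex hull ({vtx T 0, vtx T 1, vtx T 2} - {u}))"
    by (subst triangle_eq[OF T]) (rule facet_of_convex_hull_affine_independent[OF ind(1)])
  also have "\<dots> \<longleftrightarrow> e \<noteq> {} \<and> (e = convex hull {vtx T 1, vtx T 2} \<or> e = convex hull {vtx T 2, vtx T 0} \<or> e = convex hull {vtx T 0, vtx T 1})"
  proof -
    have "{vtx T 0, vtx T 1, vtx T 2} - {vtx T 0} = {vtx T 1, vtx T 2}"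
      "{vtx T 0, vtx T 1, vtx T 2} - {vtx T 1} = {vtx T 2, vtx T 0}"
      "{vtx T 0, vtx T 1, vtx T 2} - {vtx T 2} = {vtx T 0, vtx T 1}" using ind(2-4) by auto
    then show ?thesis by (metis insert_iff empty_iff)
  qed
  also have "\<dots> \<longleftrightarrow> e = side T 0 \<or> e = side T 1 \<or> e = side T 2"
    unfolding side_simps[OF T] segment_convex_hull by auto
  also have "\<dots> \<longleftrightarrow> (\<exists>k<3. e = side T k)"
  proof -
    have "(0::nat) < 3" "(1::nat) < 3" "(2::nat) < 3" by simp_all
    then show ?thesis using less_3_cases by blast
  qed
  finally show ?thesis .
qed

text \<open>
  The barycentric coordinate of \<open>x\<close> that belongs to vertex \<open>k\<close>.
\<close>
definition bary :: "(real^2) set \<Rightarrow> nat \<Rightarrow> real^2 \<Rightarrow> real" where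
  "bary T k x = rot (edge_vec T k) \<bullet> (vtx T (k + 1) - x) / (2 * area T)"

lemma bary_simps:
  assumes T: "oriented_triangle T"
  shows "bary T 0 x = rot (vtx T 2 - vtx T 1) \<bullet> (vtx T 1 - x) / (2 * area T)"
    "bary T 1 x = rot (vtx T 0 - vtx T 2) \<bullet> (vtx T 2 - x) / (2 * area T)"
    "bary T 2 x = rot (vtx T 1 - vtx T 0) \<bullet> (vtx T 0 - x) / (2 * area T)"
  using vtx_periodic(3)[OF T] by (simp_all add: bary_def edge_vec_def numeral_2_eq_2)

lemma bary_sum:
  assumes T: "oriented_triangle T"
  shows "bary T 0 x + bary T 1 x + bary T 2 x = 1"
    "bary T 0 x *\<^sub>R vtx T 0 + bary T 1 x *\<^sub>R vtx T 1 + bary T 2 x *\<^sub>R vtx T 2 = x"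
proof -
  have A: "2 * area T \<noteq> 0" using area_pos[OF T] by simp
  define a where "a = vtx T 0"
  define b where "b = vtx T 1"
  define c where "c = vtx T 2"
  have D: "2 * area T = (b $ 1 - a $ 1) * (c $ 2 - a $ 2) - (b $ 2 - a $ 2) * (c $ 1 - a $ 1)"
    by (simp add: area_def cross2_def a_def b_def c_def)
  note e = bary_simps[OF T, folded a_def b_def c_def] inner_vec2 rot_nth
  show "bary T 0 x + bary T 1 x + bary T 2 x = 1"
    unfolding e add_divide_distrib[symmetric] divide_eq_1_iff
    using A unfolding D by (auto simp: algebra_simps)
  have k: "u / (2 * area T) * p + v / (2 * area T) * q + w / (2 * area T) * r = z"
    if "u * p + v * q + w * r = ((b $ 1 - a $ 1) * (c $ 2 - a $ 2) - (b $ 2 - a $ 2) * (c $ 1 - a $ 1)) * z" for u v w p q r z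
    using that[folded D] A by (simp add: field_simps)
  have "(bary T 0 x *\<^sub>R a + bary T 1 x *\<^sub>R b + bary T 2 x *\<^sub>R c) $ 1 = x $ 1"
    "(bary T 0 x *\<^sub>R a + bary T 1 x *\<^sub>R b + bary T 2 x *\<^sub>R c) $ 2 = x $ 2"
    unfolding vector_add_component vector_scaleR_component e real_scaleR_def
     apply (rule k, simp add: algebra_simps)
    apply (rule k, simp add: algebra_simps)
    done
  then show "bary T 0 x *\<^sub>R vtx T 0 + bary T 1 x *\<^sub>R vtx T 1 + bary T 2 x *\<^sub>R vtx T 2 = x"
    by (simp add: vec_eq_2 a_def b_def c_def)
qed

lemma bary_vtx:
  assumes T: "oriented_triangle T" and k: "k < 3"
  shows "bary T k (vtx T k) = 1" "bary T k (vtx T (k + 1)) = 0" "bary T k (vtx T (k + 2)) = 0"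
proof -
  have A: "2 * area T \<noteq> 0" using area_pos[OF T] by simp
  show "bary T k (vtx T (k + 1)) = 0" by (simp add: bary_def)
  show "bary T k (vtx T (k + 2)) = 0"
    by (simp add: bary_def edge_vec_def inner_vec2 algebra_simps)
  have "rot (edge_vec T k) \<bullet> (vtx T (k + 1) - vtx T k) = 2 * area T"
    using less_3_cases[OF k] vtx_periodic[OF T]
    by (elim disjE) (simp_all add: edge_vec_def area_def cross2_def inner_vec2 numeral_2_eq_2 algebra_simps)
  then show "bary T k (vtx T k) = 1" using A by (simp add: bary_def)
qed

lemma bary_diff:
  "bary T k (x - s *\<^sub>R n) = bary T k x + s * (rot (edge_vec T k) \<bullet> n) / (2 * area T)"
  by (simp add: bary_def inner_diff_right add_divide_distrib[symmetric])

lemma mem_triangle_iff: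
  assumes T: "oriented_triangle T"
  shows "x \<in> T \<longleftrightarrow> (\<forall>k<3. 0 \<le> bary T k x)"
proof
  assume x: "x \<in> T"
  show "\<forall>k<3. 0 \<le> bary T k x"
  proof (intro allI impI)
    fix k :: nat assume k: "k < 3"
    have A: "0 < area T" by (rule area_pos[OF T])
    have eq: "{y. 0 \<le> bary T k y} = {y. rot (edge_vec T k) \<bullet> y \<le> rot (edge_vec T k) \<bullet> vtx T (k + 1)}"
      using A by (auto simp: bary_def inner_diff_right zero_le_divide_iff)
    have "vtx T j \<in> {y. 0 \<le> bary T k y}" if "j < 3" for j
    proof -
      have "j = k \<or> vtx T j = vtx T (k + 1) \<or> vtx T j = vtx T (k + 2)"
        using less_3_cases[OF k] less_3_cases[OF that] vtx_periodic[OF T]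
        by (elim disjE) (simp_all add: numeral_2_eq_2)
      then show ?thesis using bary_vtx[OF T k] by (elim disjE) simp_all
    qed
    note v = this[of 0] this[of 1] this[of 2]
    have "convex hull {vtx T 0, vtx T 1, vtx T 2} \<subseteq> {y. 0 \<le> bary T k y}"
      by (rule hull_minimal) (use v in simp, unfold eq, rule convex_halfspace_le)
    then show "0 \<le> bary T k x" using x triangle_eq[OF T] by auto
  qed
next
  assume h: "\<forall>k<3. 0 \<le> bary T k x"
  have h': "0 \<le> bary T 0 x" "0 \<le> bary T 1 x" "0 \<le> bary T 2 x" using h by simp_all
  have "bary T 0 x *\<^sub>R vtx T 0 + bary T 1 x *\<^sub>R vtx T 1 + bary T 2 x *\<^sub>R vtx T 2 \<in> convex hull {vtx T 0, vtx T 1, vtx T 2}"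
    unfolding convex_hull_3 using h' bary_sum(1)[OF T] by blast
  then show "x \<in> T" using bary_sum(2)[OF T] triangle_eq[OF T] by simp
qed

lemma bary_le_1:
  assumes "oriented_triangle T" "x \<in> T" "k < 3"
  shows "0 \<le> bary T k x" "bary T k x \<le> 1"
proof -
  have h: "0 \<le> bary T 0 x" "0 \<le> bary T 1 x" "0 \<le> bary T 2 x" "0 \<le> bary T k x"
    using mem_triangle_iff[OF assms(1)] assms(2,3) by simp_all
  show "0 \<le> bary T k x" by (rule h)
  show "bary T k x \<le> 1" using less_3_cases[OF assms(3)] h bary_sum(1)[OF assms(1), of x] by auto
qed

lemma interior_triangleI:
  assumes T: "oriented_triangle T" and x: "\<And>k. k < 3 \<Longrightarrow> 0 < bary T k x"
  shows "x \<in> interior T"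
proof (rule interiorI)
  have "continuous_on UNIV (bary T k)" for k unfolding bary_def
    using area_pos[OF T] by (intro continuous_intros) auto
  then show "open ({y. 0 < bary T 0 y} \<inter> {y. 0 < bary T 1 y} \<inter> {y. 0 < bary T 2 y})"
    by (intro open_Int open_Collect_less continuous_on_const) auto
  show "x \<in> {y. 0 < bary T 0 y} \<inter> {y. 0 < bary T 1 y} \<inter> {y. 0 < bary T 2 y}" using x by simp
  show "{y. 0 < bary T 0 y} \<inter> {y. 0 < bary T 1 y} \<inter> {y. 0 < bary T 2 y} \<subseteq> T"
  proof
    fix y assume y: "y \<in> {y. 0 < bary T 0 y} \<inter> {y. 0 < bary T 1 y} \<inter> {y. 0 < bary T 2 y}"
    show "y \<in> T" unfolding mem_triangle_iff[OF T]
    proof (intro allI impI)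
      fix k :: nat assume "k < 3"
      then show "0 \<le> bary T k y" using y less_3_cases[of k] by (auto intro: less_imp_le)
    qed
  qed
qed

lemma interior_triangle_nonempty:
  assumes T: "oriented_triangle T"
  shows "interior T \<noteq> {}" "closure (interior T) = T"
proof -
  have "measure lborel T \<noteq> 0" using area_pos[OF T] triangle_measure(1)[OF T] by simp
  then have "\<not> negligible T"
    using negligible_imp_measure0 triangle_facts(3)[OF T] by (metis borel_closed measure_completion sets_lborel)
  then show ne: "interior T \<noteq> {}"
    using negligible_convex_interior[OF triangle_facts(2)[OF T]] by blast
  show "closure (interior T) = T"
    using convex_closure_interior[OF triangle_facts(2)[OF T] ne] triangle_facts(3)[OF T] by simp
qed

definition edge_mid :: "(real^2) set \<Rightarrow> real^2" where
  "edge_mid e = edge_mean e (\<lambda>x. x)"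

lemma segment_mean_affine:
  assumes "linear L"
  shows "segment_mean a b (\<lambda>x. c + L x) = c + L (midpoint a b)"
proof -
  interpret linear L by fact
  have "((\<lambda>t. (c + L a) + t *\<^sub>R L (b - a)) has_integral ((1 - 0) *\<^sub>R (c + L a) + (1/2::real) *\<^sub>R L (b - a))) {0..1}"
  proof (intro has_integral_add has_integral_scaleR_left)
    show "((\<lambda>x. c + L a) has_integral (1 - 0) *\<^sub>R (c + L a)) {0..1::real}"
      using has_integral_const_real[of "c + L a" 0 1] by simp
    show "((\<lambda>t. t) has_integral 1/2) {0..1::real}"
      using ident_has_integral[of 0 "1::real"] by simp
  qed
  moreover have e: "c + L (linepath a b t) = (c + L a) + t *\<^sub>R L (b - a)" for t
    by (simp add: linepath_def add scale diff algebra_simps)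
  ultimately have "((\<lambda>t. c + L (linepath a b t)) has_integral ((1 - 0) *\<^sub>R (c + L a) + (1/2::real) *\<^sub>R L (b - a))) {0..1}" by (simp only: e)
  then have "segment_mean a b (\<lambda>x. c + L x) = (1 - 0) *\<^sub>R (c + L a) + (1/2::real) *\<^sub>R L (b - a)"
    unfolding segment_mean_def by (rule integral_unique)
  also have "\<dots> = c + L (midpoint a b)"
  proof -
    have "L (midpoint a b) = L a + (1/2::real) *\<^sub>R L (b - a)"
    proof -
      have "midpoint a b = a + (1/2::real) *\<^sub>R (b - a)"
        by (simp add: midpoint_def vec_eq_2 field_simps)
      then show ?thesis by (simp only: add scale)
    qed
    then show ?thesis by simp
  qed
  finally show ?thesis .
qed

lemma edge_mid_segment: "edge_mid (closed_segment a b) = midpoint a b"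
  using segment_mean_affine[of "\<lambda>x. x" a b 0] by (simp add: edge_mid_def edge_mean_segment linear_iff)

lemma edge_mid_side: "edge_mid (side T k) = midpoint (vtx T (k + 1)) (vtx T (k + 2))"
  by (simp add: side_def edge_mid_segment)

lemma edge_mean_affine:
  assumes "linear L"
  shows "edge_mean (side T k) (\<lambda>x. c + L x) = c + L (edge_mid (side T k))"
  using segment_mean_affine[OF assms] by (simp add: side_def edge_mid_segment edge_mean_segment)

lemma diameter_closed_segment: "diameter (closed_segment a b) = norm (b - a)" for a b :: "real^2"
proof (rule antisym)
  show "diameter (closed_segment a b) \<le> norm (b - a)"
  proof (rule diameter_le)
    fix x y assume "x \<in> closed_segment a b" "y \<in> closed_segment a b"
    then obtain s t where st: "x = (1 - s) *\<^sub>R a + s *\<^sub>R b" "y = (1 - t) *\<^sub>R a + t *\<^sub>R b" "0 \<le> s" "s \<le> 1" "0 \<le> t" "t \<le> 1"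
      by (auto simp: closed_segment_def)
    have "x - y = (s - t) *\<^sub>R (b - a)" unfolding st by (simp add: algebra_simps)
    then have "norm (x - y) = \<bar>s - t\<bar> * norm (b - a)" by simp
    also have "\<dots> \<le> 1 * norm (b - a)" using st by (intro mult_right_mono) auto
    finally show "norm (x - y) \<le> norm (b - a)" by simp
  qed simp
  show "norm (b - a) \<le> diameter (closed_segment a b)"
    using diameter_bounded_bound[of "closed_segment a b" b a] by (simp add: dist_norm bounded_closed_segment)
qed

lemma diameter_side: "diameter (side T k) = norm (edge_vec T k)"
  by (simp add: side_def edge_vec_def diameter_closed_segment)

lemma edge_integral_mean: "edge_integral e f = diameter e *\<^sub>R edge_mean e f"
  by (simp add: edge_integral_def edge_mean_def segment_mean_def case_prod_unfold Let_def)

lemma orthogonal_rot: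
  assumes "v \<bullet> u = 0" "u \<noteq> 0"
  shows "v = ((v \<bullet> rot u) / (u \<bullet> u)) *\<^sub>R rot u"
proof -
  have n: "u \<bullet> u \<noteq> 0" using assms(2) by simp
  have o: "v $ 1 * u $ 1 + v $ 2 * u $ 2 = 0" using assms(1) by (simp add: inner_vec2)
  have "(u \<bullet> u) *\<^sub>R v = (v \<bullet> rot u) *\<^sub>R rot u"
    unfolding vec_eq_2 using o by (simp add: inner_vec2) algebra
  then have "(1 / (u \<bullet> u)) *\<^sub>R ((u \<bullet> u) *\<^sub>R v) = (1 / (u \<bullet> u)) *\<^sub>R ((v \<bullet> rot u) *\<^sub>R rot u)" by simp
  then show ?thesis using n by simp
qed

definition side_normal :: "(real^2) set \<Rightarrow> nat \<Rightarrow> real^2" where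
  "side_normal T k = (1 / norm (edge_vec T k)) *\<^sub>R rot (edge_vec T k)"

lemma outer_normal_side:
  assumes T: "oriented_triangle T" and k: "k < 3"
  shows "outer_normal T (side T k) = side_normal T k"
  unfolding outer_normal_def
proof (rule the_equality)
  have A: "0 < area T" by (rule area_pos[OF T])
  define l where "l = norm (edge_vec T k)"
  have l: "0 < l" using edge_vec_nonzero[OF T k] by (simp add: l_def)
  define n where "n = side_normal T k"
  have n: "n = (1 / l) *\<^sub>R rot (edge_vec T k)" by (simp add: n_def side_normal_def l_def)
  have norm: "norm n = 1" using l by (simp add: n l_def)
  have eb: "n \<bullet> (vtx T (k + 1) - x) = 2 * area T / l * bary T k x" for x
    using A l by (simp add: n bary_def)
  have flat: "n \<bullet> x = n \<bullet> vtx T (k + 1)" if "x \<in> side T k" for x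
  proof -
    obtain t where x: "x = (1 - t) *\<^sub>R vtx T (k + 1) + t *\<^sub>R vtx T (k + 2)"
      using \<open>x \<in> side T k\<close> by (auto simp: side_def closed_segment_def)
    have "x = vtx T (k + 1) + t *\<^sub>R edge_vec T k" by (simp add: x edge_vec_def algebra_simps)
    moreover have "rot (edge_vec T k) \<bullet> edge_vec T k = 0" by (simp add: inner_vec2)
    ultimately show ?thesis by (simp add: n inner_add_right)
  qed
  have below: "n \<bullet> x \<le> n \<bullet> vtx T (k + 1)" if "x \<in> T" for x
  proof -
    have "0 \<le> 2 * area T / l * bary T k x"
      using bary_le_1(1)[OF T that k] A l by simp
    then show ?thesis using eb[of x] by (simp add: inner_diff_right)
  qed
  show "norm (side_normal T k) = 1 \<and> (\<exists>c. (\<forall>x\<in>side T k. side_normal T k \<bullet> x = c) \<and> (\<forall>x\<in>T. side_normal T k \<bullet> x \<le> c))"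
    using norm flat below unfolding n_def[symmetric] by blast
  fix n' assume n': "norm n' = 1 \<and> (\<exists>c. (\<forall>x\<in>side T k. n' \<bullet> x = c) \<and> (\<forall>x\<in>T. n' \<bullet> x \<le> c))"
  then obtain c where c: "\<And>x. x \<in> side T k \<Longrightarrow> n' \<bullet> x = c" "\<And>x. x \<in> T \<Longrightarrow> n' \<bullet> x \<le> c" by blast
  have e: "vtx T (k + 1) \<in> side T k" "vtx T (k + 2) \<in> side T k" by (simp_all add: side_def)
  have "n' \<bullet> edge_vec T k = 0" using c(1)[OF e(1)] c(1)[OF e(2)] by (simp add: edge_vec_def inner_diff_right)
  from orthogonal_rot[OF this edge_vec_nonzero[OF T k]]
  obtain t where t: "n' = t *\<^sub>R rot (edge_vec T k)" by blast
  then have nt: "n' = (t * l) *\<^sub>R n" using l by (simp add: n)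
  then have "\<bar>t * l\<bar> = 1" using n' norm by simp
  \<comment> \<open>The opposite normal is excluded by the third vertex.\<close>
  moreover have "t * l \<noteq> - 1"
  proof
    assume "t * l = - 1"
    then have "n' = - n" using nt by simp
    then have "n \<bullet> (vtx T (k + 1) - vtx T k) \<le> 0"
      using c(1)[OF e(1)] c(2)[OF vtx_in[OF T k]] by (simp add: inner_diff_right)
    moreover have "n \<bullet> (vtx T (k + 1) - vtx T k) > 0" using eb[of "vtx T k"] bary_vtx(1)[OF T k] A l by simp
    ultimately show False by simp
  qed
  ultimately have "t * l = 1" by linarith
  then show "n' = side_normal T k" using nt by (simp add: n_def)
qed

lemma bary_edge_mid:
  assumes T: "oriented_triangle T" and k: "k < 3" and j: "j < 3"
  shows "bary T j (edge_mid (side T k)) = (if j = k then 0 else 1/2)"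
proof -
  have m: "bary T j (midpoint u v) = (bary T j u + bary T j v) / 2" for u v
    using area_pos[OF T] by (simp add: bary_def midpoint_def inner_diff_right inner_add_right field_simps)
  show ?thesis unfolding edge_mid_side m
    using less_3_cases[OF k] less_3_cases[OF j] vtx_periodic[OF T] bary_vtx[OF T j]
    by (elim disjE) (simp_all add: numeral_2_eq_2)
qed

text \<open>
  Used to show that two triangles on the same side of a common edge overlap.
\<close>
lemma below_side_interior:
  assumes T: "oriented_triangle T" and k: "k < 3"
  obtains d where "0 < d" "\<And>s. 0 < s \<Longrightarrow> s < d \<Longrightarrow> edge_mid (side T k) - s *\<^sub>R side_normal T k \<in> interior T"
proof -
  have A: "0 < area T" by (rule area_pos[OF T])
  define n where "n = side_normal T k"
  define g where "g j = rot (edge_vec T j) \<bullet> n / (2 * area T)" for j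
  define C where "C = \<bar>g 0\<bar> + \<bar>g 1\<bar> + \<bar>g 2\<bar>"
  have C: "\<bar>g j\<bar> \<le> C" if "j < 3" for j using less_3_cases[OF that] by (auto simp: C_def)
  have C0: "0 \<le> C" by (simp add: C_def)
  \<comment> \<open>The two other barycentric coordinates equal 1/2 at the midpoint and change by at most \<open>s C\<close>.\<close>
  define d where "d = 1 / (2 * (C + 1))"
  have d: "0 < d" using C0 by (simp add: d_def)
  have "edge_mid (side T k) - s *\<^sub>R n \<in> interior T" if s: "0 < s" "s < d" for s
  proof (rule interior_triangleI[OF T])
    fix j :: nat assume j: "j < 3"
    have b: "bary T j (edge_mid (side T k) - s *\<^sub>R n) = (if j = k then 0 else 1/2) + s * g j"
      unfolding bary_diff bary_edge_mid[OF T k j] by (simp add: g_def)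
    show "0 < bary T j (edge_mid (side T k) - s *\<^sub>R n)"
    proof (cases "j = k")
      case True
      have "rot (edge_vec T k) \<bullet> n = norm (edge_vec T k)"
        using edge_vec_nonzero[OF T k] unfolding n_def side_normal_def inner_scaleR_right
        by (simp add: power2_norm_eq_inner[symmetric] power2_eq_square)
      then have "0 < g k" using A edge_vec_nonzero[OF T k] by (simp add: g_def)
      then show ?thesis unfolding b using True s by simp
    next
      case False
      have "\<bar>s * g j\<bar> \<le> s * C" using s C[OF j] by (simp add: abs_mult)
      also have "\<dots> \<le> d * C" using s C0 by (intro mult_right_mono) auto
      also have "\<dots> < 1/2" using C0 by (simp add: d_def field_simps)
      finally show ?thesis unfolding b using False by (simp add: abs_less_iff)
    qed
  qed
  then show ?thesis using that[OF d] unfolding n_def by blast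
qed

lemma side_normal_eq_or_opposite:
  assumes "side T k = side T' k'"
  shows "side_normal T' k' = side_normal T k \<or> side_normal T' k' = - side_normal T k"
proof -
  have "{vtx T (k + 1), vtx T (k + 2)} = {vtx T' (k' + 1), vtx T' (k' + 2)}"
    using assms by (simp add: side_def closed_segment_eq)
  then have "edge_vec T' k' = edge_vec T k \<or> edge_vec T' k' = - edge_vec T k"
    by (auto simp: doubleton_eq_iff edge_vec_def)
  moreover have "rot (- v) = - rot v" for v by (simp add: vec_eq_2)
  ultimately show ?thesis by (auto simp: side_normal_def)
qed

text \<open>
  The outward normals of two triangles at a common edge are equal or opposite. If they were equal, points just
  below the midpoint of the edge would be interior to both triangles. A third triangle would have a
  normal opposite to both of two opposite vectors.
\<close>
lemma interior_edge_neighbours: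
  assumes m: "triangle_mesh \<T>" and e: "e \<in> interior_edges \<T>"
  obtains T k T' k' where "T \<noteq> T'" "{T \<in> \<T>. e facet_of T} = {T, T'}" "k < 3" "k' < 3" "e = side T k" "e = side T' k'"
    "outer_normal T' e = - outer_normal T e"
proof -
  have o: "oriented_triangle T" if "T \<in> \<T>" for T using m that by (simp add: triangle_mesh_def)
  have sk: "\<exists>k<3. e = side T k" if "T \<in> \<T>" "e facet_of T" for T
    using facet_of_triangle[OF o[OF that(1)]] that(2) by simp
  have opp: "outer_normal T' e = - outer_normal T e \<and> outer_normal T e \<noteq> 0"
    if T: "T \<in> \<T>" "T' \<in> \<T>" "e facet_of T" "e facet_of T'" "T \<noteq> T'" for T T'
  proof -
    obtain k k' where k: "k < 3" "e = side T k" "k' < 3" "e = side T' k'" using sk T by meson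
    have n: "outer_normal T e = side_normal T k" "outer_normal T' e = side_normal T' k'"
      using outer_normal_side[OF o[OF T(1)] k(1)] outer_normal_side[OF o[OF T(2)] k(3)] k by simp_all
    have nz: "side_normal T k \<noteq> 0"
      using edge_vec_nonzero[OF o[OF T(1)] k(1)] by (metis norm_rot norm_eq_zero side_normal_def scaleR_eq_0_iff divide_eq_0_iff zero_neq_one)
    have "side_normal T' k' \<noteq> side_normal T k"
    proof
      assume eq: "side_normal T' k' = side_normal T k"
      obtain d where d: "0 < d" "\<And>s. 0 < s \<Longrightarrow> s < d \<Longrightarrow> edge_mid (side T k) - s *\<^sub>R side_normal T k \<in> interior T"
        using below_side_interior[OF o[OF T(1)] k(1)] by blast
      obtain d' where d': "0 < d'" "\<And>s. 0 < s \<Longrightarrow> s < d' \<Longrightarrow> edge_mid (side T' k') - s *\<^sub>R side_normal T' k' \<in> interior T'"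
        using below_side_interior[OF o[OF T(2)] k(3)] by blast
      define s where "s = min d d' / 2"
      have "0 < s" "s < d" "s < d'" using d(1) d'(1) by (auto simp: s_def)
      then have "edge_mid e - s *\<^sub>R side_normal T k \<in> interior T \<inter> interior T'"
        using d(2)[of s] d'(2)[of s] eq k by simp
      then show False using m T by (auto simp: triangle_mesh_def)
    qed
    then show ?thesis using side_normal_eq_or_opposite[of T k T' k'] k n nz by simp
  qed
  obtain T T' where T: "T \<in> \<T>" "T' \<in> \<T>" "e facet_of T" "e facet_of T'" "T \<noteq> T'"
    using e unfolding interior_edges_def by blast
  have "T'' = T \<or> T'' = T'" if T'': "T'' \<in> \<T>" "e facet_of T''" for T''
  proof (rule ccontr)
    assume "\<not> (T'' = T \<or> T'' = T')"
    then have "outer_normal T'' e = - outer_normal T e" "outer_normal T'' e = - outer_normal T' e"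
      "outer_normal T' e = - outer_normal T e" "outer_normal T e \<noteq> 0"
      using opp[OF T(1) T''(1) T(3) T''(2)] opp[OF T(2) T''(1) T(4) T''(2)] opp[OF T] by auto
    then have "outer_normal T e + outer_normal T e = 0" by (metis add.right_inverse minus_minus)
    then show False using \<open>outer_normal T e \<noteq> 0\<close> by (simp add: scaleR_2[symmetric])
  qed
  then have N: "{T \<in> \<T>. e facet_of T} = {T, T'}" using T by blast
  obtain k k' where k: "k < 3" "e = side T k" "k' < 3" "e = side T' k'" using sk T by meson
  show ?thesis using that[OF T(5) N k(1,3,2,4)] opp[OF T] by blast
qed

text \<open>
  A face of \<open>T\<close> that meets the interior of \<open>T\<close> is \<open>T\<close>, so two triangles with a common interior point are both
  equal to their intersection.
\<close>
lemma conforming_triangle_mesh: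
  assumes "conforming_triangulation \<Omega> \<T>"
  shows "triangle_mesh \<T>"
proof -
  have tr: "triangulation \<T>" and sx: "\<And>T. T \<in> \<T> \<Longrightarrow> 2 simplex T" using assms by (auto simp: conforming_triangulation_def)
  have "interior T \<inter> interior T' = {}" if T: "T \<in> \<T>" "T' \<in> \<T>" "T \<noteq> T'" for T T'
  proof (rule ccontr)
    assume ne: "interior T \<inter> interior T' \<noteq> {}"
    have f: "(T \<inter> T') face_of T" "(T \<inter> T') face_of T'"
      using tr T unfolding triangulation_def by (blast, metis inf_commute)
    have "T \<inter> T' = T" using face_of_disjoint_interior[OF f(1)] ne interior_subset by blast
    moreover have "T \<inter> T' = T'" using face_of_disjoint_interior[OF f(2)] ne interior_subset by blast
    ultimately show False using T(3) by blast
  qed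
  then show ?thesis using tr sx simplex_oriented_triangle unfolding triangle_mesh_def triangulation_def by auto
qed

text \<open>
  That interiors of triangles lie in \<open>\<Omega>\<close>, and not merely in its closure, is the regularity
  \<open>interior (closure \<Omega>) = \<Omega>\<close> of the domain.
\<close>
lemma triangulation_covers:
  assumes d: "polygonal_domain \<Omega>" and c: "conforming_triangulation \<Omega> \<T>"
  shows "T \<in> \<T> \<Longrightarrow> interior T \<subseteq> \<Omega>" "\<Omega> \<subseteq> (\<Union>T\<in>\<T>. interior T) \<union> (\<Union>T\<in>\<T>. frontier T)"
    "(\<Union>T\<in>\<T>. frontier T) \<in> null_sets lborel"
proof -
  have u: "\<Union>\<T> = closure \<Omega>" using c by (simp add: conforming_triangulation_def)
  show "interior T \<subseteq> \<Omega>" if "T \<in> \<T>"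
  proof -
    have "interior T \<subseteq> interior (closure \<Omega>)" using u that by (intro interior_mono) auto
    then show ?thesis using d by (simp add: polygonal_domain_def)
  qed
  show "\<Omega> \<subseteq> (\<Union>T\<in>\<T>. interior T) \<union> (\<Union>T\<in>\<T>. frontier T)"
  proof
    fix x assume "x \<in> \<Omega>"
    then obtain T where "T \<in> \<T>" "x \<in> T" using u closure_subset by blast
    then show "x \<in> (\<Union>T\<in>\<T>. interior T) \<union> (\<Union>T\<in>\<T>. frontier T)"
      using closure_subset by (auto simp: frontier_def)
  qed
  show "(\<Union>T\<in>\<T>. frontier T) \<in> null_sets lborel"
    using conforming_triangle_mesh[OF c] triangle_facts(5) unfolding triangle_mesh_def
    by (intro null_sets.finite_UN) auto
qed

text \<open>
  The skeleton is a null set, and by completeness of the Lebesgue measure the arbitrary values of \<open>f\<close> on it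
  do not affect measurability.
\<close>
lemma domain_integral:
  fixes f :: "real^2 \<Rightarrow> 'b::euclidean_space"
  assumes d: "polygonal_domain \<Omega>" and c: "conforming_triangulation \<Omega> \<T>"
    and F: "\<And>T. T \<in> \<T> \<Longrightarrow> continuous_on UNIV (F T)"
    and f: "\<And>T x. T \<in> \<T> \<Longrightarrow> x \<in> interior T \<Longrightarrow> f x = F T x"
  shows "set_integrable lebesgue \<Omega> f" "(LINT x:\<Omega>|lebesgue. f x) = (\<Sum>T\<in>\<T>. LINT x:T|lborel. F T x)"
proof -
  note m = conforming_triangle_mesh[OF c]
  note gi = glue_integral[OF m F]
  have "AE x in lborel. x \<notin> (\<Union>T\<in>\<T>. frontier T)" by (rule AE_not_in[OF triangulation_covers(3)[OF d c]])
  then have "AE x in lebesgue. x \<notin> (\<Union>T\<in>\<T>. frontier T)" by (rule AE_completion)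
  then have ae: "AE x in lebesgue. glue \<T> F x = indicat_real \<Omega> x *\<^sub>R f x"
  proof eventually_elim
    case (elim x)
    show ?case
    proof (cases "\<exists>T\<in>\<T>. x \<in> interior T")
      case True
      then obtain T where T: "T \<in> \<T>" "x \<in> interior T" by blast
      then show ?thesis using glue_interior[OF m T] f[OF T] triangulation_covers(1)[OF d c T(1)] by (auto simp: indicator_def)
    next
      case False
      then have "x \<notin> \<Omega>" using elim triangulation_covers(2)[OF d c] by blast
      then show ?thesis using False by (subst glue_outside) auto
    qed
  qed
  have mg: "glue \<T> F \<in> borel_measurable lebesgue"
    using borel_measurable_integrable[OF gi(1)] by (rule measurable_completion)
  have mf: "(\<lambda>x. indicat_real \<Omega> x *\<^sub>R f x) \<in> borel_measurable lebesgue"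
    by (rule borel_measurable_AE[OF mg ae])
  have ig: "integrable lebesgue (glue \<T> F)" using gi(1) by (simp add: integrable_completion)
  show "set_integrable lebesgue \<Omega> f" unfolding set_integrable_def
    using integrable_cong_AE[OF mg mf ae] ig by simp
  have "(LINT x:\<Omega>|lebesgue. f x) = (LINT x|lebesgue. glue \<T> F x)"
    unfolding set_lebesgue_integral_def by (rule integral_cong_AE[symmetric, OF mg mf ae])
  also have "\<dots> = (LINT x|lborel. glue \<T> F x)"
    using borel_measurable_integrable[OF gi(1)] by (simp add: integral_completion)
  also have "\<dots> = (\<Sum>T\<in>\<T>. LINT x:T|lborel. F T x)" by (rule gi(2))
  finally show "(LINT x:\<Omega>|lebesgue. f x) = (\<Sum>T\<in>\<T>. LINT x:T|lborel. F T x)" .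
qed

section \<open>Forms and norms of piecewise affine fields\<close>

definition affine_fun :: "(real^2 \<Rightarrow> 'b::euclidean_space) \<Rightarrow> bool" where
  "affine_fun G \<longleftrightarrow> linear (\<lambda>x. G x - G 0)"

lemma affine_fun_continuous: "affine_fun G \<Longrightarrow> continuous_on S G"
proof -
  assume "affine_fun G"
  then have "continuous_on S (\<lambda>x. (G x - G 0) + G 0)"
    unfolding affine_fun_def by (intro continuous_intros linear_continuous_on linear_conv_bounded_linear[THEN iffD1])
  then show ?thesis by simp
qed

lemma affine_funI: "linear L \<Longrightarrow> affine_fun (\<lambda>x. a + L x)"
  by (simp add: affine_fun_def linear_0)

lemma affine_fun_const [simp]: "affine_fun (\<lambda>x. c)"
  by (simp add: affine_fun_def linear_iff)

lemma affine_fun_add: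
  assumes "affine_fun F" "affine_fun G"
  shows "affine_fun (\<lambda>x. F x + t *\<^sub>R G x)"
proof -
  have "linear (\<lambda>x. (F x - F 0) + t *\<^sub>R (G x - G 0))"
    using assms unfolding affine_fun_def by (intro linear_compose_add linear_compose_scale_right)
  then show ?thesis unfolding affine_fun_def by (simp add: algebra_simps)
qed

lemma edge_mean_affine_fun:
  assumes "affine_fun G"
  shows "edge_mean (side T k) G = G (edge_mid (side T k))"
  using edge_mean_affine[of "\<lambda>x. G x - G 0" T k "G 0"] assms by (simp add: affine_fun_def)

text \<open>
  A closed triangle is the closure of its interior, so the limit from the interior exists and is unique at
  every point of \<open>T\<close>.
\<close>
lemma elt_extension:
  fixes G :: "real^2 \<Rightarrow> 'b::euclidean_space"
  assumes T: "oriented_triangle T" and G: "continuous_on UNIV G"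
    and f: "\<And>x. x \<in> interior T \<Longrightarrow> f x = G x" and x: "x \<in> T"
  shows "elt f T x = G x"
  unfolding elt_def
proof (rule tendsto_Lim)
  have "x islimpt interior T"
  proof (cases "x \<in> interior T")
    case True
    then show ?thesis by (simp add: interior_limit_point)
  next
    case False
    then show ?thesis using x interior_triangle_nonempty(2)[OF T] by (auto simp: closure_def)
  qed
  then show "\<not> trivial_limit (at x within interior T)" by (simp add: trivial_limit_within)
  have "(G \<longlongrightarrow> G x) (at x within interior T)"
    using G by (meson UNIV_I continuous_on_def tendsto_within_subset subset_UNIV)
  moreover have "\<forall>\<^sub>F y in at x within interior T. G y = f y"
    unfolding eventually_at_filter by (rule eventuallyI) (use f in auto)
  ultimately show "(f \<longlongrightarrow> G x) (at x within interior T)" by (rule Lim_transform_eventually)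
qed

text \<open>
  The divergence of an affine function. This algebraic form is linear in the function without any
  differentiability argument.
\<close>
definition affine_div :: "(real^2 \<Rightarrow> real^2^2) \<Rightarrow> real^2" where
  "affine_div G = (\<chi> i. \<Sum>j\<in>UNIV. (G (axis j 1) - G 0) $ i $ j)"

lemma affine_div_add: "affine_div (\<lambda>x. F x + t *\<^sub>R G x) = affine_div F + t *\<^sub>R affine_div G"
  by (simp add: affine_div_def vec_eq_2 sum_2 algebra_simps)

lemma affine_div_const [simp]: "affine_div (\<lambda>x. c) = 0"
  by (simp add: affine_div_def vec_eq_2)

lemma div_h_affine:
  assumes G: "affine_fun G" and f: "\<And>x. x \<in> interior T \<Longrightarrow> f x = G x" and x: "x \<in> interior T"
  shows "div_h f x = affine_div G"
proof -
  have "((\<lambda>v. G v - G 0) has_derivative (\<lambda>v. G v - G 0)) (at x)"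
    using G unfolding affine_fun_def by (simp add: bounded_linear_imp_has_derivative linear_conv_bounded_linear)
  then have "((\<lambda>v. (G v - G 0) + G 0) has_derivative (\<lambda>v. (G v - G 0) + 0)) (at x)"
    by (intro has_derivative_add has_derivative_const)
  then have "(G has_derivative (\<lambda>v. G v - G 0)) (at x)" by simp
  then have "(f has_derivative (\<lambda>v. G v - G 0)) (at x)"
    by (rule has_derivative_transform_within_open[OF _ open_interior x]) (simp add: f)
  then have "frechet_derivative f (at x) = (\<lambda>v. G v - G 0)" by (rule frechet_derivative_at[symmetric])
  then show ?thesis by (simp add: div_h_def affine_div_def)
qed

text \<open>
  The field \<open>f\<close> is given on every element by an affine function that is defined on the whole plane. Discrete
  fields are handled through these affine functions, which do not depend on values on the skeleton.
\<close>
definition represents :: "mesh \<Rightarrow> (real^2 \<Rightarrow> 'b::euclidean_space) \<Rightarrow> ((real^2) set \<Rightarrow> real^2 \<Rightarrow> 'b) \<Rightarrow> bool" where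
  "represents \<T> f F \<longleftrightarrow> (\<forall>T\<in>\<T>. affine_fun (F T) \<and> (\<forall>x\<in>interior T. f x = F T x))"

lemma represents_add:
  assumes "represents \<T> f F" "represents \<T> g G"
  shows "represents \<T> (\<lambda>x. f x + t *\<^sub>R g x) (\<lambda>T x. F T x + t *\<^sub>R G T x)"
  using assms by (simp add: represents_def affine_fun_add)

definition field_jump :: "mesh \<Rightarrow> ((real^2) set \<Rightarrow> real^2 \<Rightarrow> real^2^2) \<Rightarrow> (real^2) set \<Rightarrow> real^2 \<Rightarrow> real^2" where
  "field_jump \<T> F e x = (\<Sum>T | T \<in> \<T> \<and> e facet_of T. F T x *v outer_normal T e)"

lemma field_jump_add:
  "field_jump \<T> (\<lambda>T x. F T x + t *\<^sub>R G T x) e x = field_jump \<T> F e x + t *\<^sub>R field_jump \<T> G e x"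
  unfolding field_jump_def
  by (simp add: matrix_vector_mult_add_rdistrib scaleR_matrix_vector_assoc[symmetric] sum.distrib scaleR_sum_right)

lemma continuous_on_deviator:
  assumes "continuous_on S (G :: real^2 \<Rightarrow> real^2^2)"
  shows "continuous_on S (\<lambda>x. deviator (G x))"
  unfolding deviator_def trace_def by (intro continuous_intros assms) simp

lemma continuous_on_matrix_vector:
  assumes "continuous_on S (G :: real^2 \<Rightarrow> real^2^2)"
  shows "continuous_on S (\<lambda>x. G x *v n)"
  unfolding matrix_vector_mult_def
  by (intro continuous_on_vec_lambda continuous_on_sum continuous_intros assms)

lemma continuous_on_field_jump:
  assumes "\<And>T. T \<in> \<T> \<Longrightarrow> continuous_on UNIV (F T)"
  shows "continuous_on S (field_jump \<T> F e)"
  unfolding field_jump_def[abs_def]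
  by (intro continuous_on_sum continuous_on_matrix_vector) (use assms in \<open>auto intro: continuous_on_subset\<close>)

lemma deviator_add: "deviator (A + t *\<^sub>R B) = deviator A + t *\<^sub>R deviator B"
  by (simp add: deviator_def trace_def sum.distrib sum_distrib_left[symmetric] algebra_simps add_divide_distrib)

text \<open>
  The form \<open>a_h\<close> without the factor \<open>1 / \<nu>\<close>, in terms of the affine functions. The weight \<open>1 / |e|\<close> turns
  edge integrals into edge means.
\<close>
definition field_form :: "mesh \<Rightarrow> ((real^2) set \<Rightarrow> real^2 \<Rightarrow> real^2^2) \<Rightarrow> ((real^2) set \<Rightarrow> real^2 \<Rightarrow> real^2^2) \<Rightarrow> real" where
  "field_form \<T> F G = (\<Sum>T\<in>\<T>. LINT x:T|lborel. deviator (F T x) \<bullet> deviator (G T x))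
     + (\<Sum>e\<in>interior_edges \<T>. edge_mean e (\<lambda>x. field_jump \<T> F e x \<bullet> field_jump \<T> G e x))"

lemma field_form_commute: "field_form \<T> F G = field_form \<T> G F"
  by (simp add: field_form_def inner_commute)

lemma linepath_integrable:
  assumes "continuous_on UNIV (f :: real^2 \<Rightarrow> real)"
  shows "(\<lambda>t. f (linepath a b t)) integrable_on {0..1}"
  by (intro integrable_continuous_real continuous_on_compose2[OF assms]) (auto intro: continuous_on_linepath)

lemma edge_mean_add:
  assumes "continuous_on UNIV (f :: real^2 \<Rightarrow> real)" "continuous_on UNIV g"
  shows "edge_mean e (\<lambda>x. f x + t * g x) = edge_mean e f + t * edge_mean e g"
proof -
  have "segment_mean a b (\<lambda>x. f x + t * g x) = segment_mean a b f + t * segment_mean a b g" for a b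
    unfolding segment_mean_def
    using linepath_integrable[OF assms(1), of a b] linepath_integrable[OF assms(2), of a b]
    by (simp add: Henstock_Kurzweil_Integration.integral_add integrable_on_mult_right)
  then show ?thesis by (simp add: edge_mean_def case_prod_unfold Let_def)
qed

lemma edge_mean_mono:
  assumes "continuous_on UNIV (f :: real^2 \<Rightarrow> real)" "continuous_on UNIV g" "\<And>x. x \<in> side T k \<Longrightarrow> f x \<le> g x"
  shows "edge_mean (side T k) f \<le> edge_mean (side T k) g"
  unfolding side_def edge_mean_segment segment_mean_def
  by (rule Henstock_Kurzweil_Integration.integral_le) (use assms(3) in \<open>auto intro!: linepath_integrable assms simp: side_def linepath_in_path\<close>)

lemma edge_mean_cong:
  assumes "\<And>x. x \<in> side T k \<Longrightarrow> f x = g x"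
  shows "edge_mean (side T k) f = edge_mean (side T k) g"
  unfolding side_def edge_mean_segment segment_mean_def
  by (rule Henstock_Kurzweil_Integration.integral_cong) (use assms in \<open>simp add: side_def linepath_in_path\<close>)

lemma edge_mean_const: "edge_mean (side T k) (\<lambda>x. c) = c" for c :: real
  by (simp add: side_def edge_mean_segment segment_mean_def)

lemma field_form_add:
  assumes m: "triangle_mesh \<T>"
    and c: "\<And>T. T \<in> \<T> \<Longrightarrow> continuous_on UNIV (F T)" "\<And>T. T \<in> \<T> \<Longrightarrow> continuous_on UNIV (G T)" "\<And>T. T \<in> \<T> \<Longrightarrow> continuous_on UNIV (H T)"
  shows "field_form \<T> F (\<lambda>T x. G T x + t *\<^sub>R H T x) = field_form \<T> F G + t * field_form \<T> F H"
proof -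
  have e: "edge_mean e (\<lambda>x. field_jump \<T> F e x \<bullet> field_jump \<T> (\<lambda>T x. G T x + t *\<^sub>R H T x) e x)
      = edge_mean e (\<lambda>x. field_jump \<T> F e x \<bullet> field_jump \<T> G e x) + t * edge_mean e (\<lambda>x. field_jump \<T> F e x \<bullet> field_jump \<T> H e x)" for e
    unfolding field_jump_add inner_add_right inner_scaleR_right
    by (rule edge_mean_add; intro continuous_intros continuous_on_field_jump c)
  have v: "(LINT x:T|lborel. deviator (F T x) \<bullet> deviator (G T x + t *\<^sub>R H T x))
      = (LINT x:T|lborel. deviator (F T x) \<bullet> deviator (G T x)) + t * (LINT x:T|lborel. deviator (F T x) \<bullet> deviator (H T x))"
    if T: "T \<in> \<T>" for T
  proof -
    have o: "oriented_triangle T" using m T by (simp add: triangle_mesh_def)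
    have i: "set_integrable lborel T (\<lambda>x. deviator (F T x) \<bullet> deviator (G T x))"
      "set_integrable lborel T (\<lambda>x. t * (deviator (F T x) \<bullet> deviator (H T x)))"
      by (rule triangle_integrable_elt[OF o], intro continuous_intros continuous_on_deviator c T)+
    show ?thesis unfolding deviator_add inner_add_right inner_scaleR_right set_integral_add(2)[OF i]
      by (simp only: set_integral_mult_right)
  qed
  show ?thesis unfolding field_form_def e using v
    by (simp add: sum.distrib sum_distrib_left distrib_left)
qed

lemma edge_mean_nonneg:
  assumes "continuous_on UNIV (f :: real^2 \<Rightarrow> real)" "\<And>x. 0 \<le> f x"
  shows "0 \<le> edge_mean (side T k) f"
  using edge_mean_mono[OF continuous_on_const assms(1), of T k 0] assms(2) by (simp add: edge_mean_const)

lemma interior_edge_side: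
  assumes m: "triangle_mesh \<T>" and e: "e \<in> interior_edges \<T>"
  obtains T k where "T \<in> \<T>" "k < 3" "e = side T k"
proof -
  obtain T where T: "T \<in> \<T>" "e facet_of T" using e unfolding interior_edges_def by blast
  then have "oriented_triangle T" using m by (simp add: triangle_mesh_def)
  then show ?thesis using facet_of_triangle[of T e] T that by blast
qed

lemma field_form_nonneg:
  assumes m: "triangle_mesh \<T>" and c: "\<And>T. T \<in> \<T> \<Longrightarrow> continuous_on UNIV (F T)"
  shows "0 \<le> field_form \<T> F F"
proof -
  have "0 \<le> edge_mean e (\<lambda>x. field_jump \<T> F e x \<bullet> field_jump \<T> F e x)" if e: "e \<in> interior_edges \<T>" for e
  proof -
    obtain T k where k: "T \<in> \<T>" "k < 3" "e = side T k" by (rule interior_edge_side[OF m e])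
    show ?thesis unfolding k(3) by (rule edge_mean_nonneg) (intro continuous_intros continuous_on_field_jump c, simp_all)
  qed
  moreover have "0 \<le> (LINT x:T|lborel. deviator (F T x) \<bullet> deviator (F T x))" for T
    unfolding set_lebesgue_integral_def by (rule Bochner_Integration.integral_nonneg) simp
  ultimately show ?thesis unfolding field_form_def by (intro add_nonneg_nonneg sum_nonneg)
qed

lemma represents_tensor_jump:
  assumes m: "triangle_mesh \<T>" and r: "represents \<T> \<tau> F" and x: "x \<in> e"
  shows "tensor_jump \<T> e \<tau> x = field_jump \<T> F e x"
  unfolding tensor_jump_def field_jump_def
proof (rule sum.cong[OF refl])
  fix T assume "T \<in> {T. T \<in> \<T> \<and> e facet_of T}"
  then have T: "T \<in> \<T>" "x \<in> T" using facet_of_imp_subset x by auto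
  have "elt \<tau> T x = F T x"
    using m T r by (intro elt_extension affine_fun_continuous) (auto simp: triangle_mesh_def represents_def)
  then show "elt \<tau> T x *v outer_normal T e = F T x *v outer_normal T e" by simp
qed

lemma represents_edge_form:
  assumes m: "triangle_mesh \<T>" and r: "represents \<T> \<sigma> F" "represents \<T> \<tau> G" and e: "e \<in> interior_edges \<T>"
  shows "edge_integral e (\<lambda>x. edge_weight e * (tensor_jump \<T> e \<sigma> x \<bullet> tensor_jump \<T> e \<tau> x))
    = edge_mean e (\<lambda>x. field_jump \<T> F e x \<bullet> field_jump \<T> G e x)"
proof -
  obtain T k where k: "T \<in> \<T>" "k < 3" "e = side T k" by (rule interior_edge_side[OF m e])
  have d: "0 < diameter e" using m k edge_vec_nonzero by (simp add: diameter_side triangle_mesh_def)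
  have "edge_mean e (\<lambda>x. edge_weight e * (tensor_jump \<T> e \<sigma> x \<bullet> tensor_jump \<T> e \<tau> x))
    = edge_mean e (\<lambda>x. edge_weight e * (field_jump \<T> F e x \<bullet> field_jump \<T> G e x))"
    unfolding k(3) by (rule edge_mean_cong) (simp add: represents_tensor_jump[OF m r(1)] represents_tensor_jump[OF m r(2)])
  also have "\<dots> = edge_weight e * edge_mean e (\<lambda>x. field_jump \<T> F e x \<bullet> field_jump \<T> G e x)"
    by (simp add: edge_mean_def segment_mean_def case_prod_unfold Let_def)
  finally show ?thesis using d by (simp add: edge_integral_mean edge_weight_def)
qed

lemma represents_a_h:
  assumes d: "polygonal_domain \<Omega>" and c: "conforming_triangulation \<Omega> \<T>"
    and r: "represents \<T> \<sigma> F" "represents \<T> \<tau> G"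
  shows "a_h \<Omega> \<T> \<nu> \<sigma> \<tau> = 1 / \<nu> * field_form \<T> F G"
proof -
  note m = conforming_triangle_mesh[OF c]
  have "(LINT x:\<Omega>|lebesgue. deviator (\<sigma> x) \<bullet> deviator (\<tau> x)) = (\<Sum>T\<in>\<T>. LINT x:T|lborel. deviator (F T x) \<bullet> deviator (G T x))"
    using r by (intro domain_integral(2)[OF d c] continuous_intros continuous_on_deviator affine_fun_continuous)
      (auto simp: represents_def)
  then show ?thesis unfolding a_h_def field_form_def
    by (simp add: represents_edge_form[OF m r] distrib_left)
qed

lemma triangle_integral_const:
  assumes "oriented_triangle T"
  shows "(LINT x:T|lborel. c) = area T * (c::real)"
  using triangle_measure[OF assms] by (simp add: set_lebesgue_integral_def)

lemma piecewise_constant_integral: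
  assumes d: "polygonal_domain \<Omega>" and c: "conforming_triangulation \<Omega> \<T>"
    and f: "\<And>T x. T \<in> \<T> \<Longrightarrow> x \<in> interior T \<Longrightarrow> f x = (g T :: real)"
  shows "(LINT x:\<Omega>|lebesgue. f x) = (\<Sum>T\<in>\<T>. area T * g T)"
proof -
  have "(LINT x:\<Omega>|lebesgue. f x) = (\<Sum>T\<in>\<T>. LINT x:T|lborel. g T)"
    by (rule domain_integral(2)[OF d c continuous_on_const f])
  also have "\<dots> = (\<Sum>T\<in>\<T>. area T * g T)"
    using conforming_triangle_mesh[OF c] by (intro sum.cong refl triangle_integral_const) (simp add: triangle_mesh_def)
  finally show ?thesis .
qed

definition represents0 :: "mesh \<Rightarrow> (real^2 \<Rightarrow> 'b) \<Rightarrow> ((real^2) set \<Rightarrow> 'b) \<Rightarrow> bool" where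
  "represents0 \<T> v c \<longleftrightarrow> (\<forall>T\<in>\<T>. \<forall>x\<in>interior T. v x = c T)"

lemma represents_div_h:
  assumes "represents \<T> \<tau> F" "T \<in> \<T>" "x \<in> interior T"
  shows "div_h \<tau> x = affine_div (F T)"
  using assms by (intro div_h_affine[of _ T]) (auto simp: represents_def)

lemma represents_b_h:
  assumes d: "polygonal_domain \<Omega>" and c: "conforming_triangulation \<Omega> \<T>"
    and r: "represents \<T> \<tau> F" and v: "represents0 \<T> v w"
  shows "b_h \<Omega> \<tau> v = (\<Sum>T\<in>\<T>. area T * (w T \<bullet> affine_div (F T)))"
  unfolding b_h_def
  by (rule piecewise_constant_integral[OF d c]) (use v represents_div_h[OF r] in \<open>simp add: represents0_def\<close>)

lemma represents_nc_norm:
  assumes d: "polygonal_domain \<Omega>" and c: "conforming_triangulation \<Omega> \<T>"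
    and r: "represents \<T> \<tau> F" and v: "represents0 \<T> v w"
  shows "nc_norm \<Omega> \<T> \<nu> (\<tau>, v) = sqrt (1 / \<nu> * field_form \<T> F F
     + 1 / \<nu> * (\<Sum>T\<in>\<T>. area T * (norm (affine_div (F T)))\<^sup>2) + \<nu> * (\<Sum>T\<in>\<T>. area T * (norm (w T))\<^sup>2))"
proof -
  note m = conforming_triangle_mesh[OF c]
  have n: "(L2_norm \<Omega> f)\<^sup>2 = (LINT x:\<Omega>|lebesgue. (norm (f x))\<^sup>2)" for f :: "real^2 \<Rightarrow> 'c::euclidean_space"
    unfolding L2_norm_def set_lebesgue_integral_def
    by (rule real_sqrt_pow2, rule Bochner_Integration.integral_nonneg) simp
  have 1: "(L2_norm \<Omega> (div_h \<tau>))\<^sup>2 = (\<Sum>T\<in>\<T>. area T * (norm (affine_div (F T)))\<^sup>2)"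
    unfolding n by (rule piecewise_constant_integral[OF d c]) (simp add: represents_div_h[OF r])
  have 2: "(L2_norm \<Omega> v)\<^sup>2 = (\<Sum>T\<in>\<T>. area T * (norm (w T))\<^sup>2)"
    unfolding n by (rule piecewise_constant_integral[OF d c]) (use v in \<open>simp add: represents0_def\<close>)
  have 3: "(edge_L2_norm e (\<lambda>x. sqrt (edge_weight e) *\<^sub>R tensor_jump \<T> e \<tau> x))\<^sup>2
      = edge_integral e (\<lambda>x. edge_weight e * (tensor_jump \<T> e \<tau> x \<bullet> tensor_jump \<T> e \<tau> x))"
    if e: "e \<in> interior_edges \<T>" for e
  proof -
    obtain T k where k: "T \<in> \<T>" "k < 3" "e = side T k" by (rule interior_edge_side[OF m e])
    have w: "0 \<le> edge_weight e" by (simp add: edge_weight_def k(3) diameter_side)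
    have eq: "(norm (sqrt (edge_weight e) *\<^sub>R y))\<^sup>2 = edge_weight e * (y \<bullet> y)" for y :: "real^2"
      using w by (simp add: power_mult_distrib power2_norm_eq_inner)
    have ca: "continuous_on UNIV (F T)" if "T \<in> \<T>" for T
      using r that by (auto simp: represents_def affine_fun_continuous)
    have "0 \<le> edge_mean e (\<lambda>x. field_jump \<T> F e x \<bullet> field_jump \<T> F e x)"
      unfolding k(3) by (rule edge_mean_nonneg) (intro continuous_intros continuous_on_field_jump ca, simp_all)
    then show ?thesis
      unfolding edge_L2_norm_def eq represents_edge_form[OF m r r e] by (rule real_sqrt_pow2)
  qed
  have "1 / \<nu> * (L2_norm \<Omega> (\<lambda>x. deviator (\<tau> x)))\<^sup>2 + 1 / \<nu> * (\<Sum>e\<in>interior_edges \<T>.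
       (edge_L2_norm e (\<lambda>x. sqrt (edge_weight e) *\<^sub>R tensor_jump \<T> e \<tau> x))\<^sup>2) = a_h \<Omega> \<T> \<nu> \<tau> \<tau>"
    unfolding a_h_def n power2_norm_eq_inner[of "deviator _"] using 3 by simp
  then show ?thesis unfolding nc_norm_def 1 2 prod.case represents_a_h[OF d c r r, symmetric] by simp
qed

text \<open>
  The Crouzeix-Raviart condition.
\<close>
definition midpoint_continuous :: "mesh \<Rightarrow> ((real^2) set \<Rightarrow> real^2 \<Rightarrow> 'b) \<Rightarrow> bool" where
  "midpoint_continuous \<T> F \<longleftrightarrow> (\<forall>e\<in>interior_edges \<T>. \<forall>T\<in>\<T>. \<forall>T'\<in>\<T>. e facet_of T \<longrightarrow> e facet_of T' \<longrightarrow>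
     F T (edge_mid e) = F T' (edge_mid e))"

lemma represents_L2:
  assumes d: "polygonal_domain \<Omega>" and c: "conforming_triangulation \<Omega> \<T>" and r: "represents \<T> v G"
  shows "v \<in> L2_on \<Omega>"
proof -
  have O: "\<Omega> \<in> sets lebesgue" using d by (simp add: polygonal_domain_def borel_open)
  have ca: "continuous_on UNIV (G T)" if "T \<in> \<T>" for T
    using r that by (auto simp: represents_def affine_fun_continuous)
  have "set_integrable lebesgue \<Omega> v" "set_integrable lebesgue \<Omega> (\<lambda>x. (v x)\<^sup>2)"
    using r by (rule_tac F=G in domain_integral(1)[OF d c], auto intro!: ca simp: represents_def)
      (rule domain_integral(1)[OF d c, of "\<lambda>T x. (G T x)\<^sup>2"], auto intro!: ca continuous_intros simp: represents_def)
  then show ?thesis unfolding L2_on_def using O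
    by (auto simp: set_integrable_def integrable_restrict_space borel_measurable_restrict_space_iff dest: borel_measurable_integrable)
qed

text \<open>
  The jump is an affine multiple of the normal along the edge, so its integral is its length times the
  value at the midpoint.
\<close>
lemma CR_iff:
  assumes d: "polygonal_domain \<Omega>" and c: "conforming_triangulation \<Omega> \<T>" and r: "represents \<T> v G"
  shows "v \<in> CR \<Omega> \<T> \<longleftrightarrow> midpoint_continuous \<T> G"
proof -
  note m = conforming_triangle_mesh[OF c]
  have o: "oriented_triangle T" if "T \<in> \<T>" for T using m that by (simp add: triangle_mesh_def)
  have af: "affine_fun (G T)" if "T \<in> \<T>" for T using r that by (simp add: represents_def)
  have "\<exists>(a::real) (b::real^2). \<forall>x\<in>interior T. v x = a + b \<bullet> x" if T: "T \<in> \<T>" for T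
  proof -
    have l: "linear (\<lambda>x. G T x - G T 0)" using af[OF T] by (simp add: affine_fun_def)
    define w where "w = adjoint (\<lambda>x. G T x - G T 0) 1"
    have "v x = G T 0 + w \<bullet> x" if "x \<in> interior T" for x
    proof -
      have "w \<bullet> x = G T x - G T 0" using adjoint_works[OF l, of x 1] by (simp add: inner_commute w_def)
      then show ?thesis using r T that by (simp add: represents_def)
    qed
    then show ?thesis by blast
  qed
  moreover have "edge_integral e (jump \<T> e v) = 0 \<longleftrightarrow>
      (\<forall>T\<in>\<T>. \<forall>T'\<in>\<T>. e facet_of T \<longrightarrow> e facet_of T' \<longrightarrow> G T (edge_mid e) = G T' (edge_mid e))"
    if e: "e \<in> interior_edges \<T>" for e
  proof -
    obtain T k T' k' where N: "T \<noteq> T'" "{T \<in> \<T>. e facet_of T} = {T, T'}" "k < 3" "k' < 3" "e = side T k" "e = side T' k'"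
      "outer_normal T' e = - outer_normal T e" by (rule interior_edge_neighbours[OF m e])
    have T: "T \<in> \<T>" "T' \<in> \<T>" "e facet_of T" "e facet_of T'" using N(2) by auto
    define n where "n = outer_normal T e"
    have n: "n \<noteq> 0"
      using outer_normal_side[OF o[OF T(1)] N(3)] edge_vec_nonzero[OF o[OF T(1)] N(3)]
      unfolding n_def N(5) side_normal_def by (metis norm_rot norm_eq_zero scaleR_eq_0_iff divide_eq_0_iff zero_neq_one)
    have d: "0 < diameter e" using edge_vec_nonzero[OF o[OF T(1)] N(3)] by (simp add: N(5) diameter_side)
    define H where "H x = (G T x - G T' x) *\<^sub>R n" for x
    have "jump \<T> e v x = H x" if x: "x \<in> e" for x
    proof -
      have "elt v S x = G S x" if S: "S \<in> \<T>" "e facet_of S" for S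
        using S r x facet_of_imp_subset[OF S(2)]
        by (intro elt_extension[OF o[OF S(1)] affine_fun_continuous[OF af[OF S(1)]]]) (auto simp: represents_def)
      then have "jump \<T> e v x = G T x *\<^sub>R n + G T' x *\<^sub>R (- n)"
        unfolding jump_def N(2) using N(1,7) T by (simp add: n_def)
      then show ?thesis by (simp add: H_def algebra_simps)
    qed
    then have "edge_mean e (jump \<T> e v) = edge_mean e H" unfolding N(5) by (rule edge_mean_cong) (simp add: N(5))
    also have "\<dots> = H (edge_mid e)"
    proof -
      have "linear (\<lambda>x. ((G T x - G T 0) - (G T' x - G T' 0)) *\<^sub>R n)"
        using af[OF T(1)] af[OF T(2)] unfolding affine_fun_def
        by (intro linear_compose[OF linear_compose_sub linear_scaleR_left, unfolded o_def])
      then have "affine_fun H" unfolding affine_fun_def H_def by (simp add: algebra_simps)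
      then show ?thesis unfolding N(5) by (rule edge_mean_affine_fun)
    qed
    finally have "edge_integral e (jump \<T> e v) = diameter e *\<^sub>R ((G T (edge_mid e) - G T' (edge_mid e)) *\<^sub>R n)"
      by (simp add: edge_integral_mean H_def)
    then have "edge_integral e (jump \<T> e v) = 0 \<longleftrightarrow> G T (edge_mid e) = G T' (edge_mid e)" using d n by simp
    moreover have "S = T \<or> S = T'" if "S \<in> \<T>" "e facet_of S" for S using that N(2) by blast
    ultimately show ?thesis using T by metis
  qed
  ultimately show ?thesis unfolding CR_def midpoint_continuous_def using represents_L2[OF d c r] by auto
qed

lemma Sigma_h_iff:
  assumes d: "polygonal_domain \<Omega>" and c: "conforming_triangulation \<Omega> \<T>" and r: "represents \<T> \<tau> F"
  shows "\<tau> \<in> Sigma_h \<Omega> \<T> \<longleftrightarrow> midpoint_continuous \<T> F"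
proof -
  have "represents \<T> (\<lambda>x. \<tau> x $ i $ j) (\<lambda>T x. F T x $ i $ j)" for i j
  proof -
    have "linear (\<lambda>x. F T x $ i $ j - F T 0 $ i $ j)" if "T \<in> \<T>" for T
    proof -
      have "linear (\<lambda>x. F T x - F T 0)" using r that by (simp add: represents_def affine_fun_def)
      moreover have "linear (\<lambda>A :: real^2^2. A $ i $ j)" by (simp add: linear_iff)
      ultimately have "linear (\<lambda>x. (F T x - F T 0) $ i $ j)" by (rule linear_compose[unfolded o_def])
      then show ?thesis by simp
    qed
    then show ?thesis using r by (simp add: represents_def affine_fun_def)
  qed
  from CR_iff[OF d c this] show ?thesis
    unfolding Sigma_h_def midpoint_continuous_def by (simp only: mem_Collect_eq vec_eq_iff) blast
qed

lemma Sigma_h_represents: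
  assumes "\<tau> \<in> Sigma_h \<Omega> \<T>"
  obtains F where "represents \<T> \<tau> F"
proof -
  have "\<exists>G. affine_fun G \<and> (\<forall>x\<in>interior T. \<tau> x = G x)" if T: "T \<in> \<T>" for T
  proof -
    have "\<exists>p :: real \<times> (real^2). \<forall>x\<in>interior T. \<tau> x $ i $ j = fst p + snd p \<bullet> x" for i j
    proof -
      have "(\<lambda>x. \<tau> x $ i $ j) \<in> CR \<Omega> \<T>" using assms by (simp add: Sigma_h_def)
      then obtain a :: real and b :: "real^2" where "\<forall>x\<in>interior T. \<tau> x $ i $ j = a + b \<bullet> x"
        unfolding CR_def using T by blast
      then show ?thesis by (intro exI[of _ "(a, b)"]) simp
    qed
    then obtain p where p: "\<And>i j x. x \<in> interior T \<Longrightarrow> \<tau> x $ i $ j = fst (p i j) + snd (p i j :: real \<times> (real^2)) \<bullet> x"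
      by metis
    define G :: "real^2 \<Rightarrow> real^2^2" where "G x = (\<chi> i j. fst (p i j)) + (\<chi> i j. snd (p i j) \<bullet> x)" for x
    have "affine_fun G" unfolding G_def
      by (rule affine_funI) (simp add: linear_iff vec_eq_iff inner_add_right)
    moreover have "\<forall>x\<in>interior T. \<tau> x = G x" using p by (simp add: G_def vec_eq_iff)
    ultimately show ?thesis by blast
  qed
  then obtain F where "\<And>T. T \<in> \<T> \<Longrightarrow> affine_fun (F T) \<and> (\<forall>x\<in>interior T. \<tau> x = F T x)" by metis
  then show ?thesis using that[of F] by (simp add: represents_def)
qed

definition field_trace :: "mesh \<Rightarrow> ((real^2) set \<Rightarrow> real^2 \<Rightarrow> real^2^2) \<Rightarrow> real" where
  "field_trace \<T> F = (\<Sum>T\<in>\<T>. LINT x:T|lborel. trace (F T x))"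

lemma continuous_on_trace:
  assumes "continuous_on S (G :: real^2 \<Rightarrow> real^2^2)"
  shows "continuous_on S (\<lambda>x. trace (G x))"
  unfolding trace_def by (intro continuous_intros assms)

lemma Sigma_h0_iff:
  assumes d: "polygonal_domain \<Omega>" and c: "conforming_triangulation \<Omega> \<T>" and r: "represents \<T> \<tau> F"
  shows "\<tau> \<in> Sigma_h0 \<Omega> \<T> \<longleftrightarrow> midpoint_continuous \<T> F \<and> field_trace \<T> F = 0"
proof -
  have "(LINT x:\<Omega>|lebesgue. trace (\<tau> x)) = field_trace \<T> F"
    unfolding field_trace_def
    using r by (intro domain_integral(2)[OF d c] continuous_on_trace affine_fun_continuous) (auto simp: represents_def)
  then show ?thesis unfolding Sigma_h0_def using Sigma_h_iff[OF d c r] by simp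
qed

lemma field_trace_add:
  assumes m: "triangle_mesh \<T>"
    and c: "\<And>T. T \<in> \<T> \<Longrightarrow> continuous_on UNIV (F T)" "\<And>T. T \<in> \<T> \<Longrightarrow> continuous_on UNIV (G T)"
  shows "field_trace \<T> (\<lambda>T x. F T x + t *\<^sub>R G T x) = field_trace \<T> F + t * field_trace \<T> G"
proof -
  have "(LINT x:T|lborel. trace (F T x + t *\<^sub>R G T x)) = (LINT x:T|lborel. trace (F T x)) + t * (LINT x:T|lborel. trace (G T x))"
    if T: "T \<in> \<T>" for T
  proof -
    have o: "oriented_triangle T" using m T by (simp add: triangle_mesh_def)
    have i: "set_integrable lborel T (\<lambda>x. trace (F T x))" "set_integrable lborel T (\<lambda>x. t * trace (G T x))"
      by (rule triangle_integrable_elt[OF o], intro continuous_intros continuous_on_trace c T)+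
    have "trace (F T x + t *\<^sub>R G T x) = trace (F T x) + t * trace (G T x)" for x
      by (simp add: trace_def sum.distrib sum_distrib_left)
    then show ?thesis using set_integral_add(2)[OF i] by (simp only: set_integral_mult_right)
  qed
  then show ?thesis unfolding field_trace_def by (simp add: sum.distrib sum_distrib_left)
qed

lemma midpoint_continuous_add:
  "midpoint_continuous \<T> F \<Longrightarrow> midpoint_continuous \<T> G \<Longrightarrow> midpoint_continuous \<T> (\<lambda>T x. F T x + t *\<^sub>R G T x)"
  for F :: "(real^2) set \<Rightarrow> real^2 \<Rightarrow> real^2^2"
  unfolding midpoint_continuous_def by metis

section \<open>The lifted stress\<close>

text \<open>
  The affine field with midpoint values \<open>m\<close>; \<open>1 - 2 bary\<close> is the Crouzeix-Raviart basis function.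
\<close>
definition cr_field :: "(real^2) set \<Rightarrow> ((real^2) set \<Rightarrow> real^2) \<Rightarrow> real^2 \<Rightarrow> real^2" where
  "cr_field T m x = (\<Sum>k<3. (1 - 2 * bary T k x) *\<^sub>R m (side T k))"

lemma cr_field_diff:
  assumes T: "oriented_triangle T"
  shows "cr_field T m x - cr_field T m y = elt_grad T m (x - y)"
proof -
  have b: "(1 - 2 * bary T k x) - (1 - 2 * bary T k y) = (1 / area T) * (rot (edge_vec T k) \<bullet> (x - y))" for k
    using area_pos[OF T] by (simp add: bary_def inner_diff_right field_simps)
  have "cr_field T m x - cr_field T m y = (\<Sum>k<3. ((1 - 2 * bary T k x) - (1 - 2 * bary T k y)) *\<^sub>R m (side T k))"
    unfolding cr_field_def sum_subtractf[symmetric] by (simp only: scaleR_diff_left)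
  then show ?thesis unfolding b elt_grad_def by (simp only: scaleR_sum_right scaleR_scaleR)
qed

lemma elt_grad_direction:
  "elt_grad T m (u + v) = elt_grad T m u + elt_grad T m v" "elt_grad T m (c *\<^sub>R u) = c *\<^sub>R elt_grad T m u"
  by (simp_all add: elt_grad_def sum3 inner_add_right algebra_simps)

lemma cr_field_mid:
  assumes T: "oriented_triangle T" and j: "j < 3"
  shows "cr_field T m (edge_mid (side T j)) = m (side T j)"
proof -
  have "cr_field T m (edge_mid (side T j)) = (\<Sum>k<3. if k = j then m (side T j) else 0)"
    unfolding cr_field_def by (rule sum.cong[OF refl]) (auto simp: bary_edge_mid[OF T j])
  then show ?thesis using j by simp
qed

lemma cr_field_bound:
  assumes T: "oriented_triangle T" and x: "x \<in> T"
  shows "(norm (cr_field T m x))\<^sup>2 \<le> 3 * (\<Sum>k<3. (norm (m (side T k)))\<^sup>2)"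
proof -
  have "norm (cr_field T m x) \<le> (\<Sum>k<3. norm (m (side T k)))"
    unfolding cr_field_def
  proof (rule order_trans[OF norm_sum], rule sum_mono)
    fix k :: nat assume "k \<in> {..<3}"
    then have "\<bar>1 - 2 * bary T k x\<bar> \<le> 1" using bary_le_1[OF T x, of k] by auto
    then show "norm ((1 - 2 * bary T k x) *\<^sub>R m (side T k)) \<le> norm (m (side T k))"
      by (simp add: mult_left_le_one_le)
  qed
  then have "(norm (cr_field T m x))\<^sup>2 \<le> (\<Sum>k<3. norm (m (side T k)))\<^sup>2" by (intro power_mono) auto
  also have "\<dots> \<le> 3 * (\<Sum>k<3. (norm (m (side T k)))\<^sup>2)" by (rule square_sum3_le)
  finally show ?thesis .
qed

definition cr_tensor :: "(2 \<Rightarrow> (real^2) set \<Rightarrow> real^2) \<Rightarrow> (real^2) set \<Rightarrow> real^2 \<Rightarrow> real^2^2" where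
  "cr_tensor m T x = (\<chi> i. cr_field T (m i) x)"

lemma cr_tensor_affine:
  assumes T: "oriented_triangle T"
  shows "affine_fun (cr_tensor m T)"
proof -
  have "cr_tensor m T x - cr_tensor m T 0 = (\<chi> i. elt_grad T (m i) x)" for x
    using cr_field_diff[OF T, of _ x 0] by (simp add: cr_tensor_def vec_eq_iff)
  then show ?thesis unfolding affine_fun_def
    by (simp only:) (simp add: linear_iff elt_grad_direction vec_eq_iff)
qed

lemma cr_tensor_affine_div:
  assumes T: "oriented_triangle T"
  shows "affine_div (cr_tensor m T) $ i = elt_div T (m i)"
proof -
  have "affine_div (cr_tensor m T) $ i = (\<Sum>j\<in>UNIV. (cr_field T (m i) (axis j 1) - cr_field T (m i) 0) $ j)"
    by (simp add: affine_div_def cr_tensor_def)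
  also have "\<dots> = (\<Sum>j\<in>UNIV. elt_grad T (m i) (axis j 1) $ j)"
    by (simp only: cr_field_diff[OF T] diff_zero)
  also have "\<dots> = elt_div T (m i)"
    by (simp add: elt_grad_def elt_div_def sum_2 sum3 inner_axis axis_def inner_vec2 algebra_simps add_divide_distrib diff_divide_distrib)
  finally show ?thesis .
qed

lemma cr_tensor_midpoint_continuous:
  assumes m: "triangle_mesh \<T>"
  shows "midpoint_continuous \<T> (cr_tensor m)"
proof -
  have "cr_tensor m T (edge_mid e) = (\<chi> i. m i e)" if T: "T \<in> \<T>" "e facet_of T" for T e
  proof -
    have o: "oriented_triangle T" using m T by (simp add: triangle_mesh_def)
    obtain k where "k < 3" "e = side T k" using facet_of_triangle[OF o, of e] T(2) by blast
    then show ?thesis using cr_field_mid[OF o] by (simp add: cr_tensor_def)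
  qed
  then show ?thesis by (simp add: midpoint_continuous_def)
qed

text \<open>
  A squared slope as a function of the side as a set. Summing over the indices avoids inverting the
  map from indices to sides.
\<close>
definition side_slope2 :: "(real^2) set \<Rightarrow> ((real^2) set \<Rightarrow> real^2) \<Rightarrow> (real^2) set \<Rightarrow> real" where
  "side_slope2 T m e = (\<Sum>k<3. if side T k = e then (slope T k m)\<^sup>2 else 0)"

lemma slope_le_side_slope2: "k < 3 \<Longrightarrow> (slope T k m)\<^sup>2 \<le> side_slope2 T m (side T k)"
  unfolding side_slope2_def
  using member_le_sum[of k "{..<3}" "\<lambda>j. if side T j = side T k then (slope T j m)\<^sup>2 else 0"] by simp

lemma side_slope2_nonneg: "0 \<le> side_slope2 T m e"
  unfolding side_slope2_def by (intro sum_nonneg) simp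

text \<open>
  The field is affine, and points of a side are at most half its length away from its midpoint.
\<close>
lemma cr_field_on_side:
  assumes T: "oriented_triangle T" and k: "k < 3" and x: "x \<in> side T k"
  shows "\<bar>(cr_field T m x - m (side T k)) \<bullet> side_normal T k\<bar> \<le> \<bar>slope T k m\<bar> / 2"
proof -
  obtain t where t: "x = (1 - t) *\<^sub>R vtx T (k + 1) + t *\<^sub>R vtx T (k + 2)" "0 \<le> t" "t \<le> 1"
    using x by (auto simp: side_def closed_segment_def)
  have xm: "x - edge_mid (side T k) = (t - 1/2) *\<^sub>R edge_vec T k"
    by (simp add: t edge_mid_side midpoint_def edge_vec_def vec_eq_2 field_simps)
  have "cr_field T m x - m (side T k) = elt_grad T m (x - edge_mid (side T k))"
    using cr_field_diff[OF T, of m x "edge_mid (side T k)"] cr_field_mid[OF T k, of m] by simp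
  also have "\<dots> = (t - 1/2) *\<^sub>R elt_grad T m (edge_vec T k)" unfolding xm elt_grad_direction by (rule refl)
  finally have "(cr_field T m x - m (side T k)) \<bullet> side_normal T k = (t - 1/2) * slope T k m"
    by (simp add: side_normal_def slope_def inner_commute)
  moreover have "\<bar>t - 1/2\<bar> \<le> 1/2" unfolding abs_le_iff using t(2,3) by auto
  then have "\<bar>t - 1/2\<bar> * \<bar>slope T k m\<bar> \<le> (1/2) * \<bar>slope T k m\<bar>" by (rule mult_right_mono) simp
  ultimately show ?thesis by (simp add: abs_mult)
qed

text \<open>
  Subtracting the common value at the midpoint, the jump is a sum of two increments, one for each
  neighbour, and each is bounded by half a slope.
\<close>
lemma cr_tensor_jump:
  assumes m: "triangle_mesh \<T>" and e: "e \<in> interior_edges \<T>" and x: "x \<in> e"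
  shows "field_jump \<T> (cr_tensor y) e x \<bullet> field_jump \<T> (cr_tensor y) e x
    \<le> (\<Sum>i\<in>UNIV. \<Sum>T\<in>\<T>. side_slope2 T (y i) e)"
proof -
  have o: "oriented_triangle T" if "T \<in> \<T>" for T using m that by (simp add: triangle_mesh_def)
  have fin: "finite \<T>" using m by (simp add: triangle_mesh_def)
  obtain T k T' k' where N: "T \<noteq> T'" "{T \<in> \<T>. e facet_of T} = {T, T'}" "k < 3" "k' < 3" "e = side T k" "e = side T' k'"
    "outer_normal T' e = - outer_normal T e" by (rule interior_edge_neighbours[OF m e])
  have T: "T \<in> \<T>" "T' \<in> \<T>" using N(2) by auto
  have n: "outer_normal T e = side_normal T k" "outer_normal T' e = side_normal T' k'"
    using outer_normal_side[OF o[OF T(1)] N(3)] outer_normal_side[OF o[OF T(2)] N(4)] N(5,6) by simp_all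
  have comp: "(field_jump \<T> (cr_tensor y) e x $ i)\<^sup>2 \<le> (\<Sum>T\<in>\<T>. side_slope2 T (y i) e)" for i
  proof -
    define p where "p = (cr_field T (y i) x - y i e) \<bullet> side_normal T k"
    define q where "q = (cr_field T' (y i) x - y i e) \<bullet> side_normal T' k'"
    have pq: "\<bar>p\<bar> \<le> \<bar>slope T k (y i)\<bar> / 2" "\<bar>q\<bar> \<le> \<bar>slope T' k' (y i)\<bar> / 2"
      using cr_field_on_side[OF o[OF T(1)] N(3), of x "y i"] cr_field_on_side[OF o[OF T(2)] N(4), of x "y i"] x N(5,6)
      by (simp_all add: p_def q_def)
    have row: "(A *v v) $ i = A $ i \<bullet> v" for A :: "real^2^2" and v by (simp add: matrix_vector_mult_def inner_vec_def)
    have nn: "side_normal T' k' = - side_normal T k" using N(7) n by simp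
    have "field_jump \<T> (cr_tensor y) e x $ i = cr_field T (y i) x \<bullet> side_normal T k + cr_field T' (y i) x \<bullet> side_normal T' k'"
      unfolding field_jump_def N(2) using N(1) by (simp add: n row cr_tensor_def)
    also have "\<dots> = p + q" unfolding p_def q_def nn by (simp add: inner_diff_left)
    finally have "(field_jump \<T> (cr_tensor y) e x $ i)\<^sup>2 = (p + q)\<^sup>2" by simp
    also have "\<dots> \<le> (slope T k (y i))\<^sup>2 + (slope T' k' (y i))\<^sup>2"
    proof -
      have "p\<^sup>2 \<le> (\<bar>slope T k (y i)\<bar> / 2)\<^sup>2" "q\<^sup>2 \<le> (\<bar>slope T' k' (y i)\<bar> / 2)\<^sup>2"
        using pq by (simp_all add: abs_le_square_iff[symmetric])
      then have "4 * p\<^sup>2 \<le> (slope T k (y i))\<^sup>2" "4 * q\<^sup>2 \<le> (slope T' k' (y i))\<^sup>2" by (simp_all add: power_divide)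
      moreover have "(p + q)\<^sup>2 \<le> 2 * p\<^sup>2 + 2 * q\<^sup>2"
        using zero_le_power2[of "p - q"] by (simp add: power2_eq_square algebra_simps)
      ultimately show ?thesis using zero_le_power2[of p] zero_le_power2[of q] by linarith
    qed
    also have "\<dots> \<le> side_slope2 T (y i) e + side_slope2 T' (y i) e"
      using slope_le_side_slope2[OF N(3), of T "y i"] slope_le_side_slope2[OF N(4), of T' "y i"] N(5,6) by simp
    also have "\<dots> = (\<Sum>S\<in>{T, T'}. side_slope2 S (y i) e)" using N(1) by simp
    also have "\<dots> \<le> (\<Sum>S\<in>\<T>. side_slope2 S (y i) e)"
      using T fin by (intro sum_mono2) (auto simp: side_slope2_nonneg)
    finally show ?thesis .
  qed
  have "field_jump \<T> (cr_tensor y) e x \<bullet> field_jump \<T> (cr_tensor y) e x = (\<Sum>i\<in>UNIV. (field_jump \<T> (cr_tensor y) e x $ i)\<^sup>2)"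
    by (simp add: inner_vec_def power2_eq_square)
  also have "\<dots> \<le> (\<Sum>i\<in>UNIV. \<Sum>T\<in>\<T>. side_slope2 T (y i) e)" by (rule sum_mono[OF comp])
  finally show ?thesis .
qed

lemma finite_interior_edges:
  assumes m: "triangle_mesh \<T>"
  shows "finite (interior_edges \<T>)"
proof (rule finite_subset)
  show "interior_edges \<T> \<subseteq> (\<Union>T\<in>\<T>. side T ` {..<3})"
  proof
    fix e assume "e \<in> interior_edges \<T>"
    then obtain T k where "T \<in> \<T>" "k < 3" "e = side T k" by (rule interior_edge_side[OF m])
    then show "e \<in> (\<Union>T\<in>\<T>. side T ` {..<3})" by auto
  qed
  show "finite (\<Union>T\<in>\<T>. side T ` {..<3})" using m by (simp add: triangle_mesh_def)
qed

lemma sum_side_slope2: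
  assumes m: "triangle_mesh \<T>"
  shows "(\<Sum>e\<in>interior_edges \<T>. \<Sum>T\<in>\<T>. side_slope2 T y e) \<le> (\<Sum>T\<in>\<T>. \<Sum>k<3. (slope T k y)\<^sup>2)"
proof -
  note fin = finite_interior_edges[OF m]
  have "(\<Sum>e\<in>interior_edges \<T>. \<Sum>T\<in>\<T>. side_slope2 T y e) = (\<Sum>T\<in>\<T>. \<Sum>e\<in>interior_edges \<T>. side_slope2 T y e)"
    by (rule sum.swap)
  also have "\<dots> = (\<Sum>T\<in>\<T>. \<Sum>k<3. \<Sum>e\<in>interior_edges \<T>. if side T k = e then (slope T k y)\<^sup>2 else 0)"
    unfolding side_slope2_def by (subst (2) sum.swap) (rule refl)
  also have "\<dots> \<le> (\<Sum>T\<in>\<T>. \<Sum>k<3. (slope T k y)\<^sup>2)"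
    using fin by (intro sum_mono) (simp add: sum.delta)
  finally show ?thesis .
qed

lemma deviator_le: "deviator A \<bullet> deviator A \<le> A \<bullet> A"
proof -
  have "deviator A \<bullet> deviator A = A \<bullet> A - (trace A)\<^sup>2 / 2"
    by (simp add: deviator_def inner_vec_def sum_2 trace_def mat_def power2_eq_square field_simps)
  then show ?thesis by simp
qed

text \<open>
  The energy bounds the volume part with the factor \<open>9\<close>: the basis functions are at most \<open>1\<close> in absolute value, the
  square of a sum of three is at most three times the sum of squares, and the energy has the weight
  \<open>area / 3\<close>.
\<close>
lemma cr_tensor_form:
  assumes m: "triangle_mesh \<T>"
  shows "field_form \<T> (cr_tensor y) (cr_tensor y) \<le> 9 * (\<Sum>i\<in>UNIV. energy \<T> (y i))"
proof -
  have o: "oriented_triangle T" if "T \<in> \<T>" for T using m that by (simp add: triangle_mesh_def)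
  have ca: "continuous_on UNIV (cr_tensor y T)" if "T \<in> \<T>" for T
    using cr_tensor_affine[OF o[OF that]] by (rule affine_fun_continuous)
  define s where "s T = (\<Sum>i\<in>UNIV. area T / 3 * (\<Sum>k<3. (norm (y i (side T k)))\<^sup>2))" for T
  define q where "q T = (\<Sum>i\<in>(UNIV :: 2 set). \<Sum>k<3. (slope T k (y i))\<^sup>2)" for T
  have vol: "(LINT x:T|lborel. deviator (cr_tensor y T x) \<bullet> deviator (cr_tensor y T x)) \<le> 9 * s T" if T: "T \<in> \<T>" for T
  proof -
    have "(LINT x:T|lborel. deviator (cr_tensor y T x) \<bullet> deviator (cr_tensor y T x))
      \<le> (LINT x:T|lborel. (\<Sum>i\<in>UNIV. 3 * (\<Sum>k<3. (norm (y i (side T k)))\<^sup>2)))"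
    proof (rule set_integral_mono)
      fix x assume x: "x \<in> T"
      have "deviator (cr_tensor y T x) \<bullet> deviator (cr_tensor y T x) \<le> cr_tensor y T x \<bullet> cr_tensor y T x" by (rule deviator_le)
      also have "\<dots> = (\<Sum>i\<in>UNIV. (norm (cr_field T (y i) x))\<^sup>2)"
        by (subst inner_vec_def) (simp add: cr_tensor_def power2_norm_eq_inner)
      also have "\<dots> \<le> (\<Sum>i\<in>UNIV. 3 * (\<Sum>k<3. (norm (y i (side T k)))\<^sup>2))"
        by (rule sum_mono[OF cr_field_bound[OF o[OF T] x]])
      finally show "deviator (cr_tensor y T x) \<bullet> deviator (cr_tensor y T x) \<le> (\<Sum>i\<in>UNIV. 3 * (\<Sum>k<3. (norm (y i (side T k)))\<^sup>2))" .
    qed (rule triangle_integrable_elt[OF o[OF T]], intro continuous_intros continuous_on_deviator ca T)+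
    also have "\<dots> = 9 * s T" unfolding triangle_integral_const[OF o[OF T]] s_def by (simp add: sum_2 field_simps)
    finally show ?thesis .
  qed
  have edge: "edge_mean e (\<lambda>x. field_jump \<T> (cr_tensor y) e x \<bullet> field_jump \<T> (cr_tensor y) e x)
      \<le> (\<Sum>i\<in>UNIV. \<Sum>T\<in>\<T>. side_slope2 T (y i) e)" if e: "e \<in> interior_edges \<T>" for e
  proof -
    obtain T k where k: "T \<in> \<T>" "k < 3" "e = side T k" by (rule interior_edge_side[OF m e])
    have "edge_mean (side T k) (\<lambda>x. field_jump \<T> (cr_tensor y) e x \<bullet> field_jump \<T> (cr_tensor y) e x)
      \<le> edge_mean (side T k) (\<lambda>x. (\<Sum>i\<in>UNIV. \<Sum>T\<in>\<T>. side_slope2 T (y i) e))"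
    proof (rule edge_mean_mono)
      show "continuous_on UNIV (\<lambda>x. field_jump \<T> (cr_tensor y) e x \<bullet> field_jump \<T> (cr_tensor y) e x)"
        by (intro continuous_intros continuous_on_field_jump ca)
    qed (use cr_tensor_jump[OF m e] k(3) in auto)
    then show ?thesis unfolding edge_mean_const using k(3) by simp
  qed
  have "field_form \<T> (cr_tensor y) (cr_tensor y) \<le> (\<Sum>T\<in>\<T>. 9 * s T) + (\<Sum>e\<in>interior_edges \<T>. \<Sum>i\<in>UNIV. \<Sum>T\<in>\<T>. side_slope2 T (y i) e)"
    unfolding field_form_def by (intro add_mono sum_mono vol edge)
  also have "(\<Sum>e\<in>interior_edges \<T>. \<Sum>i\<in>UNIV. \<Sum>T\<in>\<T>. side_slope2 T (y i) e)
      = (\<Sum>i\<in>UNIV. \<Sum>e\<in>interior_edges \<T>. \<Sum>T\<in>\<T>. side_slope2 T (y i) e)" by (rule sum.swap)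
  also have "\<dots> \<le> (\<Sum>i\<in>UNIV. \<Sum>T\<in>\<T>. \<Sum>k<3. (slope T k (y i))\<^sup>2)" by (rule sum_mono[OF sum_side_slope2[OF m]])
  also have "\<dots> = (\<Sum>T\<in>\<T>. q T)" unfolding q_def by (rule sum.swap)
  also have "\<dots> \<le> (\<Sum>T\<in>\<T>. 9 * q T)" by (intro sum_mono) (auto simp: q_def intro!: sum_nonneg)
  also have "(\<Sum>T\<in>\<T>. 9 * s T) + (\<Sum>T\<in>\<T>. 9 * q T) = 9 * (\<Sum>T\<in>\<T>. q T + s T)"
    by (simp add: sum.distrib sum_distrib_left)
  also have "(\<Sum>T\<in>\<T>. q T + s T) = (\<Sum>i\<in>UNIV. energy \<T> (y i))"
    unfolding energy_def by (subst sum.swap) (simp add: q_def s_def sum.distrib)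
  finally show ?thesis by simp
qed

lemma energy_nonneg:
  assumes m: "triangle_mesh \<T>"
  shows "0 \<le> energy \<T> y"
  unfolding energy_def using m area_pos
  by (intro sum_nonneg add_nonneg_nonneg mult_nonneg_nonneg) (auto simp: triangle_mesh_def intro: less_imp_le)

lemma field_jump_const:
  assumes m: "triangle_mesh \<T>" and e: "e \<in> interior_edges \<T>"
  shows "field_jump \<T> (\<lambda>T x. A) e x = 0"
proof -
  obtain T k T' k' where N: "T \<noteq> T'" "{T \<in> \<T>. e facet_of T} = {T, T'}"
    "outer_normal T' e = - outer_normal T e" by (rule interior_edge_neighbours[OF m e])
  have "A *v (- v) = - (A *v v)" for v by (simp add: matrix_vector_mult_def vec_eq_iff sum_negf)
  then show ?thesis unfolding field_jump_def N(2) using N(1,3) by simp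
qed

text \<open>
  A multiple of the identity changes neither deviators nor jumps. This permits the normalisation of the trace.
\<close>
lemma field_form_add_identity:
  assumes m: "triangle_mesh \<T>"
  shows "field_form \<T> (\<lambda>T x. F T x + t *\<^sub>R mat 1) (\<lambda>T x. F T x + t *\<^sub>R mat 1) = field_form \<T> F F"
proof -
  have "deviator (mat 1) = 0" by (simp add: deviator_def trace_def mat_def sum_2)
  then have "deviator (A + t *\<^sub>R mat 1) = deviator A" for A by (simp add: deviator_add)
  moreover have "field_jump \<T> (\<lambda>T x. F T x + t *\<^sub>R mat 1) e x = field_jump \<T> F e x" if "e \<in> interior_edges \<T>" for e x
    using field_jump_const[OF m that, of "mat 1" x] field_jump_add[of \<T> F t "\<lambda>T x. mat 1" e x] by simp
  ultimately show ?thesis unfolding field_form_def by simp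
qed

text \<open>
  Each row is a lifting of one component of \<open>w\<close>; a multiple of the identity is added to make the mean of
  the trace zero.
\<close>
theorem stress_lifting:
  assumes m: "triangle_mesh \<T>" and ne: "\<T> \<noteq> {}" and L: "1 \<le> L"
    and box: "\<And>T z. T \<in> \<T> \<Longrightarrow> z \<in> T \<Longrightarrow> \<bar>z $ 1\<bar> \<le> L - 1 \<and> \<bar>z $ 2\<bar> \<le> L - 1"
  obtains G where "\<forall>T\<in>\<T>. affine_fun (G T)" "midpoint_continuous \<T> G" "field_trace \<T> G = 0"
    "field_form \<T> G G \<le> 9 * (\<Sum>T\<in>\<T>. area T * (w T \<bullet> affine_div (G T)))"
    "(\<Sum>T\<in>\<T>. area T * (norm (affine_div (G T)))\<^sup>2) \<le> (\<Sum>T\<in>\<T>. area T * (w T \<bullet> affine_div (G T)))"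
    "(\<Sum>T\<in>\<T>. area T * (w T \<bullet> affine_div (G T))) \<le> (\<Sum>T\<in>\<T>. area T * (norm (w T))\<^sup>2)"
    "(\<Sum>T\<in>\<T>. area T * (norm (w T))\<^sup>2) \<le> 2 * (residual_const L + 1) * (\<Sum>T\<in>\<T>. area T * (w T \<bullet> affine_div (G T)))"
proof -
  have o: "oriented_triangle T" if "T \<in> \<T>" for T using m that by (simp add: triangle_mesh_def)
  have fin: "finite \<T>" using m by (simp add: triangle_mesh_def)
  define b where "b i y = (\<Sum>T\<in>\<T>. area T * (w T $ i * elt_div T y))" for i :: 2 and y
  define D where "D y = (\<Sum>T\<in>\<T>. area T * (elt_div T y)\<^sup>2)" for y
  define S where "S i = (\<Sum>T\<in>\<T>. area T * (w T $ i)\<^sup>2)" for i :: 2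
  have "\<exists>y. energy \<T> y + D y = b i y \<and> b i y \<le> S i \<and> S i \<le> 2 * (residual_const L + 1) * b i y" for i :: 2
  proof -
    obtain y where "energy \<T> y + (\<Sum>T\<in>\<T>. area T * (elt_div T y)\<^sup>2) = (\<Sum>T\<in>\<T>. area T * (w T $ i * elt_div T y))"
      "(\<Sum>T\<in>\<T>. area T * (w T $ i * elt_div T y)) \<le> (\<Sum>T\<in>\<T>. area T * (w T $ i)\<^sup>2)"
      "(\<Sum>T\<in>\<T>. area T * (w T $ i)\<^sup>2) \<le> 2 * (residual_const L + 1) * (\<Sum>T\<in>\<T>. area T * (w T $ i * elt_div T y))"
      by (rule discrete_lifting[OF m L box, where u="\<lambda>T. w T $ i"])
    then show ?thesis unfolding D_def b_def S_def by blast
  qed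
  then have "\<forall>i. \<exists>y. energy \<T> y + D y = b i y \<and> b i y \<le> S i \<and> S i \<le> 2 * (residual_const L + 1) * b i y" by blast
  from choice[OF this] obtain y where
    y: "\<forall>i. energy \<T> (y i) + D (y i) = b i (y i) \<and> b i (y i) \<le> S i \<and> S i \<le> 2 * (residual_const L + 1) * b i (y i)" ..
  \<comment> \<open>The trace of the identity is 2.\<close>
  define c where "c = - field_trace \<T> (cr_tensor y) / (2 * (\<Sum>T\<in>\<T>. area T))"
  define G where "G = (\<lambda>T x. cr_tensor y T x + c *\<^sub>R mat 1)"
  have Ap: "0 < (\<Sum>T\<in>\<T>. area T)" using fin ne area_pos[OF o] by (intro sum_pos) auto
  have af: "affine_fun (G T)" if "T \<in> \<T>" for T
    unfolding G_def by (rule affine_fun_add[OF cr_tensor_affine[OF o[OF that]] affine_fun_const])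
  have mc: "midpoint_continuous \<T> G"
    unfolding G_def by (rule midpoint_continuous_add[OF cr_tensor_midpoint_continuous[OF m]]) (simp add: midpoint_continuous_def)
  have tr: "field_trace \<T> G = 0"
  proof -
    have "field_trace \<T> (\<lambda>T x. mat 1) = (\<Sum>T\<in>\<T>. area T * 2)"
      unfolding field_trace_def by (rule sum.cong[OF refl]) (simp add: triangle_integral_const[OF o] trace_def mat_def sum_2)
    moreover have "field_trace \<T> G = field_trace \<T> (cr_tensor y) + c * field_trace \<T> (\<lambda>T x. mat 1)"
      unfolding G_def by (rule field_trace_add[OF m]) (auto intro: affine_fun_continuous cr_tensor_affine o)
    ultimately show ?thesis using Ap by (simp add: c_def sum_distrib_right[symmetric])
  qed
  have gd: "affine_div (G T) $ i = elt_div T (y i)" if "T \<in> \<T>" for T i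
    using cr_tensor_affine_div[OF o[OF that], of y i] affine_div_add[of "cr_tensor y T" c "\<lambda>x. mat 1"] by (simp add: G_def)
  have ip: "(\<Sum>T\<in>\<T>. area T * (w T \<bullet> affine_div (G T))) = (\<Sum>i\<in>UNIV. b i (y i))"
  proof -
    have "(\<Sum>T\<in>\<T>. area T * (w T \<bullet> affine_div (G T))) = (\<Sum>T\<in>\<T>. \<Sum>i\<in>UNIV. area T * (w T $ i * elt_div T (y i)))"
      by (rule sum.cong[OF refl]) (simp add: inner_vec_def gd sum_distrib_left)
    also have "\<dots> = (\<Sum>i\<in>UNIV. b i (y i))" unfolding b_def by (rule sum.swap)
    finally show ?thesis .
  qed
  have dd: "(\<Sum>T\<in>\<T>. area T * (norm (affine_div (G T)))\<^sup>2) = (\<Sum>i\<in>UNIV. D (y i))"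
  proof -
    have "(\<Sum>T\<in>\<T>. area T * (norm (affine_div (G T)))\<^sup>2) = (\<Sum>T\<in>\<T>. \<Sum>i\<in>UNIV. area T * (elt_div T (y i))\<^sup>2)"
      unfolding power2_norm_eq_inner inner_vec_def
      by (rule sum.cong[OF refl]) (simp add: gd sum_distrib_left power2_eq_square)
    also have "\<dots> = (\<Sum>i\<in>UNIV. D (y i))" unfolding D_def by (rule sum.swap)
    finally show ?thesis .
  qed
  have ss: "(\<Sum>T\<in>\<T>. area T * (norm (w T))\<^sup>2) = (\<Sum>i\<in>UNIV. S i)"
  proof -
    have "(\<Sum>T\<in>\<T>. area T * (norm (w T))\<^sup>2) = (\<Sum>T\<in>\<T>. \<Sum>i\<in>UNIV. area T * (w T $ i)\<^sup>2)"
      unfolding power2_norm_eq_inner inner_vec_def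
      by (rule sum.cong[OF refl]) (simp add: sum_distrib_left power2_eq_square)
    also have "\<dots> = (\<Sum>i\<in>UNIV. S i)" unfolding S_def by (rule sum.swap)
    finally show ?thesis .
  qed
  have D0: "0 \<le> D (y i)" for i unfolding D_def using area_pos[OF o] by (intro sum_nonneg mult_nonneg_nonneg) (auto intro: less_imp_le)
  have e0: "0 \<le> energy \<T> (y i)" for i by (rule energy_nonneg[OF m])
  have "field_form \<T> G G \<le> 9 * (\<Sum>i\<in>UNIV. b i (y i))"
  proof -
    have "field_form \<T> G G = field_form \<T> (cr_tensor y) (cr_tensor y)" unfolding G_def by (rule field_form_add_identity[OF m])
    also have "\<dots> \<le> 9 * (\<Sum>i\<in>UNIV. energy \<T> (y i))" by (rule cr_tensor_form[OF m])
    also have "\<dots> \<le> 9 * (\<Sum>i\<in>UNIV. b i (y i))"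
    proof (intro mult_left_mono sum_mono)
      fix i :: 2 show "energy \<T> (y i) \<le> b i (y i)" using y D0[of i] by (metis add_increasing2 order_refl)
    qed simp
    finally show ?thesis .
  qed
  moreover have "(\<Sum>i\<in>UNIV. D (y i)) \<le> (\<Sum>i\<in>UNIV. b i (y i))"
  proof (rule sum_mono)
    fix i :: 2 show "D (y i) \<le> b i (y i)" using y e0[of i] by (metis add_increasing order_refl)
  qed
  moreover have "(\<Sum>i\<in>UNIV. b i (y i)) \<le> (\<Sum>i\<in>UNIV. S i)" using y by (intro sum_mono) blast
  moreover have "(\<Sum>i\<in>UNIV. S i) \<le> 2 * (residual_const L + 1) * (\<Sum>i\<in>UNIV. b i (y i))"
    unfolding sum_distrib_left using y by (intro sum_mono) blast
  ultimately show ?thesis by (intro that[of G] ballI af mc tr) (unfold ip dd ss)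
qed

section \<open>The inf-sup condition\<close>

text \<open>
  A nonempty open set is not a null set.
\<close>
lemma open_AE_empty:
  fixes U :: "(real^2) set"
  assumes U: "open U" "U \<subseteq> \<Omega>" and O: "\<Omega> \<in> sets lebesgue" and ae: "AE x in lebesgue_on \<Omega>. x \<notin> U"
  shows "U = {}"
proof -
  have "AE x in lebesgue. x \<in> \<Omega> \<longrightarrow> x \<notin> U" using ae O by (simp add: AE_restrict_space_iff)
  then have "AE x in lebesgue. x \<notin> U" using U(2) by (auto elim: eventually_mono)
  moreover have "U \<in> sets lebesgue" using U(1) by (simp add: borel_open)
  ultimately have "U \<in> null_sets lebesgue" using AE_iff_null_sets by blast
  then show ?thesis using open_not_negligible[OF U(1)] by (auto simp: negligible_iff_null_sets)
qed

text \<open>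
  If the pair vanishes almost everywhere, its affine functions vanish on the interiors of the elements, so
  the pair is also represented by zero functions and its norm is zero.
\<close>
lemma nonzero_pair_if_norm:
  assumes d: "polygonal_domain \<Omega>" and c: "conforming_triangulation \<Omega> \<T>"
    and r: "represents \<T> \<tau> F" and v: "represents0 \<T> v w" and nz: "nc_norm \<Omega> \<T> \<nu> (\<tau>, v) \<noteq> 0"
  shows "nonzero_pair \<Omega> (\<tau>, v)"
proof (rule ccontr)
  assume "\<not> nonzero_pair \<Omega> (\<tau>, v)"
  then have ae: "AE x in lebesgue_on \<Omega>. \<tau> x = 0 \<and> v x = 0" by (simp add: nonzero_pair_def)
  have O: "\<Omega> \<in> sets lebesgue" using d by (simp add: polygonal_domain_def borel_open)
  have z: "{x \<in> interior T. F T x \<noteq> 0} = {} \<and> {x \<in> interior T. w T \<noteq> 0} = {}" if T: "T \<in> \<T>" for T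
  proof
    have sub: "interior T \<subseteq> \<Omega>" by (rule triangulation_covers(1)[OF d c T])
    have "continuous_on (interior T) (F T)" using r T by (auto simp: represents_def affine_fun_continuous)
    then have "open {x \<in> interior T. F T x \<noteq> 0}"
      using continuous_open_preimage[of "interior T" "F T" "- {0}"]
      by (simp add: vimage_def Int_def open_Compl)
    then show "{x \<in> interior T. F T x \<noteq> 0} = {}"
    proof (rule open_AE_empty[OF _ _ O])
      show "AE x in lebesgue_on \<Omega>. x \<notin> {x \<in> interior T. F T x \<noteq> 0}"
        using ae by eventually_elim (use r T in \<open>auto simp: represents_def\<close>)
    qed (use sub in blast)
    show "{x \<in> interior T. w T \<noteq> 0} = {}"
    proof (rule open_AE_empty[OF _ _ O])
      show "AE x in lebesgue_on \<Omega>. x \<notin> {x \<in> interior T. w T \<noteq> 0}"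
        using ae by eventually_elim (use v T in \<open>auto simp: represents0_def\<close>)
    qed (cases "w T = 0", use sub in auto)
  qed
  have r0: "represents \<T> \<tau> (\<lambda>T x. 0)" using r z by (auto simp: represents_def)
  have v0: "represents0 \<T> v (\<lambda>T. 0)" using v z by (auto simp: represents0_def)
  have "field_jump \<T> (\<lambda>T x. 0) e x = 0" for e x unfolding field_jump_def by simp
  then have "field_form \<T> (\<lambda>T x. 0) (\<lambda>T x. 0) = 0"
    by (simp add: field_form_def deviator_def trace_def edge_mean_def segment_mean_def case_prod_unfold Let_def)
  then have "nc_norm \<Omega> \<T> \<nu> (\<tau>, v) = 0" using represents_nc_norm[OF d c r0 v0] by simp
  then show False using nz by simp
qed

lemma norm_add_scaleR_square:
  "(norm (x + s *\<^sub>R y))\<^sup>2 = (norm x)\<^sup>2 + 2 * s * (x \<bullet> y) + s\<^sup>2 * (norm (y :: real^2))\<^sup>2"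
  unfolding power2_norm_eq_inner by (simp add: inner_add_left inner_add_right inner_commute power2_eq_square algebra_simps)

lemma weighted_norm_square_expand:
  fixes x y :: "'i \<Rightarrow> real^2"
  shows "(\<Sum>T\<in>\<T>. a T * (norm (x T + s *\<^sub>R y T))\<^sup>2)
    = (\<Sum>T\<in>\<T>. a T * (norm (x T))\<^sup>2) + 2 * s * (\<Sum>T\<in>\<T>. a T * (x T \<bullet> y T)) + s\<^sup>2 * (\<Sum>T\<in>\<T>. a T * (norm (y T))\<^sup>2)"
  unfolding norm_add_scaleR_square by (simp add: sum.distrib sum_distrib_left algebra_simps)

lemma field_form_expand:
  assumes m: "triangle_mesh \<T>"
    and c: "\<And>T. T \<in> \<T> \<Longrightarrow> continuous_on UNIV (F T)" "\<And>T. T \<in> \<T> \<Longrightarrow> continuous_on UNIV (G T)"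
  shows "field_form \<T> (\<lambda>T x. F T x + t *\<^sub>R G T x) (\<lambda>T x. F T x + t *\<^sub>R G T x)
    = field_form \<T> F F + 2 * t * field_form \<T> F G + t\<^sup>2 * field_form \<T> G G"
proof -
  define H where "H = (\<lambda>T x. F T x + t *\<^sub>R G T x)"
  have cH: "continuous_on UNIV (H T)" if "T \<in> \<T>" for T unfolding H_def by (intro continuous_intros c that)
  have "field_form \<T> H H = field_form \<T> H F + t * field_form \<T> H G"
    using field_form_add[where t=t and F=H and G=F and H=G, OF m cH c(1) c(2)] unfolding H_def[symmetric] by simp
  also have "field_form \<T> H F = field_form \<T> F F + t * field_form \<T> F G"
    using field_form_add[where t=t and F=F and G=F and H=G, OF m c(1) c(1) c(2)] unfolding H_def[symmetric] by (simp only: field_form_commute[of \<T> H F])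
  also have "field_form \<T> H G = field_form \<T> F G + t * field_form \<T> G G"
    using field_form_add[where t=t and F=G and G=F and H=G, OF m c(2) c(1) c(2)] unfolding H_def[symmetric] field_form_commute[of \<T> G F]
    by (simp only: field_form_commute[of \<T> H G])
  finally show ?thesis unfolding H_def[symmetric] by (simp add: power2_eq_square algebra_simps)
qed

text \<open>
  A nonnegative affine function on the real line is constant.
\<close>
lemma affine_in_cross_term:
  fixes A B :: real
  assumes "\<And>s. 0 \<le> A + 2 * s * B"
  shows "B = 0"
proof (rule ccontr)
  assume B: "B \<noteq> 0"
  have "0 \<le> A + 2 * (- (A + 1) / (2 * B)) * B" by (rule assms)
  also have "\<dots> = - 1" using B by (simp add: field_simps)
  finally show False by simp
qed

text \<open>
  With \<open>A\<close>, \<open>D\<close> and \<open>S\<close> the squares of the deviator and jump part, the divergence and \<open>u\<close>, and with \<open>b\<close> the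
  pairing of \<open>u\<close> with the lifted stress \<open>G\<close>, the test pair \<open>(\<sigma> + t G, - u + div \<sigma> / \<nu>)\<close> gives
  \<open>(A + t a(\<sigma>, G) + D) / \<nu> + t b\<close>; the terms \<open>b_h(\<sigma>, u)\<close> cancel. The mixed term is absorbed by
  Young's inequality.
\<close>
lemma inf_sup_on_mesh:
  assumes d: "polygonal_domain \<Omega>" and c: "conforming_triangulation \<Omega> \<T>"
    and L: "1 \<le> L" and box: "\<And>T z. T \<in> \<T> \<Longrightarrow> z \<in> T \<Longrightarrow> \<bar>z $ 1\<bar> \<le> L - 1 \<and> \<bar>z $ 2\<bar> \<le> L - 1"
    and \<nu>: "0 < \<nu>" and \<sigma>: "\<sigma> \<in> Sigma_h0 \<Omega> \<T>" and u: "u \<in> V_h \<T>"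
  obtains p where "p \<in> Sigma_h0 \<Omega> \<T> \<times> V_h \<T>" "nonzero_pair \<Omega> p"
    "1 / (72 * (residual_const L + 1)) * nc_norm \<Omega> \<T> \<nu> (\<sigma>, u) \<le> B_nc \<Omega> \<T> \<nu> (\<sigma>, u) p / nc_norm \<Omega> \<T> \<nu> p"
proof -
  note m = conforming_triangle_mesh[OF c]
  have o: "oriented_triangle T" if "T \<in> \<T>" for T using m that by (simp add: triangle_mesh_def)
  have fin: "finite \<T>" using m by (simp add: triangle_mesh_def)
  have ne: "\<T> \<noteq> {}" using d c closure_subset[of \<Omega>] by (auto simp: polygonal_domain_def conforming_triangulation_def)
  have A0: "0 \<le> area T" if "T \<in> \<T>" for T using area_pos[OF o[OF that]] by simp
  have \<sigma>h: "\<sigma> \<in> Sigma_h \<Omega> \<T>" using \<sigma> by (simp add: Sigma_h0_def)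
  obtain F where F: "represents \<T> \<sigma> F" by (rule Sigma_h_represents[OF \<sigma>h])
  have F': "midpoint_continuous \<T> F" "field_trace \<T> F = 0" using Sigma_h0_iff[OF d c F] \<sigma> by auto
  have cF: "continuous_on UNIV (F T)" if "T \<in> \<T>" for T using F that by (auto simp: represents_def affine_fun_continuous)
  have "\<forall>T\<in>\<T>. \<exists>k. \<forall>x\<in>interior T. u x = k" using u by (simp add: V_h_def)
  from bchoice[OF this] obtain w where "\<forall>T\<in>\<T>. \<forall>x\<in>interior T. u x = w T" ..
  then have w: "represents0 \<T> u w" by (simp add: represents0_def)
  define A where "A = field_form \<T> F F"
  define D where "D = (\<Sum>T\<in>\<T>. area T * (norm (affine_div (F T)))\<^sup>2)"
  define S where "S = (\<Sum>T\<in>\<T>. area T * (norm (w T))\<^sup>2)"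
  define n2 where "n2 = 1 / \<nu> * A + 1 / \<nu> * D + \<nu> * S"
  have A: "0 \<le> A" unfolding A_def by (rule field_form_nonneg[OF m cF])
  have D: "0 \<le> D" unfolding D_def by (intro sum_nonneg mult_nonneg_nonneg A0) auto
  have S: "0 \<le> S" unfolding S_def by (intro sum_nonneg mult_nonneg_nonneg A0) auto
  have parts: "0 \<le> 1 / \<nu> * A" "0 \<le> 1 / \<nu> * D" "0 \<le> \<nu> * S" using A D S \<nu> by simp_all
  have n2: "nc_norm \<Omega> \<T> \<nu> (\<sigma>, u) = sqrt n2"
    unfolding represents_nc_norm[OF d c F w] n2_def A_def D_def S_def by (rule refl)
  have K: "0 \<le> residual_const L" by (rule residual_const_nonneg[OF L])
  have Vh: "v \<in> V_h \<T>" if "represents0 \<T> v z" for v z using that by (auto simp: V_h_def represents0_def)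
  show ?thesis
  proof (cases "n2 = 0")
    case True
    then have "1 / \<nu> * D = 0" using parts unfolding n2_def by linarith
    then have "D = 0" using \<nu> by simp
    then have "\<forall>T\<in>\<T>. area T * (norm (affine_div (F T)))\<^sup>2 = 0"
      unfolding D_def by (subst (asm) sum_nonneg_eq_0_iff) (use fin A0 in auto)
    then have g0: "affine_div (F T) = 0" if "T \<in> \<T>" for T using area_pos[OF o[OF that]] that by auto
    define v :: "real^2 \<Rightarrow> real^2" where "v x = axis 1 1" for x
    have r0: "represents \<T> (\<lambda>x. 0) (\<lambda>T x. 0 :: real^2^2)" by (simp add: represents_def)
    have v0: "represents0 \<T> v (\<lambda>T. axis 1 1)" by (simp add: represents0_def v_def)
    have mem: "((\<lambda>x. 0), v) \<in> Sigma_h0 \<Omega> \<T> \<times> V_h \<T>"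
      using Sigma_h0_iff[OF d c r0] Vh[OF v0] by (simp add: midpoint_continuous_def field_trace_def trace_def)
    have fj0: "field_jump \<T> (\<lambda>T x. 0) e x = 0" for e x unfolding field_jump_def by simp
    have ff0: "field_form \<T> H (\<lambda>T x. 0) = 0" for H
      by (simp add: field_form_def fj0 deviator_def trace_def edge_mean_def segment_mean_def case_prod_unfold Let_def)
    have "nc_norm \<Omega> \<T> \<nu> ((\<lambda>x. 0), v) = sqrt (\<nu> * (\<Sum>T\<in>\<T>. area T))"
      unfolding represents_nc_norm[OF d c r0 v0] ff0 by simp
    also have "\<dots> \<noteq> 0" using \<nu> sum_pos[OF fin ne, of area] area_pos[OF o] by simp
    finally have nz: "nonzero_pair \<Omega> ((\<lambda>x. 0), v)" by (rule nonzero_pair_if_norm[OF d c r0 v0])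
    have "B_nc \<Omega> \<T> \<nu> (\<sigma>, u) ((\<lambda>x. 0), v) = 0"
      unfolding B_nc_def prod.case represents_a_h[OF d c F r0] represents_b_h[OF d c r0 w] represents_b_h[OF d c F v0] ff0
      by (simp add: g0)
    then show ?thesis using that[OF mem nz] n2 True by simp
  next
    case False
    then have n2p: "0 < n2" using parts unfolding n2_def by linarith
    obtain G where G: "\<forall>T\<in>\<T>. affine_fun (G T)" "midpoint_continuous \<T> G" "field_trace \<T> G = 0"
      "field_form \<T> G G \<le> 9 * (\<Sum>T\<in>\<T>. area T * (w T \<bullet> affine_div (G T)))"
      "(\<Sum>T\<in>\<T>. area T * (norm (affine_div (G T)))\<^sup>2) \<le> (\<Sum>T\<in>\<T>. area T * (w T \<bullet> affine_div (G T)))"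
      "(\<Sum>T\<in>\<T>. area T * (w T \<bullet> affine_div (G T))) \<le> (\<Sum>T\<in>\<T>. area T * (norm (w T))\<^sup>2)"
      "(\<Sum>T\<in>\<T>. area T * (norm (w T))\<^sup>2) \<le> 2 * (residual_const L + 1) * (\<Sum>T\<in>\<T>. area T * (w T \<bullet> affine_div (G T)))"
      by (rule stress_lifting[OF m ne L box, where w=w])
    have cG: "continuous_on UNIV (G T)" if "T \<in> \<T>" for T using bspec[OF G(1) that] by (rule affine_fun_continuous)
    \<comment> \<open>Since \<open>AG \<le> 9 b\<close>, this choice makes \<open>t\<^sup>2 AG / \<nu>\<close> at most \<open>t b\<close>, of which Young's inequality spends one half.\<close>
    define t where "t = \<nu> / 9"
    define AG where "AG = field_form \<T> G G"
    define AF where "AF = field_form \<T> F G"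
    define DG where "DG = (\<Sum>T\<in>\<T>. area T * (norm (affine_div (G T)))\<^sup>2)"
    define Y where "Y = (\<Sum>T\<in>\<T>. area T * (affine_div (F T) \<bullet> affine_div (G T)))"
    define X where "X = (\<Sum>T\<in>\<T>. area T * (w T \<bullet> affine_div (F T)))"
    define b where "b = (\<Sum>T\<in>\<T>. area T * (w T \<bullet> affine_div (G T)))"
    have gb: "AG \<le> 9 * b" "DG \<le> b" "b \<le> S" "S \<le> 2 * (residual_const L + 1) * b"
      using G(4-7) unfolding AG_def DG_def b_def S_def by blast+
    define H where "H = (\<lambda>T x. F T x + t *\<^sub>R G T x)"
    define \<tau> where "\<tau> = (\<lambda>x. \<sigma> x + t *\<^sub>R glue \<T> G x)"
    define z where "z T = - w T + (1 / \<nu>) *\<^sub>R affine_div (F T)" for T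
    define v where "v = glue \<T> (\<lambda>T x. z T)"
    have rG: "represents \<T> (glue \<T> G) G" using G(1) by (auto simp: represents_def glue_interior[OF m])
    have rH: "represents \<T> \<tau> H" unfolding \<tau>_def H_def by (rule represents_add[OF F rG])
    have rv: "represents0 \<T> v z" by (auto simp: represents0_def v_def glue_interior[OF m])
    have mem: "(\<tau>, v) \<in> Sigma_h0 \<Omega> \<T> \<times> V_h \<T>"
    proof -
      have "midpoint_continuous \<T> H" unfolding H_def by (rule midpoint_continuous_add[OF F'(1) G(2)])
      moreover have "field_trace \<T> H = 0" unfolding H_def
        using field_trace_add[where F=F and G=G and t=t, OF m cF cG] F'(2) G(3) by simp
      ultimately show ?thesis using Sigma_h0_iff[OF d c rH] Vh[OF rv] by simp
    qed
    have gH: "affine_div (H T) = affine_div (F T) + t *\<^sub>R affine_div (G T)" for T unfolding H_def by (rule affine_div_add)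
    have HH: "field_form \<T> H H = A + 2 * t * AF + t\<^sup>2 * AG"
      unfolding H_def A_def AF_def AG_def by (rule field_form_expand[OF m cF cG])
    have FH: "field_form \<T> F H = A + t * AF"
      unfolding H_def A_def AF_def by (rule field_form_add[OF m]) (intro cF cG, assumption)+
    define N where "N = 1 / \<nu> * (A + 2 * t * AF + t\<^sup>2 * AG) + 1 / \<nu> * (D + 2 * t * Y + t\<^sup>2 * DG)
       + \<nu> * (S - 2 * (1 / \<nu>) * X + (1 / \<nu>)\<^sup>2 * D)"
    have N: "nc_norm \<Omega> \<T> \<nu> (\<tau>, v) = sqrt N"
    proof -
      have "(\<Sum>T\<in>\<T>. area T * (norm (z T))\<^sup>2) = S - 2 * (1 / \<nu>) * X + (1 / \<nu>)\<^sup>2 * D"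
        unfolding z_def weighted_norm_square_expand S_def X_def D_def by (simp add: sum_negf)
      moreover have "(\<Sum>T\<in>\<T>. area T * (norm (affine_div (H T)))\<^sup>2) = D + 2 * t * Y + t\<^sup>2 * DG"
        unfolding gH weighted_norm_square_expand D_def Y_def DG_def by (rule refl)
      ultimately show ?thesis unfolding represents_nc_norm[OF d c rH rv] HH N_def by simp
    qed
    have B: "B_nc \<Omega> \<T> \<nu> (\<sigma>, u) (\<tau>, v) = 1 / \<nu> * (A + t * AF) + t * b + 1 / \<nu> * D"
    proof -
      have "(\<Sum>T\<in>\<T>. area T * (w T \<bullet> affine_div (H T))) = X + t * b"
        unfolding gH X_def b_def by (simp add: inner_add_right sum.distrib sum_distrib_left algebra_simps)
      moreover have "(\<Sum>T\<in>\<T>. area T * (z T \<bullet> affine_div (F T))) = - X + 1 / \<nu> * D"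
        unfolding z_def X_def D_def power2_norm_eq_inner
        by (simp add: inner_add_left sum.distrib sum_subtractf sum_distrib_left sum_negf algebra_simps)
      ultimately show ?thesis
        unfolding B_nc_def prod.case represents_a_h[OF d c F rH] represents_b_h[OF d c rH w] represents_b_h[OF d c F rv] FH
        by simp
    qed
    have sq: "0 \<le> A + 2 * s * AF + s\<^sup>2 * AG" for s
    proof -
      have "0 \<le> field_form \<T> (\<lambda>T x. F T x + s *\<^sub>R G T x) (\<lambda>T x. F T x + s *\<^sub>R G T x)"
        by (rule field_form_nonneg[OF m]) (intro continuous_intros cF cG)
      then show ?thesis
        using field_form_expand[where F=F and G=G and t=s, OF m cF cG] unfolding A_def AF_def AG_def by simp
    qed
    have sqD: "0 \<le> D + 2 * s * Y + s\<^sup>2 * DG" for s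
    proof -
      have "0 \<le> (\<Sum>T\<in>\<T>. area T * (norm (affine_div (F T) + s *\<^sub>R affine_div (G T)))\<^sup>2)"
        by (intro sum_nonneg mult_nonneg_nonneg A0) auto
      then show ?thesis unfolding weighted_norm_square_expand D_def Y_def DG_def .
    qed
    have sqX: "0 \<le> S + 2 * s * X + s\<^sup>2 * D" for s
    proof -
      have "0 \<le> (\<Sum>T\<in>\<T>. area T * (norm (w T + s *\<^sub>R affine_div (F T)))\<^sup>2)"
        by (intro sum_nonneg mult_nonneg_nonneg A0) auto
      then show ?thesis unfolding weighted_norm_square_expand S_def X_def D_def .
    qed
    have b0: "0 \<le> b"
    proof -
      have "0 \<le> DG" unfolding DG_def by (intro sum_nonneg mult_nonneg_nonneg A0) auto
      then show ?thesis using gb(2) by linarith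
    qed
    have tAG: "1 / \<nu> * (t\<^sup>2 * AG) \<le> \<nu> * b / 9"
    proof -
      have "1 / \<nu> * (t\<^sup>2 * AG) = \<nu> / 81 * AG" using \<nu> by (simp add: t_def power2_eq_square field_simps)
      also have "\<dots> \<le> \<nu> / 81 * (9 * b)" using gb(1) \<nu> by (intro mult_left_mono) auto
      finally show ?thesis by simp
    qed
    have tDG: "1 / \<nu> * (t\<^sup>2 * DG) \<le> \<nu> * b / 81"
    proof -
      have "1 / \<nu> * (t\<^sup>2 * DG) = \<nu> / 81 * DG" using \<nu> by (simp add: t_def power2_eq_square field_simps)
      also have "\<dots> \<le> \<nu> / 81 * b" using gb(2) \<nu> by (intro mult_left_mono) auto
      finally show ?thesis by simp
    qed
    have nb: "\<nu> * b \<le> \<nu> * S" using gb(3) \<nu> by simp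
    have nb0: "0 \<le> \<nu> * b" using b0 \<nu> by simp
    have N4: "N \<le> 4 * n2"
    proof -
      have twice: "r * (x + 2 * s * y + s\<^sup>2 * k) \<le> 2 * (r * x) + 2 * (r * (s\<^sup>2 * k))"
        if "0 \<le> x + 2 * (- s) * y + (- s)\<^sup>2 * k" "0 \<le> r" for r x y k s :: real
      proof -
        have "r * (x + 2 * s * y + s\<^sup>2 * k) \<le> r * (2 * x + 2 * (s\<^sup>2 * k))"
          using that by (intro mult_left_mono) (simp_all add: algebra_simps)
        then show ?thesis by (simp add: distrib_left)
      qed
      have "1 / \<nu> * (A + 2 * t * AF + t\<^sup>2 * AG) \<le> 2 * (1 / \<nu> * A) + 2 * (1 / \<nu> * (t\<^sup>2 * AG))"
        by (rule twice[OF sq]) (use \<nu> in simp)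
      moreover have "1 / \<nu> * (D + 2 * t * Y + t\<^sup>2 * DG) \<le> 2 * (1 / \<nu> * D) + 2 * (1 / \<nu> * (t\<^sup>2 * DG))"
        by (rule twice[OF sqD]) (use \<nu> in simp)
      moreover have "\<nu> * (S - 2 * (1 / \<nu>) * X + (1 / \<nu>)\<^sup>2 * D) \<le> 2 * (\<nu> * S) + 2 * (1 / \<nu> * D)"
      proof -
        have "\<nu> * (S + 2 * (- (1 / \<nu>)) * X + (- (1 / \<nu>))\<^sup>2 * D) \<le> 2 * (\<nu> * S) + 2 * (\<nu> * ((- (1 / \<nu>))\<^sup>2 * D))"
          by (rule twice[OF sqX]) (use \<nu> in simp)
        moreover have "\<nu> * ((- (1 / \<nu>))\<^sup>2 * D) = 1 / \<nu> * D" using \<nu> by (simp add: power2_eq_square)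
        ultimately show ?thesis by simp
      qed
      ultimately have "N \<le> 2 * (1 / \<nu> * A) + 2 * (\<nu> * b / 9) + (2 * (1 / \<nu> * D) + 2 * (\<nu> * b / 81)) + (2 * (\<nu> * S) + 2 * (1 / \<nu> * D))"
        unfolding N_def using tAG tDG by linarith
      moreover have "n \<le> 4 * (x + y + r)"
        if "n \<le> 2 * x + 2 * (k / 9) + (2 * y + 2 * (k / 81)) + (2 * r + 2 * y)" "0 \<le> x" "0 \<le> y" "0 \<le> r" "k \<le> r" "0 \<le> k"
        for n x y r k :: real using that by (simp add: field_simps)
      ultimately show ?thesis unfolding n2_def using parts nb nb0 by blast
    qed
    define \<kappa> where "\<kappa> = 1 / (36 * (residual_const L + 1))"
    have \<kappa>: "0 < \<kappa>" "\<kappa> \<le> 1 / 2" using K by (auto simp: \<kappa>_def field_simps)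
    have Bn: "\<kappa> * n2 \<le> B_nc \<Omega> \<T> \<nu> (\<sigma>, u) (\<tau>, v)"
    proof -
      have "- (1 / \<nu> * A) - 1 / \<nu> * (t\<^sup>2 * AG) \<le> 2 * (1 / \<nu> * (t * AF))"
      proof -
        have "0 \<le> 1 / \<nu> * (A + 2 * t * AF + t\<^sup>2 * AG)" using sq[of t] \<nu> by simp
        then show ?thesis by (simp add: algebra_simps)
      qed
      then have "1 / \<nu> * A / 2 + \<nu> * b / 18 + 1 / \<nu> * D \<le> B_nc \<Omega> \<T> \<nu> (\<sigma>, u) (\<tau>, v)"
        unfolding B using tAG by (simp add: distrib_left t_def)
      moreover have "\<kappa> * (1 / \<nu> * A) \<le> 1 / 2 * (1 / \<nu> * A)" using \<kappa> parts by (intro mult_right_mono) auto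
      moreover have "\<kappa> * (1 / \<nu> * D) \<le> 1 * (1 / \<nu> * D)" using \<kappa> parts by (intro mult_right_mono) auto
      moreover have "\<kappa> * (\<nu> * S) \<le> \<nu> * b / 18"
      proof -
        have "\<kappa> * (\<nu> * S) \<le> \<kappa> * (\<nu> * (2 * (residual_const L + 1) * b))"
          using gb(4) \<kappa> \<nu> by (intro mult_left_mono) auto
        also have "\<dots> = \<nu> * b / 18" using K by (simp add: \<kappa>_def field_simps)
        finally show ?thesis .
      qed
      moreover have "q1 + q2 + q3 \<le> B" if "x / 2 + k + y \<le> B" "q1 \<le> 1 / 2 * x" "q2 \<le> 1 * y" "q3 \<le> k"
        for q1 q2 q3 x y k B :: real using that by simp
      ultimately show ?thesis unfolding n2_def distrib_left by blast
    qed
    \<comment> \<open>If the test pair had norm zero, the Cauchy-Schwarz inequality would make the form vanish on it.\<close>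
    have Np: "0 < N"
    proof (rule ccontr)
      assume "\<not> 0 < N"
      have h: "0 \<le> 1 / \<nu> * field_form \<T> H H" "0 \<le> 1 / \<nu> * (D + 2 * t * Y + t\<^sup>2 * DG)"
        "0 \<le> \<nu> * (S - 2 * (1 / \<nu>) * X + (1 / \<nu>)\<^sup>2 * D)"
        using sq[of t] sqD[of t] sqX[of "- (1 / \<nu>)"] \<nu> unfolding HH by simp_all
      then have "1 / \<nu> * field_form \<T> H H = 0" "1 / \<nu> * (D + 2 * t * Y + t\<^sup>2 * DG) = 0"
        "\<nu> * (S - 2 * (1 / \<nu>) * X + (1 / \<nu>)\<^sup>2 * D) = 0"
        using \<open>\<not> 0 < N\<close> unfolding N_def HH by linarith+
      then have z0: "field_form \<T> H H = 0" "(\<Sum>T\<in>\<T>. area T * (norm (affine_div (H T)))\<^sup>2) = 0"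
        "(\<Sum>T\<in>\<T>. area T * (norm (z T))\<^sup>2) = 0"
        using \<nu> unfolding gH z_def weighted_norm_square_expand D_def Y_def DG_def S_def X_def by (simp_all add: sum_negf)
      have g0: "affine_div (H T) = 0" "z T = 0" if T: "T \<in> \<T>" for T
      proof -
        have "\<forall>T\<in>\<T>. area T * (norm (affine_div (H T)))\<^sup>2 = 0" "\<forall>T\<in>\<T>. area T * (norm (z T))\<^sup>2 = 0"
          using z0(2,3) by (subst (asm) sum_nonneg_eq_0_iff; use fin A0 in auto)+
        then show "affine_div (H T) = 0" "z T = 0" using area_pos[OF o[OF T]] T by auto
      qed
      have "field_form \<T> F H = 0"
      proof (rule affine_in_cross_term)
        fix s
        have cH: "continuous_on UNIV (H T)" if "T \<in> \<T>" for T
          using rH that by (auto simp: represents_def affine_fun_continuous)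
        have "0 \<le> field_form \<T> (\<lambda>T x. F T x + s *\<^sub>R H T x) (\<lambda>T x. F T x + s *\<^sub>R H T x)"
          by (rule field_form_nonneg[OF m]) (intro continuous_intros cF cH)
        then show "0 \<le> A + 2 * s * field_form \<T> F H"
          using field_form_expand[where F=F and G=H and t=s, OF m cF cH] z0(1) unfolding A_def by simp
      qed
      then have "B_nc \<Omega> \<T> \<nu> (\<sigma>, u) (\<tau>, v) = 0"
        unfolding B_nc_def prod.case represents_a_h[OF d c F rH] represents_b_h[OF d c rH w] represents_b_h[OF d c F rv]
        by (simp add: g0)
      then show False using Bn mult_pos_pos[OF \<kappa>(1) n2p] by linarith
    qed
    have nz: "nonzero_pair \<Omega> (\<tau>, v)" by (rule nonzero_pair_if_norm[where \<nu>=\<nu>, OF d c rH rv]) (use N Np in simp)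
    have "1 / (72 * (residual_const L + 1)) * sqrt n2 \<le> B_nc \<Omega> \<T> \<nu> (\<sigma>, u) (\<tau>, v) / sqrt N"
    proof -
      have "sqrt N \<le> sqrt (4 * n2)" using N4 by (rule real_sqrt_le_mono)
      then have le: "sqrt N \<le> 2 * sqrt n2" by (simp add: real_sqrt_mult)
      have k2: "1 / (72 * (residual_const L + 1)) = \<kappa> / 2" by (simp add: \<kappa>_def)
      have "(\<kappa> / 2 * sqrt n2) * sqrt N \<le> (\<kappa> / 2 * sqrt n2) * (2 * sqrt n2)"
        using le \<kappa> n2p by (intro mult_left_mono) auto
      also have "\<dots> = \<kappa> * n2" using n2p by simp
      finally have "(\<kappa> / 2 * sqrt n2) * sqrt N \<le> B_nc \<Omega> \<T> \<nu> (\<sigma>, u) (\<tau>, v)" using Bn by linarith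
      then show ?thesis unfolding k2 using Np by (simp add: pos_le_divide_eq)
    qed
    then show ?thesis using that[OF mem nz] n2 N by simp
  qed
qed

theorem theorem5p4:
  fixes \<Omega> :: "point set" and H :: "real set" and \<T> :: "real \<Rightarrow> mesh"
  assumes "polygonal_domain \<Omega>"
    and "\<And>h. h \<in> H \<Longrightarrow> 0 < h \<and> conforming_triangulation \<Omega> (\<T> h) \<and> mesh_size (\<T> h) = h"
  shows "\<exists>\<alpha>>0. \<forall>h\<in>H. \<forall>\<nu>>0. \<forall>\<sigma>\<in>Sigma_h0 \<Omega> (\<T> h). \<forall>u\<in>V_h (\<T> h).
    ereal (\<alpha> * nc_norm \<Omega> (\<T> h) \<nu> (\<sigma>, u)) \<le>
      (SUP p\<in>{p \<in> Sigma_h0 \<Omega> (\<T> h) \<times> V_h (\<T> h). nonzero_pair \<Omega> p}.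
        ereal (B_nc \<Omega> (\<T> h) \<nu> (\<sigma>, u) p / nc_norm \<Omega> (\<T> h) \<nu> p))"
proof -
  have "bounded (closure \<Omega>)" using assms(1) by (intro bounded_closure) (simp add: polygonal_domain_def)
  then obtain R where R: "\<And>z. z \<in> closure \<Omega> \<Longrightarrow> norm z \<le> R" unfolding bounded_iff by blast
  define L where "L = \<bar>R\<bar> + 1"
  have L: "1 \<le> L" by (simp add: L_def)
  define \<alpha> where "\<alpha> = 1 / (72 * (residual_const L + 1))"
  have \<alpha>: "0 < \<alpha>" using residual_const_nonneg[OF L] by (simp add: \<alpha>_def)
  have "ereal (\<alpha> * nc_norm \<Omega> (\<T> h) \<nu> (\<sigma>, u)) \<le>
      (SUP p\<in>{p \<in> Sigma_h0 \<Omega> (\<T> h) \<times> V_h (\<T> h). nonzero_pair \<Omega> p}.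
        ereal (B_nc \<Omega> (\<T> h) \<nu> (\<sigma>, u) p / nc_norm \<Omega> (\<T> h) \<nu> p))"
    if h: "h \<in> H" and \<nu>: "0 < \<nu>" and \<sigma>: "\<sigma> \<in> Sigma_h0 \<Omega> (\<T> h)" and u: "u \<in> V_h (\<T> h)" for h \<nu> \<sigma> u
  proof -
    have c: "conforming_triangulation \<Omega> (\<T> h)" using assms(2)[OF h] by blast
    have box: "\<bar>z $ 1\<bar> \<le> L - 1 \<and> \<bar>z $ 2\<bar> \<le> L - 1" if "T \<in> \<T> h" "z \<in> T" for T z
    proof -
      have "z \<in> closure \<Omega>" using c that unfolding conforming_triangulation_def by blast
      then have "norm z \<le> \<bar>R\<bar>" using R by force
      then show ?thesis using component_le_norm_cart[of z 1] component_le_norm_cart[of z 2] by (simp add: L_def)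
    qed
    obtain p where p: "p \<in> Sigma_h0 \<Omega> (\<T> h) \<times> V_h (\<T> h)" "nonzero_pair \<Omega> p"
      "\<alpha> * nc_norm \<Omega> (\<T> h) \<nu> (\<sigma>, u) \<le> B_nc \<Omega> (\<T> h) \<nu> (\<sigma>, u) p / nc_norm \<Omega> (\<T> h) \<nu> p"
      unfolding \<alpha>_def by (rule inf_sup_on_mesh[OF assms(1) c L box \<nu> \<sigma> u])
    have "ereal (\<alpha> * nc_norm \<Omega> (\<T> h) \<nu> (\<sigma>, u)) \<le> ereal (B_nc \<Omega> (\<T> h) \<nu> (\<sigma>, u) p / nc_norm \<Omega> (\<T> h) \<nu> p)"
      using p(3) by simp
    also have "\<dots> \<le> (SUP p\<in>{p \<in> Sigma_h0 \<Omega> (\<T> h) \<times> V_h (\<T> h). nonzero_pair \<Omega> p}.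
        ereal (B_nc \<Omega> (\<T> h) \<nu> (\<sigma>, u) p / nc_norm \<Omega> (\<T> h) \<nu> p))"
      using p(1,2) by (intro SUP_upper) simp
    finally show ?thesis .
  qed
  then show ?thesis using \<alpha> by blast
qed

end
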